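(* Let $\Sigma_3\subset S^6$ be the Borůvka sphere, positioned so that it is a $J$-holomorphic curve, and let $C=\mathrm C(\Sigma_3)=\{r\sigma\in\mathbb R^7: r>0,\ \sigma\in\Sigma_3\}\subset\mathbb R^7$ be the (associative) cone over it. Then its upper and lower stability indices are $$\text{s-ind}_+(C)=41,\qquad \text{s-ind}_-(C)=30.$$ In particular, $C$ is not rigid as an associative cone.
   Context: **$\mathrm G_2$ structure.** On $\mathbb R^7$ with standard basis $e_1,\dots,e_7$, dual basis $e^1,\dots,e^7$, and Euclidean inner product, let $$\varphi=e^{123}+e^{145}-e^{167}+e^{247}-e^{256}-e^{346}-e^{357},\qquad e^{ijk}=e^i\wedge e^j\wedge e^k.$$ The cross product is defined by $\langle u\times v,w\rangle=\varphi(u,v,w)$. The group $\mathrm G_2$ is the stabilizer of $\varphi$ in $\mathrm{GL}_7(\mathbb R)$. An oriented $3$-dimensional submanifold $N\subset\mathbb R^7$ is associative if $\varphi|_N=\mathrm{vol}_N$. The almost complex structure $J$ on $S^6$ is $J_p(v)=p\times v$ for $p\in S^6$, $v\in T_pS^6$. An oriented surface $\Sigma\subset S^6$ is a $J$-holomorphic curve if $J(T\Sigma)=T\Sigma$; this holds iff its cone is associative. **Borůvka sphere $\Sigma_3$.** Take an orthogonal basis $p_1,\dots,p_7$, with equal $L^2(S^2)$-norms, of the space of harmonic homogeneous cubic polynomials in three real variables, normalized so that $\sum p_i^2=1$ on $S^2$. The Borůvka sphere is the image of $(p_1,\dots,p_7):S^2\to S^6$. It is unique up to congruence, linearly full, minimal,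 of constant curvature $\tfrac16$, and congruent to a $J$-holomorphic curve. Here $\Sigma_3$ denotes such a $J$-holomorphic copy. **Stability indices.** Let $\Sigma\subset S^6$ be a closed connected $J$-holomorphic curve with cone $C$, and let $\nabla$ be the Levi-Civita connection of $S^6$. The characteristic $\mathrm{SU}(3)$-connection is $\widehat\nabla_uX=\nabla_uX+\frac12(\nabla_uJ)JX$. Let $\widehat\nabla^\perp$ be its normal part on the normal bundle $N\Sigma$ of $\Sigma$ in $S^6$. The Dirac operator $D_\Sigma:\Gamma(N\Sigma)\to\Gamma(N\Sigma)$ is $$D_\Sigma=f_1\times\widehat\nabla^\perp_{f_1}+f_2\times\widehat\nabla^\perp_{f_2},$$ where $\{f_1,f_2\}$ is a local oriented orthonormal frame on $\Sigma$. For $\lambda\in\mathbb R$ let $d_\lambda=\dim_{\mathbb R}\{\nu\in\Gamma(N\Sigma): (JD_\Sigma)\nu=(\lambda+1)\nu\}$. Let $\mathrm H\le\mathrm G_2$ be the maximal subgroup of $\mathrm G_2$ that fixes $\Sigma$ (as a set). The upper and lower stability indices of $C$ are $$\text{s-ind}_+(C)=\tfrac12d_{-1}+d_1+\sum_{\lambda\in(-1,1)}d_\lambda-7-\dim(\mathrm G_2/\mathrm H),\qquad \text{s-ind}_-(C)=\tfrac12d_{-1}+\sum_{\lambda\in(-1,1)}d_\lambda-7.$$ The cone $C$ is called rigid if $\text{s-ind}_+(C)=\text{s-ind}_-(C)$. *)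

theory Defs
  imports "HOL-Analysis.Analysis" "HOL-Library.Function_Algebras"
begin

section \<open>The \<open>G\<^sub>2\<close> structure on \<open>\<real>\<^sup>7\<close>\<close>

definition wedge3 :: "7 \<Rightarrow> 7 \<Rightarrow> 7 \<Rightarrow> real^7 \<Rightarrow> real^7 \<Rightarrow> real^7 \<Rightarrow> real" where
  "wedge3 i j k u v w =
     det (vector [vector [u $ i, u $ j, u $ k],
                  vector [v $ i, v $ j, v $ k],
                  vector [w $ i, w $ j, w $ k]] :: real^3^3)"

definition phi :: "real^7 \<Rightarrow> real^7 \<Rightarrow> real^7 \<Rightarrow> real" where
  "phi u v w =
     wedge3 1 2 3 u v w + wedge3 1 4 5 u v w - wedge3 1 6 7 u v w + wedge3 2 4 7 u v w
     - wedge3 2 5 6 u v w - wedge3 3 4 6 u v w - wedge3 3 5 7 u v w"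

definition cross7 :: "real^7 \<Rightarrow> real^7 \<Rightarrow> real^7" where
  "cross7 u v = (\<chi> k. phi u v (axis k 1))"

lemma linear_phi: "linear (phi u v)"
  by (rule linearI)
    (simp_all add: phi_def wedge3_def det_3 algebra_simps)

text \<open>The defining property of the cross product.\<close>

lemma inner_cross7: "cross7 u v \<bullet> w = phi u v w"
proof -
  have "phi u v w = phi u v (\<Sum>k\<in>UNIV. w $ k *\<^sub>R axis k 1)"
    by (simp add: basis_expansion flip: scalar_mult_eq_scaleR)
  also have "\<dots> = (\<Sum>k\<in>UNIV. w $ k * phi u v (axis k 1))"
    by (simp add: linear_sum [OF linear_phi] linear_cmul [OF linear_phi])
  finally show ?thesis
    by (simp add: inner_vec_def cross7_def mult.commute)
qed

definition G2 :: "(real^7^7) set" where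
  "G2 = {A. invertible A \<and> (\<forall>u v w. phi (A *v u) (A *v v) (A *v w) = phi u v w)}"

text \<open>The Lie algebra of a closed subgroup of \<open>GL\<^sub>7(\<real>)\<close>: the initial velocities of its
  one-parameter subgroups.  A homogeneous space \<open>G/H\<close> has dimension \<open>dim G - dim H\<close>.\<close>

definition lie_algebra :: "(real^7^7) set \<Rightarrow> (real^7^7) set" where
  "lie_algebra G = {X. \<exists>\<gamma>. (\<forall>s t. \<gamma> (s + t) = \<gamma> s ** \<gamma> t) \<and> (\<forall>t. \<gamma> t \<in> G) \<and>
                          (\<gamma> has_vector_derivative X) (at 0)}"

definition dim_quotient :: "(real^7^7) set \<Rightarrow> (real^7^7) set \<Rightarrow> real" where
  "dim_quotient G H = real (dim (lie_algebra G)) - real (dim (lie_algebra H))"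

definition G2_stabilizer :: "(real^7) set \<Rightarrow> (real^7^7) set" where
  "G2_stabilizer S = {A \<in> G2. (\<lambda>x. A *v x) ` S = S}"


section \<open>Smooth maps and submanifolds\<close>

primrec Ck_on :: "nat \<Rightarrow> 'a::euclidean_space set \<Rightarrow> ('a \<Rightarrow> 'b::real_normed_vector) \<Rightarrow> bool" where
  "Ck_on 0 U f \<longleftrightarrow> continuous_on U f"
| "Ck_on (Suc k) U f \<longleftrightarrow> f differentiable_on U \<and>
     (\<forall>v. Ck_on k U (\<lambda>x. frechet_derivative f (at x) v))"

text \<open>Only meant for open \<open>U\<close>.\<close>

definition smooth_on :: "'a::euclidean_space set \<Rightarrow> ('a \<Rightarrow> 'b::real_normed_vector) \<Rightarrow> bool" where
  "smooth_on U f \<longleftrightarrow> (\<forall>k. Ck_on k U f)"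

text \<open>Smoothness of a map on an arbitrary subset of Euclidean space; on an embedded submanifold
  this agrees with smoothness in local coordinates.\<close>

definition smooth_along :: "'a::euclidean_space set \<Rightarrow> ('a \<Rightarrow> 'b::real_normed_vector) \<Rightarrow> bool" where
  "smooth_along S f \<longleftrightarrow>
     (\<forall>p\<in>S. \<exists>U g. open U \<and> p \<in> U \<and> smooth_on U g \<and> (\<forall>q\<in>S \<inter> U. g q = f q))"

definition smooth_surface :: "(real^7) set \<Rightarrow> bool" where
  "smooth_surface S \<longleftrightarrow>
     (\<forall>p\<in>S. \<exists>U V \<psi> \<eta>. open U \<and> p \<in> U \<and> open V \<and>
        smooth_on V \<psi> \<and> homeomorphism V (S \<inter> U) \<psi> \<eta> \<and>
        (\<forall>x\<in>V. inj (frechet_derivative (\<psi> :: real^2 \<Rightarrow> real^7) (at x))))"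

definition tangent_space :: "(real^7) set \<Rightarrow> real^7 \<Rightarrow> (real^7) set" where
  "tangent_space S p = {v. \<exists>e \<gamma>. 0 < e \<and> smooth_on {-e<..<e::real} \<gamma> \<and> \<gamma> ` {-e<..<e} \<subseteq> S \<and>
                              \<gamma> 0 = p \<and> (\<gamma> has_vector_derivative v) (at 0)}"


section \<open>The nearly Kaehler six-sphere and its \<open>J\<close>-holomorphic curves\<close>

abbreviation S6 :: "(real^7) set" where
  "S6 \<equiv> sphere 0 1"

definition TS6 :: "real^7 \<Rightarrow> (real^7) set" where
  "TS6 p = {v. p \<bullet> v = 0}"

definition J :: "real^7 \<Rightarrow> real^7 \<Rightarrow> real^7" where
  "J p v = cross7 p v"

definition J_holomorphic_curve :: "(real^7) set \<Rightarrow> bool" where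
  "J_holomorphic_curve S \<longleftrightarrow>
     smooth_surface S \<and> S \<subseteq> S6 \<and> (\<forall>p\<in>S. J p ` tangent_space S p = tangent_space S p)"

text \<open>A \<open>J\<close>-holomorphic curve carries the orientation induced by \<open>J\<close>, for which
  \<open>(f\<^sub>1, J f\<^sub>1)\<close> is positive and its cone is associative: \<open>phi p f\<^sub>1 f\<^sub>2 = 1\<close>.\<close>

definition oriented_frame :: "(real^7) set \<Rightarrow> real^7 \<Rightarrow> real^7 \<Rightarrow> real^7 \<Rightarrow> bool" where
  "oriented_frame S p f\<^sub>1 f\<^sub>2 \<longleftrightarrow>
     f\<^sub>1 \<in> tangent_space S p \<and> f\<^sub>2 \<in> tangent_space S p \<and>
     norm f\<^sub>1 = 1 \<and> norm f\<^sub>2 = 1 \<and> f\<^sub>1 \<bullet> f\<^sub>2 = 0 \<and> 0 < J p f\<^sub>1 \<bullet> f\<^sub>2"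

definition normal_space :: "(real^7) set \<Rightarrow> real^7 \<Rightarrow> (real^7) set" where
  "normal_space S p = TS6 p \<inter> (tangent_space S p)\<^sup>\<bottom>"

definition orth_proj :: "(real^7) set \<Rightarrow> real^7 \<Rightarrow> real^7" where
  "orth_proj W v = (THE w. w \<in> W \<and> v - w \<in> W\<^sup>\<bottom>)"


section \<open>Connections\<close>

text \<open>The Levi-Civita connection of \<open>S6\<close> is the tangential part of the flat connection of
  \<open>\<real>\<^sup>7\<close> (it is metric and torsion-free, see \<open>levi_civita_metric\<close> and
  \<open>levi_civita_torsion_free\<close> below).  It acts on vector fields \<open>X\<close> tangent to \<open>S6\<close> that are
  given only along a submanifold \<open>S\<close> of \<open>S6\<close>, and is evaluated only on \<open>u\<close> in
  \<open>tangent_space S p\<close>; the derivative within \<open>S\<close> is uniquely determined on such vectors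
  (\<open>frechet_derivative_within_curve\<close>).\<close>

definition nabla :: "(real^7) set \<Rightarrow> (real^7 \<Rightarrow> real^7) \<Rightarrow> real^7 \<Rightarrow> real^7 \<Rightarrow> real^7" where
  "nabla S X p u = orth_proj (TS6 p) (frechet_derivative X (at p within S) u)"

lemma frechet_derivative_within_curve:
  fixes X :: "real^7 \<Rightarrow> 'b::real_normed_vector"
  assumes X: "X differentiable (at p within S)"
    and \<gamma>: "(\<gamma> has_vector_derivative u) (at 0)" "\<gamma> 0 = p"
    and e: "0 < e" "\<gamma> ` {-e<..<e::real} \<subseteq> S"
  shows "((\<lambda>t. X (\<gamma> t)) has_vector_derivative frechet_derivative X (at p within S) u) (at 0)"
proof -
  let ?T = "{-e<..<e}" and ?D = "frechet_derivative X (at p within S)"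
  have D: "(X has_derivative ?D) (at p within S)"
    using X frechet_derivative_works by blast
  have "(\<gamma> has_derivative (\<lambda>h. h *\<^sub>R u)) (at 0 within ?T)"
    using \<gamma>(1) has_derivative_at_withinI by (auto simp: has_vector_derivative_def)
  moreover have "(X has_derivative ?D) (at (\<gamma> 0) within \<gamma> ` ?T)"
    using has_derivative_subset [OF D e(2)] \<gamma>(2) by simp
  ultimately have "(X \<circ> \<gamma> has_derivative ?D \<circ> (\<lambda>h. h *\<^sub>R u)) (at 0 within ?T)"
    by (rule diff_chain_within)
  moreover have "at 0 within ?T = at 0"
    using e(1) by (intro at_within_open) auto
  moreover have "?D \<circ> (\<lambda>h. h *\<^sub>R u) = (\<lambda>h. h *\<^sub>R ?D u)"
    using linear_cmul [OF has_derivative_linear [OF D]] by auto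
  ultimately show ?thesis
    by (simp add: has_vector_derivative_def o_def)
qed

lemma frechet_derivative_sphere_unique:
  fixes f :: "real^7 \<Rightarrow> real"
  assumes f: "(f has_derivative f') (at p within S6)" and p: "p \<in> S6" and u: "u \<in> TS6 p"
  shows "frechet_derivative f (at p within S6) u = f' u"
proof -
  obtain \<gamma> :: "real \<Rightarrow> real^7"
    where \<gamma>: "\<gamma> 0 = p" "(\<gamma> has_vector_derivative u) (at 0)" "range \<gamma> \<subseteq> S6"
  proof (cases "u = 0")
    case True
    then show thesis
      using that [of "\<lambda>_. p"] p by auto
  next
    case False
    define a v where "a = norm u" and "v = sgn u"
    define c where "c = (\<lambda>t. cos (a * t) *\<^sub>R p + sin (a * t) *\<^sub>R v)"
    have av: "a *\<^sub>R v = u"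
      using False by (simp add: a_def v_def sgn_div_norm)
    have 1: "p \<bullet> p = 1" "v \<bullet> v = 1"
      using p False by (simp_all add: dot_square_norm norm_sgn v_def)
    have 2: "p \<bullet> v = 0"
      using u by (simp add: TS6_def sgn_div_norm v_def)
    have 3: "v \<bullet> p = 0"
      using 2 by (simp only: inner_commute)
    have "c t \<bullet> c t = (cos (a * t))\<^sup>2 + (sin (a * t))\<^sup>2" for t
      unfolding c_def by (simp add: inner_add_left inner_add_right power2_eq_square 1 2 3)
    then have "range c \<subseteq> S6"
      by (auto simp: norm_eq_1)
    moreover have "(c has_vector_derivative
        (- sin (a * 0) * a) *\<^sub>R p + (cos (a * 0) * a) *\<^sub>R v) (at 0)"
      unfolding c_def has_vector_derivative_def
      by (rule derivative_eq_intros refl | simp add: algebra_simps fun_eq_iff)+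
    then have "(c has_vector_derivative u) (at 0)"
      by (simp add: av)
    moreover have "c 0 = p"
      by (simp add: c_def)
    ultimately show thesis
      using that by blast
  qed
  have "((\<lambda>t. f (\<gamma> t)) has_vector_derivative frechet_derivative f (at p within S6) u) (at 0)"
    using f \<gamma> by (intro frechet_derivative_within_curve [where e = 1])
      (auto simp: differentiable_def)
  moreover have "((\<lambda>t. f (\<gamma> t)) has_vector_derivative f' u) (at 0)"
  proof -
    have "(f \<circ> \<gamma> has_derivative f' \<circ> (\<lambda>h. h *\<^sub>R u)) (at 0)"
      using has_derivative_subset [OF f \<gamma>(3)] \<gamma>(1,2)
      by (intro diff_chain_within) (auto simp: has_vector_derivative_def)
    moreover have "f' \<circ> (\<lambda>h. h *\<^sub>R u) = (\<lambda>h. h *\<^sub>R f' u)"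
      using linear_cmul [OF has_derivative_linear [OF f]] by auto
    ultimately show ?thesis
      by (simp add: has_vector_derivative_def o_def)
  qed
  ultimately show ?thesis
    using vector_derivative_unique_at by blast
qed

lemma orth_proj_eqI:
  assumes "subspace W" "w \<in> W" "v - w \<in> W\<^sup>\<bottom>"
  shows "orth_proj W v = w"
  unfolding orth_proj_def
proof (rule the_equality)
  fix w' assume w': "w' \<in> W \<and> v - w' \<in> W\<^sup>\<bottom>"
  then have "w - w' \<in> W"
    using assms subspace_diff by blast
  then have "(w - w') \<bullet> ((v - w') - (v - w)) = 0"
    using w' assms(3) by (simp add: orthogonal_comp_def orthogonal_def inner_diff_right)
  then show "w' = w" by simp
qed (use assms in auto)

lemma orth_proj_TS6:
  assumes "p \<in> S6"
  shows "orth_proj (TS6 p) v = v - (p \<bullet> v) *\<^sub>R p"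
proof (rule orth_proj_eqI)
  show "subspace (TS6 p)"
    by (auto simp: subspace_def TS6_def inner_add_right)
  have "p \<bullet> p = 1"
    using assms by (simp add: dot_square_norm)
  then show "v - (p \<bullet> v) *\<^sub>R p \<in> TS6 p"
    by (simp add: TS6_def inner_diff_right)
  show "v - (v - (p \<bullet> v) *\<^sub>R p) \<in> (TS6 p)\<^sup>\<bottom>"
    by (auto simp: TS6_def orthogonal_comp_def orthogonal_def inner_commute)
qed

lemma levi_civita_metric:
  assumes p: "p \<in> S6" and u: "u \<in> TS6 p"
    and X: "X differentiable (at p within S6)" "X p \<in> TS6 p"
    and Y: "Y differentiable (at p within S6)" "Y p \<in> TS6 p"
  shows "frechet_derivative (\<lambda>q. X q \<bullet> Y q) (at p within S6) u
         = nabla S6 X p u \<bullet> Y p + X p \<bullet> nabla S6 Y p u"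
proof -
  have XY: "p \<bullet> Y p = 0" "X p \<bullet> p = 0"
    using X(2) Y(2) by (simp_all add: TS6_def inner_commute)
  have "((\<lambda>q. X q \<bullet> Y q) has_derivative
      (\<lambda>h. X p \<bullet> frechet_derivative Y (at p within S6) h + frechet_derivative X (at p within S6) h \<bullet> Y p))
      (at p within S6)"
    using X(1) Y(1) by (intro has_derivative_inner) (auto simp: frechet_derivative_works)
  from frechet_derivative_sphere_unique [OF this p u] show ?thesis
    using XY by (simp add: nabla_def orth_proj_TS6 [OF p] inner_diff_left inner_diff_right)
qed

lemma levi_civita_torsion_free:
  assumes p: "p \<in> S6"
    and X: "X differentiable (at p within S6)" "\<And>q. q \<in> S6 \<Longrightarrow> X q \<in> TS6 q"
    and Y: "Y differentiable (at p within S6)" "\<And>q. q \<in> S6 \<Longrightarrow> Y q \<in> TS6 q"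
  shows "nabla S6 Y p (X p) - nabla S6 X p (Y p)
         = frechet_derivative Y (at p within S6) (X p) - frechet_derivative X (at p within S6) (Y p)"
proof -
  have *: "p \<bullet> frechet_derivative Z (at p within S6) u + u \<bullet> Z p = 0"
    if Z: "Z differentiable (at p within S6)" "\<And>q. q \<in> S6 \<Longrightarrow> Z q \<in> TS6 q" and u: "u \<in> TS6 p" for Z u
  proof -
    have h1: "((\<lambda>q. q \<bullet> Z q) has_derivative
        (\<lambda>h. p \<bullet> frechet_derivative Z (at p within S6) h + h \<bullet> Z p)) (at p within S6)"
      using Z(1) by (intro has_derivative_inner) (auto simp: frechet_derivative_works)
    have h2: "((\<lambda>q. q \<bullet> Z q) has_derivative (\<lambda>h. 0)) (at p within S6)"
      by (rule has_derivative_transform [where f = "\<lambda>_. 0"]) (use p Z(2) in \<open>auto simp: TS6_def\<close>)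
    show ?thesis
      using frechet_derivative_sphere_unique [OF h1 p u] frechet_derivative_sphere_unique [OF h2 p u]
      by simp
  qed
  have "p \<bullet> frechet_derivative X (at p within S6) (Y p) = p \<bullet> frechet_derivative Y (at p within S6) (X p)"
    using * [OF X Y(2) [OF p]] * [OF Y X(2) [OF p]] by (simp add: inner_commute)
  then show ?thesis
    by (simp add: nabla_def orth_proj_TS6 [OF p])
qed

text \<open>\<open>(\<nabla>\<^sub>u J) X = \<nabla>\<^sub>u (J X) - J (\<nabla>\<^sub>u X)\<close>\<close>

definition nabla_J :: "(real^7) set \<Rightarrow> (real^7 \<Rightarrow> real^7) \<Rightarrow> real^7 \<Rightarrow> real^7 \<Rightarrow> real^7" where
  "nabla_J S X p u = nabla S (\<lambda>q. J q (X q)) p u - J p (nabla S X p u)"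

definition char_nabla :: "(real^7) set \<Rightarrow> (real^7 \<Rightarrow> real^7) \<Rightarrow> real^7 \<Rightarrow> real^7 \<Rightarrow> real^7" where
  "char_nabla S X p u = nabla S X p u + (1/2) *\<^sub>R nabla_J S (\<lambda>q. J q (X q)) p u"

definition char_nabla_perp :: "(real^7) set \<Rightarrow> (real^7 \<Rightarrow> real^7) \<Rightarrow> real^7 \<Rightarrow> real^7 \<Rightarrow> real^7" where
  "char_nabla_perp S \<nu> p u = orth_proj (normal_space S p) (char_nabla S \<nu> p u)"


section \<open>The Dirac operator and the stability indices\<close>

text \<open>Sections are extended by zero off \<open>S\<close>, so that they form a vector space of functions.\<close>

definition normal_sections :: "(real^7) set \<Rightarrow> (real^7 \<Rightarrow> real^7) set" where
  "normal_sections S =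
     {\<nu>. smooth_along S \<nu> \<and> (\<forall>p\<in>S. \<nu> p \<in> normal_space S p) \<and> (\<forall>p. p \<notin> S \<longrightarrow> \<nu> p = 0)}"

text \<open>The value does not depend on the oriented orthonormal frame.\<close>

definition dirac :: "(real^7) set \<Rightarrow> (real^7 \<Rightarrow> real^7) \<Rightarrow> real^7 \<Rightarrow> real^7" where
  "dirac S \<nu> p =
     (THE w. \<exists>f\<^sub>1 f\<^sub>2. oriented_frame S p f\<^sub>1 f\<^sub>2 \<and>
        w = cross7 f\<^sub>1 (char_nabla_perp S \<nu> p f\<^sub>1) + cross7 f\<^sub>2 (char_nabla_perp S \<nu> p f\<^sub>2))"

definition eigensections :: "(real^7) set \<Rightarrow> real \<Rightarrow> (real^7 \<Rightarrow> real^7) set" where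
  "eigensections S l =
     {\<nu> \<in> normal_sections S. \<forall>p\<in>S. J p (dirac S \<nu> p) = (l + 1) *\<^sub>R \<nu> p}"

interpretation fun_space: vector_space "\<lambda>c (f :: 'a \<Rightarrow> 'b::real_vector) x. c *\<^sub>R f x"
  by unfold_locales (auto simp: fun_eq_iff algebra_simps)

text \<open>The library dimension of an infinite-dimensional space is zero; here it is \<open>\<infinity>\<close>.\<close>

definition fun_edim :: "('a \<Rightarrow> 'b::real_vector) set \<Rightarrow> enat" where
  "fun_edim V = (if \<exists>B. finite B \<and> V \<subseteq> fun_space.span B then enat (fun_space.dim V) else \<infinity>)"

definition eigen_dim :: "(real^7) set \<Rightarrow> real \<Rightarrow> ereal" where
  "eigen_dim S l = ereal_of_enat (fun_edim (eigensections S l))"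

definition cone_over :: "(real^7) set \<Rightarrow> (real^7) set" where
  "cone_over S = {r *\<^sub>R x | r x. 0 < r \<and> x \<in> S}"

definition link :: "(real^7) set \<Rightarrow> (real^7) set" where
  "link C = C \<inter> S6"

lemma link_cone_over:
  assumes "S \<subseteq> S6"
  shows "link (cone_over S) = S"
proof
  show "link (cone_over S) \<subseteq> S"
    using assms by (auto simp: link_def cone_over_def)
  show "S \<subseteq> link (cone_over S)"
    using assms by (force simp: link_def cone_over_def intro: exI [where x = 1])
qed

text \<open>As extended reals, the indices (in particular the sums over the continuum of all \<open>l\<close> in
  \<open>(-1,1)\<close>) are finite only if all the multiplicities involved are finite and almost all of them
  vanish.\<close>

definition s_ind_plus :: "(real^7) set \<Rightarrow> ereal" where
  "s_ind_plus C =
     eigen_dim (link C) (-1) / 2 + eigen_dim (link C) 1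
     + (\<Sum>\<^sub>\<infinity>l\<in>{-1<..<1}. eigen_dim (link C) l)
     - 7 - ereal (dim_quotient G2 (G2_stabilizer (link C)))"

definition s_ind_minus :: "(real^7) set \<Rightarrow> ereal" where
  "s_ind_minus C =
     eigen_dim (link C) (-1) / 2 + (\<Sum>\<^sub>\<infinity>l\<in>{-1<..<1}. eigen_dim (link C) l) - 7"

definition rigid_cone :: "(real^7) set \<Rightarrow> bool" where
  "rigid_cone C \<longleftrightarrow> s_ind_plus C = s_ind_minus C"


section \<open>The Boruvka sphere\<close>

definition partial :: "'n \<Rightarrow> (real^'n \<Rightarrow> real) \<Rightarrow> real^'n \<Rightarrow> real" where
  "partial i f x = frechet_derivative f (at x) (axis i 1)"

definition harmonic_cubics :: "(real^3 \<Rightarrow> real) set" where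
  "harmonic_cubics =
     {f. real_polynomial_function f \<and> (\<forall>c x. f (c *\<^sub>R x) = c ^ 3 * f x) \<and>
         (\<forall>x. (\<Sum>i\<in>UNIV. partial i (partial i f) x) = 0)}"

text \<open>Integration over the unit two-sphere, in spherical coordinates.\<close>

definition S2_integral :: "(real^3 \<Rightarrow> real) \<Rightarrow> real" where
  "S2_integral f = integral {0..pi} (\<lambda>t. integral {0..2*pi} (\<lambda>s.
     f (vector [sin t * cos s, sin t * sin s, cos t]) * sin t))"

text \<open>A change of the basis \<open>P\<close> amounts to an orthogonal transformation of \<open>\<real>\<^sup>7\<close>, so
  this predicate describes all the congruent copies of the Boruvka sphere in \<open>S6\<close>.\<close>

definition boruvka_sphere :: "(real^7) set \<Rightarrow> bool" where
  "boruvka_sphere S \<longleftrightarrow>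
     (\<exists>P :: 7 \<Rightarrow> real^3 \<Rightarrow> real.
        inj P \<and> fun_space.independent (range P) \<and> fun_space.span (range P) = harmonic_cubics \<and>
        (\<forall>i j. i \<noteq> j \<longrightarrow> S2_integral (\<lambda>x. P i x * P j x) = 0) \<and>
        (\<forall>i j. S2_integral (\<lambda>x. (P i x)\<^sup>2) = S2_integral (\<lambda>x. (P j x)\<^sup>2)) \<and>
        (\<forall>x\<in>sphere 0 1. (\<Sum>i\<in>UNIV. (P i x)\<^sup>2) = 1) \<and>
        S = (\<lambda>x. \<chi> i. P i x) ` sphere 0 1)"

end

theory Submission
  imports Defs "HOL-Complex_Analysis.Cauchy_Integral_Formula"
begin

text \<open>The Boruvka sphere is an orbit of a three-dimensional group, and this makes all the data in the
  definition of the stability indices computable by algebra on the unit sphere \<open>S3\<close> of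
  \<open>\<complex>\<^sup>2\<close>, which covers it through the Hopf map \<open>q \<mapsto> x(q)\<close> onto the unit sphere of
  \<open>\<real>\<^sup>3\<close>.

  Each of the seven cubics is the cubic form of a symmetric trace-free tensor.  Inserting into these
  tensors the vector \<open>x\<close>, the isotropic tangent vector \<open>m\<close> (the derivative of \<open>x\<close>) and its conjugate
  gives seven maps \<open>H\<^sub>0, \<dots>, H\<^sub>6\<close> from \<open>S3\<close> to \<open>\<complex>\<^sup>7\<close>, where \<open>H\<^sub>3\<close> is the point of
  the surface, \<open>H\<^sub>4\<close> is tangent, \<open>H\<^sub>5\<close> and \<open>H\<^sub>6\<close> are normal, and \<open>H\<^bsub>6-j\<^esub>\<close> is up to sign the
  conjugate of \<open>H\<^sub>j\<close>.  Two of the three invariant vector fields of \<open>S3\<close> combine to a raising operator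
  \<open>up\<close> and a lowering operator \<open>dn\<close>, which take \<open>H\<^sub>j\<close> to \<open>(6 - j) H\<^bsub>j+1\<^esub>\<close> and \<open>- j H\<^bsub>j-1\<^esub>\<close>.  Hence
  the relation \<open>H\<^sub>3 \<bullet> H\<^sub>3 = 1\<close>, differentiated repeatedly, yields all the inner products of
  the frame (\<open>cdot_H\<close>), and \<open>H\<^sub>3 \<times> H\<^sub>4 = - \<i> H\<^sub>4\<close>, which expresses that the surface is
  \<open>J\<close>-holomorphic, yields all its cross products (\<open>cross_H\<close>).

  A normal field \<open>\<nu>\<close> is recorded by its components \<open>a = \<nu> \<bullet> H\<^sub>5\<close> and \<open>b = \<nu> \<bullet> H\<^sub>6\<close>, functions of
  weight 4 and 6 along the Hopf fibres.  In these terms the equation \<open>J D \<nu> = (l + 1) \<nu>\<close> becomes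
  \<open>up a = (l + 1) b\<close> and \<open>dn b = - 6 (l + 1) a\<close> (\<open>eigensections_iff\<close>), so that \<open>dn (up a) = - \<theta> a\<close>
  with \<open>\<theta> = 6 (l + 1)\<^sup>2\<close>.  Raising \<open>a\<close> increases the weight \<open>k\<close> by 2 and decreases \<open>\<theta>\<close> by
  \<open>k + 2\<close>; a maximum principle forbids \<open>\<theta>\<close> to become negative.  Therefore, in the range below 30,
  only the values 0, 6, 14 and 24 occur, and after 0, 1, 2 and 3 steps one arrives at
  functions annihilated by \<open>up\<close>, which are the homogeneous holomorphic polynomials of degree 4, 6, 8
  and 10 by Liouville's theorem (\<open>ladder_param_4\<close>).  Their real dimensions are 10, 14, 18 and 22,
  and the four values of \<open>\<theta>\<close> belong to \<open>l = - 1\<close>, \<open>0\<close>, \<open>sqrt (7/3) - 1\<close> and \<open>1\<close>.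

  It remains to find the dimension of the quotient of \<open>G2\<close> by the stabiliser.  The Lie algebra of
  \<open>G2\<close> has dimension 14: differentiating the invariance of \<open>phi\<close> gives 35 linear equations for the
  49 entries of a matrix, and explicit solutions generate periodic one-parameter groups.  The stabiliser has a Lie
  algebra of dimension 3.  On the one hand left multiplications by unit quaternions act on \<open>S3\<close>,
  commute with \<open>up\<close> and \<open>dn\<close>, and therefore carry the frame at one point to the frame
  at another by a fixed element of \<open>G2\<close> (\<open>Rho_stabilizer\<close>).  On the other hand an infinitesimal
  symmetry \<open>Z\<close> moves each point of the surface tangentially, and differentiating this statement
  determines \<open>Z\<close> from a complex and a real number (\<open>infinitesimal_eq_0\<close>).  So the indices are
  \<open>5 + 22 + (14 + 18) - 7 - 11 = 41\<close> and \<open>5 + (14 + 18) - 7 = 30\<close>.\<close>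

section \<open>Calculus of smooth maps\<close>

lemma Ck_on_continuous: "Ck_on k U f \<Longrightarrow> continuous_on U f"
  by (cases k) (auto simp: differentiable_imp_continuous_on)

lemma Ck_on_Suc_D: "Ck_on (Suc k) U f \<Longrightarrow> Ck_on k U f"
proof (induction k arbitrary: f)
  case 0
  then show ?case by (simp add: differentiable_imp_continuous_on)
next
  case (Suc k)
  then show ?case by (metis Ck_on.simps(2))
qed

lemma frechet_derivative_cong_open:
  assumes "open U" "x \<in> U" "\<And>y. y \<in> U \<Longrightarrow> f y = g y"
  shows "frechet_derivative f (at x) = frechet_derivative g (at x)"
proof -
  have "(f has_derivative D) (at x) \<longleftrightarrow> (g has_derivative D) (at x)" for D
    using assms by (metis (no_types, lifting) has_derivative_transform_within_open)
  then show ?thesis by (simp add: frechet_derivative_def)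
qed

lemma Ck_on_cong:
  assumes "open U" "\<And>y. y \<in> U \<Longrightarrow> f y = g y" "Ck_on k U f"
  shows "Ck_on k U g"
  using assms(2,3)
proof (induction k arbitrary: f g)
  case 0
  then show ?case by (simp cong: continuous_on_cong)
next
  case (Suc k)
  have "g differentiable_on U"
    using Suc.prems by (auto simp: differentiable_on_def intro: differentiable_transform_within [OF _ zero_less_one])
  moreover have "Ck_on k U (\<lambda>x. frechet_derivative g (at x) v)" for v
    by (rule Suc.IH [of "\<lambda>x. frechet_derivative f (at x) v"])
      (use Suc.prems frechet_derivative_cong_open [OF assms(1)] in \<open>auto, metis\<close>)
  ultimately show ?case by simp
qed

lemma Ck_on_subset:
  assumes "open U" "U \<subseteq> V" "Ck_on k V f"
  shows "Ck_on k U f"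
  using assms(3)
proof (induction k arbitrary: f)
  case 0
  then show ?case using assms continuous_on_subset by auto
next
  case (Suc k)
  then show ?case using assms differentiable_on_subset by auto
qed

lemma differentiable_on_open:
  "open U \<Longrightarrow> f differentiable_on U \<longleftrightarrow> (\<forall>x\<in>U. f differentiable (at x))"
  by (simp add: differentiable_on_eq_differentiable_at)

lemma Ck_on_SucI:
  assumes U: "open U" and D: "\<And>x. x \<in> U \<Longrightarrow> (f has_derivative f' x) (at x)"
    and k: "\<And>v. Ck_on k U (\<lambda>x. f' x v)"
  shows "Ck_on (Suc k) U f"
proof -
  have "f differentiable_on U"
    using D by (auto simp: differentiable_on_open [OF U] differentiable_def)
  moreover have "Ck_on k U (\<lambda>x. frechet_derivative f (at x) v)" for v
    by (rule Ck_on_cong [OF U _ k [of v]]) (simp add: frechet_derivative_at [OF D, symmetric])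
  ultimately show ?thesis by simp
qed

lemma Ck_on_SucD:
  assumes U: "open U" and f: "Ck_on (Suc k) U f"
  shows "x \<in> U \<Longrightarrow> (f has_derivative frechet_derivative f (at x)) (at x)"
    and "Ck_on k U (\<lambda>x. frechet_derivative f (at x) v)"
  using f by (auto simp: differentiable_on_open [OF U] frechet_derivative_works)

lemma Ck_on_const: "open U \<Longrightarrow> Ck_on k U (\<lambda>x. c)"
proof (induction k arbitrary: c)
  case 0
  then show ?case by simp
next
  case (Suc k)
  then show ?case by (intro Ck_on_SucI [where f' = "\<lambda>_ _. 0"]) auto
qed

lemma Ck_on_bounded_linear:
  assumes "bounded_linear L" "open U"
  shows "Ck_on k U f \<Longrightarrow> Ck_on k U (\<lambda>x. L (f x))"
proof (induction k arbitrary: f)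
  case 0
  then show ?case using assms by (simp add: bounded_linear.continuous_on)
next
  case (Suc k)
  show ?case
    by (rule Ck_on_SucI [OF assms(2), where f' = "\<lambda>x v. L (frechet_derivative f (at x) v)"])
      (use Ck_on_SucD [OF assms(2) Suc.prems] Suc.IH assms(1) in
        \<open>auto intro: bounded_linear.has_derivative\<close>)
qed

lemma Ck_on_id: "open U \<Longrightarrow> Ck_on k U (\<lambda>x. x)"
proof (cases k)
  case (Suc j)
  assume "open U"
  then show ?thesis
    unfolding Suc by (intro Ck_on_SucI [where f' = "\<lambda>_ v. v"] Ck_on_const) auto
qed simp

lemma Ck_on_add:
  assumes "open U"
  shows "Ck_on k U f \<Longrightarrow> Ck_on k U g \<Longrightarrow> Ck_on k U (\<lambda>x. f x + g x)"
proof (induction k arbitrary: f g)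
  case 0
  then show ?case by (simp add: continuous_on_add)
next
  case (Suc k)
  show ?case
    by (rule Ck_on_SucI [OF assms,
        where f' = "\<lambda>x v. frechet_derivative f (at x) v + frechet_derivative g (at x) v"])
      (use Ck_on_SucD [OF assms Suc.prems(1)] Ck_on_SucD [OF assms Suc.prems(2)] Suc.IH in
        \<open>auto intro: has_derivative_add\<close>)
qed

lemma Ck_on_sum:
  assumes "open U" "\<And>i. i \<in> I \<Longrightarrow> Ck_on k U (f i)"
  shows "Ck_on k U (\<lambda>x. \<Sum>i\<in>I. f i x)"
  using assms(2)
  by (induction I rule: infinite_finite_induct) (auto simp: Ck_on_const Ck_on_add assms(1))

lemma Ck_on_bilinear:
  assumes B: "bounded_bilinear B" and U: "open U"
  shows "Ck_on k U f \<Longrightarrow> Ck_on k U g \<Longrightarrow> Ck_on k U (\<lambda>x. B (f x) (g x))"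
proof (induction k arbitrary: f g)
  case 0
  then show ?case using bounded_bilinear.continuous_on [OF B] by auto
next
  case (Suc k)
  show ?case
    by (rule Ck_on_SucI [OF U, where f' = "\<lambda>x v. B (f x) (frechet_derivative g (at x) v)
          + B (frechet_derivative f (at x) v) (g x)"])
      (use Ck_on_SucD [OF U Suc.prems(1)] Ck_on_SucD [OF U Suc.prems(2)] Suc.IH
         Ck_on_Suc_D [OF Suc.prems(1)] Ck_on_Suc_D [OF Suc.prems(2)] in
        \<open>auto intro: Ck_on_add [OF U] bounded_bilinear.FDERIV [OF B]\<close>)
qed

text \<open>By the chain rule, \<open>D(g \<circ> f)\<close> is a combination of the partial derivatives of \<open>g\<close>,
  composed with \<open>f\<close>, with coefficients from \<open>Df\<close>; this makes the induction on the order work.\<close>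

lemma Ck_on_compose:
  fixes f :: "'a::euclidean_space \<Rightarrow> 'b::euclidean_space"
  assumes U: "open U" and V: "open V" and fUV: "f ` U \<subseteq> V"
  shows "Ck_on k U f \<Longrightarrow> Ck_on k V g \<Longrightarrow> Ck_on k U (\<lambda>x. g (f x))"
proof (induction k arbitrary: g)
  case 0
  then show ?case using continuous_on_compose2 [OF _ _ fUV] by simp
next
  case (Suc k)
  let ?Df = "\<lambda>x. frechet_derivative f (at x)" and ?Dg = "\<lambda>x. frechet_derivative g (at (f x))"
  have D: "((\<lambda>x. g (f x)) has_derivative (\<lambda>v. \<Sum>b\<in>Basis. (?Df x v \<bullet> b) *\<^sub>R ?Dg x b)) (at x)"
    if x: "x \<in> U" for x
  proof -
    have g: "(g has_derivative ?Dg x) (at (f x))"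
      using Ck_on_SucD(1) [OF V Suc.prems(2)] fUV x by auto
    have "((g \<circ> f) has_derivative ?Dg x \<circ> ?Df x) (at x)"
      using Ck_on_SucD(1) [OF U Suc.prems(1) x] g by (rule diff_chain_at)
    moreover have "?Dg x \<circ> ?Df x = (\<lambda>v. \<Sum>b\<in>Basis. (?Df x v \<bullet> b) *\<^sub>R ?Dg x b)"
    proof
      fix v
      have "?Dg x (?Df x v) = ?Dg x (\<Sum>b\<in>Basis. (?Df x v \<bullet> b) *\<^sub>R b)"
        by (simp add: euclidean_representation)
      then show "(?Dg x \<circ> ?Df x) v = (\<Sum>b\<in>Basis. (?Df x v \<bullet> b) *\<^sub>R ?Dg x b)"
        using has_derivative_linear [OF g] by (simp add: linear_sum linear_scale)
    qed
    ultimately show ?thesis by (simp add: o_def)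
  qed
  have f: "Ck_on k U f" "\<And>v. Ck_on k U (\<lambda>x. ?Df x v)"
    using Ck_on_Suc_D [OF Suc.prems(1)] Ck_on_SucD [OF U Suc.prems(1)] by auto
  have C: "Ck_on k U (\<lambda>x. \<Sum>b\<in>Basis. (?Df x v \<bullet> b) *\<^sub>R ?Dg x b)" for v
  proof (rule Ck_on_sum [OF U])
    fix b :: 'b
    have "Ck_on k U (\<lambda>x. ?Df x v \<bullet> b)"
      using Ck_on_bounded_linear [OF bounded_linear_inner_left U f(2)] by blast
    moreover have "Ck_on k U (\<lambda>x. ?Dg x b)"
      using Suc.IH [OF f(1) Ck_on_SucD(2) [OF V Suc.prems(2), of b]] .
    ultimately show "Ck_on k U (\<lambda>x. (?Df x v \<bullet> b) *\<^sub>R ?Dg x b)"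
      by (rule Ck_on_bilinear [OF bounded_bilinear_scaleR U])
  qed
  show ?case
    by (rule Ck_on_SucI [OF U D C])
qed

lemma smooth_on_cong:
  "open U \<Longrightarrow> (\<And>y. y \<in> U \<Longrightarrow> f y = g y) \<Longrightarrow> smooth_on U f \<Longrightarrow> smooth_on U g"
  unfolding smooth_on_def using Ck_on_cong by blast

lemma smooth_on_continuous: "smooth_on U f \<Longrightarrow> continuous_on U f"
  unfolding smooth_on_def using Ck_on_continuous by blast

lemma smooth_on_subset: "open U \<Longrightarrow> U \<subseteq> V \<Longrightarrow> smooth_on V f \<Longrightarrow> smooth_on U f"
  unfolding smooth_on_def using Ck_on_subset by blast

lemma smooth_on_const: "open U \<Longrightarrow> smooth_on U (\<lambda>x. c)"
  unfolding smooth_on_def using Ck_on_const by blast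

lemma smooth_on_id: "open U \<Longrightarrow> smooth_on U (\<lambda>x. x)"
  unfolding smooth_on_def using Ck_on_id by blast

lemma smooth_on_add:
  "open U \<Longrightarrow> smooth_on U f \<Longrightarrow> smooth_on U g \<Longrightarrow> smooth_on U (\<lambda>x. f x + g x)"
  unfolding smooth_on_def using Ck_on_add by blast

lemma smooth_on_sum:
  "open U \<Longrightarrow> (\<And>i. i \<in> I \<Longrightarrow> smooth_on U (f i)) \<Longrightarrow> smooth_on U (\<lambda>x. \<Sum>i\<in>I. f i x)"
  unfolding smooth_on_def by (simp add: Ck_on_sum)

lemma smooth_on_bounded_linear:
  "bounded_linear L \<Longrightarrow> open U \<Longrightarrow> smooth_on U f \<Longrightarrow> smooth_on U (\<lambda>x. L (f x))"
  unfolding smooth_on_def using Ck_on_bounded_linear by blast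

lemma smooth_on_linear:
  fixes L :: "'a::euclidean_space \<Rightarrow> 'b::real_normed_vector"
  shows "linear L \<Longrightarrow> open U \<Longrightarrow> smooth_on U L"
  using smooth_on_bounded_linear [OF _ _ smooth_on_id] linear_conv_bounded_linear by blast

lemma smooth_on_bilinear:
  "bounded_bilinear B \<Longrightarrow> open U \<Longrightarrow> smooth_on U f \<Longrightarrow> smooth_on U g \<Longrightarrow>
    smooth_on U (\<lambda>x. B (f x) (g x))"
  unfolding smooth_on_def using Ck_on_bilinear by blast

lemmas smooth_on_mult = smooth_on_bilinear [OF bounded_bilinear_mult]

lemmas smooth_on_scaleR = smooth_on_bilinear [OF bounded_bilinear_scaleR]

lemmas smooth_on_inner = smooth_on_bilinear [OF bounded_bilinear_inner]

lemma smooth_on_compose: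
  fixes f :: "'a::euclidean_space \<Rightarrow> 'b::euclidean_space"
  shows "open U \<Longrightarrow> open V \<Longrightarrow> f ` U \<subseteq> V \<Longrightarrow> smooth_on U f \<Longrightarrow> smooth_on V g \<Longrightarrow>
    smooth_on U (\<lambda>x. g (f x))"
  unfolding smooth_on_def using Ck_on_compose by blast

lemma smooth_on_has_derivative:
  "open U \<Longrightarrow> smooth_on U f \<Longrightarrow> x \<in> U \<Longrightarrow> (f has_derivative frechet_derivative f (at x)) (at x)"
  unfolding smooth_on_def using Ck_on_SucD(1) by blast

lemma smooth_on_frechet_derivative:
  assumes "open U" "smooth_on U f"
  shows "smooth_on U (\<lambda>x. frechet_derivative f (at x) v)"
  using assms Ck_on_SucD(2) unfolding smooth_on_def by blast

lemma smooth_on_derivative_along: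
  fixes f :: "'a::euclidean_space \<Rightarrow> 'b::real_normed_vector"
  assumes U: "open U" and f: "smooth_on U f" and L: "smooth_on U L"
  shows "smooth_on U (\<lambda>x. frechet_derivative f (at x) (L x))"
proof (rule smooth_on_cong [OF U])
  show "smooth_on U (\<lambda>x. \<Sum>b\<in>Basis. (L x \<bullet> b) *\<^sub>R frechet_derivative f (at x) b)"
  proof (rule smooth_on_sum [OF U])
    fix b :: 'a
    have "smooth_on U (\<lambda>x. L x \<bullet> b)"
      using smooth_on_bounded_linear [OF bounded_linear_inner_left U L] by blast
    then show "smooth_on U (\<lambda>x. (L x \<bullet> b) *\<^sub>R frechet_derivative f (at x) b)"
      using smooth_on_frechet_derivative [OF U f] by (rule smooth_on_scaleR [OF U])
  qed
  fix x assume "x \<in> U"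
  then have lin: "linear (frechet_derivative f (at x))"
    using smooth_on_has_derivative [OF U f] has_derivative_linear by blast
  have "frechet_derivative f (at x) (L x) = frechet_derivative f (at x) (\<Sum>b\<in>Basis. (L x \<bullet> b) *\<^sub>R b)"
    by (simp add: euclidean_representation)
  then show "(\<Sum>b\<in>Basis. (L x \<bullet> b) *\<^sub>R frechet_derivative f (at x) b)
      = frechet_derivative f (at x) (L x)"
    using lin by (simp add: linear_sum linear_scale)
qed

lemma smooth_on_powr: "smooth_on {0<..} (\<lambda>t::real. t powr s)"
  unfolding smooth_on_def
proof
  fix k show "Ck_on k {0<..} (\<lambda>t::real. t powr s)"
  proof (induction k arbitrary: s)
    case 0
    then show ?case by (auto intro!: continuous_intros)
  next
    case (Suc k)
    show ?case
    proof (rule Ck_on_SucI [where f' = "\<lambda>t v. (s * t powr (s - 1)) * v"])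
      show "((\<lambda>t. t powr s) has_derivative (\<lambda>v. (s * t powr (s - 1)) * v)) (at t)"
        if "t \<in> {0<..}" for t :: real
        using has_real_derivative_powr [of t s] that
        by (simp add: has_field_derivative_def)
      show "Ck_on k {0<..} (\<lambda>t::real. s * t powr (s - 1) * v)" for v
        using Ck_on_bounded_linear [OF bounded_linear_mult_left [of "s * v"] _ Suc.IH [of "s - 1"]]
        by (auto simp: mult_ac)
    qed simp
  qed
qed

lemma smooth_on_sgn:
  fixes f :: "'a::euclidean_space \<Rightarrow> 'b::euclidean_space"
  assumes U: "open U" and f: "smooth_on U f" and nz: "\<And>x. x \<in> U \<Longrightarrow> f x \<noteq> 0"
  shows "smooth_on U (\<lambda>x. sgn (f x))"
proof (rule smooth_on_cong [OF U])
  have "smooth_on U (\<lambda>x. (f x \<bullet> f x) powr (-1/2))"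
    by (rule smooth_on_compose [OF U _ _ smooth_on_inner [OF U f f] smooth_on_powr])
      (use nz in auto)
  then show "smooth_on U (\<lambda>x. ((f x \<bullet> f x) powr (-1/2)) *\<^sub>R f x)"
    using U f by (intro smooth_on_scaleR)
  fix x assume "x \<in> U"
  then have "f x \<bullet> f x > 0" using nz by simp
  then have "(f x \<bullet> f x) powr (-1/2) = inverse (norm (f x))"
    by (simp add: powr_minus powr_half_sqrt norm_eq_sqrt_inner)
  then show "((f x \<bullet> f x) powr (-1/2)) *\<^sub>R f x = sgn (f x)"
    by (simp add: sgn_div_norm)
qed

lemma smooth_on_sin_cos: "smooth_on UNIV (\<lambda>t::real. sin (c * t))" "smooth_on UNIV (\<lambda>t::real. cos (c * t))"
proof -
  have "Ck_on k UNIV (\<lambda>t::real. sin (c * t)) \<and> Ck_on k UNIV (\<lambda>t::real. cos (c * t))" for k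
  proof (induction k)
    case 0
    show ?case by (auto intro!: continuous_intros)
  next
    case (Suc k)
    have sin: "Ck_on k UNIV (\<lambda>t::real. sin (c * t) * v)" and cos: "Ck_on k UNIV (\<lambda>t::real. cos (c * t) * v)" for v
      using Suc Ck_on_bounded_linear [OF bounded_linear_mult_left [of v]] by auto
    show ?case
    proof
      show "Ck_on (Suc k) UNIV (\<lambda>t::real. sin (c * t))"
        by (rule Ck_on_SucI [where f' = "\<lambda>t v. cos (c * t) * (c * v)"])
          (auto intro!: cos derivative_eq_intros)
      show "Ck_on (Suc k) UNIV (\<lambda>t::real. cos (c * t))"
        by (rule Ck_on_SucI [where f' = "\<lambda>t v. sin (c * t) * (- c * v)"])
          (use sin [of "- (c * v)" for v] in \<open>auto intro!: derivative_eq_intros\<close>)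
    qed
  qed
  then show "smooth_on UNIV (\<lambda>t::real. sin (c * t))" "smooth_on UNIV (\<lambda>t::real. cos (c * t))"
    by (auto simp: smooth_on_def)
qed

text \<open>Symmetry of second derivatives, by the mean value theorem applied twice to the second
  difference.\<close>

lemma second_difference_mvt:
  fixes f :: "'a::euclidean_space \<Rightarrow> real"
  assumes f: "smooth_on (ball x e) f" and h: "h > 0" "h * (norm u + norm v) < e"
  shows "\<exists>y. norm (y - x) \<le> h * (norm u + norm v) \<and>
    f (x + h *\<^sub>R u + h *\<^sub>R v) - f (x + h *\<^sub>R u) - f (x + h *\<^sub>R v) + f x
    = h\<^sup>2 * frechet_derivative (\<lambda>y. frechet_derivative f (at y) u) (at y) v"
proof -
  let ?U = "ball x e"
  define F where "F = (\<lambda>y. frechet_derivative f (at y) u)"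
  have F: "smooth_on ?U F"
    unfolding F_def using f by (intro smooth_on_frechet_derivative) auto
  have near: "norm (s *\<^sub>R u + t *\<^sub>R v) \<le> h * (norm u + norm v)" if "0 \<le> s" "s \<le> h" "0 \<le> t" "t \<le> h" for s t
  proof -
    have "norm (s *\<^sub>R u + t *\<^sub>R v) \<le> s * norm u + t * norm v"
      using that norm_triangle_ineq [of "s *\<^sub>R u" "t *\<^sub>R v"] by simp
    also have "\<dots> \<le> h * norm u + h * norm v"
      using that by (intro add_mono mult_right_mono) auto
    finally show ?thesis by (simp add: algebra_simps)
  qed
  have inU: "x + s *\<^sub>R u + t *\<^sub>R v \<in> ?U" if "0 \<le> s" "s \<le> h" "0 \<le> t" "t \<le> h" for s t
  proof -
    have "dist x (x + s *\<^sub>R u + t *\<^sub>R v) = norm (s *\<^sub>R u + t *\<^sub>R v)"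
      by (simp add: dist_norm algebra_simps norm_minus_commute)
    then show ?thesis using near [OF that] h by simp
  qed
  have D: "((\<lambda>s. g (x + s *\<^sub>R u + t *\<^sub>R v)) has_real_derivative frechet_derivative g (at (x + s *\<^sub>R u + t *\<^sub>R v)) u) (at s)"
    "((\<lambda>t. g (x + s *\<^sub>R u + t *\<^sub>R v)) has_real_derivative frechet_derivative g (at (x + s *\<^sub>R u + t *\<^sub>R v)) v) (at t)"
    if g: "smooth_on ?U g" and st: "0 \<le> s" "s \<le> h" "0 \<le> t" "t \<le> h" for g :: "'a \<Rightarrow> real" and s t
  proof -
    let ?D = "frechet_derivative g (at (x + s *\<^sub>R u + t *\<^sub>R v))"
    have Dg: "(g has_derivative ?D) (at (x + s *\<^sub>R u + t *\<^sub>R v))"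
      using g inU [OF st] by (intro smooth_on_has_derivative [of ?U]) auto
    have lin: "?D (r *\<^sub>R y) = r * ?D y" for r y
      using has_derivative_linear [OF Dg] by (simp add: linear_scale)
    have "((\<lambda>s. x + s *\<^sub>R u + t *\<^sub>R v) has_derivative (\<lambda>r. r *\<^sub>R u)) (at s)"
      by (auto intro!: derivative_eq_intros)
    from diff_chain_at [OF this, of g ?D] Dg show "((\<lambda>s. g (x + s *\<^sub>R u + t *\<^sub>R v)) has_real_derivative ?D u) (at s)"
      by (simp add: o_def has_field_derivative_def lin mult_commute_abs)
    have "((\<lambda>t. x + s *\<^sub>R u + t *\<^sub>R v) has_derivative (\<lambda>r. r *\<^sub>R v)) (at t)"
      by (auto intro!: derivative_eq_intros)
    from diff_chain_at [OF this, of g ?D] Dg show "((\<lambda>t. g (x + s *\<^sub>R u + t *\<^sub>R v)) has_real_derivative ?D v) (at t)"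
      by (simp add: o_def has_field_derivative_def lin mult_commute_abs)
  qed
  have "\<exists>s>0. s < h \<and> (f (x + h *\<^sub>R u + h *\<^sub>R v) - f (x + h *\<^sub>R u + 0 *\<^sub>R v))
      - (f (x + 0 *\<^sub>R u + h *\<^sub>R v) - f (x + 0 *\<^sub>R u + 0 *\<^sub>R v))
      = (h - 0) * (F (x + s *\<^sub>R u + h *\<^sub>R v) - F (x + s *\<^sub>R u + 0 *\<^sub>R v))"
    unfolding F_def using h D(1) [OF f, of _ h] D(1) [OF f, of _ 0] 
    by (intro MVT2 [of 0 h "\<lambda>s. f (x + s *\<^sub>R u + h *\<^sub>R v) - f (x + s *\<^sub>R u + 0 *\<^sub>R v)"
          "\<lambda>s. frechet_derivative f (at (x + s *\<^sub>R u + h *\<^sub>R v)) u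
             - frechet_derivative f (at (x + s *\<^sub>R u + 0 *\<^sub>R v)) u"] DERIV_diff) auto
  then obtain s where s: "0 < s" "s < h" and
    1: "f (x + h *\<^sub>R u + h *\<^sub>R v) - f (x + h *\<^sub>R u) - f (x + h *\<^sub>R v) + f x
      = h * (F (x + s *\<^sub>R u + h *\<^sub>R v) - F (x + s *\<^sub>R u + 0 *\<^sub>R v))"
    by (auto simp: algebra_simps)
  have "\<exists>t>0. t < h \<and> F (x + s *\<^sub>R u + h *\<^sub>R v) - F (x + s *\<^sub>R u + 0 *\<^sub>R v)
      = (h - 0) * frechet_derivative F (at (x + s *\<^sub>R u + t *\<^sub>R v)) v"
    using h s by (intro MVT2 D(2) [OF F]) auto
  then obtain t where t: "0 < t" "t < h" and
    2: "F (x + s *\<^sub>R u + h *\<^sub>R v) - F (x + s *\<^sub>R u + 0 *\<^sub>R v)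
      = h * frechet_derivative F (at (x + s *\<^sub>R u + t *\<^sub>R v)) v"
    by auto
  show ?thesis
    using near [of s t] s t 1 2
    by (intro exI [of _ "x + s *\<^sub>R u + t *\<^sub>R v"]) (auto simp: F_def power2_eq_square algebra_simps)
qed

lemma symmetric_second_derivative_real:
  fixes f :: "'a::euclidean_space \<Rightarrow> real"
  assumes U: "open U" and f: "smooth_on U f" and x: "x \<in> U"
  shows "frechet_derivative (\<lambda>y. frechet_derivative f (at y) u) (at x) v
       = frechet_derivative (\<lambda>y. frechet_derivative f (at y) v) (at x) u" (is "?A u v x = ?A v u x")
proof (rule ccontr)
  assume ne: "?A u v x \<noteq> ?A v u x"
  define d where "d = \<bar>?A u v x - ?A v u x\<bar> / 2"
  have d: "d > 0" using ne by (simp add: d_def)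
  have "continuous_on U (?A u v)" "continuous_on U (?A v u)"
    by (rule smooth_on_continuous, rule smooth_on_frechet_derivative [OF U],
        rule smooth_on_frechet_derivative [OF U f])+
  then have "isCont (?A u v) x" "isCont (?A v u) x"
    using U x by (simp_all add: continuous_on_eq_continuous_at)
  then have "\<exists>e1>0. \<forall>y. dist y x < e1 \<longrightarrow> \<bar>?A u v y - ?A u v x\<bar> < d"
    and "\<exists>e2>0. \<forall>y. dist y x < e2 \<longrightarrow> \<bar>?A v u y - ?A v u x\<bar> < d"
    using d by (simp_all add: continuous_at_eps_delta dist_real_def)
  then obtain e1 e2 where e1: "e1 > 0" "\<And>y. dist y x < e1 \<Longrightarrow> \<bar>?A u v y - ?A u v x\<bar> < d"
    and e2: "e2 > 0" "\<And>y. dist y x < e2 \<Longrightarrow> \<bar>?A v u y - ?A v u x\<bar> < d"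
    by metis
  obtain e3 where e3: "e3 > 0" "ball x e3 \<subseteq> U"
    using U x openE by blast
  define e where "e = min e1 (min e2 e3)"
  have e: "e > 0" using e1 e2 e3 by (simp add: e_def)
  have fe: "smooth_on (ball x e) f"
    by (rule smooth_on_subset [OF _ _ f]) (use e3 in \<open>auto simp: e_def\<close>)
  define h where "h = e / (norm u + norm v + 1)"
  have pos: "norm u + norm v + 1 > 0" by (simp add: add_nonneg_pos)
  have h: "h > 0" "h * (norm u + norm v) < e"
    using e pos by (auto simp: h_def field_simps)
  obtain y where y: "norm (y - x) \<le> h * (norm u + norm v)"
    "f (x + h *\<^sub>R u + h *\<^sub>R v) - f (x + h *\<^sub>R u) - f (x + h *\<^sub>R v) + f x = h\<^sup>2 * ?A u v y"
    using second_difference_mvt [OF fe h] by blast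
  obtain z where z: "norm (z - x) \<le> h * (norm u + norm v)"
    "f (x + h *\<^sub>R v + h *\<^sub>R u) - f (x + h *\<^sub>R v) - f (x + h *\<^sub>R u) + f x = h\<^sup>2 * ?A v u z"
    using second_difference_mvt [OF fe, of h v u] h by (auto simp: add.commute)
  have swap: "x + h *\<^sub>R v + h *\<^sub>R u = x + h *\<^sub>R u + h *\<^sub>R v"
    by (simp add: add_ac)
  have "h\<^sup>2 * ?A u v y = h\<^sup>2 * ?A v u z"
    using y(2) z(2) [unfolded swap] by linarith
  then have "?A u v y = ?A v u z" using h by simp
  moreover have "\<bar>?A u v y - ?A u v x\<bar> < d" "\<bar>?A v u z - ?A v u x\<bar> < d"
    using y z h e1 e2 by (auto simp: dist_norm e_def)
  moreover have False if "r = s" "\<bar>r - a\<bar> < \<bar>a - b\<bar> / 2" "\<bar>s - b\<bar> < \<bar>a - b\<bar> / 2" for r s a b :: real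
    using that by (auto simp: abs_if field_simps split: if_splits)
  ultimately show False unfolding d_def by blast
qed

lemma symmetric_second_derivative:
  fixes f :: "'a::euclidean_space \<Rightarrow> 'b::euclidean_space"
  assumes U: "open U" and f: "smooth_on U f" and x: "x \<in> U"
  shows "frechet_derivative (\<lambda>y. frechet_derivative f (at y) u) (at x) v
       = frechet_derivative (\<lambda>y. frechet_derivative f (at y) v) (at x) u"
proof (rule euclidean_eqI)
  fix b :: 'b assume "b \<in> Basis"
  have D: "frechet_derivative (\<lambda>y. g y \<bullet> b) (at y) w = frechet_derivative g (at y) w \<bullet> b"
    if "smooth_on U g" "y \<in> U" for g :: "'a \<Rightarrow> 'b" and y w
    using has_derivative_inner_left [OF smooth_on_has_derivative [OF U that], of b]
    by (simp add: frechet_derivative_at [symmetric])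
  have fb: "smooth_on U (\<lambda>y. f y \<bullet> b)"
    by (intro smooth_on_bounded_linear [OF bounded_linear_inner_left] U f)
  have *: "frechet_derivative (\<lambda>y. frechet_derivative f (at y) w) (at x) w' \<bullet> b
    = frechet_derivative (\<lambda>y. frechet_derivative (\<lambda>y. f y \<bullet> b) (at y) w) (at x) w'" for w w'
    using D [OF smooth_on_frechet_derivative [OF U f] x] D [OF f]
      frechet_derivative_cong_open [OF U x, of "\<lambda>y. frechet_derivative (\<lambda>y. f y \<bullet> b) (at y) w"
        "\<lambda>y. frechet_derivative f (at y) w \<bullet> b"] by simp
  show "frechet_derivative (\<lambda>y. frechet_derivative f (at y) u) (at x) v \<bullet> b
     = frechet_derivative (\<lambda>y. frechet_derivative f (at y) v) (at x) u \<bullet> b"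
    unfolding * by (rule symmetric_second_derivative_real [OF U fb x])
qed

lemma smooth_along_cong:
  "smooth_along S f \<Longrightarrow> (\<And>q. q \<in> S \<Longrightarrow> f q = g q) \<Longrightarrow> smooth_along S g"
  unfolding smooth_along_def by (metis IntD1)

lemma smooth_on_imp_along: "open U \<Longrightarrow> S \<subseteq> U \<Longrightarrow> smooth_on U f \<Longrightarrow> smooth_along S f"
  unfolding smooth_along_def by blast

lemma smooth_along_const: "smooth_along S (\<lambda>q. c)"
  by (rule smooth_on_imp_along [OF open_UNIV subset_UNIV smooth_on_const [OF open_UNIV]])

lemma smooth_along_linear:
  fixes L :: "'a::euclidean_space \<Rightarrow> 'b::real_normed_vector"
  shows "linear L \<Longrightarrow> smooth_along S L"
  by (rule smooth_on_imp_along [OF open_UNIV subset_UNIV smooth_on_linear [OF _ open_UNIV]])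

lemma smooth_along_bounded_linear:
  assumes L: "bounded_linear L" and f: "smooth_along S f"
  shows "smooth_along S (\<lambda>q. L (f q))"
  unfolding smooth_along_def
proof
  fix p assume "p \<in> S"
  then obtain U g where U: "open U" "p \<in> U" "smooth_on U g" "\<forall>q\<in>S \<inter> U. g q = f q"
    using f unfolding smooth_along_def by blast
  show "\<exists>U g. open U \<and> p \<in> U \<and> smooth_on U g \<and> (\<forall>q\<in>S \<inter> U. g q = L (f q))"
    by (rule exI [of _ U], rule exI [of _ "\<lambda>q. L (g q)"])
      (use U smooth_on_bounded_linear [OF L U(1,3)] in auto)
qed

lemma smooth_along_bilinear:
  assumes B: "bounded_bilinear B" and f: "smooth_along S f" and g: "smooth_along S g"
  shows "smooth_along S (\<lambda>q. B (f q) (g q))"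
  unfolding smooth_along_def
proof
  fix p assume p: "p \<in> S"
  obtain U F where U: "open U" "p \<in> U" "smooth_on U F" "\<forall>q\<in>S \<inter> U. F q = f q"
    using f p unfolding smooth_along_def by blast
  obtain V G where V: "open V" "p \<in> V" "smooth_on V G" "\<forall>q\<in>S \<inter> V. G q = g q"
    using g p unfolding smooth_along_def by blast
  have o: "open (U \<inter> V)" using U V by auto
  have "smooth_on (U \<inter> V) (\<lambda>q. B (F q) (G q))"
    by (rule smooth_on_bilinear [OF B o smooth_on_subset [OF o _ U(3)] smooth_on_subset [OF o _ V(3)]]) auto
  then show "\<exists>U h. open U \<and> p \<in> U \<and> smooth_on U h \<and> (\<forall>q\<in>S \<inter> U. h q = B (f q) (g q))"
    using U V o by (intro exI [of _ "U \<inter> V"] exI [of _ "\<lambda>q. B (F q) (G q)"]) auto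
qed

lemmas smooth_along_mult = smooth_along_bilinear [OF bounded_bilinear_mult]

lemma smooth_along_add:
  assumes f: "smooth_along S f" and g: "smooth_along S g"
  shows "smooth_along S (\<lambda>q. f q + g q)"
  unfolding smooth_along_def
proof
  fix p assume p: "p \<in> S"
  obtain U F where U: "open U" "p \<in> U" "smooth_on U F" "\<forall>q\<in>S \<inter> U. F q = f q"
    using f p unfolding smooth_along_def by blast
  obtain V G where V: "open V" "p \<in> V" "smooth_on V G" "\<forall>q\<in>S \<inter> V. G q = g q"
    using g p unfolding smooth_along_def by blast
  have o: "open (U \<inter> V)" using U V by auto
  have "smooth_on (U \<inter> V) (\<lambda>q. F q + G q)"
    by (rule smooth_on_add [OF o smooth_on_subset [OF o _ U(3)] smooth_on_subset [OF o _ V(3)]]) auto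
  then show "\<exists>U h. open U \<and> p \<in> U \<and> smooth_on U h \<and> (\<forall>q\<in>S \<inter> U. h q = f q + g q)"
    using U V o by (intro exI [of _ "U \<inter> V"] exI [of _ "\<lambda>q. F q + G q"]) auto
qed

lemma smooth_along_sum:
  "(\<And>i. i \<in> I \<Longrightarrow> smooth_along S (f i)) \<Longrightarrow> smooth_along S (\<lambda>q. \<Sum>i\<in>I. f i q)"
  by (induction I rule: infinite_finite_induct) (auto simp: smooth_along_const smooth_along_add)

lemma smooth_along_cmult:
  fixes f :: "'a::euclidean_space \<Rightarrow> complex"
  shows "smooth_along S f \<Longrightarrow> smooth_along S (\<lambda>q. c * f q)"
  by (rule smooth_along_bounded_linear [OF bounded_linear_mult_right])

lemma smooth_along_compose:
  fixes f :: "'a::euclidean_space \<Rightarrow> 'b::euclidean_space"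
  assumes f: "smooth_along S f" and g: "smooth_along T g" and fST: "f ` S \<subseteq> T"
  shows "smooth_along S (\<lambda>q. g (f q))"
  unfolding smooth_along_def
proof
  fix p assume p: "p \<in> S"
  obtain U F where U: "open U" "p \<in> U" "smooth_on U F" "\<forall>q\<in>S \<inter> U. F q = f q"
    using f p unfolding smooth_along_def by blast
  have "f p \<in> T" using p fST by blast
  then obtain V G where V: "open V" "f p \<in> V" "smooth_on V G" "\<forall>q\<in>T \<inter> V. G q = g q"
    using g unfolding smooth_along_def by blast
  define W where "W = U \<inter> F -` V"
  have W: "open W"
    unfolding W_def using smooth_on_continuous [OF U(3)] U(1) V(1) by (rule continuous_open_preimage)
  have "F p = f p" using U p by auto
  then have "p \<in> W" using U V by (simp add: W_def)
  moreover have "smooth_on W (\<lambda>q. G (F q))"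
    by (rule smooth_on_compose [OF W V(1) _ smooth_on_subset [OF W _ U(3)] V(3)]) (auto simp: W_def)
  moreover have "G (F q) = g (f q)" if "q \<in> S \<inter> W" for q
    using that U V fST by (auto simp: W_def)
  ultimately show "\<exists>U h. open U \<and> p \<in> U \<and> smooth_on U h \<and> (\<forall>q\<in>S \<inter> U. h q = g (f q))"
    using W by (intro exI [of _ W] exI [of _ "\<lambda>q. G (F q)"]) auto
qed

lemma smooth_along_continuous:
  assumes "smooth_along S f"
  shows "continuous_on S f"
  unfolding continuous_on_eq_continuous_within
proof
  fix p assume p: "p \<in> S"
  then obtain U g where U: "open U" "p \<in> U" "smooth_on U g" "\<forall>q\<in>S \<inter> U. g q = f q"
    using assms unfolding smooth_along_def by blast
  have "isCont g p"
    using smooth_on_continuous [OF U(3)] U(1,2) by (simp add: continuous_on_eq_continuous_at)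
  then have "continuous (at p within S) g"
    by (rule continuous_at_imp_continuous_within)
  moreover obtain e where e: "e > 0" "ball p e \<subseteq> U" using U openE by blast
  moreover have "g x = f x" if "x \<in> S" "dist x p < e" for x
    using U(4) e(2) that by (metis IntI dist_commute mem_ball subsetD)
  ultimately show "continuous (at p within S) f"
    using p by (intro continuous_transform_within [of p S g e f]) auto
qed

section \<open>Invariant vector fields on the three-sphere\<close>

abbreviation S3 :: "(complex \<times> complex) set" where
  "S3 \<equiv> sphere 0 1"

text \<open>Orthogonal complex structures; the integral curves of such a linear field on \<open>S3\<close> are the great
  circles \<open>flow L t q\<close>.\<close>

definition unit_field :: "(complex \<times> complex \<Rightarrow> complex \<times> complex) \<Rightarrow> bool" where
  "unit_field L \<longleftrightarrow> linear L \<and> (\<forall>q. L (L q) = - q) \<and> (\<forall>q. q \<bullet> L q = 0) \<and> (\<forall>q. norm (L q) = norm q)"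

definition I1 :: "complex \<times> complex \<Rightarrow> complex \<times> complex" where
  "I1 q = (- cnj (snd q), cnj (fst q))"

definition I2 :: "complex \<times> complex \<Rightarrow> complex \<times> complex" where
  "I2 q = (- \<i> * cnj (snd q), \<i> * cnj (fst q))"

definition I3 :: "complex \<times> complex \<Rightarrow> complex \<times> complex" where
  "I3 q = (\<i> * fst q, \<i> * snd q)"

lemma unit_field_I: "unit_field I1" "unit_field I2" "unit_field I3"
  by (auto simp: unit_field_def I1_def I2_def I3_def linear_iff inner_complex_def norm_prod_def
      algebra_simps norm_mult scaleR_conv_of_real complex_eq_iff add.commute)

lemma I_mult: "I1 (I2 q) = I3 q" "I2 (I1 q) = - I3 q" "I3 (I1 q) = I2 q" "I1 (I3 q) = - I2 q"
  "I2 (I3 q) = I1 q" "I3 (I2 q) = - I1 q"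
  by (auto simp: I1_def I2_def I3_def)

definition flow :: "(complex \<times> complex \<Rightarrow> complex \<times> complex) \<Rightarrow> real \<Rightarrow> complex \<times> complex \<Rightarrow> complex \<times> complex"
  where "flow L t q = cos t *\<^sub>R q + sin t *\<^sub>R L q"

lemma flow_0 [simp]: "flow L 0 q = q"
  by (simp add: flow_def)

lemma unit_fieldD:
  assumes "unit_field L"
  shows "linear L" "L (L q) = - q" "q \<bullet> L q = 0" "L q \<bullet> q = 0" "norm (L q) = norm q" "L q \<bullet> L q = q \<bullet> q"
  using assms unfolding unit_field_def norm_eq by (blast, blast, blast, metis inner_commute, blast+)

lemma flow_S3: assumes "unit_field L" "q \<in> S3" shows "flow L t q \<in> S3"
proof -
  have q: "q \<bullet> q = 1" using assms(2) by (simp add: dot_square_norm)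
  have "flow L t q \<bullet> flow L t q = (cos t)\<^sup>2 + (sin t)\<^sup>2"
    by (simp add: flow_def unit_fieldD [OF assms(1)] inner_add_left inner_add_right q power2_eq_square)
  then show ?thesis by (simp add: norm_eq_1)
qed

lemma flow_add: assumes "unit_field L" shows "flow L s (flow L t q) = flow L (s + t) q"
proof -
  have "L (flow L t q) = cos t *\<^sub>R L q + sin t *\<^sub>R (- q)"
    by (simp only: flow_def linear_add [OF unit_fieldD(1) [OF assms]] linear_scale [OF unit_fieldD(1) [OF assms]]
        unit_fieldD(2) [OF assms])
  then have "flow L s (flow L t q) = cos s *\<^sub>R flow L t q + sin s *\<^sub>R (cos t *\<^sub>R L q + sin t *\<^sub>R (- q))"
    by (simp only: flow_def [of L s "flow L t q"])
  then show ?thesis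
    by (simp add: flow_def cos_add sin_add algebra_simps)
qed

lemma has_vector_derivative_flow: "((\<lambda>t. flow L t q) has_vector_derivative L q) (at 0)"
  unfolding flow_def by (auto intro!: derivative_eq_intros simp: has_vector_derivative_def fun_eq_iff)

definition X :: "(complex \<times> complex \<Rightarrow> complex \<times> complex) \<Rightarrow> (complex \<times> complex \<Rightarrow> 'b::real_normed_vector)
    \<Rightarrow> complex \<times> complex \<Rightarrow> 'b" where
  "X L f q = vector_derivative (\<lambda>t. f (flow L t q)) (at 0)"

lemma X_eqI: "((\<lambda>t. f (flow L t q)) has_vector_derivative v) (at 0) \<Longrightarrow> X L f q = v"
  unfolding X_def by (rule vector_derivative_at)

lemma has_vector_derivative_ext_flow:
  assumes L: "unit_field L" and q: "q \<in> S3 \<inter> U" and U: "open U" and g: "smooth_on U g"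
    and eq: "\<forall>q\<in>S3 \<inter> U. g q = f q"
  shows "((\<lambda>t. f (flow L t q)) has_vector_derivative frechet_derivative g (at q) (L q)) (at 0)"
proof -
  have Dg: "(g has_derivative frechet_derivative g (at q)) (at q)"
    using smooth_on_has_derivative [OF U g] q by auto
  then have "((\<lambda>t. g (flow L t q)) has_derivative (\<lambda>t. frechet_derivative g (at q) (t *\<^sub>R L q))) (at 0)"
    using has_derivative_compose [OF has_vector_derivative_flow [unfolded has_vector_derivative_def], of g "frechet_derivative g (at q)" L q]
    by simp
  then have *: "((\<lambda>t. g (flow L t q)) has_vector_derivative frechet_derivative g (at q) (L q)) (at 0)"
    using has_derivative_linear [OF Dg] by (simp add: has_vector_derivative_def linear_scale)
  have "continuous_on UNIV (\<lambda>t. flow L t q)"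
    unfolding flow_def by (intro continuous_intros)
  then have "open ((\<lambda>t. flow L t q) -` U)"
    using U by (simp add: open_vimage)
  moreover have "0 \<in> (\<lambda>t. flow L t q) -` U" using q by simp
  ultimately show ?thesis
    by (rule has_vector_derivative_transform_within_open [OF *])
      (use eq flow_S3 [OF L, of q] q in simp)
qed

lemma X_ext:
  assumes L: "unit_field L" and q: "q \<in> S3 \<inter> U" and U: "open U" and g: "smooth_on U g"
    and eq: "\<forall>q\<in>S3 \<inter> U. g q = f q"
  shows "X L f q = frechet_derivative g (at q) (L q)"
  by (rule X_eqI [OF has_vector_derivative_ext_flow [OF assms]])

lemma has_vector_derivative_X:
  assumes L: "unit_field L" and f: "smooth_along S3 f" and q: "q \<in> S3"
  shows "((\<lambda>t. f (flow L t q)) has_vector_derivative X L f q) (at 0)"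
proof -
  obtain U g where U: "open U" "q \<in> U" "smooth_on U g" "\<forall>q\<in>S3 \<inter> U. g q = f q"
    using f q unfolding smooth_along_def by blast
  then have "q \<in> S3 \<inter> U" using q by simp
  from has_vector_derivative_ext_flow [OF L this U(1,3,4)] X_ext [OF L this U(1,3,4)]
  show ?thesis by simp
qed

lemma has_vector_derivative_X_at:
  assumes L: "unit_field L" and f: "smooth_along S3 f" and q: "q \<in> S3"
  shows "((\<lambda>t. f (flow L t q)) has_vector_derivative X L f (flow L t q)) (at t)"
proof -
  have "((\<lambda>s. f (flow L s (flow L t q))) has_vector_derivative X L f (flow L t q)) (at (t - t))"
    using has_vector_derivative_X [OF L f flow_S3 [OF L q]] by simp
  then have "(((\<lambda>s. f (flow L s (flow L t q))) \<circ> (\<lambda>s. s - t)) has_vector_derivative 1 *\<^sub>R X L f (flow L t q)) (at t)"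
    by (intro vector_diff_chain_at) (auto intro!: derivative_eq_intros simp: has_vector_derivative_def)
  then show ?thesis by (simp add: o_def flow_add [OF L])
qed

lemma X_cong:
  assumes "unit_field L" "q \<in> S3" "\<And>q. q \<in> S3 \<Longrightarrow> f q = g q"
  shows "X L f q = X L g q"
  using assms flow_S3 by (simp add: X_def)

lemma smooth_along_X:
  assumes L: "unit_field L" and f: "smooth_along S3 f"
  shows "smooth_along S3 (X L f)"
  unfolding smooth_along_def
proof
  fix p assume "p \<in> S3"
  then obtain U g where U: "open U" "p \<in> U" "smooth_on U g" "\<forall>q\<in>S3 \<inter> U. g q = f q"
    using f unfolding smooth_along_def by blast
  have "smooth_on U L"
    by (rule smooth_on_linear [OF unit_fieldD(1) [OF L] U(1)])
  then have "smooth_on U (\<lambda>q. frechet_derivative g (at q) (L q))"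
    by (rule smooth_on_derivative_along [OF U(1,3)])
  moreover have "\<forall>q\<in>S3 \<inter> U. frechet_derivative g (at q) (L q) = X L f q"
    using X_ext [OF L _ U(1,3,4)] by simp
  ultimately show "\<exists>U g. open U \<and> p \<in> U \<and> smooth_on U g \<and> (\<forall>q\<in>S3 \<inter> U. g q = X L f q)"
    using U by blast
qed

text \<open>Two vector fields that are linear on the ambient space have as bracket the commutator of the
  two linear maps; the second-order terms cancel by symmetry.\<close>

lemma X_X_ext:
  fixes f :: "complex \<times> complex \<Rightarrow> complex"
  assumes L: "unit_field L" and M: "unit_field M" and q: "q \<in> S3 \<inter> U" and U: "open U" and g: "smooth_on U g"
    and eq: "\<forall>q\<in>S3 \<inter> U. g q = f q"
  shows "X L (X M f) q = frechet_derivative g (at q) (M (L q))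
     + frechet_derivative (\<lambda>y. frechet_derivative g (at y) (M q)) (at q) (L q)"
proof -
  let ?D = "\<lambda>y. frechet_derivative g (at y)"
  define H where "H = (\<lambda>u. frechet_derivative (\<lambda>y. ?D y u) (at q))"
  have qU: "q \<in> U" using q by simp
  have linM: "linear M" by (rule unit_fieldD(1) [OF M])
  have lin: "linear (?D y)" if "y \<in> U" for y
    using smooth_on_has_derivative [OF U g that] has_derivative_linear by blast
  have DM: "smooth_on U (\<lambda>y. ?D y (M y))"
    by (rule smooth_on_derivative_along [OF U g smooth_on_linear [OF linM U]])
  have H: "((\<lambda>y. ?D y u) has_derivative H u) (at q)" for u
    unfolding H_def by (rule smooth_on_has_derivative [OF U smooth_on_frechet_derivative [OF U g] qU])
  have Hlin: "linear (H u)" for u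
    using H has_derivative_linear by blast
  have Hsym: "H u v = H v u" for u v
    unfolding H_def by (rule symmetric_second_derivative [OF U g qU])
  have expand: "?D y (M y) = (\<Sum>b\<in>Basis. (M y \<bullet> b) *\<^sub>R ?D y b)" if "y \<in> U" for y
  proof -
    have "?D y (M y) = ?D y (\<Sum>b\<in>Basis. (M y \<bullet> b) *\<^sub>R b)"
      by (simp add: euclidean_representation)
    then show ?thesis using lin [OF that] by (simp add: linear_sum linear_scale)
  qed
  have "((\<lambda>y. \<Sum>b\<in>Basis. (M y \<bullet> b) *\<^sub>R ?D y b) has_derivative
      (\<lambda>v. \<Sum>b\<in>Basis. (M q \<bullet> b) *\<^sub>R H b v + (M v \<bullet> b) *\<^sub>R ?D q b)) (at q)"
  proof (rule has_derivative_sum)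
    fix b :: "complex \<times> complex"
    have "(M has_derivative M) (at q)"
      using linM linear_imp_has_derivative by blast
    then have "((\<lambda>y. M y \<bullet> b) has_derivative (\<lambda>v. M v \<bullet> b)) (at q)"
      by (rule has_derivative_inner_left)
    then show "((\<lambda>y. (M y \<bullet> b) *\<^sub>R ?D y b) has_derivative
        (\<lambda>v. (M q \<bullet> b) *\<^sub>R H b v + (M v \<bullet> b) *\<^sub>R ?D q b)) (at q)"
      using H by (rule has_derivative_scaleR)
  qed
  then have "((\<lambda>y. ?D y (M y)) has_derivative
      (\<lambda>v. \<Sum>b\<in>Basis. (M q \<bullet> b) *\<^sub>R H b v + (M v \<bullet> b) *\<^sub>R ?D q b)) (at q)"
    by (rule has_derivative_transform_within_open [OF _ U qU]) (simp add: expand)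
  then have "frechet_derivative (\<lambda>y. ?D y (M y)) (at q)
      = (\<lambda>v. \<Sum>b\<in>Basis. (M q \<bullet> b) *\<^sub>R H b v + (M v \<bullet> b) *\<^sub>R ?D q b)"
    by (rule frechet_derivative_at [symmetric])
  then have "frechet_derivative (\<lambda>y. ?D y (M y)) (at q) (L q)
      = (\<Sum>b\<in>Basis. (M q \<bullet> b) *\<^sub>R H (L q) b) + (\<Sum>b\<in>Basis. (M (L q) \<bullet> b) *\<^sub>R ?D q b)"
    by (simp add: sum.distrib Hsym)
  also have "(\<Sum>b\<in>Basis. (M q \<bullet> b) *\<^sub>R H (L q) b) = H (L q) (\<Sum>b\<in>Basis. (M q \<bullet> b) *\<^sub>R b)"
    using Hlin by (simp add: linear_sum linear_scale)
  also have "(\<Sum>b\<in>Basis. (M (L q) \<bullet> b) *\<^sub>R ?D q b) = ?D q (\<Sum>b\<in>Basis. (M (L q) \<bullet> b) *\<^sub>R b)"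
    using lin [OF qU] by (simp add: linear_sum linear_scale)
  finally have "frechet_derivative (\<lambda>y. ?D y (M y)) (at q) (L q) = H (M q) (L q) + ?D q (M (L q))"
    by (simp add: euclidean_representation Hsym)
  moreover have "X L (X M f) q = frechet_derivative (\<lambda>y. ?D y (M y)) (at q) (L q)"
    by (rule X_ext [OF L q U DM]) (use X_ext [OF M _ U g eq] in simp)
  ultimately show ?thesis by (simp add: H_def)
qed

lemma X_commute:
  fixes f :: "complex \<times> complex \<Rightarrow> complex"
  assumes f: "smooth_along S3 f" and q: "q \<in> S3"
  shows "X I1 (X I2 f) q - X I2 (X I1 f) q = - 2 * X I3 f q"
    and "X I3 (X I1 f) q - X I1 (X I3 f) q = - 2 * X I2 f q"
    and "X I3 (X I2 f) q - X I2 (X I3 f) q = 2 * X I1 f q"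
proof -
  obtain U g where U: "open U" "q \<in> U" "smooth_on U g" "\<forall>q\<in>S3 \<inter> U. g q = f q"
    using f q unfolding smooth_along_def by blast
  have qU: "q \<in> S3 \<inter> U" using q U by simp
  have lin: "linear (frechet_derivative g (at q))"
    using smooth_on_has_derivative [OF U(1,3,2)] has_derivative_linear by blast
  note XX = X_X_ext [OF _ _ qU U(1,3,4)] and X = X_ext [OF _ qU U(1,3,4)]
  note sym = symmetric_second_derivative [OF U(1,3,2)]
  show "X I1 (X I2 f) q - X I2 (X I1 f) q = - 2 * X I3 f q"
    using sym [of "I1 q" "I2 q"]
    by (simp add: XX X unit_field_I I_mult linear_neg [OF lin])
  show "X I3 (X I1 f) q - X I1 (X I3 f) q = - 2 * X I2 f q"
    using sym [of "I1 q" "I3 q"]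
    by (simp add: XX X unit_field_I I_mult linear_neg [OF lin])
  show "X I3 (X I2 f) q - X I2 (X I3 f) q = 2 * X I1 f q"
    using sym [of "I2 q" "I3 q"]
    by (simp add: XX X unit_field_I I_mult linear_neg [OF lin])
qed

lemma X_lincomb:
  fixes f :: "complex \<times> complex \<Rightarrow> complex"
  assumes L: "unit_field L" and f: "smooth_along S3 f" and g: "smooth_along S3 g" and q: "q \<in> S3"
  shows "X L (\<lambda>q. c * f q + d * g q) q = c * X L f q + d * X L g q"
  by (rule X_eqI) (intro has_vector_derivative_add has_vector_derivative_mult_right
      has_vector_derivative_X assms)

lemma X_cmult:
  fixes f :: "complex \<times> complex \<Rightarrow> complex"
  assumes L: "unit_field L" and f: "smooth_along S3 f" and q: "q \<in> S3"
  shows "X L (\<lambda>q. c * f q) q = c * X L f q"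
  by (rule X_eqI) (intro has_vector_derivative_mult_right has_vector_derivative_X assms)

section \<open>Raising and lowering operators\<close>

text \<open>The complex vector field \<open>z \<partial>/\<partial>(cnj w) - w \<partial>/\<partial>(cnj z)\<close>, tangent to the sphere; \<open>dn\<close> is its complex
  conjugate.\<close>

definition up :: "(complex \<times> complex \<Rightarrow> complex) \<Rightarrow> complex \<times> complex \<Rightarrow> complex" where
  "up f q = 1/2 * X I1 f q + \<i>/2 * X I2 f q"

definition dn :: "(complex \<times> complex \<Rightarrow> complex) \<Rightarrow> complex \<times> complex \<Rightarrow> complex" where
  "dn f q = 1/2 * X I1 f q + - \<i>/2 * X I2 f q"

text \<open>Only the derivatives along the two flows at the given point enter, so the values of \<open>up\<close> and
  \<open>dn\<close> on algebraic expressions follow without proofs of smoothness.\<close>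

definition has_updn :: "(complex \<times> complex \<Rightarrow> complex) \<Rightarrow> complex \<Rightarrow> complex \<Rightarrow> complex \<times> complex \<Rightarrow> bool" where
  "has_updn f p n q \<longleftrightarrow> ((\<lambda>t. f (flow I1 t q)) has_vector_derivative p + n) (at 0) \<and>
     ((\<lambda>t. f (flow I2 t q)) has_vector_derivative - \<i> * (p - n)) (at 0)"

lemma has_updn_X:
  assumes "has_updn f p n q"
  shows "X I1 f q = p + n" "X I2 f q = - \<i> * (p - n)"
  using assms X_eqI unfolding has_updn_def by blast+

lemma has_updn_imp:
  assumes "has_updn f p n q"
  shows "up f q = p" "dn f q = n"
  unfolding up_def dn_def has_updn_X [OF assms] by (simp_all add: field_simps)

lemma has_updn_smooth:
  assumes "smooth_along S3 f" "q \<in> S3"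
  shows "has_updn f (up f q) (dn f q) q"
  using has_vector_derivative_X [OF unit_field_I(1) assms] has_vector_derivative_X [OF unit_field_I(2) assms]
  by (simp add: has_updn_def up_def dn_def algebra_simps)

lemma has_updn_const: "has_updn (\<lambda>q. c) 0 0 q"
  by (simp add: has_updn_def)

lemma has_updn_add:
  assumes "has_updn f p n q" "has_updn g p' n' q"
  shows "has_updn (\<lambda>q. f q + g q) (p + p') (n + n') q"
  using has_vector_derivative_add [of "\<lambda>t. f (flow I1 t q)" "p + n" "at 0" "\<lambda>t. g (flow I1 t q)" "p' + n'"]
    has_vector_derivative_add [of "\<lambda>t. f (flow I2 t q)" "- \<i> * (p - n)" "at 0" "\<lambda>t. g (flow I2 t q)" "- \<i> * (p' - n')"]
    assms
  by (simp add: has_updn_def algebra_simps)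

lemma has_updn_mult:
  assumes "has_updn f p n q" "has_updn g p' n' q"
  shows "has_updn (\<lambda>q. f q * g q) (p * g q + f q * p') (n * g q + f q * n') q"
  using has_vector_derivative_mult [of "\<lambda>t. f (flow I1 t q)" "p + n" 0 UNIV "\<lambda>t. g (flow I1 t q)" "p' + n'"]
    has_vector_derivative_mult [of "\<lambda>t. f (flow I2 t q)" "- \<i> * (p - n)" 0 UNIV "\<lambda>t. g (flow I2 t q)" "- \<i> * (p' - n')"]
    assms
  by (simp add: has_updn_def algebra_simps)

lemma has_updn_cmult:
  assumes "has_updn f p n q"
  shows "has_updn (\<lambda>q. c * f q) (c * p) (c * n) q"
  using has_updn_mult [OF has_updn_const assms, of c] by simp

lemma has_updn_cnj:
  assumes "has_updn f p n q"
  shows "has_updn (\<lambda>q. cnj (f q)) (cnj n) (cnj p) q"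
  using assms
    bounded_linear.has_vector_derivative [OF bounded_linear_cnj, of "\<lambda>t. f (flow I1 t q)" "p + n"]
    bounded_linear.has_vector_derivative [OF bounded_linear_cnj, of "\<lambda>t. f (flow I2 t q)" "- \<i> * (p - n)"]
  by (simp add: has_updn_def algebra_simps)

lemma has_updn_sum:
  assumes "\<And>i. i \<in> A \<Longrightarrow> has_updn (f i) (p i) (n i) q"
  shows "has_updn (\<lambda>q. \<Sum>i\<in>A. f i q) (\<Sum>i\<in>A. p i) (\<Sum>i\<in>A. n i) q"
  using assms
  by (induction A rule: infinite_finite_induct) (auto simp: has_updn_const has_updn_add)

lemma has_updn_linear:
  assumes "bounded_linear L"
  shows "has_updn (\<lambda>q. L q) (1/2 * L (I1 q) + \<i>/2 * L (I2 q)) (1/2 * L (I1 q) - \<i>/2 * L (I2 q)) q"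
  using bounded_linear.has_vector_derivative [OF assms has_vector_derivative_flow [of I1 q]]
    bounded_linear.has_vector_derivative [OF assms has_vector_derivative_flow [of I2 q]]
  by (simp add: has_updn_def algebra_simps)

lemma has_updn_fst: "has_updn (\<lambda>q. fst q) 0 (- cnj (snd q)) q"
  using has_updn_linear [OF bounded_linear_fst, of q] by (simp add: I1_def I2_def)

lemma has_updn_snd: "has_updn (\<lambda>q. snd q) 0 (cnj (fst q)) q"
  using has_updn_linear [OF bounded_linear_snd, of q] by (simp add: I1_def I2_def)

lemma smooth_along_up: "smooth_along S3 f \<Longrightarrow> smooth_along S3 (up f)"
  unfolding up_def by (intro smooth_along_add smooth_along_cmult smooth_along_X unit_field_I)

lemma smooth_along_dn: "smooth_along S3 f \<Longrightarrow> smooth_along S3 (dn f)"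
  unfolding dn_def by (intro smooth_along_add smooth_along_cmult smooth_along_X unit_field_I)

lemma smooth_along_cnj: "smooth_along S f \<Longrightarrow> smooth_along S (\<lambda>q. cnj (f q))"
  by (rule smooth_along_bounded_linear [OF bounded_linear_cnj])

lemma up_cong: "q \<in> S3 \<Longrightarrow> (\<And>q. q \<in> S3 \<Longrightarrow> f q = g q) \<Longrightarrow> up f q = up g q"
  using X_cong [OF unit_field_I(1), of q f g] X_cong [OF unit_field_I(2), of q f g] by (simp add: up_def)

lemma dn_cong: "q \<in> S3 \<Longrightarrow> (\<And>q. q \<in> S3 \<Longrightarrow> f q = g q) \<Longrightarrow> dn f q = dn g q"
  using X_cong [OF unit_field_I(1), of q f g] X_cong [OF unit_field_I(2), of q f g] by (simp add: dn_def)

lemma up_cmult: "smooth_along S3 f \<Longrightarrow> q \<in> S3 \<Longrightarrow> up (\<lambda>q. c * f q) q = c * up f q"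
  using has_updn_imp(1) [OF has_updn_cmult [OF has_updn_smooth]] .

lemma dn_cmult: "smooth_along S3 f \<Longrightarrow> q \<in> S3 \<Longrightarrow> dn (\<lambda>q. c * f q) q = c * dn f q"
  using has_updn_imp(2) [OF has_updn_cmult [OF has_updn_smooth]] .

lemma up_add: "smooth_along S3 f \<Longrightarrow> smooth_along S3 g \<Longrightarrow> q \<in> S3 \<Longrightarrow> up (\<lambda>q. f q + g q) q = up f q + up g q"
  using has_updn_imp(1) [OF has_updn_add [OF has_updn_smooth has_updn_smooth]] .

lemma dn_add: "smooth_along S3 f \<Longrightarrow> smooth_along S3 g \<Longrightarrow> q \<in> S3 \<Longrightarrow> dn (\<lambda>q. f q + g q) q = dn f q + dn g q"
  using has_updn_imp(2) [OF has_updn_add [OF has_updn_smooth has_updn_smooth]] .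

lemma dn_cnj: "smooth_along S3 f \<Longrightarrow> q \<in> S3 \<Longrightarrow> dn (\<lambda>q. cnj (f q)) q = cnj (up f q)"
  using has_updn_imp(2) [OF has_updn_cnj [OF has_updn_smooth]] .

lemma up_0: "up (\<lambda>q. 0) q = 0"
  using has_updn_imp(1) [OF has_updn_const] .

text \<open>The weight of \<open>f\<close> under the circle action whose orbits are the Hopf fibres.\<close>

definition charged :: "real \<Rightarrow> (complex \<times> complex \<Rightarrow> complex) \<Rightarrow> bool" where
  "charged k f \<longleftrightarrow> (\<forall>q\<in>S3. X I3 f q = \<i> * of_real k * f q)"

lemma second_order_expand:
  assumes f: "smooth_along S3 f" and q: "q \<in> S3"
  shows "up (dn f) q = 1/4 * (X I1 (X I1 f) q + X I2 (X I2 f) q - \<i> * (X I1 (X I2 f) q - X I2 (X I1 f) q))"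
    and "dn (up f) q = 1/4 * (X I1 (X I1 f) q + X I2 (X I2 f) q + \<i> * (X I1 (X I2 f) q - X I2 (X I1 f) q))"
    and "X I3 (up f) q = 1/2 * X I3 (X I1 f) q + \<i>/2 * X I3 (X I2 f) q"
    and "X I3 (dn f) q = 1/2 * X I3 (X I1 f) q - \<i>/2 * X I3 (X I2 f) q"
proof -
  note s = smooth_along_X [OF unit_field_I(1) f] smooth_along_X [OF unit_field_I(2) f]
  have U: "X L (up f) q = 1/2 * X L (X I1 f) q + \<i>/2 * X L (X I2 f) q" if "unit_field L" for L
    using X_lincomb [OF that s q, of "1/2" "\<i>/2"] by (simp add: up_def [abs_def])
  have D: "X L (dn f) q = 1/2 * X L (X I1 f) q + - \<i>/2 * X L (X I2 f) q" if "unit_field L" for L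
    using X_lincomb [OF that s q, of "1/2" "- \<i>/2"] by (simp add: dn_def [abs_def])
  show "up (dn f) q = 1/4 * (X I1 (X I1 f) q + X I2 (X I2 f) q - \<i> * (X I1 (X I2 f) q - X I2 (X I1 f) q))"
    "dn (up f) q = 1/4 * (X I1 (X I1 f) q + X I2 (X I2 f) q + \<i> * (X I1 (X I2 f) q - X I2 (X I1 f) q))"
    "X I3 (up f) q = 1/2 * X I3 (X I1 f) q + \<i>/2 * X I3 (X I2 f) q"
    "X I3 (dn f) q = 1/2 * X I3 (X I1 f) q - \<i>/2 * X I3 (X I2 f) q"
    unfolding up_def [of "dn f"] dn_def [of "up f"] U [OF unit_field_I(1)] U [OF unit_field_I(2)]
      U [OF unit_field_I(3)] D [OF unit_field_I(1)] D [OF unit_field_I(2)] D [OF unit_field_I(3)]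
    by (simp_all add: field_simps)
qed

text \<open>The commutator of the first two invariant fields is a multiple of the third, which acts on a
  charged function as a scalar.\<close>

lemma up_dn_commute:
  assumes f: "smooth_along S3 f" and q: "q \<in> S3" and k: "charged k f"
  shows "up (dn f) q = dn (up f) q - of_real k * f q"
proof -
  have *: "X I1 (X I2 f) q - X I2 (X I1 f) q = - 2 * (\<i> * of_real k * f q)"
    using X_commute(1) [OF f q] k q by (simp add: charged_def)
  show ?thesis unfolding second_order_expand [OF f q] * by (simp add: field_simps)
qed

lemma X_I3_cmult_charged:
  assumes f: "smooth_along S3 f" and q: "q \<in> S3" and k: "charged k f" and L: "unit_field L"
  shows "X L (X I3 f) q = \<i> * of_real k * X L f q"
proof -
  have "X L (X I3 f) q = X L (\<lambda>q. (\<i> * of_real k) * f q) q"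
    using k by (intro X_cong [OF L q]) (auto simp: charged_def)
  then show ?thesis using X_cmult [OF L f q, of "\<i> * of_real k"] by simp
qed

lemma charged_up:
  assumes f: "smooth_along S3 f" and k: "charged k f"
  shows "charged (k + 2) (up f)"
  unfolding charged_def
proof
  fix q assume q: "q \<in> S3"
  have *: "X I3 (X I1 f) q = \<i> * of_real k * X I1 f q - 2 * X I2 f q"
    "X I3 (X I2 f) q = \<i> * of_real k * X I2 f q + 2 * X I1 f q"
    using X_commute(2,3) [OF f q] X_I3_cmult_charged [OF f q k] unit_field_I by (simp_all add: algebra_simps)
  show "X I3 (up f) q = \<i> * of_real (k + 2) * up f q"
    unfolding second_order_expand [OF f q] * up_def by (simp add: field_simps)
qed

lemma charged_dn:
  assumes f: "smooth_along S3 f" and k: "charged k f"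
  shows "charged (k - 2) (dn f)"
  unfolding charged_def
proof
  fix q assume q: "q \<in> S3"
  have *: "X I3 (X I1 f) q = \<i> * of_real k * X I1 f q - 2 * X I2 f q"
    "X I3 (X I2 f) q = \<i> * of_real k * X I2 f q + 2 * X I1 f q"
    using X_commute(2,3) [OF f q] X_I3_cmult_charged [OF f q k] unit_field_I by (simp_all add: algebra_simps)
  show "X I3 (dn f) q = \<i> * of_real (k - 2) * dn f q"
    unfolding second_order_expand [OF f q] * dn_def by (simp add: field_simps)
qed

lemma has_vector_derivative_cis:
  "((\<lambda>t. cis (k * t)) has_vector_derivative \<i> * of_real k * cis (k * t)) (at t)"
proof -
  have "((\<lambda>z. exp (\<i> * of_real k * z)) has_field_derivative \<i> * of_real k * exp (\<i> * of_real k * of_real t)) (at (of_real t))"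
    by (auto intro!: derivative_eq_intros)
  from has_vector_derivative_real_field [OF this] show ?thesis
    by (simp add: cis_conv_exp algebra_simps)
qed

lemma charged_phase:
  assumes f: "smooth_along S3 f" and k: "charged k f" and q: "q \<in> S3"
  shows "f (flow I3 t q) = cis (k * t) * f q"
proof -
  have "((\<lambda>t. cis (- (k * t)) * f (flow I3 t q)) has_vector_derivative 0) (at t)" for t
  proof -
    have 1: "((\<lambda>t. f (flow I3 t q)) has_vector_derivative \<i> * of_real k * f (flow I3 t q)) (at t)"
      using has_vector_derivative_X_at [OF unit_field_I(3) f q] k flow_S3 [OF unit_field_I(3) q]
      by (simp add: charged_def)
    have 2: "((\<lambda>t. cis (- (k * t))) has_vector_derivative - \<i> * of_real k * cis (- (k * t))) (at t)"
      using has_vector_derivative_cis [of "- k"] by simp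
    show ?thesis
      using has_vector_derivative_mult [OF 2 1] by (simp add: algebra_simps)
  qed
  then obtain c where "\<And>t. cis (- (k * t)) * f (flow I3 t q) = c"
    by (rule has_vector_derivative_zero_constant [OF convex_UNIV, of "\<lambda>t. cis (- (k * t)) * f (flow I3 t q)"]) simp
  then have "cis (- (k * t)) * f (flow I3 t q) = cis (- (k * 0)) * f (flow I3 0 q)"
    by (simp only:)
  then have "cis (k * t) * (cis (- (k * t)) * f (flow I3 t q)) = cis (k * t) * f q"
    by simp
  then show ?thesis by (simp only: mult.assoc [symmetric] cis_mult) simp
qed

lemma charged_phaseI:
  assumes "\<And>q t. q \<in> S3 \<Longrightarrow> f (flow I3 t q) = cis (k * t) * f q"
  shows "charged k f"
  unfolding charged_def
proof
  fix q assume q: "q \<in> S3"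
  have "((\<lambda>t. cis (k * t) * f q) has_vector_derivative \<i> * of_real k * f q) (at 0)"
    using has_vector_derivative_mult [OF has_vector_derivative_cis [of k 0] has_vector_derivative_const [of "f q"]] by simp
  then show "X I3 f q = \<i> * of_real k * f q"
    using assms [OF q] by (intro X_eqI) simp
qed

lemma flow_I3: "flow I3 t q = (cis t * fst q, cis t * snd q)"
  by (simp add: flow_def I3_def prod_eq_iff cis_conv_exp exp_Euler complex_eq_iff cos_of_real sin_of_real scaleR_conv_of_real algebra_simps)

text \<open>At a maximum of \<open>|a|\<^sup>2\<close> the operator \<open>X\<^sub>1\<^sup>2 + X\<^sub>2\<^sup>2\<close>, which is a multiple of the
  identity on \<open>a\<close>, cannot act with a positive multiple.\<close>

lemma second_derivative_le_0_at_max: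
  fixes \<phi> \<psi> :: "real \<Rightarrow> real"
  assumes \<phi>: "\<And>t. (\<phi> has_real_derivative \<psi> t) (at t)" and \<psi>: "(\<psi> has_real_derivative c) (at 0)"
    and max: "\<And>t. \<phi> t \<le> \<phi> 0"
  shows "c \<le> 0"
proof (rule ccontr)
  assume "\<not> c \<le> 0"
  then obtain d where d: "d > 0" "\<And>h. 0 < h \<Longrightarrow> h < d \<Longrightarrow> \<psi> 0 < \<psi> (0 + h)"
    using DERIV_pos_inc_right [OF \<psi>] by auto
  have "\<psi> 0 = 0"
    using DERIV_local_max [OF \<phi> zero_less_one] max by blast
  moreover obtain z where "0 < z" "z < d / 2" "\<phi> (d/2) - \<phi> 0 = (d/2 - 0) * \<psi> z"
    using MVT2 [of 0 "d/2" \<phi> \<psi>] \<phi> d(1) by auto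
  ultimately have "\<phi> (d/2) > \<phi> 0"
    using d(2) [of z] d(1) by (smt (verit) mult_pos_pos field_sum_of_halves)
  then show False using max [of "d/2"] by simp
qed

lemma max_principle:
  assumes a: "smooth_along S3 a" and k: "charged k a"
    and eig: "\<And>q. q \<in> S3 \<Longrightarrow> dn (up a) q = - of_real \<theta> * a q" and neg: "2 * \<theta> + k < 0"
    and q: "q \<in> S3"
  shows "a q = 0"
proof -
  have cont: "continuous_on S3 a"
    by (rule smooth_along_continuous [OF a])
  have "continuous_on S3 (\<lambda>q. a q \<bullet> a q)"
    by (intro continuous_intros cont)
  moreover have "S3 \<noteq> {}" using q by blast
  ultimately obtain p where p: "p \<in> S3" "\<And>q. q \<in> S3 \<Longrightarrow> a q \<bullet> a q \<le> a p \<bullet> a p"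
    using continuous_attains_sup [OF compact_sphere] by blast
  have "X L a p \<bullet> X L a p + a p \<bullet> X L (X L a) p \<le> 0" if L: "unit_field L" for L
  proof -
    let ?c = "\<lambda>t. flow L t p"
    have 1: "((\<lambda>t. a (?c t)) has_vector_derivative X L a (?c t)) (at t)" for t
      by (rule has_vector_derivative_X_at [OF L a p(1)])
    have 2: "((\<lambda>t. X L a (?c t)) has_vector_derivative X L (X L a) (?c t)) (at t)" for t
      by (rule has_vector_derivative_X_at [OF L smooth_along_X [OF L a] p(1)])
    have "((\<lambda>t. a (?c t) \<bullet> a (?c t)) has_real_derivative 2 * (a (?c t) \<bullet> X L a (?c t))) (at t)" for t
      using has_derivative_inner [OF 1 [unfolded has_vector_derivative_def] 1 [unfolded has_vector_derivative_def]]
      by (simp add: has_field_derivative_def inner_commute mult_commute_abs algebra_simps)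
    moreover have "((\<lambda>t. 2 * (a (?c t) \<bullet> X L a (?c t))) has_real_derivative
        2 * (X L a p \<bullet> X L a p + a p \<bullet> X L (X L a) p)) (at 0)"
      unfolding has_field_derivative_def
      by (rule has_derivative_eq_rhs [OF has_derivative_mult_right [OF has_derivative_inner
              [OF 1 [of 0, unfolded has_vector_derivative_def] 2 [of 0, unfolded has_vector_derivative_def]]]])
        (simp add: fun_eq_iff algebra_simps inner_commute)
    moreover have "a (?c t) \<bullet> a (?c t) \<le> a (?c 0) \<bullet> a (?c 0)" for t
      using p(2) [OF flow_S3 [OF L p(1)]] by simp
    ultimately have "2 * (X L a p \<bullet> X L a p + a p \<bullet> X L (X L a) p) \<le> 0"
      by (rule second_derivative_le_0_at_max)
    then show ?thesis by simp
  qed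
  then have *: "a p \<bullet> X L (X L a) p \<le> 0" if "unit_field L" for L
    using that inner_ge_zero [of "X L a p"] by (smt (verit))
  have "X I1 (X I1 a) p + X I2 (X I2 a) p = 2 * (up (dn a) p + dn (up a) p)"
    by (simp add: second_order_expand [OF a p(1)] algebra_simps)
  also have "\<dots> = of_real (- 2 * (2 * \<theta> + k)) * a p"
    using eig [OF p(1)] by (simp add: up_dn_commute [OF a p(1) k] algebra_simps)
  also have "\<dots> = (- 2 * (2 * \<theta> + k)) *\<^sub>R a p"
    by (simp only: scaleR_conv_of_real)
  finally have "a p \<bullet> ((- 2 * (2 * \<theta> + k)) *\<^sub>R a p) \<le> 0"
    using * [OF unit_field_I(1)] * [OF unit_field_I(2)] by (metis add_nonpos_nonpos inner_add_right)
  then have "(- 2 * (2 * \<theta> + k)) * (a p \<bullet> a p) \<le> 0"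
    by simp
  moreover have "- 2 * (2 * \<theta> + k) > 0" using neg by simp
  ultimately have "a p \<bullet> a p \<le> 0"
    by (metis mult_le_0_iff not_le)
  then show ?thesis using p(2) [OF q] by (metis inner_ge_zero inner_eq_zero_iff order_antisym order_trans)
qed

definition ladder :: "real \<Rightarrow> real \<Rightarrow> (complex \<times> complex \<Rightarrow> complex) set" where
  "ladder k \<theta> = {a. smooth_along S3 a \<and> charged k a \<and> (\<forall>q\<in>S3. dn (up a) q = - of_real \<theta> * a q)}"

lemma ladderD:
  assumes "a \<in> ladder k \<theta>"
  shows "smooth_along S3 a" "charged k a" "q \<in> S3 \<Longrightarrow> dn (up a) q = - of_real \<theta> * a q"
  using assms unfolding ladder_def by blast+

lemma ladder_eq_0: "a \<in> ladder k \<theta> \<Longrightarrow> 2 * \<theta> + k < 0 \<Longrightarrow> q \<in> S3 \<Longrightarrow> a q = 0"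
  using max_principle [of a k \<theta>] ladderD by blast

text \<open>By \<open>up_dn_commute\<close> the eigenvalue drops by \<open>k + 2\<close> when the charge rises from \<open>k\<close> to \<open>k + 2\<close>.\<close>

lemma ladder_up:
  assumes "a \<in> ladder k \<theta>"
  shows "up a \<in> ladder (k + 2) (\<theta> - (k + 2))"
  unfolding ladder_def
proof (intro CollectI conjI ballI)
  note a = ladderD [OF assms]
  show s: "smooth_along S3 (up a)" by (rule smooth_along_up [OF a(1)])
  show k: "charged (k + 2) (up a)" by (rule charged_up [OF a(1,2)])
  fix q assume q: "q \<in> S3"
  have "up (dn (up a)) q = up (\<lambda>q. - of_real \<theta> * a q) q"
    by (rule up_cong [OF q a(3)])
  also have "\<dots> = - of_real \<theta> * up a q"
    by (rule up_cmult [OF a(1) q])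
  finally show "dn (up (up a)) q = - of_real (\<theta> - (k + 2)) * up a q"
    using up_dn_commute [OF s q k] by (simp add: algebra_simps)
qed

lemma up_dn_ladder:
  assumes "c \<in> ladder k \<theta>" "q \<in> S3"
  shows "up (dn c) q = - of_real (\<theta> + k) * c q"
  using up_dn_commute [OF ladderD(1) [OF assms(1)] assms(2) ladderD(2) [OF assms(1)]]
    ladderD(3) [OF assms] by (simp add: algebra_simps)

lemma ladder_dn:
  assumes "c \<in> ladder k \<theta>"
  shows "dn c \<in> ladder (k - 2) (\<theta> + k)"
  unfolding ladder_def
proof (intro CollectI conjI ballI)
  note c = ladderD [OF assms]
  show "smooth_along S3 (dn c)" by (rule smooth_along_dn [OF c(1)])
  show "charged (k - 2) (dn c)" by (rule charged_dn [OF c(1,2)])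
  fix q assume q: "q \<in> S3"
  have "dn (up (dn c)) q = dn (\<lambda>q. - of_real (\<theta> + k) * c q) q"
    by (rule dn_cong [OF q up_dn_ladder [OF assms]])
  then show "dn (up (dn c)) q = - of_real (\<theta> + k) * dn c q"
    using dn_cmult [OF c(1) q] by simp
qed

lemma ladder_0_up:
  assumes "a \<in> ladder k 0" "k > - 2" "q \<in> S3"
  shows "up a q = 0"
  using ladder_eq_0 [OF ladder_up [OF assms(1)] _ assms(3)] assms(2) by simp

lemma ladder_lincomb:
  assumes a: "a \<in> ladder k \<theta>" and b: "b \<in> ladder k \<theta>"
  shows "(\<lambda>q. c * a q + d * b q) \<in> ladder k \<theta>"
  unfolding ladder_def
proof (intro CollectI conjI ballI)
  note a = ladderD [OF a] and b = ladderD [OF b]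
  note s = smooth_along_cmult [OF a(1), of c] smooth_along_cmult [OF b(1), of d]
  show "smooth_along S3 (\<lambda>q. c * a q + d * b q)" by (rule smooth_along_add [OF s])
  show "charged k (\<lambda>q. c * a q + d * b q)"
    using a(2) b(2) X_lincomb [OF unit_field_I(3) a(1) b(1)] by (simp add: charged_def algebra_simps)
  fix q assume q: "q \<in> S3"
  have u: "up (\<lambda>q. c * a q + d * b q) q = c * up a q + d * up b q" if "q \<in> S3" for q
    by (simp add: up_add [OF s that] up_cmult [OF a(1) that] up_cmult [OF b(1) that])
  have "dn (up (\<lambda>q. c * a q + d * b q)) q = dn (\<lambda>q. c * up a q + d * up b q) q"
    by (rule dn_cong [OF q u])
  also have "\<dots> = c * dn (up a) q + d * dn (up b) q"
    by (simp add: dn_add smooth_along_cmult smooth_along_up a(1) b(1) dn_cmult q [unfolded mem_sphere_0])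
  finally show "dn (up (\<lambda>q. c * a q + d * b q)) q = - of_real \<theta> * (c * a q + d * b q)"
    using a(3) [OF q] b(3) [OF q] by (simp add: algebra_simps)
qed

lemma ladder_up_inj:
  assumes "a \<in> ladder k \<theta>" "\<theta> \<noteq> 0" "\<And>q. q \<in> S3 \<Longrightarrow> up a q = 0" "q \<in> S3"
  shows "a q = 0"
proof -
  have "dn (up a) q = dn (\<lambda>q. 0) q"
    by (rule dn_cong [OF assms(4,3)])
  then have "dn (up a) q = 0"
    using has_updn_imp(2) [OF has_updn_const] by simp
  then show ?thesis using ladderD(3) [OF assms(1,4)] assms(2) by simp
qed

text \<open>Iterated raising from charge 4 lowers \<open>\<theta>\<close> by 6, 8, 10 and 12.  When \<open>\<theta>\<close> starts
  below 30 and never hits 0, it becomes so negative that the ladder space vanishes.\<close>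

lemma ladder_4_trivial:
  assumes a: "a \<in> ladder 4 \<theta>" and \<theta>: "\<theta> < 30" "\<theta> \<notin> {0, 6, 14, 24}" and q: "q \<in> S3"
  shows "a q = 0"
proof -
  note a1 = ladder_up [OF a, simplified]
  note a2 = ladder_up [OF a1, simplified]
  note a3 = ladder_up [OF a2, simplified]
  note a4 = ladder_up [OF a3, simplified]
  have z4: "up (up (up (up a))) q = 0" if "q \<in> S3" for q
    by (rule ladder_eq_0 [OF a4 _ that]) (use \<theta> in simp)
  have z3: "up (up (up a)) q = 0" if "q \<in> S3" for q
    by (rule ladder_up_inj [OF a3 _ z4 that]) (use \<theta> in auto)
  have z2: "up (up a) q = 0" if "q \<in> S3" for q
    by (rule ladder_up_inj [OF a2 _ z3 that]) (use \<theta> in auto)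
  have z1: "up a q = 0" if "q \<in> S3" for q
    by (rule ladder_up_inj [OF a1 _ z2 that]) (use \<theta> in auto)
  show ?thesis
    by (rule ladder_up_inj [OF a _ z1 q]) (use \<theta> in auto)
qed

section \<open>Holomorphic functions of positive charge\<close>

definition hol_poly :: "nat \<Rightarrow> (nat \<Rightarrow> complex) \<Rightarrow> complex \<times> complex \<Rightarrow> complex" where
  "hol_poly n \<gamma> q = (\<Sum>j\<le>n. \<gamma> j * (fst q ^ (n - j) * snd q ^ j))"

lemma has_updn_power:
  assumes "has_updn f 0 n q"
  shows "\<exists>n'. has_updn (\<lambda>q. f q ^ j) 0 n' q"
proof (induction j)
  case 0
  show ?case using has_updn_const [of 1 q] by auto
next
  case (Suc j)
  then obtain n' where "has_updn (\<lambda>q. f q ^ j) 0 n' q" by blast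
  from has_updn_mult [OF assms this] show ?case by auto
qed

lemma hol_poly_up: "up (hol_poly n \<gamma>) q = 0"
proof -
  have "\<exists>n'. has_updn (\<lambda>q. fst q ^ i * snd q ^ j) 0 n' q" for i j
  proof -
    obtain n1 n2 where "has_updn (\<lambda>q. fst q ^ i) 0 n1 q" "has_updn (\<lambda>q. snd q ^ j) 0 n2 q"
      using has_updn_power [OF has_updn_fst] has_updn_power [OF has_updn_snd] by blast
    from has_updn_mult [OF this] show ?thesis by auto
  qed
  then obtain N where N: "\<And>i j. has_updn (\<lambda>q. fst q ^ i * snd q ^ j) 0 (N i j) q"
    by metis
  have "has_updn (hol_poly n \<gamma>) (\<Sum>j\<le>n. \<gamma> j * 0) (\<Sum>j\<le>n. \<gamma> j * N (n - j) j) q"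
    unfolding hol_poly_def [abs_def]
    by (rule has_updn_sum, rule has_updn_cmult, rule N)
  then show ?thesis using has_updn_imp(1) by fastforce
qed

lemma smooth_along_power:
  fixes f :: "'a::euclidean_space \<Rightarrow> complex"
  shows "smooth_along S f \<Longrightarrow> smooth_along S (\<lambda>q. f q ^ j)"
  by (induction j) (simp_all add: smooth_along_const smooth_along_mult)

lemma smooth_along_fst: "smooth_along S (fst :: complex \<times> complex \<Rightarrow> complex)"
  and smooth_along_snd: "smooth_along S (snd :: complex \<times> complex \<Rightarrow> complex)"
  by (rule smooth_along_linear, simp add: linear_fst linear_snd)+

lemma smooth_along_hol_poly: "smooth_along S3 (hol_poly n \<gamma>)"
  unfolding hol_poly_def [abs_def]
  by (intro smooth_along_sum smooth_along_cmult smooth_along_mult smooth_along_power smooth_along_fst smooth_along_snd)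

lemma hol_poly_ladder: "hol_poly n \<gamma> \<in> ladder (real n) 0"
  unfolding ladder_def
proof (intro CollectI conjI ballI)
  show "smooth_along S3 (hol_poly n \<gamma>)" by (rule smooth_along_hol_poly)
  show "charged (real n) (hol_poly n \<gamma>)"
  proof (rule charged_phaseI)
    fix q t
    have "(cis t * fst q) ^ (n - j) * (cis t * snd q) ^ j = cis (real n * t) * (fst q ^ (n - j) * snd q ^ j)"
      if "j \<le> n" for j
    proof -
      have "cis t ^ (n - j) * cis t ^ j = cis t ^ n"
        using that by (simp add: power_add [symmetric])
      then have "cis t ^ (n - j) * cis t ^ j = cis (real n * t)"
        by (simp only: Complex.DeMoivre)
      then show ?thesis by (simp add: power_mult_distrib)
    qed
    then show "hol_poly n \<gamma> (flow I3 t q) = cis (real n * t) * hol_poly n \<gamma> q"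
      by (auto simp: hol_poly_def flow_I3 sum_distrib_left mult.left_commute intro!: sum.cong)
  qed
  fix q assume q: "q \<in> S3"
  have "dn (up (hol_poly n \<gamma>)) q = dn (\<lambda>q. 0) q"
    by (rule dn_cong [OF q hol_poly_up])
  then show "dn (up (hol_poly n \<gamma>)) q = - of_real 0 * hol_poly n \<gamma> q"
    using has_updn_imp(2) [OF has_updn_const] by simp
qed

lemma has_derivative_into_S3:
  fixes f :: "complex \<times> complex \<Rightarrow> complex"
  assumes f: "smooth_along S3 f" and \<gamma>: "(\<gamma> has_derivative D) (at x)" "\<And>y. \<gamma> y \<in> S3"
    and D: "\<And>v. D v = r1 v *\<^sub>R I1 (\<gamma> x) + r2 v *\<^sub>R I2 (\<gamma> x) + r3 v *\<^sub>R I3 (\<gamma> x)"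
  shows "((\<lambda>y. f (\<gamma> y)) has_derivative
     (\<lambda>v. r1 v *\<^sub>R X I1 f (\<gamma> x) + r2 v *\<^sub>R X I2 f (\<gamma> x) + r3 v *\<^sub>R X I3 f (\<gamma> x))) (at x)"
proof -
  obtain U g where U: "open U" "\<gamma> x \<in> U" "smooth_on U g" "\<forall>q\<in>S3 \<inter> U. g q = f q"
    using f \<gamma>(2) [of x] unfolding smooth_along_def by blast
  let ?D = "frechet_derivative g (at (\<gamma> x))"
  have Dg: "(g has_derivative ?D) (at (\<gamma> x))"
    by (rule smooth_on_has_derivative [OF U(1,3,2)])
  have q: "\<gamma> x \<in> S3 \<inter> U" using \<gamma>(2) U(2) by blast
  have "((\<lambda>y. g (\<gamma> y)) has_derivative (\<lambda>v. ?D (D v))) (at x)"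
    by (rule has_derivative_compose [OF \<gamma>(1) Dg])
  then have "((\<lambda>y. f (\<gamma> y)) has_derivative (\<lambda>v. ?D (D v))) (at x)"
  proof (rule has_derivative_transform_eventually)
    have "(\<gamma> \<longlongrightarrow> \<gamma> x) (at x)"
      using has_derivative_continuous [OF \<gamma>(1)] by (simp add: continuous_at)
    then have "\<forall>\<^sub>F y in at x. \<gamma> y \<in> U"
      using U(1,2) by (rule topological_tendstoD)
    then show "\<forall>\<^sub>F y in at x within UNIV. g (\<gamma> y) = f (\<gamma> y)"
      by (rule eventually_mono) (use U(4) \<gamma>(2) in blast)
    show "g (\<gamma> x) = f (\<gamma> x)" using U(4) q by blast
  qed simp
  moreover have "?D (D v) = r1 v *\<^sub>R X I1 f (\<gamma> x) + r2 v *\<^sub>R X I2 f (\<gamma> x) + r3 v *\<^sub>R X I3 f (\<gamma> x)" for v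
    unfolding D X_ext [OF unit_field_I(1) q U(1,3,4)] X_ext [OF unit_field_I(2) q U(1,3,4)]
      X_ext [OF unit_field_I(3) q U(1,3,4)]
    using has_derivative_linear [OF Dg] by (simp add: linear_add linear_scale)
  ultimately show ?thesis by simp
qed

text \<open>The affine chart \<open>\<zeta> \<mapsto> [1 : \<zeta>]\<close> of the projective line, lifted to the sphere.  On it, a
  function of charge \<open>2l\<close> killed by \<open>up\<close> becomes entire after multiplication with
  \<open>(1 + |\<zeta>|\<^sup>2)\<^sup>l\<close>, and it grows like a polynomial since the sphere is compact.\<close>

definition chart :: "complex \<Rightarrow> complex \<times> complex" where
  "chart \<zeta> = inverse (sqrt (1 + \<zeta> \<bullet> \<zeta>)) *\<^sub>R (1, \<zeta>)"

lemma one_plus_inner_pos: "1 + \<zeta> \<bullet> \<zeta> > (0::real)"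
  by (simp add: add_pos_nonneg)

lemma chart_S3: "chart \<zeta> \<in> S3"
proof -
  define r where "r = inverse (sqrt (1 + \<zeta> \<bullet> \<zeta>))"
  have "r * r * (1 + \<zeta> \<bullet> \<zeta>) = 1"
    using one_plus_inner_pos [of \<zeta>] by (simp add: r_def field_simps)
  then have "chart \<zeta> \<bullet> chart \<zeta> = 1"
    unfolding chart_def r_def [symmetric] by (simp add: inner_prod_def algebra_simps)
  then show ?thesis by (simp add: norm_eq_1)
qed

lemma has_derivative_chart:
  fixes \<zeta> :: complex
  defines "w \<equiv> 1 + \<zeta> \<bullet> \<zeta>"
  shows "(chart has_derivative (\<lambda>\<eta>. (Re \<eta> / w) *\<^sub>R I1 (chart \<zeta>) + (Im \<eta> / w) *\<^sub>R I2 (chart \<zeta>)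
     + (Im (cnj \<zeta> * \<eta>) / w) *\<^sub>R I3 (chart \<zeta>))) (at \<zeta>)"
proof -
  have w: "w > 0" unfolding w_def by (rule one_plus_inner_pos)
  define r where "r = inverse (sqrt w)"
  have r: "r * r * w = 1" "r > 0" using w by (auto simp: r_def field_simps)
  have rw: "1 / w = r * r" using r(1) w by (simp add: field_simps)
  have "((\<lambda>\<zeta>. inverse (sqrt (1 + \<zeta> \<bullet> \<zeta>))) has_derivative (\<lambda>\<eta>. - (r * r * r) * (\<zeta> \<bullet> \<eta>))) (at \<zeta>)"
    using w unfolding w_def r_def
    by (auto intro!: derivative_eq_intros simp: fun_eq_iff inner_commute field_simps)
  from has_derivative_scaleR [OF this has_derivative_Pair [OF has_derivative_const has_derivative_ident]]
  have "(chart has_derivative (\<lambda>\<eta>. r *\<^sub>R (0, \<eta>) + (- (r * r * r) * (\<zeta> \<bullet> \<eta>)) *\<^sub>R (1, \<zeta>))) (at \<zeta>)"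
    by (simp add: chart_def [abs_def] r_def w_def)
  moreover have "r *\<^sub>R (0, \<eta>) + (- (r * r * r) * (\<zeta> \<bullet> \<eta>)) *\<^sub>R (1, \<zeta>)
    = (Re \<eta> / w) *\<^sub>R I1 (chart \<zeta>) + (Im \<eta> / w) *\<^sub>R I2 (chart \<zeta>)
     + (Im (cnj \<zeta> * \<eta>) / w) *\<^sub>R I3 (chart \<zeta>)" for \<eta>
  proof -
    have c: "chart \<zeta> = (of_real r, of_real r * \<zeta>)"
      by (simp add: chart_def r_def w_def scaleR_conv_of_real)
    have "x / w = x * (r * r)" for x using rw by (metis mult.right_neutral times_divide_eq_right)
    note q = this
    have one: "r = r * r * r * (1 + \<zeta> \<bullet> \<zeta>)" using r(1) by (simp add: w_def algebra_simps)
    have "r * x = r * r * r * (1 + \<zeta> \<bullet> \<zeta>) * x" for x using one by simp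
    note one' = this [unfolded inner_complex_def]
    show ?thesis
      unfolding q c
      by (simp add: I1_def I2_def I3_def complex_eq_iff inner_complex_def one' [of "Re \<eta>"] one' [of "Im \<eta>"])
        (simp add: algebra_simps)
  qed
  ultimately show ?thesis by simp
qed

lemma ladder_0_hol_poly:
  assumes c: "c \<in> ladder (2 * real l) 0"
  obtains \<gamma> where "\<And>q. q \<in> S3 \<Longrightarrow> c q = hol_poly (2 * l) \<gamma> q"
proof -
  note sc = ladderD(1) [OF c] and cc = ladderD(2) [OF c]
  define h where "h = (\<lambda>\<zeta>. of_real ((1 + \<zeta> \<bullet> \<zeta>) ^ l) * c (chart \<zeta>))"
  have hol: "h holomorphic_on UNIV"
  proof (rule holomorphic_onI)
    fix \<zeta> :: complex
    define w where "w = 1 + \<zeta> \<bullet> \<zeta>"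
    have w: "w > 0" unfolding w_def by (rule one_plus_inner_pos)
    let ?q = "chart \<zeta>"
    have q: "?q \<in> S3" by (rule chart_S3)
    have "up c ?q = 0" by (rule ladder_0_up [OF c _ q]) simp
    then have X1: "X I1 c ?q = dn c ?q" and X2: "X I2 c ?q = \<i> * dn c ?q"
      using has_updn_X [OF has_updn_smooth [OF sc q]] by simp_all
    have X3: "X I3 c ?q = \<i> * of_real (2 * real l) * c ?q"
      using cc q by (simp add: charged_def)
    have 1: "((\<lambda>\<zeta>. c (chart \<zeta>)) has_derivative (\<lambda>\<eta>. (Re \<eta> / w) *\<^sub>R X I1 c ?q + (Im \<eta> / w) *\<^sub>R X I2 c ?q
        + (Im (cnj \<zeta> * \<eta>) / w) *\<^sub>R X I3 c ?q)) (at \<zeta>)"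
      using has_derivative_into_S3 [OF sc has_derivative_chart chart_S3 refl] unfolding w_def .
    have "((\<lambda>\<zeta>. (1 + \<zeta> \<bullet> \<zeta>) ^ l) has_derivative (\<lambda>\<eta>. real l * (2 * (\<zeta> \<bullet> \<eta>)) * w ^ (l - 1))) (at \<zeta>)"
      by (rule has_derivative_eq_rhs [OF has_derivative_power [OF has_derivative_add [OF has_derivative_const
              has_derivative_inner [OF has_derivative_ident has_derivative_ident]]]])
        (simp add: fun_eq_iff inner_commute w_def)
    then have 2: "((\<lambda>\<zeta>. of_real ((1 + \<zeta> \<bullet> \<zeta>) ^ l) :: complex) has_derivative
        (\<lambda>\<eta>. of_real (real l * (2 * (\<zeta> \<bullet> \<eta>)) * w ^ (l - 1)))) (at \<zeta>)"
      by (rule has_derivative_of_real)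
    have wl: "real l * x * w ^ (l - 1) = real l * x * (w ^ l / w)" for x
      using w by (cases l) auto
    have "(h has_derivative (\<lambda>\<eta>. (of_real (w ^ l / w) * (2 * of_real (real l) * cnj \<zeta> * c ?q + dn c ?q)) * \<eta>)) (at \<zeta>)"
      unfolding h_def
    proof (rule has_derivative_eq_rhs [OF has_derivative_mult [OF 2 1]], rule ext)
      fix \<eta>
      have "of_real (Re \<eta>) + \<i> * of_real (Im \<eta>) = \<eta>" by (simp add: complex_eq_iff)
      then have a: "of_real (Re \<eta>) * dn c ?q + of_real (Im \<eta>) * (\<i> * dn c ?q) = \<eta> * dn c ?q"
        by (metis (no_types) distrib_right mult.assoc mult.commute)
      have b: "of_real (\<zeta> \<bullet> \<eta>) + \<i> * of_real (Im (cnj \<zeta> * \<eta>)) = cnj \<zeta> * \<eta>"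
        by (simp add: complex_eq_iff inner_complex_def)
      have "of_real ((1 + \<zeta> \<bullet> \<zeta>) ^ l) * ((Re \<eta> / w) *\<^sub>R X I1 c ?q + (Im \<eta> / w) *\<^sub>R X I2 c ?q
          + (Im (cnj \<zeta> * \<eta>) / w) *\<^sub>R X I3 c ?q)
          + of_real (real l * (2 * (\<zeta> \<bullet> \<eta>)) * w ^ (l - 1)) * c ?q
        = of_real (w ^ l / w) * ((of_real (Re \<eta>) * dn c ?q + of_real (Im \<eta>) * (\<i> * dn c ?q))
          + 2 * of_real (real l) * (of_real (\<zeta> \<bullet> \<eta>) + \<i> * of_real (Im (cnj \<zeta> * \<eta>))) * c ?q)"
        unfolding X1 X2 X3 wl w_def [symmetric] using w
        by (simp add: scaleR_conv_of_real field_simps)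
      then show "of_real ((1 + \<zeta> \<bullet> \<zeta>) ^ l) * ((Re \<eta> / w) *\<^sub>R X I1 c ?q + (Im \<eta> / w) *\<^sub>R X I2 c ?q
          + (Im (cnj \<zeta> * \<eta>) / w) *\<^sub>R X I3 c ?q)
          + of_real (real l * (2 * (\<zeta> \<bullet> \<eta>)) * w ^ (l - 1)) * c ?q
        = of_real (w ^ l / w) * (2 * of_real (real l) * cnj \<zeta> * c ?q + dn c ?q) * \<eta>"
        unfolding a b by (simp add: algebra_simps)
    qed
    then show "h field_differentiable at \<zeta> within UNIV"
      unfolding field_differentiable_def has_field_derivative_def by blast
  qed
  obtain B where B: "\<And>q. q \<in> S3 \<Longrightarrow> norm (c q) \<le> B"
  proof -
    have "bounded (c ` S3)"
      by (intro compact_imp_bounded compact_continuous_image smooth_along_continuous sc compact_sphere)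
    then show thesis using that unfolding bounded_iff by blast
  qed
  have growth: "norm (h \<zeta>) \<le> (B * 2 ^ l) * norm \<zeta> ^ (2 * l)" if "1 \<le> norm \<zeta>" for \<zeta>
  proof -
    have "1 + \<zeta> \<bullet> \<zeta> \<le> 2 * (norm \<zeta>)\<^sup>2"
      using that by (simp add: power2_norm_eq_inner [symmetric])
    then have "(1 + \<zeta> \<bullet> \<zeta>) ^ l \<le> (2 * (norm \<zeta>)\<^sup>2) ^ l"
      using one_plus_inner_pos [of \<zeta>] by (intro power_mono) auto
    moreover have "norm (h \<zeta>) = (1 + \<zeta> \<bullet> \<zeta>) ^ l * norm (c (chart \<zeta>))"
      using one_plus_inner_pos [of \<zeta>] by (simp add: h_def norm_mult norm_power del: of_real_power of_real_add)
    ultimately have "norm (h \<zeta>) \<le> (2 * (norm \<zeta>)\<^sup>2) ^ l * B"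
      using B [OF chart_S3, of \<zeta>] one_plus_inner_pos [of \<zeta>] by (simp add: mult_mono)
    moreover have "norm \<zeta> ^ (2 * l) = ((norm \<zeta>)\<^sup>2) ^ l" by (rule power_mult)
    ultimately show ?thesis by (simp only: power_mult_distrib mult_ac)
  qed
  define \<gamma> where "\<gamma> = (\<lambda>k. (deriv ^^ k) h 0 / fact k)"
  have h: "h \<zeta> = (\<Sum>k\<le>2 * l. \<gamma> k * \<zeta> ^ k)" for \<zeta>
    unfolding \<gamma>_def by (rule Liouville_polynomial [OF hol growth])
  have main: "c q = hol_poly (2 * l) \<gamma> q" if q: "q \<in> S3" and z: "fst q \<noteq> 0" for q
  proof -
    define \<zeta> where "\<zeta> = snd q / fst q"
    define t where "t = Arg (fst q)"
    have n: "(norm (fst q))\<^sup>2 + (norm (snd q))\<^sup>2 = 1"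
      using q by (simp add: norm_prod_def)
    have w: "1 + \<zeta> \<bullet> \<zeta> = inverse ((norm (fst q))\<^sup>2)"
      using n z by (simp add: \<zeta>_def power2_norm_eq_inner [symmetric] norm_divide power_divide field_simps)
    have "chart \<zeta> = norm (fst q) *\<^sub>R (1, \<zeta>)"
      using z by (simp add: chart_def w real_sqrt_inverse)
    moreover have z': "cis t * of_real (norm (fst q)) = fst q"
      using rcis_cmod_Arg [of "fst q"] by (simp add: t_def rcis_def mult.commute)
    ultimately have fl: "flow I3 t (chart \<zeta>) = q"
      using z by (simp add: flow_I3 prod_eq_iff scaleR_conv_of_real \<zeta>_def mult.assoc [symmetric])
    have e: "c q = cis (2 * real l * t) * c (chart \<zeta>)"
      using charged_phase [OF sc cc chart_S3, of t \<zeta>] fl by simp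
    have "norm (fst q) ^ (2 * l) * (1 + \<zeta> \<bullet> \<zeta>) ^ l = 1"
      using z by (simp add: w power_mult power_inverse)
    moreover have "of_real (norm (fst q)) ^ (2 * l) * h \<zeta>
        = of_real (norm (fst q) ^ (2 * l) * (1 + \<zeta> \<bullet> \<zeta>) ^ l) * c (chart \<zeta>)"
      by (simp only: h_def of_real_mult of_real_power mult.assoc)
    ultimately have "of_real (norm (fst q)) ^ (2 * l) * h \<zeta> = c (chart \<zeta>)"
      by simp
    moreover have "cis (2 * real l * t) = cis t ^ (2 * l)"
      by (simp add: Complex.DeMoivre)
    ultimately have "c q = (cis t * of_real (norm (fst q))) ^ (2 * l) * h \<zeta>"
      using e by (simp add: power_mult_distrib mult.assoc)
    also have "\<dots> = (\<Sum>k\<le>2 * l. \<gamma> k * (fst q ^ (2 * l) * \<zeta> ^ k))"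
      unfolding z' h by (simp add: sum_distrib_left mult_ac)
    also have "\<dots> = hol_poly (2 * l) \<gamma> q"
      unfolding hol_poly_def
    proof (rule sum.cong)
      fix k assume "k \<in> {..2 * l}"
      then have "fst q ^ (2 * l) = fst q ^ (2 * l - k) * fst q ^ k"
        by (simp add: power_add [symmetric])
      then show "\<gamma> k * (fst q ^ (2 * l) * \<zeta> ^ k) = \<gamma> k * (fst q ^ (2 * l - k) * snd q ^ k)"
        using z by (simp add: \<zeta>_def power_divide)
    qed simp
    finally show ?thesis .
  qed
  have "c q = hol_poly (2 * l) \<gamma> q" if q: "q \<in> S3" for q
  proof (cases "fst q = 0")
    case True
    let ?d = "\<lambda>p. c p + - 1 * hol_poly (2 * l) \<gamma> p"
    have w: "snd q \<noteq> 0" using q True by (auto simp: norm_prod_def)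
    have sm: "smooth_along S3 ?d"
      by (intro smooth_along_add smooth_along_cmult sc smooth_along_hol_poly)
    have "isCont (\<lambda>t. ?d (flow I1 t q)) 0"
      using has_vector_derivative_continuous [OF has_vector_derivative_X [OF unit_field_I(1) sm q]] by simp
    then have "((\<lambda>t. ?d (flow I1 t q)) \<longlongrightarrow> ?d q) (at 0)"
      by (simp add: isCont_def)
    moreover have "((\<lambda>t. ?d (flow I1 t q)) \<longlongrightarrow> 0) (at 0)"
    proof (rule tendsto_eventually)
      have "\<forall>\<^sub>F t in at 0. sin t \<noteq> (0::real)"
        unfolding eventually_at
        by (rule exI [of _ pi]) (auto simp: dist_real_def sin_eq_0_pi)
      then show "\<forall>\<^sub>F t in at 0. ?d (flow I1 t q) = 0"
      proof (rule eventually_mono)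
        fix t :: real assume "sin t \<noteq> 0"
        then have "fst (flow I1 t q) \<noteq> 0" using True w by (simp add: flow_def I1_def)
        then show "?d (flow I1 t q) = 0"
          using main [OF flow_S3 [OF unit_field_I(1) q]] by simp
      qed
    qed
    ultimately have "?d q = 0" using tendsto_unique [of "at (0::real)"] by force
    then show ?thesis by simp
  qed (use main q in blast)
  then show thesis using that by blast
qed

text \<open>Dividing by a power of the first coordinate gives a polynomial in the quotient of the two
  coordinates, which takes all complex values.\<close>

lemma hol_poly_eq_0:
  assumes "\<And>q. q \<in> S3 \<Longrightarrow> hol_poly n \<gamma> q = 0" "j \<le> n"
  shows "\<gamma> j = 0"
proof -
  have "(\<Sum>j\<le>n. \<gamma> j * \<zeta> ^ j) = 0" for \<zeta>
  proof -
    define r where "r = complex_of_real (inverse (sqrt (1 + \<zeta> \<bullet> \<zeta>)))"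
    have r: "r \<noteq> 0" using one_plus_inner_pos [of \<zeta>] by (simp add: r_def)
    have c: "chart \<zeta> = (r, r * \<zeta>)" by (simp add: chart_def r_def scaleR_conv_of_real)
    have "hol_poly n \<gamma> (chart \<zeta>) = r ^ n * (\<Sum>j\<le>n. \<gamma> j * \<zeta> ^ j)"
      unfolding hol_poly_def c sum_distrib_left
    proof (rule sum.cong)
      fix j assume "j \<in> {..n}"
      then have "r ^ n = r ^ (n - j) * r ^ j" by (simp add: power_add [symmetric])
      then show "\<gamma> j * (fst (r, r * \<zeta>) ^ (n - j) * snd (r, r * \<zeta>) ^ j) = r ^ n * (\<gamma> j * \<zeta> ^ j)"
        by (simp add: power_mult_distrib)
    qed simp
    then show ?thesis using assms(1) [OF chart_S3, of \<zeta>] r by simp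
  qed
  then show ?thesis using assms(2) polyfun_eq_0 [of \<gamma> n] by blast
qed

text \<open>A linear parametrisation of a ladder space by the first \<open>n + 1\<close> terms of complex sequences.\<close>

definition ladder_param :: "real \<Rightarrow> real \<Rightarrow> nat \<Rightarrow> ((nat \<Rightarrow> complex) \<Rightarrow> complex \<times> complex \<Rightarrow> complex) \<Rightarrow> bool" where
  "ladder_param k \<theta> n \<Psi> \<longleftrightarrow> (\<forall>\<gamma>. \<Psi> \<gamma> \<in> ladder k \<theta>) \<and>
     (\<forall>\<gamma> \<gamma>' c d. \<forall>q\<in>S3. \<Psi> (\<lambda>j. c * \<gamma> j + d * \<gamma>' j) q = c * \<Psi> \<gamma> q + d * \<Psi> \<gamma>' q) \<and>
     (\<forall>a\<in>ladder k \<theta>. \<exists>\<gamma>. (\<forall>j>n. \<gamma> j = 0) \<and> (\<forall>q\<in>S3. a q = \<Psi> \<gamma> q)) \<and>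
     (\<forall>\<gamma>. (\<forall>q\<in>S3. \<Psi> \<gamma> q = 0) \<longrightarrow> (\<forall>j\<le>n. \<gamma> j = 0))"

lemma ladder_param_hol_poly: "ladder_param (2 * real l) 0 (2 * l) (hol_poly (2 * l))"
  unfolding ladder_param_def
proof (intro conjI allI ballI impI)
  show "hol_poly (2 * l) \<gamma> \<in> ladder (2 * real l) 0" for \<gamma>
    using hol_poly_ladder [of "2 * l" \<gamma>] by simp
  show "hol_poly (2 * l) (\<lambda>j. c * \<gamma> j + d * \<gamma>' j) q = c * hol_poly (2 * l) \<gamma> q + d * hol_poly (2 * l) \<gamma>' q" for c d \<gamma> \<gamma>' q
    by (simp add: hol_poly_def sum_distrib_left sum.distrib [symmetric] algebra_simps)
  show "\<exists>\<gamma>. (\<forall>j>2 * l. \<gamma> j = 0) \<and> (\<forall>q\<in>S3. a q = hol_poly (2 * l) \<gamma> q)" if a: "a \<in> ladder (2 * real l) 0" for a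
  proof -
    obtain \<gamma> where \<gamma>: "\<And>q. q \<in> S3 \<Longrightarrow> a q = hol_poly (2 * l) \<gamma> q"
      using ladder_0_hol_poly [OF a] by blast
    let ?\<gamma> = "\<lambda>j. if j \<le> 2 * l then \<gamma> j else 0"
    have "hol_poly (2 * l) ?\<gamma> q = hol_poly (2 * l) \<gamma> q" for q
      unfolding hol_poly_def by (intro sum.cong) auto
    then show ?thesis using \<gamma> by (intro exI [of _ ?\<gamma>]) simp
  qed
  show "\<gamma> j = 0" if "\<forall>q\<in>S3. hol_poly (2 * l) \<gamma> q = 0" "j \<le> 2 * l" for \<gamma> j
    by (rule hol_poly_eq_0 [OF _ that(2)]) (rule bspec [OF that(1)])
qed

lemma ladder_param_dn:
  assumes \<Psi>: "ladder_param k \<theta> n \<Psi>" and nz: "\<theta> + k \<noteq> 0"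
  shows "ladder_param (k - 2) (\<theta> + k) n (\<lambda>\<gamma>. dn (\<Psi> \<gamma>))"
proof -
  have L: "\<Psi> \<gamma> \<in> ladder k \<theta>" for \<gamma> using \<Psi> unfolding ladder_param_def by blast
  note S = ladderD(1) [OF L]
  show ?thesis
    unfolding ladder_param_def
  proof (intro conjI allI ballI impI)
    show "dn (\<Psi> \<gamma>) \<in> ladder (k - 2) (\<theta> + k)" for \<gamma> by (rule ladder_dn [OF L])
    fix c d \<gamma> \<gamma>' q assume q: "q \<in> S3"
    have "dn (\<Psi> (\<lambda>j. c * \<gamma> j + d * \<gamma>' j)) q = dn (\<lambda>q. c * \<Psi> \<gamma> q + d * \<Psi> \<gamma>' q) q"
      by (rule dn_cong [OF q]) (use \<Psi> in \<open>unfold ladder_param_def, blast\<close>)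
    also have "\<dots> = c * dn (\<Psi> \<gamma>) q + d * dn (\<Psi> \<gamma>') q"
      by (simp add: dn_add smooth_along_cmult S dn_cmult q [unfolded mem_sphere_0])
    finally show "dn (\<Psi> (\<lambda>j. c * \<gamma> j + d * \<gamma>' j)) q = c * dn (\<Psi> \<gamma>) q + d * dn (\<Psi> \<gamma>') q" .
  next
    fix b assume b: "b \<in> ladder (k - 2) (\<theta> + k)"
    let ?r = "- inverse (of_real (\<theta> + k)) :: complex"
    have "up b \<in> ladder k \<theta>" using ladder_up [OF b] by simp
    from ladder_lincomb [OF this this, of ?r 0] have c: "(\<lambda>q. ?r * up b q) \<in> ladder k \<theta>" by simp
    have "\<forall>a\<in>ladder k \<theta>. \<exists>\<gamma>. (\<forall>j>n. \<gamma> j = 0) \<and> (\<forall>q\<in>S3. a q = \<Psi> \<gamma> q)"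
      using \<Psi> unfolding ladder_param_def by blast
    from bspec [OF this c] obtain \<gamma> where \<gamma>0: "\<forall>j>n. \<gamma> j = 0" and \<gamma>: "\<forall>q\<in>S3. ?r * up b q = \<Psi> \<gamma> q" by (elim exE conjE)
    have "b q = dn (\<Psi> \<gamma>) q" if q: "q \<in> S3" for q
    proof -
      have "dn (\<Psi> \<gamma>) q = dn (\<lambda>q. ?r * up b q) q" by (rule dn_cong [OF q]) (use \<gamma> in simp)
      also have "\<dots> = ?r * dn (up b) q" by (rule dn_cmult [OF smooth_along_up [OF ladderD(1) [OF b]] q])
      also have "\<dots> = b q"
        using ladderD(3) [OF b q] nz by (simp del: of_real_add)
      finally show ?thesis by simp
    qed
    then show "\<exists>\<gamma>. (\<forall>j>n. \<gamma> j = 0) \<and> (\<forall>q\<in>S3. b q = dn (\<Psi> \<gamma>) q)" using \<gamma>0 by blast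
  next
    fix \<gamma> j assume 0: "\<forall>q\<in>S3. dn (\<Psi> \<gamma>) q = 0" and j: "j \<le> n"
    have "\<Psi> \<gamma> q = 0" if q: "q \<in> S3" for q
    proof -
      have "up (dn (\<Psi> \<gamma>)) q = up (\<lambda>q. 0) q" by (rule up_cong [OF q]) (use 0 in simp)
      then show ?thesis using up_dn_ladder [OF L q] nz up_0 by (simp del: of_real_add)
    qed
    then show "\<gamma> j = 0" using \<Psi> j unfolding ladder_param_def by blast
  qed
qed

text \<open>The bottom rungs are spaces of holomorphic polynomials; lowering them step by step to charge 4 is
  an isomorphism as long as the eigenvalue on the way is not zero.\<close>

lemma ladder_param_4:
  obtains \<Psi>0 \<Psi>6 \<Psi>14 \<Psi>24 where "ladder_param 4 0 4 \<Psi>0" "ladder_param 4 6 6 \<Psi>6"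
    "ladder_param 4 14 8 \<Psi>14" "ladder_param 4 24 10 \<Psi>24"
proof -
  have 6: "ladder_param 4 6 6 (\<lambda>\<gamma>. dn (hol_poly 6 \<gamma>))"
    using ladder_param_dn [OF ladder_param_hol_poly [of 3]] by simp
  have 8: "ladder_param 6 8 8 (\<lambda>\<gamma>. dn (hol_poly 8 \<gamma>))"
    using ladder_param_dn [OF ladder_param_hol_poly [of 4]] by simp
  have 10: "ladder_param 8 10 10 (\<lambda>\<gamma>. dn (hol_poly 10 \<gamma>))"
    using ladder_param_dn [OF ladder_param_hol_poly [of 5]] by simp
  show thesis
    using that [OF _ 6] ladder_param_hol_poly [of 2] ladder_param_dn [OF 8]
      ladder_param_dn [OF ladder_param_dn [OF 10]] by simp
qed

section \<open>Harmonic cubic forms along the sphere\<close>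

definition tri :: "(3 \<Rightarrow> 3 \<Rightarrow> 3 \<Rightarrow> real) \<Rightarrow> complex^3 \<Rightarrow> complex^3 \<Rightarrow> complex^3 \<Rightarrow> complex" where
  "tri c u v w = (\<Sum>i\<in>UNIV. \<Sum>j\<in>UNIV. \<Sum>k\<in>UNIV. of_real (c i j k) * (u $ i * v $ j * w $ k))"

definition harmonic_tensor :: "(3 \<Rightarrow> 3 \<Rightarrow> 3 \<Rightarrow> real) \<Rightarrow> bool" where
  "harmonic_tensor c \<longleftrightarrow> (\<forall>i j k. c i j k = c j i k \<and> c i j k = c i k j) \<and> (\<forall>k. (\<Sum>i\<in>UNIV. c i i k) = 0)"

lemma tri_swap:
  assumes "harmonic_tensor c"
  shows "tri c u v w = tri c v u w" "tri c u v w = tri c u w v"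
proof -
  have s: "c i j k = c j i k" "c i j k = c i k j" for i j k
    using assms unfolding harmonic_tensor_def by blast+
  have "tri c u v w = (\<Sum>j\<in>UNIV. \<Sum>i\<in>UNIV. \<Sum>k\<in>UNIV. of_real (c i j k) * (u $ i * v $ j * w $ k))"
    unfolding tri_def by (rule sum.swap)
  also have "\<dots> = tri c v u w"
    unfolding tri_def by (intro sum.cong refl) (simp add: s(1) mult_ac)
  finally show "tri c u v w = tri c v u w" .
  have "tri c u v w = (\<Sum>i\<in>UNIV. \<Sum>k\<in>UNIV. \<Sum>j\<in>UNIV. of_real (c i j k) * (u $ i * v $ j * w $ k))"
    unfolding tri_def by (intro sum.cong [OF refl] sum.swap)
  also have "\<dots> = tri c u w v"
    unfolding tri_def by (intro sum.cong refl) (simp add: s(2) mult_ac)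
  finally show "tri c u v w = tri c u w v" .
qed

definition cnjv :: "complex^'n \<Rightarrow> complex^'n" where
  "cnjv v = (\<chi> i. cnj (v $ i))"

lemma cnjv_nth [simp]: "cnjv v $ i = cnj (v $ i)"
  by (simp add: cnjv_def)

lemma cnjv_cnjv [simp]: "cnjv (cnjv v) = v"
  by (simp add: vec_eq_iff)

lemma cnj_tri: "cnj (tri c u v w) = tri c (cnjv u) (cnjv v) (cnjv w)"
  by (simp add: tri_def)

text \<open>The Hopf map \<open>xv\<close> to the unit two-sphere and the complex tangent vector \<open>mv\<close>; \<open>xv q\<close>
  together with the real and imaginary parts of \<open>mv q\<close> is the frame rotated by \<open>q\<close>.\<close>

definition xv :: "complex \<times> complex \<Rightarrow> complex^3" where
  "xv q = vector [cnj (fst q) * snd q + fst q * cnj (snd q),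
     - \<i> * (cnj (fst q) * snd q) + \<i> * (fst q * cnj (snd q)), fst q * cnj (fst q) + - 1 * (snd q * cnj (snd q))]"

definition mv :: "complex \<times> complex \<Rightarrow> complex^3" where
  "mv q = vector [fst q * fst q + - 1 * (snd q * snd q), \<i> * (fst q * fst q) + \<i> * (snd q * snd q), - 2 * (fst q * snd q)]"

lemma cnjv_xv [simp]: "cnjv (xv q) = xv q"
  by (simp add: vec_eq_iff forall_3 xv_def algebra_simps)

lemma has_updn_xv: "has_updn (\<lambda>q. xv q $ i) (mv q $ i) (cnjv (mv q) $ i) q"
proof -
  note z = has_updn_fst [of q] and w = has_updn_snd [of q]
  note z' = has_updn_cnj [OF z] and w' = has_updn_cnj [OF w]
  note 1 = has_updn_add [OF has_updn_mult [OF z' w] has_updn_mult [OF z w']]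
  note 2 = has_updn_add [OF has_updn_cmult [OF has_updn_mult [OF z' w], of "- \<i>"]
      has_updn_cmult [OF has_updn_mult [OF z w'], of "\<i>"]]
  note 3 = has_updn_add [OF has_updn_mult [OF z z'] has_updn_cmult [OF has_updn_mult [OF w w'], of "- 1"]]
  have "has_updn (\<lambda>q. xv q $ 1) (mv q $ 1) (cnjv (mv q) $ 1) q"
    "has_updn (\<lambda>q. xv q $ 2) (mv q $ 2) (cnjv (mv q) $ 2) q"
    "has_updn (\<lambda>q. xv q $ 3) (mv q $ 3) (cnjv (mv q) $ 3) q"
    using 1 2 3 unfolding xv_def mv_def by (simp_all add: algebra_simps)
  then show ?thesis using exhaust_3 [of i] by auto
qed

lemma has_updn_mv: "has_updn (\<lambda>q. mv q $ i) 0 (- 2 * xv q $ i) q"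
proof -
  note z = has_updn_fst [of q] and w = has_updn_snd [of q]
  note zz = has_updn_mult [OF z z] and ww = has_updn_mult [OF w w] and zw = has_updn_mult [OF z w]
  note 1 = has_updn_add [OF zz has_updn_cmult [OF ww, of "- 1"]]
  note 2 = has_updn_add [OF has_updn_cmult [OF zz, of "\<i>"] has_updn_cmult [OF ww, of "\<i>"]]
  note 3 = has_updn_cmult [OF zw, of "- 2"]
  have "has_updn (\<lambda>q. mv q $ 1) 0 (- 2 * xv q $ 1) q"
    "has_updn (\<lambda>q. mv q $ 2) 0 (- 2 * xv q $ 2) q"
    "has_updn (\<lambda>q. mv q $ 3) 0 (- 2 * xv q $ 3) q"
    using 1 2 3 unfolding xv_def mv_def by (simp_all add: algebra_simps)
  then show ?thesis using exhaust_3 [of i] by auto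
qed

lemma has_updn_cnj_mv: "has_updn (\<lambda>q. cnjv (mv q) $ i) (- 2 * xv q $ i) 0 q"
proof -
  have "cnj (xv q $ i) = xv q $ i" using cnjv_xv [of q] by (metis cnjv_nth)
  then show ?thesis using has_updn_cnj [OF has_updn_mv [of i q]] by simp
qed

lemma has_updn_tri:
  fixes u v w :: "complex \<times> complex \<Rightarrow> complex^3"
  assumes "\<And>i. has_updn (\<lambda>q. u q $ i) (u1 $ i) (u2 $ i) q" "\<And>i. has_updn (\<lambda>q. v q $ i) (v1 $ i) (v2 $ i) q"
    "\<And>i. has_updn (\<lambda>q. w q $ i) (w1 $ i) (w2 $ i) q"
  shows "has_updn (\<lambda>q. tri c (u q) (v q) (w q)) (tri c u1 (v q) (w q) + tri c (u q) v1 (w q) + tri c (u q) (v q) w1)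
     (tri c u2 (v q) (w q) + tri c (u q) v2 (w q) + tri c (u q) (v q) w2) q"
proof -
  have "has_updn (\<lambda>q. of_real (c i j k) * (u q $ i * v q $ j * w q $ k))
     (of_real (c i j k) * ((u1 $ i * v q $ j + u q $ i * v1 $ j) * w q $ k + u q $ i * v q $ j * w1 $ k))
     (of_real (c i j k) * ((u2 $ i * v q $ j + u q $ i * v2 $ j) * w q $ k + u q $ i * v q $ j * w2 $ k)) q" for i j k
    by (intro has_updn_cmult has_updn_mult assms)
  then have "has_updn (\<lambda>q. tri c (u q) (v q) (w q))
     (\<Sum>i\<in>UNIV. \<Sum>j\<in>UNIV. \<Sum>k\<in>UNIV. of_real (c i j k) * ((u1 $ i * v q $ j + u q $ i * v1 $ j) * w q $ k + u q $ i * v q $ j * w1 $ k))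
     (\<Sum>i\<in>UNIV. \<Sum>j\<in>UNIV. \<Sum>k\<in>UNIV. of_real (c i j k) * ((u2 $ i * v q $ j + u q $ i * v2 $ j) * w q $ k + u q $ i * v q $ j * w2 $ k)) q"
    unfolding tri_def by (intro has_updn_sum)
  then show ?thesis
    by (simp add: tri_def sum.distrib [symmetric] algebra_simps)
qed

lemma tri_scale:
  "tri c (k *s u) v w = k * tri c u v w" "tri c u (k *s v) w = k * tri c u v w" "tri c u v (k *s w) = k * tri c u v w"
  by (simp_all add: tri_def sum_distrib_left mult_ac)

lemma tri_zero: "tri c 0 v w = 0" "tri c u 0 w = 0" "tri c u v 0 = 0"
  by (simp_all add: tri_def)

lemma frame_complete:
  assumes "q \<in> S3"
  shows "xv q $ i * xv q $ j + (mv q $ i * cnj (mv q $ j) + cnj (mv q $ i) * mv q $ j) / 2 = (if i = j then 1 else 0)"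
proof -
  have "(norm (fst q))\<^sup>2 + (norm (snd q))\<^sup>2 = 1"
    using assms by (simp add: norm_prod_def)
  then have n: "fst q * cnj (fst q) + snd q * cnj (snd q) = 1"
    by (metis complex_norm_square of_real_1 of_real_add)
  have *: "(if i = j then 1 else 0) = (if i = j then (fst q * cnj (fst q) + snd q * cnj (snd q))\<^sup>2 else (0::complex))"
    using n by simp
  show ?thesis
    unfolding * using exhaust_3 [of i] exhaust_3 [of j]
    by (elim disjE) (simp_all add: xv_def mv_def power2_eq_square field_simps)
qed

lemma tri_trace:
  assumes c: "harmonic_tensor c" and q: "q \<in> S3"
  shows "tri c u (mv q) (cnjv (mv q)) = - tri c u (xv q) (xv q)"
proof -
  have tr: "(\<Sum>j\<in>UNIV. c i j j) = 0" for i
  proof -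
    have "(\<Sum>j\<in>UNIV. c i j j) = (\<Sum>j\<in>UNIV. c j j i)"
      using c unfolding harmonic_tensor_def by (metis (no_types, lifting))
    then show ?thesis using c unfolding harmonic_tensor_def by simp
  qed
  have "tri c u (xv q) (xv q) + (tri c u (mv q) (cnjv (mv q)) + tri c u (cnjv (mv q)) (mv q)) / 2
    = (\<Sum>i\<in>UNIV. \<Sum>j\<in>UNIV. \<Sum>k\<in>UNIV. of_real (c i j k) * (u $ i) *
        (xv q $ j * xv q $ k + (mv q $ j * cnj (mv q $ k) + cnj (mv q $ j) * mv q $ k) / 2))"
    unfolding tri_def sum.distrib [symmetric] sum_divide_distrib
    by (intro sum.cong refl) (simp add: field_simps)
  also have "\<dots> = (\<Sum>i\<in>UNIV. of_real (\<Sum>j\<in>UNIV. c i j j) * u $ i)"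
    unfolding frame_complete [OF q] by (simp add: if_distrib sum_distrib_right cong: if_cong)
  also have "\<dots> = 0" by (simp only: tr) simp
  finally show ?thesis
    using tri_swap(2) [OF c, of u "cnjv (mv q)" "mv q"] by (simp add: add_eq_0_iff)
qed

text \<open>\<open>G c 3\<close> is the value of the cubic form at \<open>x\<close>; a larger index replaces copies of \<open>x\<close> by the isotropic
  vector \<open>m\<close>, a smaller one by its conjugate.\<close>

definition G :: "(3 \<Rightarrow> 3 \<Rightarrow> 3 \<Rightarrow> real) \<Rightarrow> nat \<Rightarrow> complex \<times> complex \<Rightarrow> complex" where
  "G c j q = (let x = xv q; m = mv q; m' = cnjv m in
     [- tri c m' m' m', tri c x m' m', - tri c x x m', tri c x x x, tri c x x m, tri c x m m, tri c m m m, 0] ! j)"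

lemma G_simps:
  "G c 0 q = - tri c (cnjv (mv q)) (cnjv (mv q)) (cnjv (mv q))"
  "G c 1 q = tri c (xv q) (cnjv (mv q)) (cnjv (mv q))"
  "G c 2 q = - tri c (xv q) (xv q) (cnjv (mv q))"
  "G c 3 q = tri c (xv q) (xv q) (xv q)"
  "G c 4 q = tri c (xv q) (xv q) (mv q)"
  "G c 5 q = tri c (xv q) (mv q) (mv q)"
  "G c 6 q = tri c (mv q) (mv q) (mv q)"
  "G c (Suc 0) q = tri c (xv q) (cnjv (mv q)) (cnjv (mv q))"
  by (simp_all add: G_def Let_def)

lemma cnj_G:
  "cnj (G c 3 q) = G c 3 q" "cnj (G c 4 q) = - G c 2 q" "cnj (G c 5 q) = G c 1 q" "cnj (G c 6 q) = - G c 0 q"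
  "cnj (G c 2 q) = - G c 4 q" "cnj (G c 1 q) = G c 5 q" "cnj (G c 0 q) = - G c 6 q"
  by (simp_all add: G_simps cnj_tri)

lemma has_updn_G:
  assumes c: "harmonic_tensor c" and q: "q \<in> S3" and j: "j \<le> 6"
  shows "has_updn (G c j) ((6 - of_nat j) * G c (j + 1) q) (- of_nat j * G c (j - 1) q) q"
proof -
  let ?x = "xv q" and ?m = "mv q" and ?m' = "cnjv (mv q)"
  have x: "has_updn (\<lambda>q. xv q $ i) (?m $ i) (?m' $ i) q" for i by (rule has_updn_xv)
  have m: "has_updn (\<lambda>q. mv q $ i) ((0::complex^3) $ i) (((- 2) *s ?x) $ i) q" for i
    using has_updn_mv [of i q] by simp
  have m': "has_updn (\<lambda>q. cnjv (mv q) $ i) (((- 2) *s ?x) $ i) ((0::complex^3) $ i) q" for i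
    using has_updn_cnj_mv [of i q] by simp
  note s = tri_swap [OF c] and neg = has_updn_cmult [of _ _ _ _ "- 1"]
  have t1: "tri c u ?m' ?m = - tri c u ?x ?x" "tri c u ?m ?m' = - tri c u ?x ?x" "tri c ?m u ?m' = - tri c u ?x ?x" for u
    using tri_trace [OF c q] s by metis+
  have t2: "tri c ?m' u ?m = - tri c u ?x ?x" "tri c ?m ?m' u = - tri c u ?x ?x" "tri c ?m' ?m u = - tri c u ?x ?x" for u
    using t1 s by metis+
  have o1: "tri c ?m ?x ?x = tri c ?x ?x ?m" "tri c ?x ?m ?x = tri c ?x ?x ?m" "tri c ?m' ?x ?x = tri c ?x ?x ?m'"
    "tri c ?x ?m' ?x = tri c ?x ?x ?m'" "tri c ?m ?x ?m = tri c ?x ?m ?m" "tri c ?m ?m ?x = tri c ?x ?m ?m"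
    "tri c ?m' ?x ?m' = tri c ?x ?m' ?m'" "tri c ?m' ?m' ?x = tri c ?x ?m' ?m'"
    using s by metis+
  note rules = tri_scale tri_zero t1 t2 o1
  have 3: "has_updn (G c 3) (3 * G c 4 q) (- 3 * G c 2 q) q"
    using has_updn_tri [OF x x x, of c] unfolding G_simps rules by (simp add: G_simps)
  have 4: "has_updn (G c 4) (2 * G c 5 q) (- 4 * G c 3 q) q"
    using has_updn_tri [OF x x m, of c] unfolding G_simps rules by (simp add: G_simps)
  have 5: "has_updn (G c 5) (1 * G c 6 q) (- 5 * G c 4 q) q"
    using has_updn_tri [OF x m m, of c] unfolding G_simps rules by (simp add: G_simps)
  have 6: "has_updn (G c 6) 0 (- 6 * G c 5 q) q"
    using has_updn_tri [OF m m m, of c] unfolding G_simps rules by (simp add: G_simps)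
  have 2: "has_updn (G c 2) (4 * G c 3 q) (- 2 * G c 1 q) q"
    using neg [OF has_updn_tri [OF x x m', of c]] unfolding G_simps rules by (simp add: G_simps)
  have 1: "has_updn (G c 1) (5 * G c 2 q) (- 1 * G c 0 q) q"
    using has_updn_tri [OF x m' m', of c] unfolding G_simps rules by (simp add: G_simps)
  have 0: "has_updn (G c 0) (6 * G c 1 q) 0 q"
    using neg [OF has_updn_tri [OF m' m' m', of c]] unfolding G_simps rules by (simp add: G_simps)
  have "j \<in> {0,1,2,3,4,5,6}" using j by auto
  then show ?thesis using 0 1 2 3 4 5 6 by (elim insertE) (simp_all add: eval_nat_numeral)
qed

section \<open>The cross product in coordinates\<close>

lemma exhaust_7: fixes x :: 7 shows "x = 1 \<or> x = 2 \<or> x = 3 \<or> x = 4 \<or> x = 5 \<or> x = 6 \<or> x = 7"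
proof (induct x)
  case (of_int z)
  then have "z = 0 \<or> z = 1 \<or> z = 2 \<or> z = 3 \<or> z = 4 \<or> z = 5 \<or> z = 6" by fastforce
  then show ?case by auto
qed

lemma forall_7: "(\<forall>i::7. P i) \<longleftrightarrow> P 1 \<and> P 2 \<and> P 3 \<and> P 4 \<and> P 5 \<and> P 6 \<and> P 7"
  by (metis exhaust_7)

lemma UNIV_7: "UNIV = {1, 2, 3, 4, 5, 6, 7::7}"
  using exhaust_7 by auto

lemma sum_7: "sum f (UNIV::7 set) = f 1 + f 2 + f 3 + f 4 + f 5 + f 6 + f 7"
  unfolding UNIV_7 by (simp add: ac_simps)

lemma vector_7 [simp]:
  "(vector [a,b,c,d,e,f,g] :: 'a::zero^7) $ 1 = a"
  "(vector [a,b,c,d,e,f,g] :: 'a::zero^7) $ 2 = b"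
  "(vector [a,b,c,d,e,f,g] :: 'a::zero^7) $ 3 = c"
  "(vector [a,b,c,d,e,f,g] :: 'a::zero^7) $ 4 = d"
  "(vector [a,b,c,d,e,f,g] :: 'a::zero^7) $ 5 = e"
  "(vector [a,b,c,d,e,f,g] :: 'a::zero^7) $ 6 = f"
  "(vector [a,b,c,d,e,f,g] :: 'a::zero^7) $ 7 = g"
  by (simp_all add: vector_def)

definition cross :: "'a::comm_ring_1^7 \<Rightarrow> 'a^7 \<Rightarrow> 'a^7" where
  "cross u v = vector [
     u$2 * v$3 - u$3 * v$2 + (u$4 * v$5 - u$5 * v$4) - (u$6 * v$7 - u$7 * v$6),
     u$3 * v$1 - u$1 * v$3 + (u$4 * v$7 - u$7 * v$4) - (u$5 * v$6 - u$6 * v$5),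
     u$1 * v$2 - u$2 * v$1 - (u$4 * v$6 - u$6 * v$4) - (u$5 * v$7 - u$7 * v$5),
     u$5 * v$1 - u$1 * v$5 + (u$7 * v$2 - u$2 * v$7) + (u$3 * v$6 - u$6 * v$3),
     u$1 * v$4 - u$4 * v$1 + (u$2 * v$6 - u$6 * v$2) + (u$3 * v$7 - u$7 * v$3),
     - (u$7 * v$1 - u$1 * v$7) - (u$2 * v$5 - u$5 * v$2) - (u$3 * v$4 - u$4 * v$3),
     - (u$1 * v$6 - u$6 * v$1) + (u$2 * v$4 - u$4 * v$2) - (u$3 * v$5 - u$5 * v$3)]"

lemma cross7_eq_cross: "cross7 u v = cross u v"
  by (simp add: vec_eq_iff forall_7 cross7_def cross_def phi_def wedge3_def det_3 axis_def algebra_simps)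

lemma phi_eq_inner_cross: "phi u v w = cross u v \<bullet> w"
  using inner_cross7 [of u v w] by (simp add: cross7_eq_cross)

lemma cross_add: "cross (u + u') v = cross u v + cross u' v" "cross u (v + v') = cross u v + cross u v'"
  by (simp_all add: vec_eq_iff forall_7 cross_def algebra_simps)

lemma cross_scale: "cross (k *s u) v = k *s cross u v" "cross u (k *s v) = k *s cross u v"
  by (simp_all add: vec_eq_iff forall_7 cross_def algebra_simps)

lemma cross_scaleR: "cross (k *\<^sub>R u) v = k *\<^sub>R cross u v" "cross u (k *\<^sub>R v) = k *\<^sub>R cross u v" for u v :: "real^7"
  by (simp_all add: vec_eq_iff forall_7 cross_def algebra_simps)

lemma cross_neg: "cross (- u) v = - cross u v" "cross u (- v) = - cross u v"
  by (simp_all add: vec_eq_iff forall_7 cross_def algebra_simps)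

lemma cross_refl: "cross u u = 0"
  by (simp add: vec_eq_iff forall_7 cross_def algebra_simps)

lemma cross_skew: "cross v u = - cross u v"
  by (simp add: vec_eq_iff forall_7 cross_def algebra_simps)

lemma cross_zero: "cross 0 v = 0" "cross u 0 = 0"
  by (simp_all add: vec_eq_iff forall_7 cross_def)

lemma cnjv_cross: "cnjv (cross u v) = cross (cnjv u) (cnjv v)"
  by (simp add: vec_eq_iff forall_7 cross_def)

lemma cross_cross: "cross p (cross p v) = (p \<bullet> v) *\<^sub>R p - (p \<bullet> p) *\<^sub>R v" for p v :: "real^7"
  by (simp add: vec_eq_iff forall_7 cross_def inner_vec_def sum_7 algebra_simps)

lemma inner_cross_self: "cross p v \<bullet> p = 0" "cross p v \<bullet> v = 0" for p v :: "real^7"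
  by (simp_all add: cross_def inner_vec_def sum_7 algebra_simps)

lemma inner_cross_cyclic: "cross p u \<bullet> v = cross u v \<bullet> p" for p u v :: "real^7"
  by (simp add: cross_def inner_vec_def sum_7 algebra_simps)

section \<open>The moving frame\<close>

text \<open>The seven coordinates of the frame vectors, one cubic form for each coordinate.\<close>

definition H :: "(7 \<Rightarrow> 3 \<Rightarrow> 3 \<Rightarrow> 3 \<Rightarrow> real) \<Rightarrow> nat \<Rightarrow> complex \<times> complex \<Rightarrow> complex^7" where
  "H c j q = (\<chi> i. G (c i) j q)"

lemma H_nth [simp]: "H c j q $ i = G (c i) j q"
  by (simp add: H_def)

lemma cnjv_H:
  "cnjv (H c 3 q) = H c 3 q" "cnjv (H c 4 q) = - H c 2 q" "cnjv (H c 5 q) = H c 1 q" "cnjv (H c 6 q) = - H c 0 q"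
  "cnjv (H c 2 q) = - H c 4 q" "cnjv (H c 1 q) = H c 5 q" "cnjv (H c 0 q) = - H c 6 q"
  by (simp_all add: vec_eq_iff cnj_G cnj_G [unfolded One_nat_def])

definition bil :: "(7 \<Rightarrow> 7 \<Rightarrow> complex) \<Rightarrow> complex^7 \<Rightarrow> complex^7 \<Rightarrow> complex" where
  "bil M u v = (\<Sum>i\<in>UNIV. \<Sum>k\<in>UNIV. M i k * (u $ i * v $ k))"

lemma has_updn_bil:
  assumes c: "\<And>i. harmonic_tensor (c i)" and q: "q \<in> S3" and ab: "a \<le> 6" "b \<le> 6"
  shows "has_updn (\<lambda>q. bil M (H c a q) (H c b q))
    ((6 - of_nat a) * bil M (H c (a + 1) q) (H c b q) + (6 - of_nat b) * bil M (H c a q) (H c (b + 1) q))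
    (- of_nat a * bil M (H c (a - 1) q) (H c b q) - of_nat b * bil M (H c a q) (H c (b - 1) q)) q"
proof -
  note A = has_updn_G [OF c q ab(1)] and B = has_updn_G [OF c q ab(2)]
  have "has_updn (\<lambda>q. bil M (H c a q) (H c b q))
    (\<Sum>i\<in>UNIV. \<Sum>k\<in>UNIV. M i k * ((6 - of_nat a) * G (c i) (a + 1) q * G (c k) b q + G (c i) a q * ((6 - of_nat b) * G (c k) (b + 1) q)))
    (\<Sum>i\<in>UNIV. \<Sum>k\<in>UNIV. M i k * (- of_nat a * G (c i) (a - 1) q * G (c k) b q + G (c i) a q * (- of_nat b * G (c k) (b - 1) q))) q"
    unfolding bil_def H_nth
    by (rule has_updn_sum, rule has_updn_sum, rule has_updn_cmult, rule has_updn_mult, rule A, rule B)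
  then show ?thesis
    by (simp add: bil_def sum.distrib [symmetric] sum_distrib_left sum_subtractf [symmetric] sum_negf [symmetric] algebra_simps)
qed

text \<open>Differentiating an identity for one pair of frame vectors gives identities for the neighbouring
  pairs.\<close>

lemma bil_chain:
  assumes c: "\<And>i. harmonic_tensor (c i)" and ab: "a \<le> 6" "b \<le> 6"
    and eq: "\<And>q. q \<in> S3 \<Longrightarrow> bil M (H c a q) (H c b q) = f q" and f: "has_updn f p n q" and q: "q \<in> S3"
  shows "(6 - of_nat a) * bil M (H c (a + 1) q) (H c b q) + (6 - of_nat b) * bil M (H c a q) (H c (b + 1) q) = p"
    "of_nat a * bil M (H c (a - 1) q) (H c b q) + of_nat b * bil M (H c a q) (H c (b - 1) q) = - n"
proof -
  note d = has_updn_imp [OF has_updn_bil [OF c q ab]] and e = has_updn_imp [OF f]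
  have "up (\<lambda>q. bil M (H c a q) (H c b q)) q = up f q" "dn (\<lambda>q. bil M (H c a q) (H c b q)) q = dn f q"
    by (rule up_cong [OF q eq], assumption, rule dn_cong [OF q eq], assumption)
  then show "(6 - of_nat a) * bil M (H c (a + 1) q) (H c b q) + (6 - of_nat b) * bil M (H c a q) (H c (b + 1) q) = p"
    unfolding d e by simp
  show "of_nat a * bil M (H c (a - 1) q) (H c b q) + of_nat b * bil M (H c a q) (H c (b - 1) q) = - n"
    using \<open>dn _ q = dn f q\<close> unfolding d e
    by (simp add: eq_neg_iff_add_eq_0 neg_eq_iff_add_eq_0 algebra_simps)
qed

definition cdot :: "complex^'n \<Rightarrow> complex^'n \<Rightarrow> complex" where
  "cdot u v = (\<Sum>i\<in>UNIV. u $ i * v $ i)"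

lemma cdot_commute: "cdot u v = cdot v u"
  by (simp add: cdot_def mult.commute)

lemma cdot_bil: "cdot u v = bil (\<lambda>i k. if i = k then 1 else 0) u v"
  by (simp add: cdot_def bil_def if_distrib if_distribR cong: if_cong)

lemma cdot_cnjv: "cnj (cdot u v) = cdot (cnjv u) (cnjv v)"
  by (simp add: cdot_def)

definition cross_form :: "7 \<Rightarrow> 7 \<Rightarrow> 7 \<Rightarrow> complex" where
  "cross_form k i j = cross (axis i 1) (axis j 1) $ k"

lemma cross_bil: "cross u v $ k = bil (cross_form k) u v"
proof -
  have "\<forall>k. cross u v $ k = bil (cross_form k) u v"
    unfolding forall_7 by (simp add: bil_def sum_7 cross_form_def cross_def axis_def algebra_simps)
  then show ?thesis by blast
qed

lemma cross_chain:
  assumes c: "\<And>i. harmonic_tensor (c i)" and abj: "a \<le> 6" "b \<le> 6" "j \<le> 6"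
    and eq: "\<And>q. q \<in> S3 \<Longrightarrow> cross (H c a q) (H c b q) = \<kappa> *s H c j q" and q: "q \<in> S3"
  shows "(6 - of_nat a) *s cross (H c (a + 1) q) (H c b q) + (6 - of_nat b) *s cross (H c a q) (H c (b + 1) q)
      = (\<kappa> * (6 - of_nat j)) *s H c (j + 1) q"
    "of_nat a *s cross (H c (a - 1) q) (H c b q) + of_nat b *s cross (H c a q) (H c (b - 1) q)
      = (\<kappa> * of_nat j) *s H c (j - 1) q"
proof -
  have "bil (cross_form k) (H c a q) (H c b q) = \<kappa> * G (c k) j q" if "q \<in> S3" for k q
    using eq [OF that] by (simp add: cross_bil [symmetric])
  note * = bil_chain [OF c abj(1,2) this has_updn_cmult [OF has_updn_G [OF c q abj(3)]] q]
  show "(6 - of_nat a) *s cross (H c (a + 1) q) (H c b q) + (6 - of_nat b) *s cross (H c a q) (H c (b + 1) q)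
      = (\<kappa> * (6 - of_nat j)) *s H c (j + 1) q"
    unfolding vec_eq_iff using * (1)
    by (simp only: vector_add_component vector_smult_component cross_bil H_nth mult.assoc simp_thms)
  show "of_nat a *s cross (H c (a - 1) q) (H c b q) + of_nat b *s cross (H c a q) (H c (b - 1) q)
      = (\<kappa> * of_nat j) *s H c (j - 1) q"
    unfolding vec_eq_iff using * (2)
    by (simp only: vector_add_component vector_smult_component cross_bil H_nth mult.assoc simp_thms mult_minus_left mult_minus_right minus_minus)
qed

text \<open>\<open>H\<^sub>3\<close> is the point of the surface, so the normalisation says that the surface lies on the unit
  sphere.\<close>

definition boruvka_tensor :: "(7 \<Rightarrow> 3 \<Rightarrow> 3 \<Rightarrow> 3 \<Rightarrow> real) \<Rightarrow> bool" where
  "boruvka_tensor c \<longleftrightarrow> (\<forall>i. harmonic_tensor (c i)) \<and> (\<forall>q\<in>S3. cdot (H c 3 q) (H c 3 q) = 1)"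

text \<open>All inner products of the frame follow from \<open>H\<^sub>3 \<bullet> H\<^sub>3 = 1\<close> by raising and lowering.\<close>

lemma cdot_H:
  assumes c: "boruvka_tensor c" and q: "q \<in> S3"
  shows "cdot (H c 3 q) (H c 3 q) = 1" "cdot (H c 4 q) (H c 2 q) = - 4/3"
    "cdot (H c 5 q) (H c 1 q) = 10/3" "cdot (H c 6 q) (H c 0 q) = - 20"
    "a \<le> 6 \<Longrightarrow> b \<le> 6 \<Longrightarrow> a + b \<noteq> 6 \<Longrightarrow> cdot (H c a q) (H c b q) = 0"
proof -
  define d where "d = (\<lambda>a b q. cdot (H c a q) (H c b q))"
  have h: "harmonic_tensor (c i)" for i using c by (simp add: boruvka_tensor_def)
  have sym: "d a b q = d b a q" for a b q by (simp add: d_def cdot_commute)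
  have U: "(6 - of_nat a) * d (a + 1) b q + (6 - of_nat b) * d a (b + 1) q = 0"
    and D: "of_nat a * d (a - 1) b q + of_nat b * d a (b - 1) q = 0"
    if "a \<le> 6" "b \<le> 6" "\<And>q. q \<in> S3 \<Longrightarrow> d a b q = k" "q \<in> S3" for a b k q
    using bil_chain [OF h that(1,2) that(3) [unfolded d_def cdot_bil] has_updn_const that(4)]
    unfolding d_def cdot_bil by (simp_all only: minus_zero)
  have k33: "d 3 3 q = 1" if "q \<in> S3" for q
    using c that by (simp add: boruvka_tensor_def d_def)
  have k43: "d 4 3 q = 0" if "q \<in> S3" for q
    using U [OF _ _ k33 that]  by (simp add: numeral_2_eq_2 [symmetric] sym [of 3 4])
  have k32: "d 3 2 q = 0" if "q \<in> S3" for q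
    using D [OF _ _ k33 that]  by (simp add: numeral_2_eq_2 [symmetric] sym [of 2 3])
  have k42: "d 4 2 q = (- 4/3)" if "q \<in> S3" for q
    using D [OF _ _ k43 that] k33 [OF that] by (simp add: numeral_2_eq_2 [symmetric] complex_eq_iff)
  have k52: "d 5 2 q = 0" if "q \<in> S3" for q
    using U [OF _ _ k42 that] k43 [OF that] by (simp add: numeral_2_eq_2 [symmetric])
  have k41: "d 4 1 q = 0" if "q \<in> S3" for q
    using D [OF _ _ k42 that] k32 [OF that] by (simp add: numeral_2_eq_2 [symmetric])
  have k51: "d 5 1 q = (10/3)" if "q \<in> S3" for q
    using D [OF _ _ k52 that] k42 [OF that] by (simp add: numeral_2_eq_2 [symmetric] complex_eq_iff)
  have k61: "d 6 1 q = 0" if "q \<in> S3" for q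
    using U [OF _ _ k51 that] k52 [OF that] by (simp add: numeral_2_eq_2 [symmetric])
  have k60: "d 6 0 q = (-20)" if "q \<in> S3" for q
    using D [OF _ _ k61 that] k51 [OF that] by (simp add: numeral_2_eq_2 [symmetric] complex_eq_iff)
  have k62: "d 6 2 q = 0" if "q \<in> S3" for q
    using U [OF _ _ k61 that]  by (simp add: numeral_2_eq_2 [symmetric])
  have k63: "d 6 3 q = 0" if "q \<in> S3" for q
    using U [OF _ _ k62 that]  by (simp add: numeral_2_eq_2 [symmetric])
  have k64: "d 6 4 q = 0" if "q \<in> S3" for q
    using U [OF _ _ k63 that]  by (simp add: numeral_2_eq_2 [symmetric])
  have k65: "d 6 5 q = 0" if "q \<in> S3" for q
    using U [OF _ _ k64 that]  by (simp add: numeral_2_eq_2 [symmetric])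
  have k66: "d 6 6 q = 0" if "q \<in> S3" for q
    using U [OF _ _ k65 that]  by (simp add: numeral_2_eq_2 [symmetric])
  have k53: "d 5 3 q = 0" if "q \<in> S3" for q
    using U [OF _ _ k52 that] k62 [OF that] by (simp add: numeral_2_eq_2 [symmetric])
  have k54: "d 5 4 q = 0" if "q \<in> S3" for q
    using U [OF _ _ k53 that] k63 [OF that] by (simp add: numeral_2_eq_2 [symmetric])
  have k55: "d 5 5 q = 0" if "q \<in> S3" for q
    using U [OF _ _ k54 that] k64 [OF that] by (simp add: numeral_2_eq_2 [symmetric])
  have k44: "d 4 4 q = 0" if "q \<in> S3" for q
    using U [OF _ _ k43 that] k53 [OF that] by (simp add: numeral_2_eq_2 [symmetric])
  have k50: "d 5 0 q = 0" if "q \<in> S3" for q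
    using D [OF _ _ k51 that] k41 [OF that] by (simp add: numeral_2_eq_2 [symmetric])
  have k40: "d 4 0 q = 0" if "q \<in> S3" for q
    using D [OF _ _ k50 that]  by (simp add: numeral_2_eq_2 [symmetric])
  have k30: "d 3 0 q = 0" if "q \<in> S3" for q
    using D [OF _ _ k40 that]  by (simp add: numeral_2_eq_2 [symmetric])
  have k20: "d 2 0 q = 0" if "q \<in> S3" for q
    using D [OF _ _ k30 that]  by (simp add: numeral_2_eq_2 [symmetric])
  have k10: "d 1 0 q = 0" if "q \<in> S3" for q
    using D [OF _ _ k20 that]  by (simp add: numeral_2_eq_2 [symmetric])
  have k00: "d 0 0 q = 0" if "q \<in> S3" for q
    using D [OF _ _ k10 that]  by (simp add: numeral_2_eq_2 [symmetric])
  have k31: "d 3 1 q = 0" if "q \<in> S3" for q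
    using D [OF _ _ k41 that] k40 [OF that] by (simp add: numeral_2_eq_2 [symmetric])
  have k21: "d 2 1 q = 0" if "q \<in> S3" for q
    using D [OF _ _ k31 that] k30 [OF that] by (simp add: numeral_2_eq_2 [symmetric])
  have k11: "d 1 1 q = 0" if "q \<in> S3" for q
    using D [OF _ _ k21 that] k20 [OF that] by (simp add: numeral_2_eq_2 [symmetric])
  have k22: "d 2 2 q = 0" if "q \<in> S3" for q
    using D [OF _ _ k32 that] k31 [OF that] by (simp add: numeral_2_eq_2 [symmetric])
  show "cdot (H c 3 q) (H c 3 q) = 1" "cdot (H c 4 q) (H c 2 q) = - 4/3"
    "cdot (H c 5 q) (H c 1 q) = 10/3" "cdot (H c 6 q) (H c 0 q) = - 20"
    using k33 [OF q] k42 [OF q] k51 [OF q] k60 [OF q] unfolding d_def by simp_all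
  have *: "d a b q = 0" if "a \<in> {0,1,2,3,4,5,6}" "b \<in> {0,1,2,3,4,5,6}" "a + b \<noteq> 6" "b \<le> a" for a b
    using that by (elim insertE emptyE; simp add: k00 [OF q] k10 [OF q] k11 [OF q] k20 [OF q] k21 [OF q] k22 [OF q] k30 [OF q] k31 [OF q] k32 [OF q] k40 [OF q] k41 [OF q] k43 [OF q] k44 [OF q] k50 [OF q] k52 [OF q] k53 [OF q] k54 [OF q] k55 [OF q] k61 [OF q] k62 [OF q] k63 [OF q] k64 [OF q] k65 [OF q] k66 [OF q] del: One_nat_def)
  show "cdot (H c a q) (H c b q) = 0" if "a \<le> 6" "b \<le> 6" "a + b \<noteq> 6"
  proof -
    have "a \<in> {0,1,2,3,4,5,6}" "b \<in> {0,1,2,3,4,5,6}" using that by auto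
    then have "d a b q = 0"
      using * [of a b] * [of b a] that(3) sym [of a b] by (cases "b \<le> a") (auto simp: add.commute)
    then show ?thesis by (simp add: d_def)
  qed
qed

text \<open>The tangent plane at \<open>H\<^sub>3\<close> is spanned by the real and imaginary parts of \<open>H\<^sub>4\<close>, and the condition
  says that \<open>J\<close> multiplies \<open>H\<^sub>4\<close> by \<open>- \<i>\<close>.\<close>

definition hol_tensor :: "(7 \<Rightarrow> 3 \<Rightarrow> 3 \<Rightarrow> 3 \<Rightarrow> real) \<Rightarrow> bool" where
  "hol_tensor c \<longleftrightarrow> boruvka_tensor c \<and> (\<forall>q\<in>S3. cross (H c 3 q) (H c 4 q) = - \<i> *s H c 4 q)"

lemma vec_solve:
  fixes x y z :: "complex^'n"
  assumes "a *s x + b *s y = k *s z" "a \<noteq> 0" "y = m *s z"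
  shows "x = ((k - b * m) / a) *s z"
proof -
  have "x $ i = ((k - b * m) / a) * z $ i" for i
  proof -
    have "a * x $ i + b * (m * z $ i) = k * z $ i"
      using assms(1,3) by (metis vector_add_component vector_smult_component)
    then show ?thesis using assms(2) by (simp add: field_simps)
  qed
  then show ?thesis by (simp add: vec_eq_iff)
qed

text \<open>Raising and lowering \<open>H\<^sub>3 \<times> H\<^sub>4 = - \<i> H\<^sub>4\<close> determines the whole multiplication table.\<close>

lemma cross_H:
  assumes c: "hol_tensor c" and q: "q \<in> S3"
  shows "cross (H c 3 q) (H c 4 q) = (- \<i>) *s H c 4 q"
    "cross (H c 3 q) (H c 5 q) = (- \<i>) *s H c 5 q"
    "cross (H c 3 q) (H c 6 q) = \<i> *s H c 6 q"
    "cross (H c 2 q) (H c 5 q) = 0 *s H c 4 q"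
    "cross (H c 2 q) (H c 6 q) = (4 * \<i>) *s H c 5 q"
    "cross (H c 4 q) (H c 5 q) = (- 2/3 * \<i>) *s H c 6 q"
    "cross (H c 4 q) (H c 6 q) = 0 *s H c 6 q"
    "cross (H c 5 q) (H c 6 q) = 0 *s H c 6 q"
    "cross (H c 1 q) (H c 6 q) = (10 * \<i>) *s H c 4 q"
    "cross (H c 2 q) (H c 4 q) = (- 4/3 * \<i>) *s H c 3 q"
    "cross (H c 1 q) (H c 5 q) = (10/3 * \<i>) *s H c 3 q"
    "cross (H c 0 q) (H c 6 q) = (20 * \<i>) *s H c 3 q"
proof -
  have h: "harmonic_tensor (c i)" for i using c by (simp add: boruvka_tensor_def hol_tensor_def)
  have 34: "cross (H c 3 q) (H c 4 q) = (- \<i>) *s H c 4 q" if "q \<in> S3" for q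
    using c that unfolding hol_tensor_def by blast
  have 35: "cross (H c 3 q) (H c 5 q) = (- \<i>) *s H c 5 q" if q: "q \<in> S3" for q
    using cross_chain(1) [OF h _ _ _ 34 q] vec_solve [of 2 "cross (H c 3 q) (H c 5 q)" 3 "cross (H c 4 q) (H c 4 q)" "- \<i> * 2" "H c 5 q" 0]
    by (simp add: cross_refl)
  have 25: "cross (H c 2 q) (H c 5 q) = 0 *s H c 4 q" if q: "q \<in> S3" for q
    using cross_chain(2) [OF h _ _ _ 35 q] vec_solve [OF _ _ 34 [OF q], of 3 "cross (H c 2 q) (H c 5 q)" 5 "- \<i> * 5"]
    by simp
  have 26: "cross (H c 2 q) (H c 6 q) = (4 * \<i>) *s H c 5 q" if q: "q \<in> S3" for q
    using cross_chain(1) [OF h _ _ _ 25 q] vec_solve [OF _ _ 35 [OF q], of 1 "cross (H c 2 q) (H c 6 q)" 4 0]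
    by (simp add: add.commute numeral_3_eq_3 [symmetric])
  have 36: "cross (H c 3 q) (H c 6 q) = \<i> *s H c 6 q" if q: "q \<in> S3" for q
    using cross_chain(1) [OF h _ _ _ 26 q] vec_solve [of 4 "cross (H c 3 q) (H c 6 q)" 0 "0" "4 * \<i>" "H c 6 q" 0]
    by simp
  have 45: "cross (H c 4 q) (H c 5 q) = (- 2/3 * \<i>) *s H c 6 q" if q: "q \<in> S3" for q
    using cross_chain(1) [OF h _ _ _ 35 q] vec_solve [OF _ _ 36 [OF q], of 3 "cross (H c 4 q) (H c 5 q)" 1 "- \<i>"]
    by simp
  have 46: "cross (H c 4 q) (H c 6 q) = 0 *s H c 6 q" if q: "q \<in> S3" for q
    using cross_chain(1) [OF h _ _ _ 45 q] by (simp add: cross_refl)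
  have 56: "cross (H c 5 q) (H c 6 q) = 0 *s H c 6 q" if q: "q \<in> S3" for q
    using cross_chain(1) [OF h _ _ _ 46 q] by simp
  have 16: "cross (H c 1 q) (H c 6 q) = (10 * \<i>) *s H c 4 q" if q: "q \<in> S3" for q
    using cross_chain(2) [OF h _ _ _ 26 q] vec_solve [OF _ _ 25 [OF q], of 2 "cross (H c 1 q) (H c 6 q)" 6 "4 * \<i> * 5"]
    by simp
  have 24: "cross (H c 2 q) (H c 4 q) = (- 4/3 * \<i>) *s H c 3 q" if q: "q \<in> S3" for q
    using cross_chain(2) [OF h _ _ _ 34 q] vec_solve [of 3 "cross (H c 2 q) (H c 4 q)" 4 "cross (H c 3 q) (H c 3 q)" "- \<i> * 4" "H c 3 q" 0]
    by (simp add: cross_refl)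
  have 15: "cross (H c 1 q) (H c 5 q) = (10/3 * \<i>) *s H c 3 q" if q: "q \<in> S3" for q
    using cross_chain(2) [OF h _ _ _ 25 q] vec_solve [OF _ _ 24 [OF q], of 2 "cross (H c 1 q) (H c 5 q)" 5 0]
    by simp
  have 06: "cross (H c 0 q) (H c 6 q) = (20 * \<i>) *s H c 3 q" if q: "q \<in> S3" for q
    using cross_chain(2) [OF h _ _ _ 16 q] vec_solve [OF _ _ 15 [OF q], of 1 "cross (H c 0 q) (H c 6 q)" 6 "10 * \<i> * 4"]
    by simp
  show "cross (H c 3 q) (H c 4 q) = (- \<i>) *s H c 4 q"
    "cross (H c 3 q) (H c 5 q) = (- \<i>) *s H c 5 q"
    "cross (H c 3 q) (H c 6 q) = \<i> *s H c 6 q"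
    "cross (H c 2 q) (H c 5 q) = 0 *s H c 4 q"
    "cross (H c 2 q) (H c 6 q) = (4 * \<i>) *s H c 5 q"
    "cross (H c 4 q) (H c 5 q) = (- 2/3 * \<i>) *s H c 6 q"
    "cross (H c 4 q) (H c 6 q) = 0 *s H c 6 q"
    "cross (H c 5 q) (H c 6 q) = 0 *s H c 6 q"
    "cross (H c 1 q) (H c 6 q) = (10 * \<i>) *s H c 4 q"
    "cross (H c 2 q) (H c 4 q) = (- 4/3 * \<i>) *s H c 3 q"
    "cross (H c 1 q) (H c 5 q) = (10/3 * \<i>) *s H c 3 q"
    "cross (H c 0 q) (H c 6 q) = (20 * \<i>) *s H c 3 q"
    by (fact 34 [OF q] 35 [OF q] 36 [OF q] 25 [OF q] 26 [OF q] 45 [OF q] 46 [OF q] 56 [OF q] 16 [OF q] 24 [OF q] 15 [OF q] 06 [OF q])+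
qed

section \<open>Harmonic cubic polynomials\<close>

lemma real_polynomial_function_derivative:
  fixes f :: "'a::euclidean_space \<Rightarrow> real"
  assumes "real_polynomial_function f"
  shows "\<exists>f'. (\<forall>v. real_polynomial_function (\<lambda>x. f' x v)) \<and> (\<forall>x. (f has_derivative f' x) (at x))"
  using assms
proof (induction f rule: real_polynomial_function.induct)
  case (linear f)
  then show ?case
    by (intro exI [of _ "\<lambda>x v. f v"]) (auto intro: real_polynomial_function.intros(2) bounded_linear_imp_has_derivative)
next
  case (const c)
  then show ?case
    by (intro exI [of _ "\<lambda>x v. 0"]) (auto intro: real_polynomial_function.intros(2))
next
  case (add f g)
  then obtain f' g' where "\<forall>v. real_polynomial_function (\<lambda>x. f' x v)" "\<forall>x. (f has_derivative f' x) (at x)"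
    "\<forall>v. real_polynomial_function (\<lambda>x. g' x v)" "\<forall>x. (g has_derivative g' x) (at x)" by blast
  then show ?case
    by (intro exI [of _ "\<lambda>x v. f' x v + g' x v"]) (simp add: real_polynomial_function.intros(3) has_derivative_add)
next
  case (mult f g)
  then obtain f' g' where "\<forall>v. real_polynomial_function (\<lambda>x. f' x v)" "\<forall>x. (f has_derivative f' x) (at x)"
    "\<forall>v. real_polynomial_function (\<lambda>x. g' x v)" "\<forall>x. (g has_derivative g' x) (at x)" by blast
  then show ?case
    using mult.hyps
    by (intro exI [of _ "\<lambda>x v. f x * g' x v + f' x v * g x"])
      (simp add: real_polynomial_function.intros(3) real_polynomial_function.intros(4) has_derivative_mult)
qed

lemma partial_polynomial:
  assumes "real_polynomial_function f"
  shows "real_polynomial_function (partial i f)"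
    and "((\<lambda>t. f (t *\<^sub>R x)) has_real_derivative (\<Sum>i\<in>UNIV. x $ i * partial i f (t *\<^sub>R x))) (at t)"
proof -
  obtain f' where f': "\<And>v. real_polynomial_function (\<lambda>x. f' x v)" "\<And>x. (f has_derivative f' x) (at x)"
    using real_polynomial_function_derivative [OF assms] by blast
  have p: "partial i f x = f' x (axis i 1)" for i x
    unfolding partial_def using frechet_derivative_at [OF f'(2)] by metis
  show "real_polynomial_function (partial i f)"
    using f'(1) [of "axis i 1"] by (simp add: p [abs_def])
  have "((\<lambda>t. t *\<^sub>R x) has_derivative (\<lambda>h. h *\<^sub>R x)) (at t)"
    by (intro derivative_eq_intros) auto
  from has_derivative_compose [OF this f'(2)]
  have "((\<lambda>t. f (t *\<^sub>R x)) has_derivative (\<lambda>h. f' (t *\<^sub>R x) (h *\<^sub>R x))) (at t)" .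
  moreover have "f' (t *\<^sub>R x) (h *\<^sub>R x) = (\<Sum>i\<in>UNIV. x $ i * partial i f (t *\<^sub>R x)) * h" for h
  proof -
    have lin: "linear (f' (t *\<^sub>R x))" using f'(2) has_derivative_linear by blast
    have "f' (t *\<^sub>R x) x = f' (t *\<^sub>R x) (\<Sum>i\<in>UNIV. x $ i *\<^sub>R axis i 1)"
      by (simp add: basis_expansion flip: scalar_mult_eq_scaleR)
    then show ?thesis using lin by (simp add: linear_sum linear_scale p sum_distrib_right mult_ac)
  qed
  ultimately show "((\<lambda>t. f (t *\<^sub>R x)) has_real_derivative (\<Sum>i\<in>UNIV. x $ i * partial i f (t *\<^sub>R x))) (at t)"
    by (simp add: has_field_derivative_def)
qed

definition cub :: "(3 \<Rightarrow> 3 \<Rightarrow> 3 \<Rightarrow> real) \<Rightarrow> real^3 \<Rightarrow> real" where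
  "cub c x = (\<Sum>i\<in>UNIV. \<Sum>j\<in>UNIV. \<Sum>k\<in>UNIV. c i j k * (x $ i * x $ j * x $ k))"

text \<open>A homogeneous cubic polynomial is \<open>1/6\<close> of its third derivative at the origin: differentiate
  \<open>f (t x) = t\<^sup>3 f x\<close> three times.\<close>

lemma homogeneous_cubic:
  fixes f :: "real^3 \<Rightarrow> real"
  assumes f: "real_polynomial_function f" and hom: "\<And>c x. f (c *\<^sub>R x) = c ^ 3 * f x"
  obtains d where "\<And>x. f x = (\<Sum>i\<in>UNIV. \<Sum>j\<in>UNIV. \<Sum>k\<in>UNIV. d i j k * (x $ i * x $ j * x $ k))"
proof -
  define d where "d = (\<lambda>i j k. partial k (partial j (partial i f)) 0 / 6)"
  have "f x = (\<Sum>i\<in>UNIV. \<Sum>j\<in>UNIV. \<Sum>k\<in>UNIV. d i j k * (x $ i * x $ j * x $ k))" for x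
  proof -
    note p1 = partial_polynomial [OF f]
    note p2 = partial_polynomial [OF p1(1)]
    note p3 = partial_polynomial [OF p2(1)]
    have e1: "(\<Sum>i\<in>UNIV. x $ i * partial i f (t *\<^sub>R x)) = 3 * t\<^sup>2 * f x" for t
    proof -
      have "((\<lambda>t. t ^ 3 * f x) has_real_derivative 3 * t\<^sup>2 * f x) (at t)"
        by (auto intro!: derivative_eq_intros)
      then show ?thesis using p1(2) [of x t] DERIV_unique unfolding hom by blast
    qed
    have e2: "(\<Sum>i\<in>UNIV. x $ i * (\<Sum>j\<in>UNIV. x $ j * partial j (partial i f) (t *\<^sub>R x))) = 6 * t * f x" for t
    proof -
      have "((\<lambda>t. \<Sum>i\<in>UNIV. x $ i * partial i f (t *\<^sub>R x)) has_real_derivative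
          (\<Sum>i\<in>UNIV. x $ i * (\<Sum>j\<in>UNIV. x $ j * partial j (partial i f) (t *\<^sub>R x)))) (at t)"
        by (rule DERIV_sum, rule DERIV_cmult, rule p2(2))
      moreover have "((\<lambda>t. 3 * t\<^sup>2 * f x) has_real_derivative 6 * t * f x) (at t)"
        by (auto intro!: derivative_eq_intros)
      ultimately show ?thesis unfolding e1 using DERIV_unique by blast
    qed
    have "(\<Sum>i\<in>UNIV. x $ i * (\<Sum>j\<in>UNIV. x $ j * (\<Sum>k\<in>UNIV. x $ k * partial k (partial j (partial i f)) (0 *\<^sub>R x)))) = 6 * f x"
    proof -
      have "((\<lambda>t. \<Sum>i\<in>UNIV. x $ i * (\<Sum>j\<in>UNIV. x $ j * partial j (partial i f) (t *\<^sub>R x))) has_real_derivative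
          (\<Sum>i\<in>UNIV. x $ i * (\<Sum>j\<in>UNIV. x $ j * (\<Sum>k\<in>UNIV. x $ k * partial k (partial j (partial i f)) (0 *\<^sub>R x))))) (at 0)"
        by (rule DERIV_sum, rule DERIV_cmult, rule DERIV_sum, rule DERIV_cmult, rule p3(2))
      moreover have "((\<lambda>t. 6 * t * f x) has_real_derivative 6 * f x) (at 0)"
        by (auto intro!: derivative_eq_intros)
      ultimately show ?thesis unfolding e2 using DERIV_unique by blast
    qed
    then show ?thesis by (simp add: d_def sum_3 algebra_simps)
  qed
  then show thesis by (rule that)
qed

lemma sorted_indices:
  fixes c :: "3 \<Rightarrow> 3 \<Rightarrow> 3 \<Rightarrow> real"
  assumes "\<And>i j k. c i j k = c j i k" "\<And>i j k. c i j k = c i k j"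
  shows "c 1 2 1 = c 1 1 2" "c 1 3 1 = c 1 1 3" "c 1 3 2 = c 1 2 3" "c 2 1 1 = c 1 1 2"
    "c 2 1 2 = c 1 2 2" "c 2 1 3 = c 1 2 3" "c 2 2 1 = c 1 2 2" "c 2 3 1 = c 1 2 3"
    "c 2 3 2 = c 2 2 3" "c 3 1 1 = c 1 1 3" "c 3 1 2 = c 1 2 3" "c 3 1 3 = c 1 3 3"
    "c 3 2 1 = c 1 2 3" "c 3 2 2 = c 2 2 3" "c 3 2 3 = c 2 3 3" "c 3 3 1 = c 1 3 3"
    "c 3 3 2 = c 2 3 3"
  using assms by metis+

lemma has_derivative_cub:
  assumes "\<And>i j k. c i j k = c j i k" "\<And>i j k. c i j k = c i k j"
  shows "(cub c has_derivative (\<lambda>v. \<Sum>i\<in>UNIV. \<Sum>j\<in>UNIV. \<Sum>k\<in>UNIV. c i j k * 3 * (v $ i * x $ j * x $ k))) (at x)"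
proof -
  have "(cub c has_derivative (\<lambda>v. \<Sum>i\<in>UNIV. \<Sum>j\<in>UNIV. \<Sum>k\<in>UNIV. c i j k *
      ((x $ i * x $ j) * v $ k + (x $ i * v $ j + v $ i * x $ j) * x $ k))) (at x)"
    unfolding cub_def [abs_def]
    by (rule has_derivative_sum, rule has_derivative_sum, rule has_derivative_sum, rule has_derivative_mult_right,
        rule has_derivative_mult, rule has_derivative_mult)
      (rule bounded_linear_imp_has_derivative, rule bounded_linear_vec_nth)+
  moreover have "(\<Sum>i\<in>UNIV. \<Sum>j\<in>UNIV. \<Sum>k\<in>UNIV. c i j k *
      ((x $ i * x $ j) * v $ k + (x $ i * v $ j + v $ i * x $ j) * x $ k))
    = (\<Sum>i\<in>UNIV. \<Sum>j\<in>UNIV. \<Sum>k\<in>UNIV. c i j k * 3 * (v $ i * x $ j * x $ k))" for v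
    unfolding sum_3 sorted_indices [of c, OF assms] by (simp add: algebra_simps)
  ultimately show ?thesis by simp
qed

lemma harmonic_cubic_tensor:
  assumes "f \<in> harmonic_cubics"
  shows "\<exists>c. harmonic_tensor c \<and> (\<forall>x. f x = cub c x)"
proof -
  have f: "real_polynomial_function f" "\<And>c x. f (c *\<^sub>R x) = c ^ 3 * f x"
    and lap: "\<And>x. (\<Sum>i\<in>UNIV. partial i (partial i f) x) = 0"
    using assms unfolding harmonic_cubics_def by blast+
  obtain d where d: "\<And>x. f x = (\<Sum>i\<in>UNIV. \<Sum>j\<in>UNIV. \<Sum>k\<in>UNIV. d i j k * (x $ i * x $ j * x $ k))"
    using homogeneous_cubic [OF f] by blast
  define c where "c = (\<lambda>i j k. (d i j k + d i k j + d j i k + d j k i + d k i j + d k j i) / 6)"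
  have fc: "f x = cub c x" for x
    unfolding d cub_def c_def sum_3 by (simp add: field_simps)
  have s: "c i j k = c j i k" "c i j k = c i k j" for i j k
    by (simp_all add: c_def add_ac)
  note D = has_derivative_cub [of c, OF s]
  note sorted = sorted_indices [of c, OF s]
  have p1: "partial l f = (\<lambda>x. \<Sum>j\<in>UNIV. \<Sum>k\<in>UNIV. c l j k * 3 * (x $ j * x $ k))" for l
  proof
    fix x
    have "partial l f x = (\<Sum>i\<in>UNIV. \<Sum>j\<in>UNIV. \<Sum>k\<in>UNIV. c i j k * 3 * (axis l 1 $ i * x $ j * x $ k))"
      unfolding partial_def ext [of f "cub c", OF fc] frechet_derivative_at [OF D, symmetric] ..
    also have "\<dots> = (\<Sum>i\<in>UNIV. if i = l then \<Sum>j\<in>UNIV. \<Sum>k\<in>UNIV. c l j k * 3 * (x $ j * x $ k) else 0)"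
      by (intro sum.cong refl) (auto simp: axis_def)
    finally show "partial l f x = (\<Sum>j\<in>UNIV. \<Sum>k\<in>UNIV. c l j k * 3 * (x $ j * x $ k))" by simp
  qed
  have p2: "partial l (partial l f) x = (\<Sum>k\<in>UNIV. 6 * c l l k * x $ k)" for l x
  proof -
    have "(partial l f has_derivative (\<lambda>v. \<Sum>j\<in>UNIV. \<Sum>k\<in>UNIV. c l j k * 3 * (x $ j * v $ k + v $ j * x $ k))) (at x)"
      unfolding p1
      by (rule has_derivative_sum, rule has_derivative_sum, rule has_derivative_mult_right, rule has_derivative_mult)
        (rule bounded_linear_imp_has_derivative, rule bounded_linear_vec_nth)+
    note d = frechet_derivative_at [OF this, symmetric]
    have "partial l (partial l f) x = (\<Sum>j\<in>UNIV. \<Sum>k\<in>UNIV. c l j k * 3 * (x $ j * axis l 1 $ k + axis l 1 $ j * x $ k))"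
      unfolding partial_def [of l "partial l f"] d ..
    also have "\<dots> = (\<Sum>k\<in>UNIV. 6 * c l l k * x $ k)"
      unfolding sum_3 using exhaust_3 [of l]
      by (elim disjE; hypsubst; simp add: axis_def sorted)
    finally show ?thesis .
  qed
  have "(\<Sum>i\<in>UNIV. c i i k) = 0" for k
  proof -
    have "(\<Sum>i\<in>UNIV. \<Sum>l\<in>UNIV. 6 * c i i l * axis k 1 $ l) = 0"
      using lap [of "axis k 1"] unfolding p2 .
    then have "(\<Sum>i\<in>UNIV. 6 * c i i k) = 0"
      by (simp add: axis_def if_distrib cong: if_cong)
    then show ?thesis by (simp add: sum_distrib_left [symmetric])
  qed
  then have "harmonic_tensor c" unfolding harmonic_tensor_def using s by blast
  then show ?thesis using fc by blast
qed

definition xr :: "complex \<times> complex \<Rightarrow> real^3" where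
  "xr q = (\<chi> i. Re (xv q $ i))"

lemma of_real_xr: "of_real (xr q $ i) = xv q $ i"
proof -
  have "cnj (xv q $ i) = xv q $ i" using cnjv_xv [of q] by (metis cnjv_nth)
  then show ?thesis by (simp add: xr_def complex_eq_iff)
qed

lemma frame_products:
  assumes "q \<in> S3"
  shows "cdot (xv q) (xv q) = 1" "cdot (xv q) (mv q) = 0" "cdot (mv q) (mv q) = 0" "cdot (mv q) (cnjv (mv q)) = 2"
    "cdot (mv q) (xv q) = 0" "cdot (cnjv (mv q)) (mv q) = 2" "cdot (xv q) (cnjv (mv q)) = 0"
    "cdot (cnjv (mv q)) (xv q) = 0" "cdot (cnjv (mv q)) (cnjv (mv q)) = 0"
proof -
  have "(norm (fst q))\<^sup>2 + (norm (snd q))\<^sup>2 = 1"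
    using assms by (simp add: norm_prod_def)
  then have n: "(fst q * cnj (fst q) + snd q * cnj (snd q))\<^sup>2 = 1"
    by (metis complex_norm_square of_real_1 of_real_add power_one)
  have 1: "cdot (xv q) (xv q) = (fst q * cnj (fst q) + snd q * cnj (snd q))\<^sup>2"
    by (simp add: cdot_def sum_3 xv_def power2_eq_square algebra_simps)
  have 2: "cdot (xv q) (mv q) = 0"
    by (simp add: cdot_def sum_3 xv_def mv_def algebra_simps)
  have 3: "cdot (mv q) (mv q) = 0"
    by (simp add: cdot_def sum_3 mv_def algebra_simps)
  have 4: "cdot (mv q) (cnjv (mv q)) = 2 * (fst q * cnj (fst q) + snd q * cnj (snd q))\<^sup>2"
    by (simp add: cdot_def sum_3 mv_def power2_eq_square algebra_simps)
  show "cdot (xv q) (xv q) = 1" "cdot (xv q) (mv q) = 0" "cdot (mv q) (mv q) = 0" "cdot (mv q) (cnjv (mv q)) = 2"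
    "cdot (mv q) (xv q) = 0" "cdot (cnjv (mv q)) (mv q) = 2" "cdot (xv q) (cnjv (mv q)) = 0"
    "cdot (cnjv (mv q)) (xv q) = 0" "cdot (cnjv (mv q)) (cnjv (mv q)) = 0"
    using 1 2 3 4 n cdot_cnjv [of "xv q" "mv q"] cdot_cnjv [of "mv q" "mv q"]
    by (simp_all add: cdot_commute [of "mv q" "xv q"] cdot_commute [of "cnjv (mv q)" "mv q"]
        cdot_commute [of "cnjv (mv q)" "xv q"])
qed

lemma xr_sphere: "q \<in> S3 \<Longrightarrow> xr q \<in> sphere 0 1"
proof -
  assume q: "q \<in> S3"
  have "of_real (xr q \<bullet> xr q) = cdot (xv q) (xv q)"
    by (simp add: inner_vec_def cdot_def of_real_xr)
  then have "xr q \<bullet> xr q = 1" using frame_products(1) [OF q] by (metis of_real_eq_1_iff)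
  then show ?thesis by (simp add: norm_eq_1)
qed

lemma Hopf_surj:
  assumes "x \<in> sphere 0 (1::real)"
  obtains q where "q \<in> S3" "xr q = x"
proof (cases "x $ 3 = -1")
  have "x \<bullet> x = 1" using assms by (simp add: norm_eq_1)
  then have n: "x $ 1 * x $ 1 + x $ 2 * x $ 2 + x $ 3 * x $ 3 = 1"
    by (simp add: inner_vec_def sum_3)
  case True
  then have "x $ 1 * x $ 1 + x $ 2 * x $ 2 = 0" using n by simp
  then have "x $ 1 = 0" "x $ 2 = 0" by (simp_all add: sum_squares_eq_zero_iff)
  then have "xr (0, 1) = x" using True by (simp add: vec_eq_iff forall_3 xr_def xv_def)
  then show thesis using that [of "(0, 1)"] by (simp add: norm_Pair)
next
  have "x \<bullet> x = 1" using assms by (simp add: norm_eq_1)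
  then have n: "x $ 1 * x $ 1 + x $ 2 * x $ 2 + x $ 3 * x $ 3 = 1"
    by (simp add: inner_vec_def sum_3)
  case False
  have "x $ 3 * x $ 3 \<le> 1" using n by (smt (verit) zero_le_square)
  then have "x $ 3 > -1" using False by (smt (verit) mult_less_cancel_left2 mult_minus_left mult_minus_right)
  define r where "r = sqrt ((1 + x $ 3) / 2)"
  have r: "r > 0" "r * r = (1 + x $ 3) / 2" using \<open>x $ 3 > -1\<close> by (simp_all add: r_def)
  define q where "q = (complex_of_real r, Complex (x $ 1 / (2 * r)) (x $ 2 / (2 * r)))"
  have sq: "(x $ 1 / (2 * r))\<^sup>2 + (x $ 2 / (2 * r))\<^sup>2 = (1 - x $ 3) / 2"
  proof -
    have "(x $ 1 / (2 * r))\<^sup>2 + (x $ 2 / (2 * r))\<^sup>2 = (x $ 1 * x $ 1 + x $ 2 * x $ 2) / (4 * (r * r))"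
      by (simp add: power2_eq_square add_divide_distrib mult_ac)
    also have "\<dots> = (1 - x $ 3) * (1 + x $ 3) / (4 * ((1 + x $ 3) / 2))"
    proof -
      have "x $ 1 * x $ 1 + x $ 2 * x $ 2 = (1 - x $ 3) * (1 + x $ 3)"
        using n by (simp add: algebra_simps)
      then show ?thesis by (simp only: r(2))
    qed
    also have "\<dots> = (1 - x $ 3) / 2"
    proof -
      have *: "s * b / (4 * (b / 2)) = s / 2" if "b > 0" for s b :: real
        using that by (simp add: field_simps)
      show ?thesis by (rule *) (use \<open>x $ 3 > -1\<close> in simp)
    qed
    finally show ?thesis .
  qed
  have "(norm q)\<^sup>2 = r * r + ((x $ 1 / (2 * r))\<^sup>2 + (x $ 2 / (2 * r))\<^sup>2)"
    by (simp add: q_def norm_Pair cmod_def power2_eq_square)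
  then have "(norm q)\<^sup>2 = 1" unfolding sq r(2) by (simp add: field_simps)
  then have "q \<in> S3" by (simp add: power2_norm_eq_inner norm_eq_1)
  moreover have "xr q = x"
  proof -
    have "r * r - ((x $ 1 / (2 * r))\<^sup>2 + (x $ 2 / (2 * r))\<^sup>2) = x $ 3"
      unfolding sq r(2) by (simp add: field_simps)
    then show ?thesis using r(1)
      by (simp add: vec_eq_iff forall_3 xr_def xv_def q_def power2_eq_square algebra_simps)
  qed
  ultimately show thesis by (rule that)
qed

definition pt :: "(7 \<Rightarrow> 3 \<Rightarrow> 3 \<Rightarrow> 3 \<Rightarrow> real) \<Rightarrow> complex \<times> complex \<Rightarrow> real^7" where
  "pt c q = (\<chi> i. Re (H c 3 q $ i))"

lemma G_3_cub: "G c 3 q = of_real (cub c (xr q))"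
  by (simp add: G_simps tri_def cub_def of_real_xr)

lemma pt_cub: "pt c q = (\<chi> i. cub (c i) (xr q))"
  by (simp add: pt_def G_3_cub)

text \<open>The coefficients of the seven cubics form the tensor, and \<open>\<Sum>p\<^sub>i\<^sup>2 = 1\<close> on the sphere
  becomes \<open>H\<^sub>3 \<bullet> H\<^sub>3 = 1\<close> because every point of the two-sphere is some \<open>x(q)\<close>.\<close>

lemma boruvka_sphere_tensor:
  assumes "boruvka_sphere S"
  shows "\<exists>c. boruvka_tensor c \<and> S = pt c ` S3"
proof -
  obtain P :: "7 \<Rightarrow> real^3 \<Rightarrow> real" where span: "fun_space.span (range P) = harmonic_cubics"
    and one: "\<forall>x\<in>sphere 0 1. (\<Sum>i\<in>UNIV. (P i x)\<^sup>2) = 1"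
    and S: "S = (\<lambda>x. \<chi> i. P i x) ` sphere 0 1"
    using assms unfolding boruvka_sphere_def by blast
  have "P i \<in> harmonic_cubics" for i
    using span fun_space.span_base [of "P i" "range P"] by blast
  then have "\<exists>c. harmonic_tensor c \<and> (\<forall>x. P i x = cub c x)" for i
    by (rule harmonic_cubic_tensor)
  then obtain c where c: "\<And>i. harmonic_tensor (c i)" "\<And>i x. P i x = cub (c i) x" by metis
  have pt: "pt c q = (\<chi> i. P i (xr q))" for q
    by (simp add: pt_cub c(2))
  have "cdot (H c 3 q) (H c 3 q) = 1" if q: "q \<in> S3" for q
  proof -
    have "cdot (H c 3 q) (H c 3 q) = of_real (\<Sum>i\<in>UNIV. (P i (xr q))\<^sup>2)"
      by (simp add: cdot_def G_3_cub c(2) power2_eq_square)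
    then show ?thesis using bspec [OF one xr_sphere [OF q]] by (simp only: of_real_1)
  qed
  then have "boruvka_tensor c" using c(1) by (simp add: boruvka_tensor_def)
  moreover have "S = pt c ` S3"
  proof
    show "S \<subseteq> pt c ` S3"
    proof
      fix p assume "p \<in> S"
      then obtain x where x: "x \<in> sphere 0 1" "p = (\<chi> i. P i x)" unfolding S by blast
      obtain q where "q \<in> S3" "xr q = x" by (rule Hopf_surj [OF x(1)])
      then show "p \<in> pt c ` S3" using x(2) pt [of q] by (intro image_eqI [of _ _ q]) simp_all
    qed
    show "pt c ` S3 \<subseteq> S"
    proof
      fix p assume "p \<in> pt c ` S3"
      then obtain q where "q \<in> S3" "p = pt c q" by blast
      then show "p \<in> S" unfolding S pt using xr_sphere by blast
    qed
  qed
  ultimately show ?thesis by blast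
qed

section \<open>The left inverse of the parametrisation\<close>

lemma tri_frame:
  assumes c: "harmonic_tensor c" and q: "q \<in> S3"
  shows "tri c (xv q) (xv q) (xv q) = G c 3 q" "tri c (xv q) (xv q) (mv q) = G c 4 q" "tri c (xv q) (xv q) (cnjv (mv q)) = - G c 2 q"
    "tri c (xv q) (mv q) (xv q) = G c 4 q" "tri c (xv q) (mv q) (mv q) = G c 5 q" "tri c (xv q) (mv q) (cnjv (mv q)) = - G c 3 q"
    "tri c (xv q) (cnjv (mv q)) (xv q) = - G c 2 q" "tri c (xv q) (cnjv (mv q)) (mv q) = - G c 3 q" "tri c (xv q) (cnjv (mv q)) (cnjv (mv q)) = G c 1 q"
    "tri c (mv q) (xv q) (xv q) = G c 4 q" "tri c (mv q) (xv q) (mv q) = G c 5 q" "tri c (mv q) (xv q) (cnjv (mv q)) = - G c 3 q"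
    "tri c (mv q) (mv q) (xv q) = G c 5 q" "tri c (mv q) (mv q) (mv q) = G c 6 q" "tri c (mv q) (mv q) (cnjv (mv q)) = - G c 4 q"
    "tri c (mv q) (cnjv (mv q)) (xv q) = - G c 3 q" "tri c (mv q) (cnjv (mv q)) (mv q) = - G c 4 q" "tri c (mv q) (cnjv (mv q)) (cnjv (mv q)) = G c 2 q"
    "tri c (cnjv (mv q)) (xv q) (xv q) = - G c 2 q" "tri c (cnjv (mv q)) (xv q) (mv q) = - G c 3 q" "tri c (cnjv (mv q)) (xv q) (cnjv (mv q)) = G c 1 q"
    "tri c (cnjv (mv q)) (mv q) (xv q) = - G c 3 q" "tri c (cnjv (mv q)) (mv q) (mv q) = - G c 4 q" "tri c (cnjv (mv q)) (mv q) (cnjv (mv q)) = G c 2 q"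
    "tri c (cnjv (mv q)) (cnjv (mv q)) (xv q) = G c 1 q" "tri c (cnjv (mv q)) (cnjv (mv q)) (mv q) = G c 2 q" "tri c (cnjv (mv q)) (cnjv (mv q)) (cnjv (mv q)) = - G c 0 q"
proof -
  note s = tri_swap [OF c]
  let ?x = "xv q" and ?m = "mv q" and ?m' = "cnjv (mv q)"
  have t: "tri c u ?m ?m' = - tri c u ?x ?x" "tri c u ?m' ?m = - tri c u ?x ?x" "tri c ?m u ?m' = - tri c u ?x ?x"
    "tri c ?m' u ?m = - tri c u ?x ?x" "tri c ?m ?m' u = - tri c u ?x ?x" "tri c ?m' ?m u = - tri c u ?x ?x" for u
    using tri_trace [OF c q] s by metis+
  have o: "tri c ?m ?x ?x = tri c ?x ?x ?m" "tri c ?x ?m ?x = tri c ?x ?x ?m" "tri c ?m' ?x ?x = tri c ?x ?x ?m'"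
    "tri c ?x ?m' ?x = tri c ?x ?x ?m'" "tri c ?m ?x ?m = tri c ?x ?m ?m" "tri c ?m ?m ?x = tri c ?x ?m ?m"
    "tri c ?m' ?x ?m' = tri c ?x ?m' ?m'" "tri c ?m' ?m' ?x = tri c ?x ?m' ?m'"
    using s by metis+
  show "tri c (xv q) (xv q) (xv q) = G c 3 q" "tri c (xv q) (xv q) (mv q) = G c 4 q" "tri c (xv q) (xv q) (cnjv (mv q)) = - G c 2 q"
    "tri c (xv q) (mv q) (xv q) = G c 4 q" "tri c (xv q) (mv q) (mv q) = G c 5 q" "tri c (xv q) (mv q) (cnjv (mv q)) = - G c 3 q"
    "tri c (xv q) (cnjv (mv q)) (xv q) = - G c 2 q" "tri c (xv q) (cnjv (mv q)) (mv q) = - G c 3 q" "tri c (xv q) (cnjv (mv q)) (cnjv (mv q)) = G c 1 q"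
    "tri c (mv q) (xv q) (xv q) = G c 4 q" "tri c (mv q) (xv q) (mv q) = G c 5 q" "tri c (mv q) (xv q) (cnjv (mv q)) = - G c 3 q"
    "tri c (mv q) (mv q) (xv q) = G c 5 q" "tri c (mv q) (mv q) (mv q) = G c 6 q" "tri c (mv q) (mv q) (cnjv (mv q)) = - G c 4 q"
    "tri c (mv q) (cnjv (mv q)) (xv q) = - G c 3 q" "tri c (mv q) (cnjv (mv q)) (mv q) = - G c 4 q" "tri c (mv q) (cnjv (mv q)) (cnjv (mv q)) = G c 2 q"
    "tri c (cnjv (mv q)) (xv q) (xv q) = - G c 2 q" "tri c (cnjv (mv q)) (xv q) (mv q) = - G c 3 q" "tri c (cnjv (mv q)) (xv q) (cnjv (mv q)) = G c 1 q"
    "tri c (cnjv (mv q)) (mv q) (xv q) = - G c 3 q" "tri c (cnjv (mv q)) (mv q) (mv q) = - G c 4 q" "tri c (cnjv (mv q)) (mv q) (cnjv (mv q)) = G c 2 q"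
    "tri c (cnjv (mv q)) (cnjv (mv q)) (xv q) = G c 1 q" "tri c (cnjv (mv q)) (cnjv (mv q)) (mv q) = G c 2 q" "tri c (cnjv (mv q)) (cnjv (mv q)) (cnjv (mv q)) = - G c 0 q"
    by (simp_all add: G_simps t o)
qed

lemma frame_expand:
  assumes q: "q \<in> S3"
  shows "u = cdot u (xv q) *s xv q + (cdot u (cnjv (mv q)) / 2) *s mv q + (cdot u (mv q) / 2) *s cnjv (mv q)"
proof -
  have "(cdot u (xv q) *s xv q + (cdot u (cnjv (mv q)) / 2) *s mv q + (cdot u (mv q) / 2) *s cnjv (mv q)) $ i = u $ i" for i
  proof -
    have "(cdot u (xv q) *s xv q + (cdot u (cnjv (mv q)) / 2) *s mv q + (cdot u (mv q) / 2) *s cnjv (mv q)) $ i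
      = (\<Sum>j\<in>UNIV. u $ j * (xv q $ j * xv q $ i + (mv q $ j * cnj (mv q $ i) + cnj (mv q $ j) * mv q $ i) / 2))"
      by (simp add: cdot_def sum_3 field_simps)
    also have "\<dots> = u $ i"
      unfolding frame_complete [OF q] by (simp add: if_distrib cong: if_cong)
    finally show ?thesis .
  qed
  then show ?thesis by (simp add: vec_eq_iff)
qed

lemma frame_linear_eq:
  fixes L L' :: "complex^3 \<Rightarrow> complex"
  assumes q: "q \<in> S3"
    and L: "\<And>u v. L (u + v) = L u + L v" "\<And>k u. L (k *s u) = k * L u"
    and L': "\<And>u v. L' (u + v) = L' u + L' v" "\<And>k u. L' (k *s u) = k * L' u"
    and eq: "L (xv q) = L' (xv q)" "L (mv q) = L' (mv q)" "L (cnjv (mv q)) = L' (cnjv (mv q))"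
  shows "L u = L' u"
  by (subst (1 2) frame_expand [OF q, of u]) (simp add: L L' eq)

lemma tri_add:
  "tri c (u + u') v w = tri c u v w + tri c u' v w" "tri c u (v + v') w = tri c u v w + tri c u v' w"
  "tri c u v (w + w') = tri c u v w + tri c u v w'"
  by (simp_all add: tri_def sum.distrib [symmetric] algebra_simps)

lemma cdot_add: "cdot (u + u') v = cdot u v + cdot u' v" "cdot u (v + v') = cdot u v + cdot u v'"
  by (simp_all add: cdot_def sum.distrib [symmetric] algebra_simps)

lemma cdot_scale: "cdot (k *s u) v = k * cdot u v" "cdot u (k *s v) = k * cdot u v"
  by (simp_all add: cdot_def sum_distrib_left algebra_simps)

lemma cdot_neg: "cdot (- u) v = - cdot u v" "cdot u (- v) = - cdot u v"
  by (simp_all add: cdot_def sum_negf)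

text \<open>The reproducing property of harmonic cubics: pairing with the value at \<open>x\<close> gives the zonal
  harmonic, whose polarisation is the right-hand side.\<close>

lemma reproducing:
  assumes c: "boruvka_tensor c" and q: "q \<in> S3"
  shows "(\<Sum>n\<in>UNIV. G (c n) 3 q * tri (c n) u v w) = (5 * (cdot u (xv q) * cdot v (xv q) * cdot w (xv q))
     - cdot u (xv q) * cdot v w - cdot v (xv q) * cdot u w - cdot w (xv q) * cdot u v) / 2"
proof -
  define F where "F = (\<lambda>u v w. \<Sum>n\<in>UNIV. G (c n) 3 q * tri (c n) u v w)"
  define R where "R = (\<lambda>u v w. (5 * (cdot u (xv q) * cdot v (xv q) * cdot w (xv q))
     - cdot u (xv q) * cdot v w - cdot v (xv q) * cdot u w - cdot w (xv q) * cdot u v) / 2)"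
  have h: "harmonic_tensor (c n)" for n using c by (simp add: boruvka_tensor_def)
  have Fl: "F (u + u') v w = F u v w + F u' v w" "F u (v + v') w = F u v w + F u v' w" "F u v (w + w') = F u v w + F u v w'"
    "F (k *s u) v w = k * F u v w" "F u (k *s v) w = k * F u v w" "F u v (k *s w) = k * F u v w" for u u' v v' w w' k
    by (simp_all add: F_def tri_add tri_scale sum.distrib [symmetric] sum_distrib_left algebra_simps)
  have Rl: "R (u + u') v w = R u v w + R u' v w" "R u (v + v') w = R u v w + R u v' w" "R u v (w + w') = R u v w + R u v w'"
    "R (k *s u) v w = k * R u v w" "R u (k *s v) w = k * R u v w" "R u v (k *s w) = k * R u v w" for u u' v v' w w' k
    by (simp_all add: R_def cdot_add cdot_scale field_simps)
  have d: "(\<Sum>n\<in>UNIV. G (c n) 3 q * G (c n) j q) = (if j = 3 then 1 else 0)" if "j \<le> 6" for j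
    using cdot_H(1) [OF c q] cdot_H(5) [OF c q, of 3 j] that by (auto simp: cdot_def)
  let ?f = "{xv q, mv q, cnjv (mv q)}"
  have 0: "F a b e = R a b e" if "a \<in> ?f" "b \<in> ?f" "e \<in> ?f" for a b e
    using that unfolding F_def R_def
    by (elim insertE emptyE; simp add: tri_frame [OF h q] d sum_negf frame_products [OF q])
  have 1: "F u b e = R u b e" if "b \<in> ?f" "e \<in> ?f" for u b e
    by (rule frame_linear_eq [OF q, of "\<lambda>u. F u b e" "\<lambda>u. R u b e"]) (rule Fl Rl | rule 0, simp, rule that, rule that)+
  have 2: "F u v e = R u v e" if "e \<in> ?f" for u v e
    by (rule frame_linear_eq [OF q, of "\<lambda>v. F u v e" "\<lambda>v. R u v e"]) (rule Fl Rl | rule 1, simp, rule that)+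
  have "F u v w = R u v w"
    by (rule frame_linear_eq [OF q, of "\<lambda>w. F u v w" "\<lambda>w. R u v w"]) (rule Fl Rl | rule 2, simp)+
  then show ?thesis by (simp add: F_def R_def)
qed

definition Tens :: "(7 \<Rightarrow> 3 \<Rightarrow> 3 \<Rightarrow> 3 \<Rightarrow> real) \<Rightarrow> real^7 \<Rightarrow> 3 \<Rightarrow> 3 \<Rightarrow> 3 \<Rightarrow> real" where
  "Tens c p i j k = (\<Sum>n\<in>UNIV. p $ n * c n i j k)"

text \<open>Contracting the tensor of a point with itself recovers \<open>x x\<^sup>T + 1/2\<close>, and a further contraction
  recovers \<open>x\<close>; so a cubic map inverts the parametrisation.\<close>

definition gmap :: "(7 \<Rightarrow> 3 \<Rightarrow> 3 \<Rightarrow> 3 \<Rightarrow> real) \<Rightarrow> real^7 \<Rightarrow> real^3" where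
  "gmap c p = (\<chi> i. \<Sum>j\<in>UNIV. \<Sum>k\<in>UNIV. Tens c p i j k * (\<Sum>l\<in>UNIV. \<Sum>m\<in>UNIV. Tens c p j l m * Tens c p k l m))"

lemma tri_axis: "tri c (axis i 1) (axis j 1) (axis k 1) = of_real (c i j k)"
  using exhaust_3 [of i] exhaust_3 [of j] exhaust_3 [of k]
  by (elim disjE; simp add: tri_def sum_3 axis_def)

lemma Tens_pt:
  assumes c: "boruvka_tensor c" and q: "q \<in> S3"
  shows "Tens c (pt c q) i j k = (5 * (xr q $ i * xr q $ j * xr q $ k)
     - xr q $ i * (if j = k then 1 else 0) - xr q $ j * (if i = k then 1 else 0) - xr q $ k * (if i = j then 1 else 0)) / 2"
proof -
  have "of_real (Tens c (pt c q) i j k) = (\<Sum>n\<in>UNIV. G (c n) 3 q * tri (c n) (axis i 1) (axis j 1) (axis k 1))"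
    by (simp add: Tens_def tri_axis pt_def G_3_cub)
  also have "\<dots> = of_real ((5 * (xr q $ i * xr q $ j * xr q $ k)
     - xr q $ i * (if j = k then 1 else 0) - xr q $ j * (if i = k then 1 else 0) - xr q $ k * (if i = j then 1 else 0)) / 2)"
  proof -
    have *: "cdot (axis i 1) v = v $ i" for i and v :: "complex^3"
      by (simp add: cdot_def axis_def if_distrib if_distribR cong: if_cong)
    show ?thesis
      unfolding reproducing [OF c q] * of_real_xr [symmetric] by (auto simp: axis_def)
  qed
  finally show ?thesis by (simp only: of_real_eq_iff)
qed

lemma gmap_pt:
  assumes c: "boruvka_tensor c" and q: "q \<in> S3"
  shows "gmap c (pt c q) = xr q"
proof -
  define x where "x = xr q"
  define s where "s = x $ 1 * x $ 1 + x $ 2 * x $ 2 + x $ 3 * x $ 3"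
  have s1: "s = 1"
    using xr_sphere [OF q] by (simp add: s_def x_def norm_eq_1 inner_vec_def sum_3)
  define T where "T = (\<lambda>i j k. (5 * (x $ i * x $ j * x $ k)
     - s * (x $ i * (if j = k then 1 else 0) + x $ j * (if i = k then 1 else 0) + x $ k * (if i = j then 1 else 0))) / 2)"
  have Q: "(\<Sum>l\<in>UNIV. \<Sum>m\<in>UNIV. T j l m * T k l m) = s * s * (x $ j * x $ k) + (if j = k then s * s * s / 2 else 0)" for j k
    using exhaust_3 [of j] exhaust_3 [of k]
    by (elim disjE; simp add: sum_3 T_def s_def; simp add: field_simps)
  have R: "(\<Sum>j\<in>UNIV. \<Sum>k\<in>UNIV. T i j k * (s * s * (x $ j * x $ k) + (if j = k then s * s * s / 2 else 0)))
      = s * s * s * s * x $ i" for i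
    using exhaust_3 [of i]
    by (elim disjE; simp add: sum_3 T_def s_def; simp add: field_simps)
  have "Tens c (pt c q) i j k = T i j k" for i j k
    unfolding Tens_pt [OF c q] T_def s1 x_def [symmetric] by (simp add: algebra_simps)
  then show ?thesis
    using R by (simp add: gmap_def Q vec_eq_iff s1 x_def)
qed

section \<open>The tangent spaces\<close>

definition cv :: "real^'n \<Rightarrow> complex^'n" where
  "cv v = (\<chi> i. of_real (v $ i))"

lemma cv_nth [simp]: "cv v $ i = of_real (v $ i)"
  by (simp add: cv_def)

lemma cv_eq_iff: "cv u = cv v \<longleftrightarrow> u = v"
  by (simp add: vec_eq_iff)

lemma cv_add: "cv (u + v) = cv u + cv v" and cv_neg: "cv (- u) = - cv u" and cv_diff: "cv (u - v) = cv u - cv v"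
  and cv_scaleR: "cv (r *\<^sub>R u) = of_real r *s cv u" and cv_zero: "cv 0 = 0"
  by (simp_all add: vec_eq_iff)

lemma cdot_cv: "cdot (cv u) (cv v) = of_real (u \<bullet> v)"
  by (simp add: cdot_def inner_vec_def)

lemma cross_cv: "cross (cv u) (cv v) = cv (cross u v)"
  by (simp add: vec_eq_iff forall_7 cross_def)

lemma cnjv_cv [simp]: "cnjv (cv u) = cv u"
  by (simp add: vec_eq_iff)

lemma cv_pt: "cv (pt c q) = H c 3 q"
  by (simp add: vec_eq_iff pt_def G_3_cub)

definition RH :: "(7 \<Rightarrow> 3 \<Rightarrow> 3 \<Rightarrow> 3 \<Rightarrow> real) \<Rightarrow> nat \<Rightarrow> complex \<Rightarrow> complex \<times> complex \<Rightarrow> real^7" where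
  "RH c j \<zeta> q = (\<chi> i. Re (\<zeta> * H c j q $ i))"

lemma cv_RH: "cv (RH c j \<zeta> q) = (\<zeta> / 2) *s H c j q + (cnj \<zeta> / 2) *s cnjv (H c j q)"
  by (simp add: vec_eq_iff RH_def complex_eq_iff field_simps)

lemma RH_add: "RH c j (\<zeta> + \<eta>) q = RH c j \<zeta> q + RH c j \<eta> q"
  and RH_scaleR: "RH c j (of_real r * \<zeta>) q = r *\<^sub>R RH c j \<zeta> q"
  by (simp_all add: vec_eq_iff RH_def algebra_simps)

lemma smooth_on_vec:
  fixes f :: "'a::euclidean_space \<Rightarrow> real^'n"
  assumes U: "open U" and f: "\<And>i. smooth_on U (\<lambda>x. f x $ i)"
  shows "smooth_on U f"
proof (rule smooth_on_cong [OF U])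
  show "smooth_on U (\<lambda>x. \<Sum>i\<in>UNIV. f x $ i *\<^sub>R axis i 1)"
    by (rule smooth_on_sum [OF U], rule smooth_on_scaleR [OF U f smooth_on_const [OF U]])
  show "(\<Sum>i\<in>UNIV. f x $ i *\<^sub>R axis i 1) = f x" for x
    by (simp add: basis_expansion flip: scalar_mult_eq_scaleR)
qed

lemma smooth_on_cnj: "open U \<Longrightarrow> smooth_on U f \<Longrightarrow> smooth_on U (\<lambda>x. cnj (f x))"
  and smooth_on_Re: "open U \<Longrightarrow> smooth_on U f \<Longrightarrow> smooth_on U (\<lambda>x. Re (f x))"
  by (rule smooth_on_bounded_linear [OF bounded_linear_cnj] smooth_on_bounded_linear [OF bounded_linear_Re], assumption+)+

lemma smooth_on_coordinates:
  "smooth_on UNIV (\<lambda>q :: complex \<times> complex. fst q)" "smooth_on UNIV (\<lambda>q :: complex \<times> complex. snd q)"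
  by (rule smooth_on_linear [OF _ open_UNIV], simp add: linear_fst linear_snd)+

lemmas smooth_on_intros_UNIV =
  smooth_on_coordinates smooth_on_add [OF open_UNIV] smooth_on_mult [OF open_UNIV] smooth_on_const [OF open_UNIV]
  smooth_on_sum [OF open_UNIV]

lemma smooth_on_xv: "smooth_on UNIV (\<lambda>q. xv q $ i)" and smooth_on_mv: "smooth_on UNIV (\<lambda>q. mv q $ i)"
proof -
  note z = smooth_on_coordinates and z' = smooth_on_cnj [OF open_UNIV smooth_on_coordinates(1)] smooth_on_cnj [OF open_UNIV smooth_on_coordinates(2)]
  have "smooth_on UNIV (\<lambda>q. xv q $ 1)" "smooth_on UNIV (\<lambda>q. xv q $ 2)" "smooth_on UNIV (\<lambda>q. xv q $ 3)"
    "smooth_on UNIV (\<lambda>q. mv q $ 1)" "smooth_on UNIV (\<lambda>q. mv q $ 2)" "smooth_on UNIV (\<lambda>q. mv q $ 3)"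
    unfolding xv_def mv_def vector_3 by (intro smooth_on_intros_UNIV z')+
  then show "smooth_on UNIV (\<lambda>q. xv q $ i)" "smooth_on UNIV (\<lambda>q. mv q $ i)"
    using exhaust_3 [of i] by auto
qed

lemma smooth_on_G: "smooth_on UNIV (G c j)" if "j \<le> 6"
proof -
  have m': "smooth_on UNIV (\<lambda>q. cnjv (mv q) $ i)" for i
    unfolding cnjv_nth by (rule smooth_on_cnj [OF open_UNIV smooth_on_mv])
  have t: "smooth_on UNIV (\<lambda>q. tri c (u q) (v q) (w q))"
    if "\<And>i. smooth_on UNIV (\<lambda>q. u q $ i)" "\<And>i. smooth_on UNIV (\<lambda>q. v q $ i)" "\<And>i. smooth_on UNIV (\<lambda>q. w q $ i)" for u v w
    unfolding tri_def by (intro smooth_on_intros_UNIV that)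
  have n: "smooth_on UNIV (\<lambda>q. - f q)" if "smooth_on UNIV f" for f :: "complex \<times> complex \<Rightarrow> complex"
    using smooth_on_bounded_linear [OF bounded_linear_minus [OF bounded_linear_ident] open_UNIV that] .
  note f = smooth_on_xv smooth_on_mv m'
  have "smooth_on UNIV (G c 0)" "smooth_on UNIV (G c 1)" "smooth_on UNIV (G c 2)" "smooth_on UNIV (G c 3)"
    "smooth_on UNIV (G c 4)" "smooth_on UNIV (G c 5)" "smooth_on UNIV (G c 6)"
    unfolding G_simps [abs_def] by (rule n t f)+
  moreover have "j \<in> {0,1,2,3,4,5,6}" using that by auto
  ultimately show ?thesis by (elim insertE emptyE) (simp_all only:)
qed

lemma smooth_on_pt: "smooth_on UNIV (pt c)"
proof (rule smooth_on_vec [OF open_UNIV])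
  show "smooth_on UNIV (\<lambda>q. pt c q $ i)" for i
    using smooth_on_Re [OF open_UNIV smooth_on_G [of 3 "c i"]] by (simp add: pt_def)
qed

lemma smooth_on_Tens: "smooth_on UNIV (\<lambda>p. Tens c p i j k)"
  by (rule smooth_on_linear [OF _ open_UNIV])
    (simp add: Tens_def linear_iff sum.distrib [symmetric] sum_distrib_left algebra_simps)

lemma smooth_on_gmap: "smooth_on UNIV (gmap c)"
proof (rule smooth_on_vec [OF open_UNIV])
  show "smooth_on UNIV (\<lambda>p. gmap c p $ i)" for i
    unfolding gmap_def vec_lambda_beta
    by (intro smooth_on_sum [OF open_UNIV] smooth_on_mult [OF open_UNIV] smooth_on_Tens)
qed

text \<open>A curve on the surface, differentiable at one point, is differentiable there in the parameter
  \<open>x\<close> too, because of the left inverse.\<close>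

lemma curve_velocity:
  assumes c: "boruvka_tensor c" and q: "q \<in> S3" and e: "0 < e"
    and \<gamma>: "\<And>t. \<bar>t\<bar> < e \<Longrightarrow> \<gamma> t \<in> pt c ` S3" "\<gamma> 0 = pt c q" "(\<gamma> has_vector_derivative v) (at 0)"
  obtains \<zeta> where "v = RH c 4 \<zeta> q"
proof -
  have h: "harmonic_tensor (c i)" for i using c by (simp add: boruvka_tensor_def)
  define y where "y = (\<lambda>t. gmap c (\<gamma> t))"
  have y0: "y 0 = xr q" using \<gamma>(2) gmap_pt [OF c q] by (simp add: y_def)
  let ?D = "frechet_derivative (gmap c) (at (\<gamma> 0))"
  have Dg: "(gmap c has_derivative ?D) (at (\<gamma> 0))"
    by (rule smooth_on_has_derivative [OF open_UNIV smooth_on_gmap UNIV_I])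
  define y' where "y' = ?D v"
  have "(y has_derivative (\<lambda>h. ?D (h *\<^sub>R v))) (at 0)"
    unfolding y_def by (rule has_derivative_compose [OF \<gamma>(3) [unfolded has_vector_derivative_def] Dg])
  then have Dy: "(y has_derivative (\<lambda>h. h *\<^sub>R y')) (at 0)"
    using has_derivative_linear [OF Dg] by (simp add: linear_scale y'_def)
  have near: "y t \<bullet> y t = 1 \<and> \<gamma> t $ i = cub (c i) (y t)" if "t \<in> {-e<..<e}" for t i
  proof -
    have "\<gamma> t \<in> pt c ` S3" using \<gamma>(1) that by auto
    then obtain p where p: "p \<in> S3" "\<gamma> t = pt c p" by blast
    then have "y t = xr p" by (simp add: y_def gmap_pt [OF c])
    then show ?thesis using xr_sphere [OF p(1)] p(2) by (simp add: norm_eq_1 pt_cub)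
  qed
  have I: "open {-e<..<e}" "0 \<in> {-e<..<e}" using e by auto
  have "((\<lambda>t. y t \<bullet> y t) has_derivative (\<lambda>h. y 0 \<bullet> (h *\<^sub>R y') + (h *\<^sub>R y') \<bullet> y 0)) (at 0)"
    by (rule has_derivative_inner [OF Dy Dy])
  then have "((\<lambda>t. 1::real) has_derivative (\<lambda>h. y 0 \<bullet> (h *\<^sub>R y') + (h *\<^sub>R y') \<bullet> y 0)) (at 0)"
    by (rule has_derivative_transform_within_open [OF _ I]) (use near in blast)
  from has_derivative_unique [OF this has_derivative_const]
  have "y 0 \<bullet> (1 *\<^sub>R y') + (1 *\<^sub>R y') \<bullet> y 0 = 0" by (rule fun_cong)
  then have orth: "y' \<bullet> xr q = 0" by (simp add: y0 inner_commute)
  define \<kappa> where "\<kappa> = cdot (cv y') (cnjv (mv q))"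
  have cx: "cv (xr q) = xv q" by (simp add: vec_eq_iff of_real_xr)
  have \<kappa>': "cdot (cv y') (mv q) = cnj \<kappa>"
    by (simp add: \<kappa>_def cdot_cnjv)
  have ex: "cv y' = (\<kappa> / 2) *s mv q + (cnj \<kappa> / 2) *s cnjv (mv q)"
    using frame_expand [OF q, of "cv y'"] orth cdot_cv [of y' "xr q"] by (simp add: \<kappa>' \<kappa>_def cx)
  have "v $ i = Re ((3 * \<kappa>) * G (c i) 4 q)" for i
  proof -
    have s: "c i a b k = c i b a k" "c i a b k = c i a k b" for a b k
      using h [of i] unfolding harmonic_tensor_def by blast+
    let ?E = "\<lambda>w. \<Sum>a\<in>UNIV. \<Sum>b\<in>UNIV. \<Sum>k\<in>UNIV. c i a b k * 3 * (w $ a * xr q $ b * xr q $ k)"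
    have "((\<lambda>t. cub (c i) (y t)) has_derivative (\<lambda>h. ?E (h *\<^sub>R y'))) (at 0)"
      by (rule has_derivative_compose [OF Dy]) (unfold y0, rule has_derivative_cub [of "c i", OF s])
    then have 1: "((\<lambda>t. \<gamma> t $ i) has_derivative (\<lambda>h. ?E (h *\<^sub>R y'))) (at 0)"
      by (rule has_derivative_transform_within_open [OF _ I]) (use near in simp)
    have 2: "((\<lambda>t. \<gamma> t $ i) has_derivative (\<lambda>h. (h *\<^sub>R v) $ i)) (at 0)"
      by (rule bounded_linear.has_derivative [OF bounded_linear_vec_nth \<gamma>(3) [unfolded has_vector_derivative_def]])
    have "(1 *\<^sub>R v) $ i = ?E (1 *\<^sub>R y')"
      using has_derivative_unique [OF 2 1] by (rule fun_cong)
    then have "of_real (v $ i) = 3 * tri (c i) (cv y') (xv q) (xv q)"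
      by (simp add: tri_def cx [symmetric] sum_distrib_left mult_ac)
    also have "\<dots> = (3 * \<kappa> / 2) * G (c i) 4 q + cnj ((3 * \<kappa> / 2) * G (c i) 4 q)"
      unfolding ex tri_add tri_scale tri_frame [OF h q] by (simp add: cnj_G algebra_simps)
    finally have "Re (of_real (v $ i)) = Re ((3 * \<kappa> / 2) * G (c i) 4 q + cnj ((3 * \<kappa> / 2) * G (c i) 4 q))"
      by simp
    then show ?thesis by simp
  qed
  then have "v = RH c 4 (3 * \<kappa>) q" by (simp add: vec_eq_iff RH_def)
  then show thesis by (rule that)
qed

text \<open>The horizontal unit direction at angle \<open>\<alpha>\<close>.\<close>

definition tilt :: "real \<Rightarrow> complex \<times> complex \<Rightarrow> complex \<times> complex" where
  "tilt \<alpha> q = cos \<alpha> *\<^sub>R I1 q + sin \<alpha> *\<^sub>R I2 q"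

lemma unit_field_tilt: "unit_field (tilt \<alpha>)"
proof -
  note 1 = unit_fieldD [OF unit_field_I(1)] and 2 = unit_fieldD [OF unit_field_I(2)] and 3 = unit_fieldD [OF unit_field_I(3)]
  have lin: "linear (tilt \<alpha>)"
    unfolding tilt_def [abs_def]
    by (intro linear_compose_add linear_compose_scale_right 1(1) 2(1))
  have orth: "I1 q \<bullet> I2 q = 0" "I2 q \<bullet> I1 q = 0" for q
    using 3(3) [of "I1 q"] by (simp_all add: I_mult inner_commute)
  have sq: "tilt \<alpha> (tilt \<alpha> q) = - q" for q
  proof -
    have "tilt \<alpha> (tilt \<alpha> q) = (- (cos \<alpha> * cos \<alpha> + sin \<alpha> * sin \<alpha>)) *\<^sub>R q"
      unfolding tilt_def linear_add [OF 1(1)] linear_add [OF 2(1)] linear_scale [OF 1(1)] linear_scale [OF 2(1)] 1(2) 2(2) I_mult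
      by (simp add: algebra_simps) (simp flip: scaleR_left_distrib)
    then show ?thesis using sin_cos_squared_add3 [of \<alpha>] by simp
  qed
  have "norm (tilt \<alpha> q) = norm q" for q
  proof -
    have "tilt \<alpha> q \<bullet> tilt \<alpha> q = (cos \<alpha> * cos \<alpha> + sin \<alpha> * sin \<alpha>) * (q \<bullet> q)"
      by (simp add: tilt_def inner_add_left inner_add_right orth 1 2 algebra_simps)
        (simp flip: distrib_right mult.assoc)
    then show ?thesis using sin_cos_squared_add3 [of \<alpha>] by (simp add: norm_eq)
  qed
  moreover have "q \<bullet> tilt \<alpha> q = 0" for q
    by (simp add: tilt_def inner_add_right 1 2)
  ultimately show ?thesis using lin sq unfolding unit_field_def by blast
qed

lemma pt_derivative_I:
  assumes c: "boruvka_tensor c" and q: "q \<in> S3"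
  shows "frechet_derivative (pt c) (at q) (I1 q) = RH c 4 6 q"
    and "frechet_derivative (pt c) (at q) (I2 q) = RH c 4 (- 6 * \<i>) q"
proof -
  have h: "harmonic_tensor (c i)" for i using c by (simp add: boruvka_tensor_def)
  have *: "((\<lambda>t. pt c (flow L t q)) has_vector_derivative frechet_derivative (pt c) (at q) (L q)) (at 0)"
    if "unit_field L" for L
    by (rule has_vector_derivative_ext_flow [OF that _ open_UNIV smooth_on_pt]) (use q in auto)
  have d: "frechet_derivative (pt c) (at q) (L q) $ i = Re d"
    if L: "unit_field L" and "((\<lambda>t. G (c i) 3 (flow L t q)) has_vector_derivative d) (at 0)" for L i d
  proof (rule vector_derivative_unique_at)
    show "((\<lambda>t. pt c (flow L t q) $ i) has_vector_derivative frechet_derivative (pt c) (at q) (L q) $ i) (at 0)"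
      by (rule bounded_linear.has_vector_derivative [OF bounded_linear_vec_nth * [OF L]])
    show "((\<lambda>t. pt c (flow L t q) $ i) has_vector_derivative Re d) (at 0)"
      using bounded_linear.has_vector_derivative [OF bounded_linear_Re that(2)] by (simp add: pt_def)
  qed
  have G3: "has_updn (G (c i) 3) (3 * G (c i) 4 q) (- 3 * G (c i) 2 q) q" for i
    using has_updn_G [OF h q, of 3 i] by (simp add: eval_nat_numeral)
  have G2: "G (c i) 2 q = - cnj (G (c i) 4 q)" for i by (simp add: cnj_G)
  show "frechet_derivative (pt c) (at q) (I1 q) = RH c 4 6 q"
    using d [OF unit_field_I(1) G3 [unfolded has_updn_def, THEN conjunct1]]
    by (simp add: vec_eq_iff RH_def G2)
  show "frechet_derivative (pt c) (at q) (I2 q) = RH c 4 (- 6 * \<i>) q"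
    using d [OF unit_field_I(2) G3 [unfolded has_updn_def, THEN conjunct2]]
    by (simp add: vec_eq_iff RH_def G2)
qed

text \<open>Every tangent vector is realised by a reparametrised integral curve of a \<open>tilt\<close> field.\<close>

definition arc :: "(7 \<Rightarrow> 3 \<Rightarrow> 3 \<Rightarrow> 3 \<Rightarrow> real) \<Rightarrow> complex \<Rightarrow> complex \<times> complex \<Rightarrow> real \<Rightarrow> complex \<times> complex" where
  "arc c \<zeta> q t = flow (tilt (- Arg \<zeta>)) (norm \<zeta> / 6 * t) q"

lemma arc_S3: "q \<in> S3 \<Longrightarrow> arc c \<zeta> q t \<in> S3"
  unfolding arc_def by (rule flow_S3 [OF unit_field_tilt])

lemma arc_0 [simp]: "arc c \<zeta> q 0 = q"
  by (simp add: arc_def)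

lemma has_vector_derivative_pt_arc:
  assumes c: "boruvka_tensor c" and q: "q \<in> S3"
  shows "((\<lambda>t. pt c (arc c \<zeta> q t)) has_vector_derivative RH c 4 \<zeta> q) (at 0)"
proof -
  let ?L = "tilt (- Arg \<zeta>)" and ?D = "frechet_derivative (pt c) (at q)"
  have lin: "linear ?D"
    by (rule has_derivative_linear [OF smooth_on_has_derivative [OF open_UNIV smooth_on_pt UNIV_I]])
  have "((\<lambda>t. pt c (flow ?L t q)) has_vector_derivative ?D (?L q)) (at 0)"
    by (rule has_vector_derivative_ext_flow [OF unit_field_tilt _ open_UNIV smooth_on_pt]) (use q in auto)
  then have 1: "((\<lambda>t. pt c (flow ?L t q)) has_vector_derivative ?D (?L q)) (at (norm \<zeta> / 6 * 0))"
    by simp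
  have "((\<lambda>t. norm \<zeta> / 6 * t) has_vector_derivative norm \<zeta> / 6) (at 0)"
    by (auto intro!: derivative_eq_intros simp: has_vector_derivative_def)
  from vector_diff_chain_at [OF this 1]
  have "((\<lambda>t. pt c (arc c \<zeta> q t)) has_vector_derivative (norm \<zeta> / 6) *\<^sub>R ?D (?L q)) (at 0)"
    by (simp add: o_def arc_def)
  moreover have "(norm \<zeta> / 6) *\<^sub>R ?D (?L q) = RH c 4 \<zeta> q"
  proof -
    have "(norm \<zeta> / 6) *\<^sub>R ?D (?L q) = RH c 4 (of_real (norm \<zeta> / 6) * (of_real (cos (Arg \<zeta>)) * 6 + of_real (- sin (Arg \<zeta>)) * (- 6 * \<i>))) q"
      unfolding tilt_def linear_add [OF lin] linear_scale [OF lin] pt_derivative_I [OF assms] RH_add RH_scaleR by simp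
    also have "of_real (norm \<zeta> / 6) * (of_real (cos (Arg \<zeta>)) * 6 + of_real (- sin (Arg \<zeta>)) * (- 6 * \<i>)) = rcis (norm \<zeta>) (Arg \<zeta>)"
      by (simp add: rcis_def complex_eq_iff)
    finally show ?thesis by (simp add: rcis_cmod_Arg)
  qed
  ultimately show ?thesis by simp
qed

lemma smooth_on_flow: "smooth_on UNIV (\<lambda>t. flow L (r * t) q)"
  unfolding flow_def
  by (intro smooth_on_add [OF open_UNIV] smooth_on_scaleR [OF open_UNIV] smooth_on_sin_cos smooth_on_const [OF open_UNIV])

lemma tangent_space_pt:
  assumes c: "boruvka_tensor c" and q: "q \<in> S3"
  shows "tangent_space (pt c ` S3) (pt c q) = range (\<lambda>\<zeta>. RH c 4 \<zeta> q)"
proof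
  show "tangent_space (pt c ` S3) (pt c q) \<subseteq> range (\<lambda>\<zeta>. RH c 4 \<zeta> q)"
  proof
    fix v assume "v \<in> tangent_space (pt c ` S3) (pt c q)"
    then obtain e \<gamma> where e: "0 < e" "\<gamma> ` {-e<..<e} \<subseteq> pt c ` S3" "\<gamma> 0 = pt c q" "(\<gamma> has_vector_derivative v) (at 0)"
      unfolding tangent_space_def by blast
    have "\<gamma> t \<in> pt c ` S3" if "\<bar>t\<bar> < e" for t
      using e(2) that by (simp add: image_subset_iff abs_less_iff)
    from curve_velocity [OF c q e(1) this e(3,4)] show "v \<in> range (\<lambda>\<zeta>. RH c 4 \<zeta> q)" by blast
  qed
  show "range (\<lambda>\<zeta>. RH c 4 \<zeta> q) \<subseteq> tangent_space (pt c ` S3) (pt c q)"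
  proof
    fix v assume "v \<in> range (\<lambda>\<zeta>. RH c 4 \<zeta> q)"
    then obtain \<zeta> where v: "v = RH c 4 \<zeta> q" by blast
    have "smooth_on UNIV (\<lambda>t. pt c (arc c \<zeta> q t))"
      unfolding arc_def by (rule smooth_on_compose [OF open_UNIV open_UNIV subset_UNIV smooth_on_flow smooth_on_pt])
    then have "smooth_on {-1<..<1} (\<lambda>t. pt c (arc c \<zeta> q t))"
      by (rule smooth_on_subset [rotated 2]) auto
    moreover have "(\<lambda>t. pt c (arc c \<zeta> q t)) ` {-1<..<1} \<subseteq> pt c ` S3"
      using arc_S3 [OF q] by blast
    ultimately show "v \<in> tangent_space (pt c ` S3) (pt c q)"
      unfolding tangent_space_def v using has_vector_derivative_pt_arc [OF c q]
      by (intro CollectI exI [of _ 1] exI [of _ "\<lambda>t. pt c (arc c \<zeta> q t)"]) simp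
  qed
qed

section \<open>The holomorphic frame\<close>

lemma cross_H_conj:
  assumes c: "hol_tensor c" and q: "q \<in> S3"
  shows "cross (H c 3 q) (H c 2 q) = \<i> *s H c 2 q" "cross (H c 3 q) (H c 1 q) = \<i> *s H c 1 q"
    "cross (H c 3 q) (H c 0 q) = (- \<i>) *s H c 0 q"
    "cross (H c 2 q) (H c 1 q) = (2/3 * \<i>) *s H c 0 q" "cross (H c 2 q) (H c 0 q) = 0"
    "cross (H c 4 q) (H c 1 q) = 0" "cross (H c 4 q) (H c 0 q) = (- 4 * \<i>) *s H c 1 q"
    "cross (H c 1 q) (H c 0 q) = 0" "cross (H c 5 q) (H c 0 q) = (- 10 * \<i>) *s H c 2 q"
proof -
  have k: "cross (cnjv u) (cnjv v) = cnj k *s cnjv w" if "cross u v = k *s w" for u v w k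
    using arg_cong [OF that, of cnjv] by (simp add: cnjv_cross [symmetric]) (simp add: vec_eq_iff)
  note * = cross_H [OF assms, THEN k, unfolded cnjv_H cross_neg]
  show "cross (H c 3 q) (H c 2 q) = \<i> *s H c 2 q" "cross (H c 3 q) (H c 1 q) = \<i> *s H c 1 q"
    "cross (H c 3 q) (H c 0 q) = (- \<i>) *s H c 0 q"
    "cross (H c 2 q) (H c 1 q) = (2/3 * \<i>) *s H c 0 q" "cross (H c 2 q) (H c 0 q) = 0"
    "cross (H c 4 q) (H c 1 q) = 0" "cross (H c 4 q) (H c 0 q) = (- 4 * \<i>) *s H c 1 q"
    "cross (H c 1 q) (H c 0 q) = 0" "cross (H c 5 q) (H c 0 q) = (- 10 * \<i>) *s H c 2 q"
    using * by (simp_all add: vec_eq_iff) (metis minus_minus)+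
qed

lemma cdot_diff: "cdot (u - u') v = cdot u v - cdot u' v" "cdot u (v - v') = cdot u v - cdot u v'"
  by (simp_all add: cdot_def sum_subtractf [symmetric] algebra_simps)

lemma bounded_bilinear_cross: "bounded_bilinear (cross :: real^7 \<Rightarrow> real^7 \<Rightarrow> real^7)"
  unfolding bilinear_conv_bounded_bilinear [symmetric] bilinear_def
  by (auto simp: linear_iff cross_add cross_scaleR)

lemma RH_inner:
  assumes c: "boruvka_tensor c" and q: "q \<in> S3"
  shows "pt c q \<bullet> pt c q = 1"
    "pt c q \<bullet> RH c 4 \<zeta> q = 0" "pt c q \<bullet> RH c 5 \<zeta> q = 0" "pt c q \<bullet> RH c 6 \<zeta> q = 0"
    "RH c 4 \<zeta> q \<bullet> pt c q = 0" "RH c 5 \<zeta> q \<bullet> pt c q = 0" "RH c 6 \<zeta> q \<bullet> pt c q = 0"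
    "RH c 4 \<zeta> q \<bullet> RH c 5 \<eta> q = 0" "RH c 4 \<zeta> q \<bullet> RH c 6 \<eta> q = 0" "RH c 5 \<zeta> q \<bullet> RH c 6 \<eta> q = 0"
    "RH c 5 \<zeta> q \<bullet> RH c 4 \<eta> q = 0" "RH c 6 \<zeta> q \<bullet> RH c 4 \<eta> q = 0" "RH c 6 \<zeta> q \<bullet> RH c 5 \<eta> q = 0"
    "RH c 4 \<zeta> q \<bullet> RH c 4 \<eta> q = 2/3 * Re (\<zeta> * cnj \<eta>)" "RH c 5 \<zeta> q \<bullet> RH c 5 \<eta> q = 5/3 * Re (\<zeta> * cnj \<eta>)"
    "RH c 6 \<zeta> q \<bullet> RH c 6 \<eta> q = 10 * Re (\<zeta> * cnj \<eta>)"
proof -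
  have of: "u \<bullet> v = r" if "cdot (cv u) (cv v) = of_real r" for u v :: "real^7" and r
    using that cdot_cv [of u v] by (metis of_real_eq_iff)
  have d: "cdot (H c 2 q) (H c 4 q) = - 4/3" "cdot (H c 1 q) (H c 5 q) = 10/3" "cdot (H c 0 q) (H c 6 q) = - 20"
    using cdot_H(2-4) [OF c q] by (simp_all add: cdot_commute)
  have one: "cdot (H c 1 q) (H c j q) = 0" "cdot (H c j q) (H c 1 q) = 0" if "j \<in> {0, 1, 2, 3, 4, 6}" for j
    using cdot_H(5) [OF c q, of 1 j] cdot_H(5) [OF c q, of j 1] that by auto
  note rules = cv_pt cv_RH cdot_add cdot_diff cdot_scale cnjv_H cdot_neg cdot_H [OF c q] d one
  show "pt c q \<bullet> pt c q = 1"
    "pt c q \<bullet> RH c 4 \<zeta> q = 0" "pt c q \<bullet> RH c 5 \<zeta> q = 0" "pt c q \<bullet> RH c 6 \<zeta> q = 0"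
    "RH c 4 \<zeta> q \<bullet> pt c q = 0" "RH c 5 \<zeta> q \<bullet> pt c q = 0" "RH c 6 \<zeta> q \<bullet> pt c q = 0"
    "RH c 4 \<zeta> q \<bullet> RH c 5 \<eta> q = 0" "RH c 4 \<zeta> q \<bullet> RH c 6 \<eta> q = 0" "RH c 5 \<zeta> q \<bullet> RH c 6 \<eta> q = 0"
    "RH c 5 \<zeta> q \<bullet> RH c 4 \<eta> q = 0" "RH c 6 \<zeta> q \<bullet> RH c 4 \<eta> q = 0" "RH c 6 \<zeta> q \<bullet> RH c 5 \<eta> q = 0"
    by (rule of, simp add: rules del: One_nat_def)+
  show "RH c 4 \<zeta> q \<bullet> RH c 4 \<eta> q = 2/3 * Re (\<zeta> * cnj \<eta>)" "RH c 5 \<zeta> q \<bullet> RH c 5 \<eta> q = 5/3 * Re (\<zeta> * cnj \<eta>)"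
    "RH c 6 \<zeta> q \<bullet> RH c 6 \<eta> q = 10 * Re (\<zeta> * cnj \<eta>)"
    by (rule of, simp add: rules del: One_nat_def, simp add: complex_eq_iff field_simps)+
qed

text \<open>A square matrix with orthonormal rows has orthonormal columns.\<close>

lemma orthonormal_rows_resolution:
  fixes f :: "'n \<Rightarrow> real^'n::finite"
  assumes "\<And>i j. f i \<bullet> f j = (if i = j then 1 else 0)"
  shows "v = (\<Sum>k\<in>UNIV. (v \<bullet> f k) *\<^sub>R f k)"
proof -
  define Q :: "real^'n^'n" where "Q = (\<chi> i. f i)"
  have "Q ** transpose Q = mat 1"
    by (simp add: vec_eq_iff Q_def matrix_matrix_mult_def transpose_def mat_def inner_vec_def [symmetric] assms
        flip: inner_vec_def)
      (use assms in \<open>simp add: inner_vec_def\<close>)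
  then have "transpose Q ** Q = mat 1"
    by (simp add: matrix_left_right_inverse)
  then have "v = transpose Q *v (Q *v v)"
    by (simp add: matrix_vector_mul_assoc)
  also have "\<dots> = (\<Sum>k\<in>UNIV. (v \<bullet> f k) *\<^sub>R f k)"
    by (simp add: vec_eq_iff Q_def matrix_vector_mult_def transpose_def inner_vec_def sum_distrib_left mult_ac)
  finally show ?thesis .
qed

text \<open>The coefficients \<open>3/2\<close>, \<open>3/5\<close> and \<open>1/10\<close> are the inverse squared lengths of the real parts of
  the frame vectors.\<close>

lemma frame_resolution:
  assumes c: "boruvka_tensor c" and q: "q \<in> S3"
  shows "v = (v \<bullet> pt c q) *\<^sub>R pt c q + (3/2) *\<^sub>R RH c 4 (cnj (cdot (cv v) (H c 4 q))) q
     + (3/5) *\<^sub>R RH c 5 (cnj (cdot (cv v) (H c 5 q))) q + (1/10) *\<^sub>R RH c 6 (cnj (cdot (cv v) (H c 6 q))) q"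
proof -
  define f :: "7 \<Rightarrow> real^7" where "f = (\<lambda>k. if k = 1 then pt c q
     else if k = 2 then sqrt (3/2) *\<^sub>R RH c 4 1 q else if k = 3 then sqrt (3/2) *\<^sub>R RH c 4 (- \<i>) q
     else if k = 4 then sqrt (3/5) *\<^sub>R RH c 5 1 q else if k = 5 then sqrt (3/5) *\<^sub>R RH c 5 (- \<i>) q
     else if k = 6 then sqrt (1/10) *\<^sub>R RH c 6 1 q else sqrt (1/10) *\<^sub>R RH c 6 (- \<i>) q)"
  have fs: "f 1 = pt c q" "f 2 = sqrt (3/2) *\<^sub>R RH c 4 1 q" "f 3 = sqrt (3/2) *\<^sub>R RH c 4 (- \<i>) q"
    "f 4 = sqrt (3/5) *\<^sub>R RH c 5 1 q" "f 5 = sqrt (3/5) *\<^sub>R RH c 5 (- \<i>) q"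
    "f 6 = sqrt (1/10) *\<^sub>R RH c 6 1 q" "f 7 = sqrt (1/10) *\<^sub>R RH c 6 (- \<i>) q"
    by (simp_all add: f_def)
  have sq: "sqrt r * (sqrt r * x) = r * x" if "r \<ge> 0" for r x
    using that by (simp flip: mult.assoc)
  have on: "f i \<bullet> f j = (if i = j then 1 else 0)" for i j
    using exhaust_7 [of i] exhaust_7 [of j]
    by (elim disjE; hypsubst; simp only: fs inner_scaleR_left inner_scaleR_right RH_inner [OF assms] sq; simp add: sq)
  have RHdot: "(v \<bullet> RH c j 1 q) *\<^sub>R RH c j 1 q + (v \<bullet> RH c j (- \<i>) q) *\<^sub>R RH c j (- \<i>) q
      = RH c j (cnj (cdot (cv v) (H c j q))) q" for j
  proof -
    have "Re (cdot (cv v) (H c j q)) = v \<bullet> RH c j 1 q" "Im (cdot (cv v) (H c j q)) = v \<bullet> RH c j (- \<i>) q"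
      by (simp_all add: cdot_def inner_vec_def RH_def)
    then show ?thesis by (simp add: vec_eq_iff RH_def)
  qed
  have "v = (\<Sum>k\<in>UNIV. (v \<bullet> f k) *\<^sub>R f k)"
    by (rule orthonormal_rows_resolution [OF on])
  also have "\<dots> = (v \<bullet> pt c q) *\<^sub>R pt c q
     + (3/2) *\<^sub>R ((v \<bullet> RH c 4 1 q) *\<^sub>R RH c 4 1 q + (v \<bullet> RH c 4 (- \<i>) q) *\<^sub>R RH c 4 (- \<i>) q)
     + (3/5) *\<^sub>R ((v \<bullet> RH c 5 1 q) *\<^sub>R RH c 5 1 q + (v \<bullet> RH c 5 (- \<i>) q) *\<^sub>R RH c 5 (- \<i>) q)
     + (1/10) *\<^sub>R ((v \<bullet> RH c 6 1 q) *\<^sub>R RH c 6 1 q + (v \<bullet> RH c 6 (- \<i>) q) *\<^sub>R RH c 6 (- \<i>) q)"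
  proof -
    have "(v \<bullet> (sqrt r *\<^sub>R u)) *\<^sub>R (sqrt r *\<^sub>R u) = r *\<^sub>R ((v \<bullet> u) *\<^sub>R u)" if "r \<ge> 0" for r and u :: "real^7"
    proof -
      have "sqrt r * (v \<bullet> u) * sqrt r = r * (v \<bullet> u)"
        using that by (metis mult.commute mult.left_commute real_sqrt_mult_self abs_of_nonneg)
      then show ?thesis by simp
    qed
    then show ?thesis unfolding sum_7 fs by (simp only: scaleR_add_right) (simp add: add.assoc)
  qed
  finally show ?thesis unfolding RHdot .
qed

lemma smooth_on_RH: "j \<le> 6 \<Longrightarrow> smooth_on UNIV (\<lambda>q. RH c j \<zeta> q)"
proof (rule smooth_on_vec [OF open_UNIV])
  fix i assume "j \<le> 6"
  then have "smooth_on UNIV (\<lambda>q. Re (\<zeta> * G (c i) j q))"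
    by (rule smooth_on_Re [OF open_UNIV smooth_on_mult [OF open_UNIV smooth_on_const [OF open_UNIV] smooth_on_G]])
  then show "smooth_on UNIV (\<lambda>q. RH c j \<zeta> q $ i)" by (simp add: RH_def)
qed

text \<open>Invariance of the tangent planes under \<open>J\<close> forces \<open>J\<close> to act on \<open>H\<^sub>4\<close> as \<open>\<i>\<close> or
  \<open>- \<i>\<close>.  The two cases are exchanged by changing the sign of the tensor, which does not change the
  surface because cubic forms are odd.\<close>

lemma J_holomorphic_hol_tensor:
  assumes c: "boruvka_tensor c" and J: "J_holomorphic_curve (pt c ` S3)"
  shows "\<exists>c'. hol_tensor c' \<and> pt c' ` S3 = pt c ` S3"
proof -
  define f g where "f = (\<lambda>q. RH c 4 1 q)" and "g = (\<lambda>q. RH c 4 (- \<i>) q)"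
  define b where "b = (\<lambda>q. 3/2 * (cross (pt c q) (f q) \<bullet> g q))"
  have ip: "f q \<bullet> f q = 2/3" "g q \<bullet> g q = 2/3" "f q \<bullet> g q = 0" "g q \<bullet> f q = 0" "pt c q \<bullet> f q = 0" "pt c q \<bullet> pt c q = 1"
    if "q \<in> S3" for q
    by (simp_all add: f_def g_def RH_inner [OF c that])
  have RHfg: "RH c 4 \<zeta> q = Re \<zeta> *\<^sub>R f q + (- Im \<zeta>) *\<^sub>R g q" for \<zeta> q
    by (simp add: vec_eq_iff RH_def f_def g_def)
  have key: "cross (pt c q) (f q) = b q *\<^sub>R g q" "cross (pt c q) (g q) = (- b q) *\<^sub>R f q" "b q * b q = 1"
    if q: "q \<in> S3" for q
  proof -
    have T: "cross (pt c q) (RH c 4 \<zeta> q) \<in> range (\<lambda>\<zeta>. RH c 4 \<zeta> q)" for \<zeta>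
    proof -
      have "J (pt c q) ` tangent_space (pt c ` S3) (pt c q) = tangent_space (pt c ` S3) (pt c q)"
        using J q unfolding J_holomorphic_curve_def by blast
      then have "J (pt c q) (RH c 4 \<zeta> q) \<in> range (\<lambda>\<zeta>. RH c 4 \<zeta> q)"
        unfolding tangent_space_pt [OF c q] by blast
      then show ?thesis by (simp add: J_def cross7_eq_cross)
    qed
    have T': "\<exists>r s. cross (pt c q) (RH c 4 \<zeta> q) = r *\<^sub>R f q + s *\<^sub>R g q" for \<zeta>
      using T [of \<zeta>] RHfg by (metis rangeE)
    obtain r s where rs: "cross (pt c q) (f q) = r *\<^sub>R f q + s *\<^sub>R g q"
      using T' [of 1] unfolding f_def by blast
    obtain r' s' where rs': "cross (pt c q) (g q) = r' *\<^sub>R f q + s' *\<^sub>R g q"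
      using T' [of "- \<i>"] unfolding g_def by blast
    have "r = 0" using inner_cross_self(2) [of "pt c q" "f q"] unfolding rs by (simp add: inner_add_left ip [OF q])
    have "s' = 0" using inner_cross_self(2) [of "pt c q" "g q"] unfolding rs' by (simp add: inner_add_left ip [OF q])
    have s: "s = b q" unfolding b_def rs by (simp add: inner_add_left ip [OF q])
    have "cross (pt c q) (g q) \<bullet> f q = - (cross (pt c q) (f q) \<bullet> g q)"
      by (simp add: inner_cross_cyclic cross_skew [of "f q" "g q"])
    then have r': "r' = - b q" unfolding b_def rs' by (simp add: inner_add_left ip [OF q])
    show 1: "cross (pt c q) (f q) = b q *\<^sub>R g q" using rs \<open>r = 0\<close> s by simp
    show 2: "cross (pt c q) (g q) = (- b q) *\<^sub>R f q" using rs' \<open>s' = 0\<close> r' by simp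
    have "cross (pt c q) (cross (pt c q) (f q)) = - f q"
      by (simp add: cross_cross ip [OF q])
    then have "(b q * b q) *\<^sub>R f q = f q" unfolding 1 cross_scaleR 2 by simp
    then have "(b q * b q) * (f q \<bullet> f q) = f q \<bullet> f q" by (metis inner_scaleR_left)
    then show "b q * b q = 1" by (simp add: ip [OF q])
  qed
  have cont: "continuous_on S3 b"
  proof -
    note co = continuous_on_subset [OF smooth_on_continuous subset_UNIV, of _ S3]
    have "continuous_on S3 (\<lambda>q. pt c q)" by (rule co [OF smooth_on_pt])
    moreover have fg: "continuous_on S3 (\<lambda>q. f q)" "continuous_on S3 (\<lambda>q. g q)"
      unfolding f_def g_def by (rule co [OF smooth_on_RH], simp)+
    ultimately have "continuous_on S3 (\<lambda>q. cross (pt c q) (f q))"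
      using bounded_bilinear.continuous_on [OF bounded_bilinear_cross] fg(1) by blast
    from continuous_on_mult_left [OF continuous_on_inner [OF this fg(2)]] show ?thesis
      unfolding b_def .
  qed
  have pm: "b q = 1 \<or> b q = - 1" if "q \<in> S3" for q
    using key(3) [OF that] by (metis square_eq_1_iff)
  have conn: "connected (b ` S3)"
    by (rule connected_continuous_image [OF cont]) (rule connected_sphere, simp)
  have H4: "H c 4 q = cv (f q) + \<i> *s cv (g q)" for q
    by (simp add: vec_eq_iff f_def g_def RH_def complex_eq_iff)
  have cr: "cross (H c 3 q) (H c 4 q) = (- \<i> * of_real (b q)) *s H c 4 q" if q: "q \<in> S3" for q
    unfolding H4 cv_pt [symmetric] cross_add cross_scale cross_cv key(1,2) [OF q] cv_scaleR
    by (simp add: vec_eq_iff algebra_simps)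
  consider "\<forall>q\<in>S3. b q = 1" | "\<forall>q\<in>S3. b q = - 1"
  proof (cases "\<exists>p\<in>S3. b p = 1")
    case True
    then obtain p where p: "p \<in> S3" "b p = 1" by blast
    have "b q = 1" if q: "q \<in> S3" for q
    proof (rule ccontr)
      assume "b q \<noteq> 1"
      then have "b q = - 1" using pm [OF q] by blast
      then have "0 \<in> b ` S3"
        using connectedD_interval [OF conn, of "- 1" 1 0] p q by (metis imageI le_numeral_extra(1) neg_le_0_iff_le zero_le_one)
      then show False using pm by force
    qed
    then show thesis using that by blast
  next
    case False
    then show thesis using that pm by blast
  qed
  then show ?thesis
  proof cases
    case 1
    then have "hol_tensor c" using c cr unfolding hol_tensor_def by simp
    then show ?thesis by blast
  next
    case 2
    \<comment> \<open>The opposite sign is repaired by the antipodal map: \<open>- c\<close> parametrises the same surface.\<close>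
    define c' where "c' = (\<lambda>n i j k. - c n i j k)"
    have t: "tri (c' n) u v w = - tri (c n) u v w" for n u v w
      by (simp add: c'_def tri_def sum_negf)
    have G': "G (c' n) 3 q = - G (c n) 3 q" "G (c' n) 4 q = - G (c n) 4 q" for n q
      by (simp_all add: G_simps t)
    then have H': "H c' 3 q = - H c 3 q" "H c' 4 q = - H c 4 q" for q
      by (simp_all add: vec_eq_iff)
    have "harmonic_tensor (c' n)" for n
    proof -
      have s: "c n i j k = c n j i k" "c n i j k = c n i k j" and z: "(\<Sum>i\<in>UNIV. c n i i k) = 0" for i j k
        using c unfolding boruvka_tensor_def harmonic_tensor_def by blast+
      show ?thesis
        unfolding harmonic_tensor_def c'_def sum_negf z
        by (intro conjI allI) (use s in \<open>metis, metis, simp\<close>)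
    qed
    then have "boruvka_tensor c'"
      using c unfolding boruvka_tensor_def H' cdot_neg by simp
    moreover have "cross (H c' 3 q) (H c' 4 q) = - \<i> *s H c' 4 q" if "q \<in> S3" for q
      unfolding H' cross_neg using cr [OF that] 2 that by (simp add: vec_eq_iff)
    ultimately have "hol_tensor c'" unfolding hol_tensor_def by simp
    moreover have anti: "pt c' q = pt c (I1 q)" for q
    proof -
      have "xv (I1 q) = - 1 *s xv q"
        by (simp add: vec_eq_iff forall_3 xv_def I1_def algebra_simps)
      then have "G (c n) 3 (I1 q) = - G (c n) 3 q" for n
        unfolding G_simps by (simp only: tri_scale) simp
      then show ?thesis by (simp add: vec_eq_iff pt_def G'(1))
    qed
    have "pt c' ` S3 = pt c ` S3"
    proof -
      have "I1 ` S3 = S3"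
      proof
        have in': "I1 q \<in> S3" if "q \<in> S3" for q using that unit_fieldD(5) [OF unit_field_I(1), of q] by simp
        then show "I1 ` S3 \<subseteq> S3" by blast
        show "S3 \<subseteq> I1 ` S3"
        proof
          fix q assume q: "q \<in> S3"
          have "I1 (I1 (I1 (I1 q))) = q" by (simp only: unit_fieldD(2) [OF unit_field_I(1)] minus_minus)
          then show "q \<in> I1 ` S3" using in' [OF in' [OF in' [OF q]]] by (metis imageI)
        qed
      qed
      then show ?thesis using anti by (metis (no_types, lifting) image_cong image_image)
    qed
    ultimately show ?thesis by blast
  qed
qed

section \<open>The Dirac operator in the frame\<close>

lemma inner_RH: "v \<bullet> RH c j \<zeta> q = Re (\<zeta> * cdot (cv v) (H c j q))"
  by (simp add: cdot_def inner_vec_def RH_def sum_distrib_left algebra_simps sum.distrib sum_subtractf)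

lemma normal_space_pt:
  assumes c: "boruvka_tensor c" and q: "q \<in> S3"
  shows "v \<in> normal_space (pt c ` S3) (pt c q) \<longleftrightarrow> pt c q \<bullet> v = 0 \<and> cdot (cv v) (H c 4 q) = 0"
proof -
  have "(\<forall>\<zeta>. v \<bullet> RH c 4 \<zeta> q = 0) \<longleftrightarrow> cdot (cv v) (H c 4 q) = 0"
  proof
    assume *: "\<forall>\<zeta>. v \<bullet> RH c 4 \<zeta> q = 0"
    have "Re (cnj (cdot (cv v) (H c 4 q)) * cdot (cv v) (H c 4 q)) = 0"
      using * unfolding inner_RH by blast
    then show "cdot (cv v) (H c 4 q) = 0"
      by (simp add: complex_eq_iff power2_eq_square [symmetric] sum_power2_eq_zero_iff)
  qed (simp add: inner_RH)
  then show ?thesis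
    unfolding normal_space_def tangent_space_pt [OF c q] TS6_def orthogonal_comp_def orthogonal_def
    by (auto simp: inner_commute)
qed

definition projN :: "(7 \<Rightarrow> 3 \<Rightarrow> 3 \<Rightarrow> 3 \<Rightarrow> real) \<Rightarrow> complex \<times> complex \<Rightarrow> real^7 \<Rightarrow> real^7" where
  "projN c q v = (3/5) *\<^sub>R RH c 5 (cnj (cdot (cv v) (H c 5 q))) q + (1/10) *\<^sub>R RH c 6 (cnj (cdot (cv v) (H c 6 q))) q"

lemma cdot_cv_RH:
  assumes c: "boruvka_tensor c" and q: "q \<in> S3"
  shows "cdot (cv (RH c 5 \<zeta> q)) (H c 4 q) = 0" "cdot (cv (RH c 6 \<zeta> q)) (H c 4 q) = 0"
    "cdot (cv (RH c 5 \<zeta> q)) (H c 5 q) = 5/3 * cnj \<zeta>" "cdot (cv (RH c 6 \<zeta> q)) (H c 5 q) = 0"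
    "cdot (cv (RH c 5 \<zeta> q)) (H c 6 q) = 0" "cdot (cv (RH c 6 \<zeta> q)) (H c 6 q) = 10 * cnj \<zeta>"
proof -
  have d: "cdot (H c 1 q) (H c 5 q) = 10/3" "cdot (H c 0 q) (H c 6 q) = - 20"
    using cdot_H(3,4) [OF c q] by (simp_all add: cdot_commute)
  have one: "cdot (H c 1 q) (H c j q) = 0" if "j \<in> {0, 1, 2, 3, 4, 6}" for j
    using cdot_H(5) [OF c q, of 1 j] that by auto
  note rules = cv_RH cdot_add cdot_diff cdot_scale cnjv_H cdot_neg cdot_H [OF c q] d one
  show "cdot (cv (RH c 5 \<zeta> q)) (H c 4 q) = 0" "cdot (cv (RH c 6 \<zeta> q)) (H c 4 q) = 0"
    "cdot (cv (RH c 5 \<zeta> q)) (H c 5 q) = 5/3 * cnj \<zeta>" "cdot (cv (RH c 6 \<zeta> q)) (H c 5 q) = 0"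
    "cdot (cv (RH c 5 \<zeta> q)) (H c 6 q) = 0" "cdot (cv (RH c 6 \<zeta> q)) (H c 6 q) = 10 * cnj \<zeta>"
    by (simp_all add: rules del: One_nat_def)
qed

lemma orth_proj_normal:
  assumes c: "boruvka_tensor c" and q: "q \<in> S3"
  shows "orth_proj (normal_space (pt c ` S3) (pt c q)) v = projN c q v"
proof (rule orth_proj_eqI)
  note n = normal_space_pt [OF assms]
  have "subspace {v. pt c q \<bullet> v = 0 \<and> cdot (cv v) (H c 4 q) = 0}"
    by (simp add: subspace_def inner_add_right cv_add cv_zero cv_scaleR cdot_add cdot_scale) (simp add: cdot_def)
  moreover have "normal_space (pt c ` S3) (pt c q) = {v. pt c q \<bullet> v = 0 \<and> cdot (cv v) (H c 4 q) = 0}"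
    using n by blast
  ultimately show "subspace (normal_space (pt c ` S3) (pt c q))" by simp
  show "projN c q v \<in> normal_space (pt c ` S3) (pt c q)"
    unfolding n projN_def
    by (simp add: inner_add_right RH_inner [OF assms] cv_add cv_scaleR cdot_add cdot_scale cdot_cv_RH [OF assms])
  have d: "v - projN c q v = (v \<bullet> pt c q) *\<^sub>R pt c q + (3/2) *\<^sub>R RH c 4 (cnj (cdot (cv v) (H c 4 q))) q"
    using frame_resolution [OF assms, of v] unfolding projN_def by (simp add: algebra_simps)
  show "v - projN c q v \<in> (normal_space (pt c ` S3) (pt c q))\<^sup>\<bottom>"
    unfolding d orthogonal_comp_def orthogonal_def
    by (auto simp: n inner_add_right inner_RH inner_commute)
qed

lemma smooth_along_differentiable:
  assumes "smooth_along S f" "p \<in> S"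
  shows "f differentiable (at p within S)"
proof -
  obtain U g where U: "open U" "p \<in> U" "smooth_on U g" "\<forall>q\<in>S \<inter> U. g q = f q"
    using assms unfolding smooth_along_def by blast
  have D: "(g has_derivative frechet_derivative g (at p)) (at p within S)"
    by (rule has_derivative_at_withinI [OF smooth_on_has_derivative [OF U(1,3,2)]])
  obtain e where e: "e > 0" "ball p e \<subseteq> U" using U openE by blast
  have eq: "g x = f x" if "x \<in> S" "dist x p < e" for x
    using U(4) e(2) that by (metis IntI dist_commute mem_ball subsetD)
  have "(f has_derivative frechet_derivative g (at p)) (at p within S)"
    by (rule has_derivative_transform_within [OF D e(1) assms(2) eq])
  then show ?thesis unfolding differentiable_def by blast
qed

lemma derivative_along_arc:
  assumes c: "boruvka_tensor c" and q: "q \<in> S3" and f: "smooth_along (pt c ` S3) f"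
  shows "((\<lambda>t. f (pt c (arc c \<zeta> q t))) has_vector_derivative
    frechet_derivative f (at (pt c q) within pt c ` S3) (RH c 4 \<zeta> q)) (at 0)"
proof (rule frechet_derivative_within_curve [where e = 1])
  show "f differentiable (at (pt c q) within pt c ` S3)"
    using smooth_along_differentiable [OF f] q by blast
  show "(\<lambda>t. pt c (arc c \<zeta> q t)) ` {-1<..<1} \<subseteq> pt c ` S3"
    using arc_S3 [OF q] by blast
qed (simp_all add: has_vector_derivative_pt_arc [OF c q])

lemma pt_S6: "boruvka_tensor c \<Longrightarrow> q \<in> S3 \<Longrightarrow> pt c q \<in> S6"
  using RH_inner(1) by (simp add: norm_eq_1)

lemma normal_sectionsD:
  assumes "\<nu> \<in> normal_sections S"
  shows "smooth_along S \<nu>" "p \<in> S \<Longrightarrow> \<nu> p \<in> normal_space S p" "p \<notin> S \<Longrightarrow> \<nu> p = 0"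
  using assms unfolding normal_sections_def by blast+

text \<open>Since \<open>J\<^sup>2 = - 1\<close>, the correction term of the characteristic connection is
  \<open>- 1/2 J (u \<times> \<nu>)\<close>.\<close>

lemma char_nabla_perp_pt:
  assumes c: "boruvka_tensor c" and q: "q \<in> S3" and \<nu>: "\<nu> \<in> normal_sections (pt c ` S3)"
  shows "char_nabla_perp (pt c ` S3) \<nu> (pt c q) (RH c 4 \<zeta> q)
    = projN c q (frechet_derivative \<nu> (at (pt c q) within pt c ` S3) (RH c 4 \<zeta> q)
        - (1/2) *\<^sub>R cross (pt c q) (cross (RH c 4 \<zeta> q) (\<nu> (pt c q))))"
proof -
  let ?S = "pt c ` S3" and ?p = "pt c q" and ?u = "RH c 4 \<zeta> q"
  let ?X1 = "\<lambda>q. J q (\<nu> q)" and ?X2 = "\<lambda>q. J q (J q (\<nu> q))"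
  define D where "D = frechet_derivative \<nu> (at ?p within ?S) ?u"
  define D1 where "D1 = frechet_derivative ?X1 (at ?p within ?S) ?u"
  define D2 where "D2 = frechet_derivative ?X2 (at ?p within ?S) ?u"
  note sm = normal_sectionsD(1) [OF \<nu>]
  have id: "smooth_along ?S (\<lambda>p. p)" by (rule smooth_along_linear) (simp add: linear_iff)
  have sm1: "smooth_along ?S ?X1"
    unfolding J_def cross7_eq_cross by (rule smooth_along_bilinear [OF bounded_bilinear_cross id sm])
  have sm2: "smooth_along ?S ?X2"
    unfolding J_def [of _ "J _ _"] cross7_eq_cross by (rule smooth_along_bilinear [OF bounded_bilinear_cross id sm1])
  have S6: "?p \<in> S6" by (rule pt_S6 [OF c q])
  have pp: "?p \<bullet> ?p = 1" by (rule RH_inner(1) [OF c q])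
  note along = derivative_along_arc [OF c q, of _ \<zeta>]
  have 0: "((\<lambda>t. \<nu> (pt c (arc c \<zeta> q t))) has_vector_derivative D) (at 0)"
    using along [OF sm] by (simp add: D_def)
  have "((\<lambda>t. cross (pt c (arc c \<zeta> q t)) (\<nu> (pt c (arc c \<zeta> q t)))) has_vector_derivative
      cross ?p D + cross ?u (\<nu> ?p)) (at 0)"
    using bounded_bilinear.has_vector_derivative [OF bounded_bilinear_cross has_vector_derivative_pt_arc [OF c q] 0] by simp
  then have D1: "D1 = cross ?p D + cross ?u (\<nu> ?p)"
    using along [OF sm1] vector_derivative_unique_at unfolding D1_def J_def cross7_eq_cross by blast
  have X2: "?X2 (pt c r) = - \<nu> (pt c r)" if "r \<in> S3" for r
  proof -
    have "pt c r \<bullet> \<nu> (pt c r) = 0"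
      using normal_sectionsD(2) [OF \<nu>] normal_space_pt [OF c that] that by blast
    then show ?thesis by (simp add: J_def cross7_eq_cross cross_cross RH_inner(1) [OF c that])
  qed
  have "((\<lambda>t. ?X2 (pt c (arc c \<zeta> q t))) has_vector_derivative - D) (at 0)"
    unfolding X2 [OF arc_S3 [OF q]] by (rule has_vector_derivative_minus [OF 0])
  then have D2: "D2 = - D"
    using along [OF sm2] vector_derivative_unique_at unfolding D2_def by blast
  have Jp: "J ?p (D1 - (?p \<bullet> D1) *\<^sub>R ?p) = cross ?p (cross ?u (\<nu> ?p)) + ((?p \<bullet> D) *\<^sub>R ?p - D)"
  proof -
    have "cross ?p (D1 - (?p \<bullet> D1) *\<^sub>R ?p) = cross ?p D1 - (?p \<bullet> D1) *\<^sub>R cross ?p ?p"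
      using cross_add(2) [of ?p "D1" "- ((?p \<bullet> D1) *\<^sub>R ?p)"] by (simp add: cross_neg cross_scaleR)
    then show ?thesis
      unfolding J_def cross7_eq_cross by (simp add: cross_refl D1 cross_add cross_cross pp)
  qed
  have "char_nabla ?S \<nu> ?p ?u = D - (1/2) *\<^sub>R cross ?p (cross ?u (\<nu> ?p)) - (?p \<bullet> D) *\<^sub>R ?p"
    unfolding char_nabla_def nabla_J_def nabla_def orth_proj_TS6 [OF S6] D_def [symmetric] D1_def [symmetric]
      D2_def [symmetric] Jp D2
    by (simp add: algebra_simps)
  moreover have "projN c q (v - k *\<^sub>R ?p) = projN c q v" for v k
    unfolding projN_def cv_diff cv_scaleR cdot_diff cdot_scale cv_pt
    using cdot_H(5) [OF c q, of 3 5] cdot_H(5) [OF c q, of 3 6] by simp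
  ultimately show ?thesis
    unfolding char_nabla_perp_def orth_proj_normal [OF c q] D_def by simp
qed

definition comp :: "(7 \<Rightarrow> 3 \<Rightarrow> 3 \<Rightarrow> 3 \<Rightarrow> real) \<Rightarrow> nat \<Rightarrow> (real^7 \<Rightarrow> real^7) \<Rightarrow> complex \<times> complex \<Rightarrow> complex" where
  "comp c j \<nu> q = cdot (cv (\<nu> (pt c q))) (H c j q)"

lemma smooth_along_pt_compose:
  assumes "smooth_along (pt c ` S3) f"
  shows "smooth_along S3 (\<lambda>q. f (pt c q))"
  by (rule smooth_along_compose [OF smooth_on_imp_along [OF open_UNIV subset_UNIV smooth_on_pt] assms subset_refl])

lemma oriented_frame_pt:
  assumes c: "hol_tensor c" and q: "q \<in> S3"
  shows "oriented_frame (pt c ` S3) (pt c q) f1 f2 \<longleftrightarrow>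
    (\<exists>\<zeta>. \<zeta> * cnj \<zeta> = 3/2 \<and> f1 = RH c 4 \<zeta> q \<and> f2 = RH c 4 (- \<i> * \<zeta>) q)"
proof -
  have b: "boruvka_tensor c" using c by (simp add: hol_tensor_def)
  note ip = RH_inner [OF b q] and T = tangent_space_pt [OF b q]
  have J: "J (pt c q) (RH c 4 \<zeta> q) = RH c 4 (- \<i> * \<zeta>) q" for \<zeta>
  proof -
    have "cv (cross (pt c q) (RH c 4 \<zeta> q)) = cv (RH c 4 (- \<i> * \<zeta>) q)"
      unfolding cross_cv [symmetric] cv_RH cv_pt cross_add cross_scale cnjv_H cross_neg cross_H(1) [OF c q] cross_H_conj(1) [OF c q]
      by (simp add: vec_eq_iff mult_ac)
    then show ?thesis by (simp add: J_def cross7_eq_cross cv_eq_iff)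
  qed
  have n1: "norm (RH c 4 \<zeta> q) = 1 \<longleftrightarrow> \<zeta> * cnj \<zeta> = 3/2" for \<zeta>
    unfolding norm_eq_1 ip complex_mult_cnj by (auto simp: complex_eq_iff power2_eq_square)
  show ?thesis
  proof
    assume "oriented_frame (pt c ` S3) (pt c q) f1 f2"
    then obtain \<zeta> \<eta> where f: "f1 = RH c 4 \<zeta> q" "f2 = RH c 4 \<eta> q" and n: "norm f1 = 1" "norm f2 = 1"
      and o: "f1 \<bullet> f2 = 0" "0 < J (pt c q) f1 \<bullet> f2"
      unfolding oriented_frame_def T by blast
    have \<zeta>: "\<zeta> * cnj \<zeta> = 3/2" and \<eta>: "\<eta> * cnj \<eta> = 3/2" using n unfolding f n1 by auto
    define \<kappa> where "\<kappa> = \<zeta> * cnj \<eta>"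
    have \<kappa>: "Re \<kappa> = 0" "Im \<kappa> > 0" using o unfolding f J ip by (simp_all add: \<kappa>_def)
    have "\<kappa> * cnj \<kappa> = (\<zeta> * cnj \<zeta>) * (\<eta> * cnj \<eta>)" by (simp add: \<kappa>_def)
    then have "\<kappa> * cnj \<kappa> = 3/2 * (3/2)" unfolding \<zeta> \<eta> .
    then have "Re (\<kappa> * cnj \<kappa>) = Re (3/2 * (3/2))" by (rule arg_cong)
    then have "(Im \<kappa>)\<^sup>2 = (3/2)\<^sup>2"
      using \<kappa>(1) by (simp add: power2_eq_square)
    then have "Im \<kappa> = 3/2" using \<kappa>(2) by (simp add: power2_eq_iff)
    then have "\<kappa> = 3/2 * \<i>" using \<kappa>(1) by (simp add: complex_eq_iff)
    then have "\<zeta> * (\<eta> * cnj \<eta>) = 3/2 * \<i> * \<eta>" by (simp add: \<kappa>_def mult_ac)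
    then have "\<eta> = - \<i> * \<zeta>" unfolding \<eta> by (simp add: complex_eq_iff)
    then show "\<exists>\<zeta>. \<zeta> * cnj \<zeta> = 3/2 \<and> f1 = RH c 4 \<zeta> q \<and> f2 = RH c 4 (- \<i> * \<zeta>) q"
      using \<zeta> f by blast
  next
    assume "\<exists>\<zeta>. \<zeta> * cnj \<zeta> = 3/2 \<and> f1 = RH c 4 \<zeta> q \<and> f2 = RH c 4 (- \<i> * \<zeta>) q"
    then obtain \<zeta> where \<zeta>: "\<zeta> * cnj \<zeta> = 3/2" and f: "f1 = RH c 4 \<zeta> q" "f2 = RH c 4 (- \<i> * \<zeta>) q" by blast
    have "(- \<i> * \<zeta>) * cnj (- \<i> * \<zeta>) = \<zeta> * cnj \<zeta>" by (simp add: complex_eq_iff)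
    then have "norm f1 = 1" "norm f2 = 1" unfolding f n1 using \<zeta> by simp_all
    moreover have "f1 \<bullet> f2 = 0" unfolding f ip by (simp add: algebra_simps)
    moreover have "J (pt c q) f1 \<bullet> f2 = norm f2 ^ 2" unfolding f J by (simp add: power2_norm_eq_inner)
    ultimately show "oriented_frame (pt c ` S3) (pt c q) f1 f2"
      unfolding oriented_frame_def T f by auto
  qed
qed

definition cprj :: "(7 \<Rightarrow> 3 \<Rightarrow> 3 \<Rightarrow> 3 \<Rightarrow> real) \<Rightarrow> complex \<times> complex \<Rightarrow> complex^7 \<Rightarrow> complex^7" where
  "cprj c q w = (3/10 * cdot w (H c 1 q)) *s H c 5 q + (3/10 * cdot w (H c 5 q)) *s H c 1 q
     - (1/20 * cdot w (H c 0 q)) *s H c 6 q - (1/20 * cdot w (H c 6 q)) *s H c 0 q"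

lemma cv_projN: "cv (projN c q v) = cprj c q (cv v)"
proof -
  have "cnj (cdot (cv v) (H c 5 q)) = cdot (cv v) (H c 1 q)" "cnj (cdot (cv v) (H c 6 q)) = - cdot (cv v) (H c 0 q)"
    "cnj (cdot (cv v) (H c 1 q)) = cdot (cv v) (H c 5 q)" "cnj (cdot (cv v) (H c 0 q)) = - cdot (cv v) (H c 6 q)"
    by (simp_all add: cdot_cnjv cnjv_H cdot_neg del: One_nat_def)
  then show ?thesis
    by (simp add: projN_def cv_add cv_scaleR cv_RH cnjv_H cprj_def vec_eq_iff)
qed

lemma cprj_lin: "cprj c q (k *s v + l *s w) = k *s cprj c q v + l *s cprj c q w"
  by (simp add: cprj_def cdot_add cdot_scale vec_eq_iff algebra_simps)

lemma cnjv_cprj: "cnjv (cprj c q w) = cprj c q (cnjv w)"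
proof -
  have *: "cnj (cdot w (H c j q)) = cdot (cnjv w) (cnjv (H c j q))" for j by (rule cdot_cnjv)
  have c': "cnj (G (c i) 0 q) = - G (c i) 6 q" "cnj (G (c i) 1 q) = G (c i) 5 q" "cnj (G (c i) 5 q) = G (c i) 1 q"
    "cnj (G (c i) 6 q) = - G (c i) 0 q" for i by (rule cnj_G)+
  show ?thesis
    unfolding vec_eq_iff cprj_def
    by (simp add: * cnjv_H cdot_neg c' algebra_simps del: One_nat_def)
qed

lemma derivative_along_flow:
  assumes c: "boruvka_tensor c" and q: "q \<in> S3" and f: "smooth_along (pt c ` S3) f" and L: "unit_field L"
  shows "((\<lambda>t. f (pt c (flow L t q))) has_vector_derivative
    frechet_derivative f (at (pt c q) within pt c ` S3) (frechet_derivative (pt c) (at q) (L q))) (at 0)"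
proof (rule frechet_derivative_within_curve [where e = 1])
  show "f differentiable (at (pt c q) within pt c ` S3)"
    using smooth_along_differentiable [OF f] q by blast
  show "((\<lambda>t. pt c (flow L t q)) has_vector_derivative frechet_derivative (pt c) (at q) (L q)) (at 0)"
    by (rule has_vector_derivative_ext_flow [OF L _ open_UNIV smooth_on_pt]) (use q in auto)
  show "(\<lambda>t. pt c (flow L t q)) ` {-1<..<1} \<subseteq> pt c ` S3"
    using flow_S3 [OF L q] by blast
qed simp_all

lemma normal_resolution:
  assumes c: "boruvka_tensor c" and q: "q \<in> S3" and v: "v \<in> normal_space (pt c ` S3) (pt c q)"
  shows "v = (3/5) *\<^sub>R RH c 5 (cnj (cdot (cv v) (H c 5 q))) q + (1/10) *\<^sub>R RH c 6 (cnj (cdot (cv v) (H c 6 q))) q"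
proof -
  have "v \<bullet> pt c q = 0" "cdot (cv v) (H c 4 q) = 0"
    using v unfolding normal_space_pt [OF c q] by (simp_all add: inner_commute)
  moreover have "RH c 4 0 q = 0" by (simp add: RH_def vec_eq_iff)
  ultimately show ?thesis using frame_resolution [OF c q, of v] by simp
qed

text \<open>The cross products of the tangent frame with the normal frame are known, and the projection to the
  normal space retains from the derivative of \<open>\<nu>\<close> only the raised component \<open>\<nu> \<bullet> H\<^sub>5\<close> and
  the lowered component \<open>\<nu> \<bullet> H\<^sub>6\<close>.\<close>

lemma dirac_pt:
  assumes c: "hol_tensor c" and q: "q \<in> S3" and \<nu>: "\<nu> \<in> normal_sections (pt c ` S3)"
  shows "J (pt c q) (dirac (pt c ` S3) \<nu> (pt c q))
    = (1/10) *\<^sub>R (RH c 6 (cnj (up (comp c 5 \<nu>) q)) q - RH c 5 (cnj (dn (comp c 6 \<nu>) q)) q)"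
proof -
  let ?S = "pt c ` S3" and ?p = "pt c q" and ?a = "comp c 5 \<nu>" and ?b = "comp c 6 \<nu>"
  have bt: "boruvka_tensor c" using c by (simp add: hol_tensor_def)
  have h: "harmonic_tensor (c i)" for i using bt by (simp add: boruvka_tensor_def)
  note sm = normal_sectionsD(1) [OF \<nu>]
  have np: "\<nu> ?p \<in> normal_space ?S ?p" using normal_sectionsD(2) [OF \<nu>] q by blast
  define n where "n = (\<lambda>i r. complex_of_real (\<nu> (pt c r) $ i))"
  have blc: "bounded_linear (\<lambda>v::real^7. complex_of_real (v $ i))" for i
    using bounded_linear_compose [OF bounded_linear_of_real bounded_linear_vec_nth] .
  have sn: "smooth_along S3 (n i)" for i
    unfolding n_def by (rule smooth_along_bounded_linear [OF blc smooth_along_pt_compose [OF sm]])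
  define Nc where "Nc = cv (\<nu> ?p)"
  have Nc: "Nc $ i = n i q" for i by (simp add: Nc_def n_def)
  define dN where "dN = (\<chi> i. dn (n i) q)"
  have up_n: "up (n i) q = cnj (dn (n i) q)" for i
    using dn_cnj [OF sn q, of i] by (simp add: n_def)
  have comp: "has_updn (comp c j \<nu>)
      (\<Sum>i\<in>UNIV. up (n i) q * G (c i) j q + n i q * ((6 - of_nat j) * G (c i) (j + 1) q))
      (\<Sum>i\<in>UNIV. dn (n i) q * G (c i) j q + n i q * (- of_nat j * G (c i) (j - 1) q)) q" if "j \<le> 6" for j
  proof -
    have "comp c j \<nu> = (\<lambda>r. \<Sum>i\<in>UNIV. n i r * G (c i) j r)"
      by (rule ext) (simp add: comp_def cdot_def n_def)
    then show ?thesis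
      by (simp only:) (rule has_updn_sum, rule has_updn_mult [OF has_updn_smooth [OF sn q] has_updn_G [OF h q that]])
  qed
  have pull: "(\<Sum>i\<in>UNIV. n i q * (k * G (c i) j q)) = k * cdot Nc (H c j q)" for k j
    by (simp add: cdot_def Nc sum_distrib_left mult_ac)
  have ud: "up (comp c j \<nu>) q = cdot (cnjv dN) (H c j q) + (6 - of_nat j) * cdot Nc (H c (j + 1) q)"
    "dn (comp c j \<nu>) q = cdot dN (H c j q) - of_nat j * cdot Nc (H c (j - 1) q)" if "j \<le> 6" for j
    unfolding has_updn_imp [OF comp [OF that]] sum.distrib pull
    by (simp_all add: cdot_def dN_def up_n)
  note ud5 = ud [of 5, simplified] and ud6 = ud [of 6, simplified]
  have N4: "cdot Nc (H c 4 q) = 0"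
    using np unfolding normal_space_pt [OF bt q] Nc_def by simp
  have Ncs: "cnjv Nc = Nc" by (simp add: Nc_def)
  have ab: "cdot Nc (H c 5 q) = ?a q" "cdot Nc (H c 6 q) = ?b q"
    by (simp_all add: comp_def Nc_def)
  have dN5: "cdot dN (H c 5 q) = dn ?a q"
    using ud5(2) N4 by simp
  have dN6: "cdot dN (H c 6 q) = dn ?b q + 6 * ?a q"
    using ud6(2) ab(1) by simp
  have "up ?a q = cdot (cnjv dN) (H c 5 q) + cdot Nc (H c 6 q)"
    using ud5(1) by simp
  then have "cnj (up ?a q) = cdot dN (H c 1 q) + cnj (?b q)"
    by (simp add: cdot_cnjv cnjv_H ab del: One_nat_def)
  then have dN1: "cdot dN (H c 1 q) = cnj (up ?a q) - cnj (?b q)" by simp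
  have "up ?b q = cdot (cnjv dN) (H c 6 q)"
    using ud6(1) by simp
  then have "cnj (up ?b q) = - cdot dN (H c 0 q)"
    by (simp add: cdot_cnjv cnjv_H cdot_neg)
  then have dN0: "cdot dN (H c 0 q) = - cnj (up ?b q)" by simp
  have Nexp: "Nc = (3/10 * cnj (?a q)) *s H c 5 q + (3/10 * ?a q) *s H c 1 q
      + (1/20 * cnj (?b q)) *s H c 6 q + (- 1/20 * ?b q) *s H c 0 q"
  proof -
    have "Nc = cv ((3/5) *\<^sub>R RH c 5 (cnj (?a q)) q + (1/10) *\<^sub>R RH c 6 (cnj (?b q)) q)"
      unfolding Nc_def comp_def by (rule arg_cong [OF normal_resolution [OF bt q np]])
    then show ?thesis
      unfolding cv_add cv_scaleR cv_RH cnjv_H by (simp add: vec_eq_iff del: One_nat_def)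
  qed
  define w where "w = (1/6) *s dN + (1/4) *s cross (H c 3 q) (cross (H c 2 q) Nc)"
  have pHN: "cross (H c 3 q) (cross (H c 2 q) Nc) = (1/5 * ?a q) *s H c 0 q + (1/5 * cnj (?b q)) *s H c 5 q"
    unfolding Nexp cross_add cross_scale cross_H [OF c q] cross_H_conj [OF c q] cross_zero
    by (simp add: vec_eq_iff)
  define Y where "Y = cprj c q w"
  have Y: "Y = (1/20 * cnj (up ?a q)) *s H c 5 q + (1/20 * dn ?a q) *s H c 1 q
      + (1/120 * cnj (up ?b q)) *s H c 6 q + (- 1/120 * dn ?b q) *s H c 0 q"
  proof -
    have d: "cdot (H c 0 q) (H c 6 q) = - 20" "cdot (H c 5 q) (H c 1 q) = 10/3"
      using cdot_H(3,4) [OF bt q] by (simp_all add: cdot_commute)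
    have z: "cdot (H c 0 q) (H c 0 q) = 0" "cdot (H c 0 q) (H c 1 q) = 0" "cdot (H c 0 q) (H c 5 q) = 0"
      "cdot (H c 5 q) (H c 5 q) = 0" "cdot (H c 5 q) (H c 0 q) = 0" "cdot (H c 5 q) (H c 6 q) = 0"
      by (rule cdot_H(5) [OF bt q]; simp)+
    have wd: "cdot w (H c 5 q) = 1/6 * dn ?a q" "cdot w (H c 1 q) = 1/6 * (cnj (up ?a q) - cnj (?b q)) + 1/6 * cnj (?b q)"
      "cdot w (H c 6 q) = 1/6 * (dn ?b q + 6 * ?a q) - ?a q" "cdot w (H c 0 q) = - 1/6 * cnj (up ?b q)"
      unfolding w_def pHN cdot_add cdot_scale dN5 dN1 dN6 dN0 d z by simp_all
    show ?thesis
      unfolding Y_def cprj_def wd by (simp add: vec_eq_iff algebra_simps del: One_nat_def)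
  qed
  define D where "D = (\<lambda>\<zeta>. frechet_derivative \<nu> (at ?p within ?S) (RH c 4 \<zeta> q))"
  have linD: "linear (frechet_derivative \<nu> (at ?p within ?S))"
    using smooth_along_differentiable [OF sm, of ?p] q has_derivative_linear frechet_derivative_works by blast
  have Dn: "X L (n i) q = of_real (frechet_derivative \<nu> (at ?p within ?S) (frechet_derivative (pt c) (at q) (L q)) $ i)"
    if "unit_field L" for L i
    unfolding n_def
    by (rule X_eqI) (rule bounded_linear.has_vector_derivative [OF blc derivative_along_flow [OF bt q sm that]])
  have dNi: "dN $ i = 1/2 * of_real (D 6 $ i) + - \<i>/2 * of_real (D (- 6 * \<i>) $ i)" for i
    unfolding dN_def vec_lambda_beta dn_def Dn [OF unit_field_I(1)] Dn [OF unit_field_I(2)] pt_derivative_I [OF bt q] D_def ..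
  have cvD: "cv (D \<zeta>) = (cnj \<zeta> / 6) *s dN + (\<zeta> / 6) *s cnjv dN" for \<zeta>
  proof -
    have "RH c 4 \<zeta> q = (Re \<zeta> / 6) *\<^sub>R RH c 4 6 q + (- Im \<zeta> / 6) *\<^sub>R RH c 4 (- 6 * \<i>) q"
      by (simp add: vec_eq_iff RH_def)
    then have D: "D \<zeta> = (Re \<zeta> / 6) *\<^sub>R D 6 + (- Im \<zeta> / 6) *\<^sub>R D (- 6 * \<i>)"
      unfolding D_def using linD by (simp add: linear_add linear_scale linear_diff)
    show ?thesis
      unfolding D by (simp add: vec_eq_iff dNi complex_eq_iff field_simps)
  qed
  define C where "C = (\<lambda>\<zeta>. char_nabla_perp ?S \<nu> ?p (RH c 4 \<zeta> q))"
  have cvC: "cv (C \<zeta>) = cnj \<zeta> *s Y + \<zeta> *s cnjv Y" for \<zeta>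
  proof -
    have "cv (D \<zeta> - (1/2) *\<^sub>R cross ?p (cross (RH c 4 \<zeta> q) (\<nu> ?p))) = cnj \<zeta> *s w + \<zeta> *s cnjv w"
    proof -
      have cw: "cnjv w = (1/6) *s cnjv dN + (- 1/4) *s cross (H c 3 q) (cross (H c 4 q) Nc)"
      proof -
        have 1: "cnjv (cross (H c 3 q) (cross (H c 2 q) Nc)) = - cross (H c 3 q) (cross (H c 4 q) Nc)"
          by (simp add: cnjv_cross cnjv_H Ncs cross_neg)
        have "cnjv w = (1/6) *s cnjv dN + (1/4) *s cnjv (cross (H c 3 q) (cross (H c 2 q) Nc))"
          by (simp add: w_def vec_eq_iff)
        then show ?thesis unfolding 1 by (simp add: vec_eq_iff)
      qed
      show ?thesis
        unfolding cv_diff cvD cv_scaleR cross_cv [symmetric] cv_RH cv_pt Nc_def [symmetric] cnjv_H cross_add cross_scale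
          cross_neg cw
        unfolding w_def by (simp add: vec_eq_iff algebra_simps)
    qed
    then have "cv (C \<zeta>) = cprj c q (cnj \<zeta> *s w + \<zeta> *s cnjv w)"
      unfolding C_def char_nabla_perp_pt [OF bt q \<nu>] cv_projN D_def by simp
    then show ?thesis
      unfolding cprj_lin by (simp add: Y_def cnjv_cprj)
  qed
  define V where "V = (\<lambda>\<zeta>. cross (RH c 4 \<zeta> q) (C \<zeta>) + cross (RH c 4 (- \<i> * \<zeta>) q) (C (- \<i> * \<zeta>)))"
  have cvV: "cv (V \<zeta>) = (\<zeta> * cnj \<zeta>) *s (cross (H c 4 q) Y + cross (cnjv (H c 4 q)) (cnjv Y))" for \<zeta>
    unfolding V_def cv_add cross_cv [symmetric] cv_RH cvC cross_add cross_scale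
    by (simp add: vec_eq_iff algebra_simps)
  have s32: "of_real (sqrt (3/2)) * cnj (of_real (sqrt (3/2))) = (3/2::complex)"
    by (simp flip: of_real_mult)
  define W where "W = V (of_real (sqrt (3/2)))"
  have W: "V \<zeta> = W" if "\<zeta> * cnj \<zeta> = 3/2" for \<zeta>
  proof -
    have "cv (V \<zeta>) = cv W" unfolding W_def cvV that s32 ..
    then show ?thesis by (simp add: cv_eq_iff)
  qed
  have "dirac ?S \<nu> ?p = W"
    unfolding dirac_def
  proof (rule the_equality)
    have "oriented_frame ?S ?p (RH c 4 (of_real (sqrt (3/2))) q) (RH c 4 (- \<i> * of_real (sqrt (3/2))) q)"
      unfolding oriented_frame_pt [OF c q] using s32 by blast
    then show "\<exists>f1 f2. oriented_frame ?S ?p f1 f2 \<and> W = cross7 f1 (char_nabla_perp ?S \<nu> ?p f1) + cross7 f2 (char_nabla_perp ?S \<nu> ?p f2)"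
      unfolding W_def V_def C_def cross7_eq_cross by blast
    fix x assume "\<exists>f1 f2. oriented_frame ?S ?p f1 f2 \<and> x = cross7 f1 (char_nabla_perp ?S \<nu> ?p f1) + cross7 f2 (char_nabla_perp ?S \<nu> ?p f2)"
    then obtain \<zeta> where "\<zeta> * cnj \<zeta> = 3/2" "x = V \<zeta>"
      unfolding oriented_frame_pt [OF c q] V_def C_def cross7_eq_cross by blast
    then show "x = W" using W by simp
  qed
  moreover have "cv (cross ?p W) = cv ((1/10) *\<^sub>R (RH c 6 (cnj (up ?a q)) q - RH c 5 (cnj (dn ?b q)) q))"
  proof -
    have W': "cv W = (3/2) *s (cross (H c 4 q) Y + cross (cnjv (H c 4 q)) (cnjv Y))"
      unfolding W_def cvV s32 ..
    have HY: "cross (H c 3 q) (cross (H c 4 q) Y) = (1/30 * cnj (up ?a q)) *s H c 6 q + (- 1/30 * dn ?b q) *s H c 1 q"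
      unfolding Y cross_add cross_scale cross_H [OF c q] cross_H_conj [OF c q] cross_zero
      by (simp add: vec_eq_iff)
    have HY': "cross (H c 3 q) (cross (cnjv (H c 4 q)) (cnjv Y))
        = (1/30 * up ?a q) *s cnjv (H c 6 q) + (- 1/30 * cnj (dn ?b q)) *s cnjv (H c 1 q)"
    proof -
      have "cross (H c 3 q) (cross (cnjv (H c 4 q)) (cnjv Y)) = cnjv (cross (H c 3 q) (cross (H c 4 q) Y))"
        by (simp only: cnjv_cross cnjv_H(1))
      then show ?thesis unfolding HY by (simp add: vec_eq_iff)
    qed
    show ?thesis
      unfolding cross_cv [symmetric] W' cv_pt cross_scale cross_add HY HY' cv_scaleR cv_diff cv_RH
      unfolding cnjv_H by (simp add: vec_eq_iff del: One_nat_def)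
  qed
  ultimately show ?thesis
    unfolding J_def cross7_eq_cross by (simp only: cv_eq_iff)
qed

section \<open>Eigensections as ladder functions\<close>

lemma xv_phase: "xv (flow I3 t q) = xv q" and mv_phase: "mv (flow I3 t q) = cis (2 * t) *s mv q"
proof -
  have c: "cnj (cis t) * cis t = 1" by (simp add: cis_cnj cis_mult)
  have "cnj (cis t * u) * (cis t * v) = (cnj (cis t) * cis t) * (cnj u * v)"
    "(cis t * u) * cnj (cis t * v) = (cnj (cis t) * cis t) * (u * cnj v)" for u v by simp_all
  note r = this [unfolded c mult_1_left]
  show "xv (flow I3 t q) = xv q"
    unfolding xv_def flow_I3 fst_conv snd_conv r ..
  have "cis t * cis t = cis (2 * t)" by (simp add: cis_mult)
  then have "(cis t * u) * (cis t * v) = cis (2 * t) * (u * v)" for u v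
    by (metis mult.assoc mult.left_commute)
  note r = this
  show "mv (flow I3 t q) = cis (2 * t) *s mv q"
    unfolding mv_def flow_I3 fst_conv snd_conv r by (simp add: vec_eq_iff forall_3 algebra_simps)
qed

lemma H_phase:
  "pt c (flow I3 t q) = pt c q" "H c 5 (flow I3 t q) = cis (4 * t) *s H c 5 q" "H c 6 (flow I3 t q) = cis (6 * t) *s H c 6 q"
proof -
  have "cis (2 * t) * cis (2 * t) = cis (4 * t)" "cis (2 * t) * cis (4 * t) = cis (6 * t)"
    by (simp_all add: cis_mult)
  then have m: "cis (2 * t) * (cis (2 * t) * u) = cis (4 * t) * u" "cis (2 * t) * (cis (4 * t) * u) = cis (6 * t) * u" for u
    by (metis mult.assoc)+
  show "pt c (flow I3 t q) = pt c q" "H c 5 (flow I3 t q) = cis (4 * t) *s H c 5 q" "H c 6 (flow I3 t q) = cis (6 * t) *s H c 6 q"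
    by (simp_all add: vec_eq_iff pt_def G_simps xv_phase mv_phase tri_scale m)
qed

lemma smooth_along_comp:
  assumes "smooth_along (pt c ` S3) \<nu>" "j \<le> 6"
  shows "smooth_along S3 (comp c j \<nu>)"
proof -
  have "smooth_along S3 (\<lambda>q. complex_of_real (\<nu> (pt c q) $ i))" for i
    by (rule smooth_along_bounded_linear [OF bounded_linear_compose [OF bounded_linear_of_real bounded_linear_vec_nth]
          smooth_along_pt_compose [OF assms(1)]])
  moreover have "smooth_along S3 (G (c i) j)" for i
    by (rule smooth_on_imp_along [OF open_UNIV subset_UNIV smooth_on_G [OF assms(2)]])
  ultimately have "smooth_along S3 (\<lambda>q. \<Sum>i\<in>UNIV. complex_of_real (\<nu> (pt c q) $ i) * G (c i) j q)"
    by (intro smooth_along_sum smooth_along_mult)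
  then show ?thesis by (simp add: comp_def [abs_def] cdot_def)
qed

lemma charged_comp: "charged 4 (comp c 5 \<nu>)" "charged 6 (comp c 6 \<nu>)"
  by (rule charged_phaseI, simp add: comp_def H_phase cdot_scale)+

text \<open>The Dirac operator in the frame, compared with the resolution of \<open>\<nu>\<close> in the same frame.\<close>

lemma eigensections_iff:
  assumes c: "hol_tensor c" and \<nu>: "\<nu> \<in> normal_sections (pt c ` S3)"
  shows "\<nu> \<in> eigensections (pt c ` S3) l \<longleftrightarrow>
    (\<forall>q\<in>S3. up (comp c 5 \<nu>) q = of_real (l + 1) * comp c 6 \<nu> q \<and> dn (comp c 6 \<nu>) q = - 6 * of_real (l + 1) * comp c 5 \<nu> q)"
proof -
  have bt: "boruvka_tensor c" using c by (simp add: hol_tensor_def)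
  have *: "J (pt c q) (dirac (pt c ` S3) \<nu> (pt c q)) = (l + 1) *\<^sub>R \<nu> (pt c q) \<longleftrightarrow>
    up (comp c 5 \<nu>) q = of_real (l + 1) * comp c 6 \<nu> q \<and> dn (comp c 6 \<nu>) q = - 6 * of_real (l + 1) * comp c 5 \<nu> q"
    (is "?L = ?R \<longleftrightarrow> ?A \<and> ?B") if q: "q \<in> S3" for q
  proof -
    have np: "\<nu> (pt c q) \<in> normal_space (pt c ` S3) (pt c q)" using normal_sectionsD(2) [OF \<nu>] q by blast
    note d = cdot_cv_RH [OF bt q]
    show ?thesis
    proof
      assume eq: "?L = ?R"
      have "cdot (cv ?L) (H c j q) = cdot (cv ?R) (H c j q)" for j using eq by simp
      note e = this [unfolded dirac_pt [OF c q \<nu>] cv_scaleR cv_diff cdot_scale cdot_diff]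
      have d': "1/10 * (0 - 5/3 * dn (comp c 6 \<nu>) q) = of_real (l + 1) * comp c 5 \<nu> q"
        using e [of 5] by (simp add: d comp_def)
      have u': "1/10 * (10 * up (comp c 5 \<nu>) q - 0) = of_real (l + 1) * comp c 6 \<nu> q"
        using e [of 6] by (simp add: d comp_def)
      have "dn (comp c 6 \<nu>) q = - 6 * (1/10 * (0 - 5/3 * dn (comp c 6 \<nu>) q))" by simp
      then show "?A \<and> ?B" using u' unfolding d' by (simp add: algebra_simps)
    next
      assume AB: "?A \<and> ?B"
      have R1: "?R = (l + 1) *\<^sub>R ((3/5) *\<^sub>R RH c 5 (cnj (comp c 5 \<nu> q)) q + (1/10) *\<^sub>R RH c 6 (cnj (comp c 6 \<nu> q)) q)"
        unfolding comp_def by (rule arg_cong [OF normal_resolution [OF bt q np]])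
      have R2: "RH c 6 (cnj (up (comp c 5 \<nu>) q)) q = (l + 1) *\<^sub>R RH c 6 (cnj (comp c 6 \<nu> q)) q"
        unfolding conjunct1 [OF AB] RH_scaleR [symmetric] by simp
      have R3: "RH c 5 (cnj (dn (comp c 6 \<nu>) q)) q = (- 6 * (l + 1)) *\<^sub>R RH c 5 (cnj (comp c 5 \<nu> q)) q"
        unfolding conjunct2 [OF AB] RH_scaleR [symmetric] by simp
      show "?L = ?R"
        unfolding dirac_pt [OF c q \<nu>] R1 R2 R3 by (simp add: vec_eq_iff algebra_simps)
    qed
  qed
  show ?thesis
    unfolding eigensections_def using \<nu> * by (auto simp del: mem_sphere_0 of_real_add)
qed

lemma comp_ladder:
  assumes c: "hol_tensor c" and \<nu>: "\<nu> \<in> eigensections (pt c ` S3) l"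
  shows "comp c 5 \<nu> \<in> ladder 4 (6 * (l + 1)\<^sup>2)"
  unfolding ladder_def
proof (intro CollectI conjI ballI)
  have n: "\<nu> \<in> normal_sections (pt c ` S3)" using \<nu> by (simp add: eigensections_def)
  note sm = smooth_along_comp [OF normal_sectionsD(1) [OF n]]
  show "smooth_along S3 (comp c 5 \<nu>)" by (rule sm) simp
  show "charged 4 (comp c 5 \<nu>)" by (rule charged_comp)
  note e = eigensections_iff [OF c n, THEN iffD1, OF \<nu>]
  fix q assume q: "q \<in> S3"
  have "dn (up (comp c 5 \<nu>)) q = dn (\<lambda>q. of_real (l + 1) * comp c 6 \<nu> q) q"
    by (rule dn_cong [OF q]) (use e in blast)
  also have "\<dots> = of_real (l + 1) * dn (comp c 6 \<nu>) q"
    by (rule dn_cmult [OF sm q]) simp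
  also have "\<dots> = - of_real (6 * (l + 1)\<^sup>2) * comp c 5 \<nu> q"
    using e q by (simp add: power2_eq_square del: of_real_add)
  finally show "dn (up (comp c 5 \<nu>)) q = - of_real (6 * (l + 1)\<^sup>2) * comp c 5 \<nu> q" .
qed

text \<open>The component of charge \<open>6\<close> is determined by that of charge \<open>4\<close>; for \<open>l = - 1\<close> it
  vanishes by the maximum principle.\<close>

lemma comp_inj:
  assumes c: "hol_tensor c" and \<nu>: "\<nu> \<in> eigensections (pt c ` S3) l"
    and 0: "\<And>q. q \<in> S3 \<Longrightarrow> comp c 5 \<nu> q = 0"
  shows "\<nu> = (\<lambda>p. 0)"
proof
  fix p
  have bt: "boruvka_tensor c" using c by (simp add: hol_tensor_def)
  have n: "\<nu> \<in> normal_sections (pt c ` S3)" using \<nu> by (simp add: eigensections_def)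
  note sm = smooth_along_comp [OF normal_sectionsD(1) [OF n], of 6, simplified]
  note e = eigensections_iff [OF c n, THEN iffD1, OF \<nu>]
  have b: "comp c 6 \<nu> q = 0" if q: "q \<in> S3" for q
  proof (cases "l + 1 = 0")
    case False
    have "up (comp c 5 \<nu>) q = up (\<lambda>q. 0) q" by (rule up_cong [OF q 0])
    then have "of_real (l + 1) * comp c 6 \<nu> q = 0" using e q up_0 by metis
    then show ?thesis using False by (simp del: of_real_add)
  next
    case True
    have dn0: "dn (comp c 6 \<nu>) q = 0" if "q \<in> S3" for q using e that True by simp
    have "comp c 6 \<nu> \<in> ladder 6 (- 6)"
      unfolding ladder_def
    proof (intro CollectI conjI ballI)
      fix q assume q: "q \<in> S3"
      have "up (dn (comp c 6 \<nu>)) q = up (\<lambda>q. 0) q" by (rule up_cong [OF q dn0])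
      then show "dn (up (comp c 6 \<nu>)) q = - of_real (- 6) * comp c 6 \<nu> q"
        using up_dn_commute [OF sm q charged_comp(2)] up_0 by simp
    qed (fact sm charged_comp(2))+
    from ladder_eq_0 [OF this _ q] show ?thesis by simp
  qed
  show "\<nu> p = 0"
  proof (cases "p \<in> pt c ` S3")
    case True
    then obtain q where q: "q \<in> S3" "p = pt c q" by blast
    have "\<nu> (pt c q) = (3/5) *\<^sub>R RH c 5 (cnj (comp c 5 \<nu> q)) q + (1/10) *\<^sub>R RH c 6 (cnj (comp c 6 \<nu> q)) q"
      unfolding comp_def by (rule normal_resolution [OF bt q(1)]) (use normal_sectionsD(2) [OF n] q in blast)
    then show ?thesis unfolding q(2) 0 [OF q(1)] b [OF q(1)] by (simp add: RH_def vec_eq_iff)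
  next
    case False
    then show ?thesis using normal_sectionsD(3) [OF n] by blast
  qed
qed

text \<open>The fibres of the Hopf map are the orbits of \<open>flow I3\<close>.  A local section is obtained by
  projecting a fixed point \<open>q0\<close> to the complex line that belongs to \<open>x\<close>.\<close>

definition lift :: "complex \<times> complex \<Rightarrow> real^3 \<Rightarrow> complex \<times> complex" where
  "lift q0 x = (1/2) *\<^sub>R (of_real (1 + x $ 3) * fst q0 + (of_real (x $ 1) - \<i> * of_real (x $ 2)) * snd q0,
     (of_real (x $ 1) + \<i> * of_real (x $ 2)) * fst q0 + of_real (1 - x $ 3) * snd q0)"

lemma lift_xr:
  assumes q: "q \<in> S3"
  shows "lift q0 (xr q) = ((cnj (fst q) * fst q0 + cnj (snd q) * snd q0) * fst q, (cnj (fst q) * fst q0 + cnj (snd q) * snd q0) * snd q)"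
proof -
  have "(norm (fst q))\<^sup>2 + (norm (snd q))\<^sup>2 = 1"
    using q by (simp add: norm_prod_def)
  then have n: "fst q * cnj (fst q) + snd q * cnj (snd q) = 1"
    by (metis complex_norm_square of_real_1 of_real_add)
  have x3: "1 + of_real (xr q $ 3) = 2 * (fst q * cnj (fst q))" "1 - of_real (xr q $ 3) = 2 * (snd q * cnj (snd q))"
    unfolding of_real_xr n [symmetric] by (simp_all add: xv_def)
  have x12: "of_real (xr q $ 1) - \<i> * of_real (xr q $ 2) = 2 * (fst q * cnj (snd q))"
    "of_real (xr q $ 1) + \<i> * of_real (xr q $ 2) = 2 * (cnj (fst q) * snd q)"
    unfolding of_real_xr by (simp_all add: xv_def algebra_simps)
  show ?thesis
    unfolding lift_def x12 of_real_add of_real_diff of_real_1 x3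
    by (simp add: prod_eq_iff scaleR_conv_of_real algebra_simps)
qed

lemma sgn_phase:
  assumes q: "q \<in> S3" and \<kappa>: "\<kappa> \<noteq> 0"
  shows "sgn (\<kappa> * fst q, \<kappa> * snd q) = flow I3 (Arg \<kappa>) q"
proof -
  have "(norm (fst q))\<^sup>2 + (norm (snd q))\<^sup>2 = 1"
    using q by (simp add: norm_prod_def)
  then have "(norm \<kappa>)\<^sup>2 * (norm (fst q))\<^sup>2 + (norm \<kappa>)\<^sup>2 * (norm (snd q))\<^sup>2 = (norm \<kappa>)\<^sup>2"
    by (simp flip: distrib_left)
  then have n: "norm (\<kappa> * fst q, \<kappa> * snd q) = norm \<kappa>"
    by (simp add: norm_Pair norm_mult power_mult_distrib)
  have "cis (Arg \<kappa>) = inverse (of_real (norm \<kappa>)) * \<kappa>"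
    using rcis_cmod_Arg [of \<kappa>] \<kappa> by (simp add: rcis_def field_simps)
  then show ?thesis
    unfolding flow_I3 by (simp add: sgn_div_norm n prod_eq_iff scaleR_conv_of_real)
qed

lemma Hopf_fibre:
  assumes q: "q \<in> S3" "q' \<in> S3" and eq: "xr q = xr q'"
  shows "\<exists>t. q = flow I3 t q'"
proof -
  have "(norm (fst q))\<^sup>2 + (norm (snd q))\<^sup>2 = 1"
    using q by (simp add: norm_prod_def)
  then have n: "cnj (fst q) * fst q + cnj (snd q) * snd q = 1"
    by (metis complex_norm_square of_real_1 of_real_add mult.commute)
  define \<kappa> where "\<kappa> = cnj (fst q') * fst q + cnj (snd q') * snd q"
  have "lift q (xr q) = q" unfolding lift_xr [OF q(1)] n by simp
  then have l: "q = (\<kappa> * fst q', \<kappa> * snd q')"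
    using lift_xr [OF q(2), of q] eq by (simp add: \<kappa>_def)
  have q0: "q \<noteq> 0" using q(1) by auto
  have "\<kappa> \<noteq> 0"
  proof
    assume "\<kappa> = 0"
    then have "q = 0" using l by (simp add: zero_prod_def)
    then show False using q0 by blast
  qed
  from sgn_phase [OF q(2) this] have "sgn q = flow I3 (Arg \<kappa>) q'" using l by metis
  moreover have "sgn q = q" using q(1) by (simp add: sgn_div_norm)
  ultimately show ?thesis by metis
qed

lemma smooth_along_local:
  assumes "\<And>p. p \<in> S \<Longrightarrow> \<exists>U. open U \<and> p \<in> U \<and> smooth_along (S \<inter> U) f"
  shows "smooth_along S f"
  unfolding smooth_along_def
proof
  fix p assume p: "p \<in> S"
  obtain U where U: "open U" "p \<in> U" "smooth_along (S \<inter> U) f" using assms [OF p] by blast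
  have "p \<in> S \<inter> U" using p U(2) by blast
  then obtain V g where V: "open V" "p \<in> V" "smooth_on V g" "\<forall>q\<in>S \<inter> U \<inter> V. g q = f q"
    using U(3) unfolding smooth_along_def by blast
  have "open (U \<inter> V)" using U V by blast
  moreover have "smooth_on (U \<inter> V) g" by (rule smooth_on_subset [OF calculation _ V(3)]) blast
  ultimately show "\<exists>U g. open U \<and> p \<in> U \<and> smooth_on U g \<and> (\<forall>q\<in>S \<inter> U. g q = f q)"
    using U(2) V(2,4) by (intro exI [of _ "U \<inter> V"] exI [of _ g]) auto
qed

lemma smooth_on_lift: "smooth_on UNIV (lift q0)"
proof -
  have "lift q0 = (\<lambda>x. lift q0 0 + (lift q0 x - lift q0 0))" by simp
  moreover have "linear (\<lambda>x. lift q0 x - lift q0 0)"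
    by (simp add: linear_iff lift_def prod_eq_iff complex_eq_iff field_simps)
  ultimately show ?thesis
    using smooth_on_add [OF open_UNIV smooth_on_const [OF open_UNIV] smooth_on_linear [OF _ open_UNIV]] by metis
qed

lemma descend:
  assumes c: "boruvka_tensor c" and N: "smooth_along S3 N" and inv: "\<And>q t. q \<in> S3 \<Longrightarrow> N (flow I3 t q) = N q"
    and f: "\<And>q. q \<in> S3 \<Longrightarrow> f (pt c q) = N q"
  shows "smooth_along (pt c ` S3) f"
proof (rule smooth_along_local)
  fix p assume "p \<in> pt c ` S3"
  then obtain q0 where q0: "q0 \<in> S3" "p = pt c q0" by blast
  define L where "L = (\<lambda>p. lift q0 (gmap c p))"
  have L: "smooth_on UNIV L"
    unfolding L_def by (rule smooth_on_compose [OF open_UNIV open_UNIV subset_UNIV smooth_on_gmap smooth_on_lift])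
  define U where "U = L -` (- {0})"
  have U: "open U"
    unfolding U_def by (rule open_vimage [OF _ smooth_on_continuous [OF L]]) (simp add: open_Compl)
  have Lp: "L (pt c q) = (let \<kappa> = cnj (fst q) * fst q0 + cnj (snd q) * snd q0 in (\<kappa> * fst q, \<kappa> * snd q))" if "q \<in> S3" for q
    unfolding L_def gmap_pt [OF c that] lift_xr [OF that] Let_def ..
  have "(norm (fst q0))\<^sup>2 + (norm (snd q0))\<^sup>2 = 1"
    using q0 by (simp add: norm_prod_def)
  then have n: "cnj (fst q0) * fst q0 + cnj (snd q0) * snd q0 = 1"
    by (metis complex_norm_square of_real_1 of_real_add mult.commute)
  have "L p = q0" unfolding q0(2) Lp [OF q0(1)] n by simp
  moreover have "q0 \<noteq> 0" using q0(1) by auto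
  ultimately have "p \<in> U" by (simp add: U_def)
  moreover have "smooth_along (pt c ` S3 \<inter> U) f"
  proof (rule smooth_along_cong)
    have "smooth_on U (\<lambda>p. sgn (L p))"
      by (rule smooth_on_sgn [OF U smooth_on_subset [OF U subset_UNIV L]]) (simp add: U_def)
    then have s: "smooth_along (pt c ` S3 \<inter> U) (\<lambda>p. sgn (L p))"
      by (rule smooth_on_imp_along [OF U Int_lower2])
    have im: "(\<lambda>p. sgn (L p)) ` (pt c ` S3 \<inter> U) \<subseteq> S3"
      by (rule image_subsetI) (simp add: U_def norm_sgn)
    show "smooth_along (pt c ` S3 \<inter> U) (\<lambda>p. N (sgn (L p)))"
      by (rule smooth_along_compose [OF s N im])
    fix r assume r: "r \<in> pt c ` S3 \<inter> U"
    then obtain q where q: "q \<in> S3" "r = pt c q" by blast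
    define \<kappa> where "\<kappa> = cnj (fst q) * fst q0 + cnj (snd q) * snd q0"
    have Lr: "L r = (\<kappa> * fst q, \<kappa> * snd q)" unfolding q(2) Lp [OF q(1)] \<kappa>_def Let_def ..
    have "\<kappa> \<noteq> 0"
    proof
      assume "\<kappa> = 0"
      then have "L r = 0" using Lr by (simp add: zero_prod_def)
      then show False using r by (simp add: U_def)
    qed
    then have "sgn (L r) = flow I3 (Arg \<kappa>) q" unfolding Lr by (rule sgn_phase [OF q(1)])
    then show "N (sgn (L r)) = f r" using inv [OF q(1)] f [OF q(1)] q(2) by simp
  qed
  ultimately show "\<exists>U. open U \<and> p \<in> U \<and> smooth_along (pt c ` S3 \<inter> U) f" using U by blast
qed

lemma smooth_along_RH:
  assumes a: "smooth_along S3 a" and j: "j \<le> 6"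
  shows "smooth_along S3 (\<lambda>q. RH c j (a q) q)"
proof -
  have G: "smooth_along S3 (G (c i) j)" for i
    by (rule smooth_on_imp_along [OF open_UNIV subset_UNIV smooth_on_G [OF j]])
  have "smooth_along S3 (\<lambda>q. \<Sum>i\<in>UNIV. Re (a q * G (c i) j q) *\<^sub>R axis i (1::real))"
    by (rule smooth_along_sum, rule smooth_along_bounded_linear [OF bounded_linear_compose [OF bounded_linear_scaleR_left bounded_linear_Re]],
        rule smooth_along_mult [OF a G])
  then show ?thesis
    by (rule smooth_along_cong) (simp add: RH_def vec_eq_iff axis_def if_distrib cong: if_cong)
qed

text \<open>Given \<open>a\<close>, take \<open>b = up a / (l + 1)\<close>, or \<open>b = 0\<close> if \<open>l = - 1\<close>.  The normal field with
  components \<open>a\<close> and \<open>b\<close> has charge 0 as a function on \<open>S3\<close>, so it descends to the surface.\<close>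

lemma comp_surj:
  assumes c: "hol_tensor c" and a: "a \<in> ladder 4 (6 * (l + 1)\<^sup>2)"
  obtains \<nu> where "\<nu> \<in> eigensections (pt c ` S3) l" "\<And>q. q \<in> S3 \<Longrightarrow> comp c 5 \<nu> q = a q"
proof -
  have bt: "boruvka_tensor c" using c by (simp add: hol_tensor_def)
  define b where "b = (\<lambda>q. inverse (of_real (l + 1)) * up a q)"
  note sa = ladderD(1) [OF a] and ca = ladderD(2) [OF a]
  have sb: "smooth_along S3 b" unfolding b_def by (rule smooth_along_cmult [OF smooth_along_up [OF sa]])
  have aph: "a (flow I3 t q) = cis (4 * t) * a q" if "q \<in> S3" for q t
    by (rule charged_phase [OF sa ca that])
  have bph: "b (flow I3 t q) = cis (6 * t) * b q" if "q \<in> S3" for q t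
    using charged_phase [OF smooth_along_up [OF sa] charged_up [OF sa ca] that] by (simp add: b_def)
  define N where "N = (\<lambda>q. (3/5) *\<^sub>R RH c 5 (cnj (a q)) q + (1/10) *\<^sub>R RH c 6 (cnj (b q)) q)"
  have "smooth_along S3 (\<lambda>q. (3/5) *\<^sub>R RH c 5 (cnj (a q)) q)" "smooth_along S3 (\<lambda>q. (1/10) *\<^sub>R RH c 6 (cnj (b q)) q)"
    by (rule smooth_along_bounded_linear [OF bounded_linear_scaleR_right smooth_along_RH [OF smooth_along_cnj [OF sa]]], simp,
        rule smooth_along_bounded_linear [OF bounded_linear_scaleR_right smooth_along_RH [OF smooth_along_cnj [OF sb]]], simp)
  then have sN: "smooth_along S3 N" unfolding N_def by (rule smooth_along_add)
  have inv: "N (flow I3 t q) = N q" if q: "q \<in> S3" for q t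
  proof -
    have e: "cnj (cis s * u) * (cis s * v) = cnj u * v" for s u v
    proof -
      have "cnj (cis s) * cis s = 1" by (simp add: cis_cnj cis_mult)
      then show ?thesis by (metis complex_cnj_mult mult.assoc mult.left_commute mult_1_left)
    qed
    have "RH c 5 (cnj (cis (4 * t) * a q)) (flow I3 t q) = RH c 5 (cnj (a q)) q"
      "RH c 6 (cnj (cis (6 * t) * b q)) (flow I3 t q) = RH c 6 (cnj (b q)) q"
      unfolding RH_def H_phase vector_smult_component e by simp_all
    then show ?thesis unfolding N_def aph [OF q] bph [OF q] by simp
  qed
  define \<nu> where "\<nu> = (\<lambda>p. if p \<in> pt c ` S3 then N (SOME q. q \<in> S3 \<and> pt c q = p) else 0)"
  have \<nu>: "\<nu> (pt c q) = N q" if q: "q \<in> S3" for q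
  proof -
    define q' where "q' = (SOME q'. q' \<in> S3 \<and> pt c q' = pt c q)"
    have "q' \<in> S3 \<and> pt c q' = pt c q" unfolding q'_def by (rule someI [of _ q]) (use q in simp)
    then have q': "q' \<in> S3" "pt c q' = pt c q" by blast+
    then have "xr q' = xr q" using gmap_pt [OF bt] q by metis
    then obtain t where "q' = flow I3 t q" using Hopf_fibre [OF q'(1) q] by blast
    then have "N q' = N q" using inv [OF q] by simp
    then show ?thesis using q unfolding \<nu>_def q'_def by simp
  qed
  have ns: "\<nu> \<in> normal_sections (pt c ` S3)"
    unfolding normal_sections_def
  proof (intro CollectI conjI ballI allI impI)
    show "smooth_along (pt c ` S3) \<nu>" by (rule descend [OF bt sN inv \<nu>])
    fix p assume "p \<in> pt c ` S3"
    then obtain q where q: "q \<in> S3" "p = pt c q" by blast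
    show "\<nu> p \<in> normal_space (pt c ` S3) p"
      unfolding q(2) normal_space_pt [OF bt q(1)] \<nu> [OF q(1)] N_def
      by (simp add: inner_add_right RH_inner [OF bt q(1)] cv_add cv_scaleR cdot_add cdot_scale cdot_cv_RH [OF bt q(1)])
  qed (simp add: \<nu>_def)
  have comps: "comp c 5 \<nu> q = a q" "comp c 6 \<nu> q = b q" if q: "q \<in> S3" for q
    unfolding comp_def \<nu> [OF q] N_def
    by (simp_all add: cv_add cv_scaleR cdot_add cdot_scale cdot_cv_RH [OF bt q])
  have "up (comp c 5 \<nu>) q = of_real (l + 1) * comp c 6 \<nu> q \<and> dn (comp c 6 \<nu>) q = - 6 * of_real (l + 1) * comp c 5 \<nu> q"
    if q: "q \<in> S3" for q
  proof -
    have u: "up (comp c 5 \<nu>) q = up a q" by (rule up_cong [OF q comps(1)])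
    have d: "dn (comp c 6 \<nu>) q = inverse (of_real (l + 1)) * dn (up a) q"
      using dn_cong [OF q comps(2)] dn_cmult [OF smooth_along_up [OF sa] q] unfolding b_def by simp
    show ?thesis
    proof (cases "l + 1 = 0")
      case True
      then have "a \<in> ladder 4 0" using a by simp
      then have "up a q = 0" using ladder_0_up [OF _ _ q] by simp
      then show ?thesis unfolding u d True by simp
    next
      case False
      define \<mu> where "\<mu> = complex_of_real (l + 1)"
      have \<mu>: "\<mu> \<noteq> 0" using False unfolding \<mu>_def by (simp del: of_real_add)
      have "dn (up a) q = - 6 * (\<mu> * \<mu>) * a q"
        using ladderD(3) [OF a q] by (simp add: \<mu>_def power2_eq_square del: of_real_add)
      then show ?thesis
        unfolding u d comps [OF q] b_def \<mu>_def [symmetric] using \<mu> by (simp add: field_simps)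
    qed
  qed
  then have "\<nu> \<in> eigensections (pt c ` S3) l"
    unfolding eigensections_iff [OF c ns] by blast
  then show thesis using comps(1) that by blast
qed

lemma comp_lincomb: "comp c j (\<lambda>p. r *\<^sub>R \<nu> p + s *\<^sub>R \<nu>' p) q = of_real r * comp c j \<nu> q + of_real s * comp c j \<nu>' q"
  by (simp add: comp_def cv_add cv_scaleR cdot_add cdot_scale)

lemma eigensections_lincomb:
  assumes c: "hol_tensor c" and \<nu>: "\<nu> \<in> eigensections (pt c ` S3) l" and \<nu>': "\<nu>' \<in> eigensections (pt c ` S3) l"
  shows "(\<lambda>p. r *\<^sub>R \<nu> p + s *\<^sub>R \<nu>' p) \<in> eigensections (pt c ` S3) l"
proof -
  have bt: "boruvka_tensor c" using c by (simp add: hol_tensor_def)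
  have n: "\<nu> \<in> normal_sections (pt c ` S3)" "\<nu>' \<in> normal_sections (pt c ` S3)"
    using \<nu> \<nu>' by (simp_all add: eigensections_def)
  have N: "(\<lambda>p. r *\<^sub>R \<nu> p + s *\<^sub>R \<nu>' p) \<in> normal_sections (pt c ` S3)"
    unfolding normal_sections_def
  proof (intro CollectI conjI ballI allI impI)
    have "smooth_along (pt c ` S3) (\<lambda>p. r *\<^sub>R \<nu> p)" "smooth_along (pt c ` S3) (\<lambda>p. s *\<^sub>R \<nu>' p)"
      by (rule smooth_along_bounded_linear [OF bounded_linear_scaleR_right normal_sectionsD(1) [OF n(1)]],
          rule smooth_along_bounded_linear [OF bounded_linear_scaleR_right normal_sectionsD(1) [OF n(2)]])
    then show "smooth_along (pt c ` S3) (\<lambda>p. r *\<^sub>R \<nu> p + s *\<^sub>R \<nu>' p)" by (rule smooth_along_add)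
    fix p assume "p \<in> pt c ` S3"
    then obtain q where q: "q \<in> S3" "p = pt c q" by blast
    then have "\<nu> p \<in> normal_space (pt c ` S3) (pt c q)" "\<nu>' p \<in> normal_space (pt c ` S3) (pt c q)"
      using normal_sectionsD(2) [OF n(1)] normal_sectionsD(2) [OF n(2)] by blast+
    then show "r *\<^sub>R \<nu> p + s *\<^sub>R \<nu>' p \<in> normal_space (pt c ` S3) p"
      unfolding q(2) normal_space_pt [OF bt q(1)]
      by (simp add: inner_add_right cv_add cv_scaleR cdot_add cdot_scale)
  qed (simp add: normal_sectionsD(3) [OF n(1)] normal_sectionsD(3) [OF n(2)])
  note sm = smooth_along_comp [OF normal_sectionsD(1) [OF n(1)]] smooth_along_comp [OF normal_sectionsD(1) [OF n(2)]]
  note e = eigensections_iff [OF c n(1), THEN iffD1, OF \<nu>] eigensections_iff [OF c n(2), THEN iffD1, OF \<nu>']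
  show ?thesis
    unfolding eigensections_iff [OF c N]
  proof
    fix q assume q: "q \<in> S3"
    have "up (comp c 5 (\<lambda>p. r *\<^sub>R \<nu> p + s *\<^sub>R \<nu>' p)) q = of_real r * up (comp c 5 \<nu>) q + of_real s * up (comp c 5 \<nu>') q"
      unfolding comp_lincomb [abs_def]
      using up_add [OF smooth_along_cmult [OF sm(1) [of 5]] smooth_along_cmult [OF sm(2) [of 5]] q]
        up_cmult [OF sm(1) [of 5] q] up_cmult [OF sm(2) [of 5] q] by simp
    moreover have "dn (comp c 6 (\<lambda>p. r *\<^sub>R \<nu> p + s *\<^sub>R \<nu>' p)) q = of_real r * dn (comp c 6 \<nu>) q + of_real s * dn (comp c 6 \<nu>') q"
      unfolding comp_lincomb [abs_def]
      using dn_add [OF smooth_along_cmult [OF sm(1) [of 6]] smooth_along_cmult [OF sm(2) [of 6]] q]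
        dn_cmult [OF sm(1) [of 6] q] dn_cmult [OF sm(2) [of 6] q] by simp
    ultimately show "up (comp c 5 (\<lambda>p. r *\<^sub>R \<nu> p + s *\<^sub>R \<nu>' p)) q = of_real (l + 1) * comp c 6 (\<lambda>p. r *\<^sub>R \<nu> p + s *\<^sub>R \<nu>' p) q \<and>
      dn (comp c 6 (\<lambda>p. r *\<^sub>R \<nu> p + s *\<^sub>R \<nu>' p)) q = - 6 * of_real (l + 1) * comp c 5 (\<lambda>p. r *\<^sub>R \<nu> p + s *\<^sub>R \<nu>' p) q"
      unfolding comp_lincomb using e(1) [rule_format, OF q] e(2) [rule_format, OF q]
      by (simp add: algebra_simps del: of_real_add)
  qed
qed

lemma eigensections_0:
  assumes c: "hol_tensor c"
  shows "(\<lambda>p. 0) \<in> eigensections (pt c ` S3) l"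
proof -
  have bt: "boruvka_tensor c" using c by (simp add: hol_tensor_def)
  have N: "(\<lambda>p. 0) \<in> normal_sections (pt c ` S3)"
    unfolding normal_sections_def
  proof (intro CollectI conjI ballI allI impI)
    fix p assume "p \<in> pt c ` S3"
    then obtain q where q: "q \<in> S3" "p = pt c q" by blast
    show "0 \<in> normal_space (pt c ` S3) p"
      unfolding q(2) normal_space_pt [OF bt q(1)] by (simp add: cv_zero) (simp add: cdot_def)
  qed (simp_all add: smooth_along_const)
  have z: "comp c j (\<lambda>p. 0) = (\<lambda>q. 0)" for j
    by (rule ext) (simp add: comp_def cv_zero cdot_def)
  show ?thesis
    unfolding eigensections_iff [OF c N] z
    using has_updn_imp [OF has_updn_const [of 0]] by simp
qed

lemma eigensections_subspace:
  assumes c: "hol_tensor c"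
  shows "fun_space.subspace (eigensections (pt c ` S3) l)"
  unfolding fun_space.subspace_def
proof (intro conjI ballI allI)
  show "0 \<in> eigensections (pt c ` S3) l"
    using eigensections_0 [OF c] by (simp add: zero_fun_def)
  fix \<nu> assume \<nu>: "\<nu> \<in> eigensections (pt c ` S3) l"
  show "(\<lambda>x. r *\<^sub>R \<nu> x) \<in> eigensections (pt c ` S3) l" for r
    using eigensections_lincomb [OF c \<nu> \<nu>, of r 0] by simp
  fix \<nu>' assume \<nu>': "\<nu>' \<in> eigensections (pt c ` S3) l"
  show "\<nu> + \<nu>' \<in> eigensections (pt c ` S3) l"
    using eigensections_lincomb [OF c \<nu> \<nu>', of 1 1] by (simp add: plus_fun_def)
qed

lemma comp_sum: "comp c j (\<Sum>i\<in>I. (\<lambda>p. r i *\<^sub>R \<nu> i p)) q = (\<Sum>i\<in>I. of_real (r i) * comp c j (\<nu> i) q)"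
proof (induction I rule: infinite_finite_induct)
  case (insert i I)
  have e: "(\<Sum>i\<in>insert i I. (\<lambda>p. r i *\<^sub>R \<nu> i p))
      = (\<lambda>p. r i *\<^sub>R \<nu> i p + 1 *\<^sub>R (\<Sum>i\<in>I. (\<lambda>p. r i *\<^sub>R \<nu> i p)) p)"
    unfolding sum.insert [OF insert.hyps] plus_fun_def scaleR_one ..
  show ?case unfolding e comp_lincomb insert.IH using insert.hyps by simp
qed (simp_all add: comp_def zero_fun_def cv_zero cdot_def)

text \<open>The component of charge 4 identifies the eigensections with the ladder space, so real and imaginary
  units as coefficients give a real basis.\<close>

lemma fun_edim_eigensections:
  assumes c: "hol_tensor c" and \<Psi>: "ladder_param 4 (6 * (l + 1)\<^sup>2) n \<Psi>"
  shows "fun_edim (eigensections (pt c ` S3) l) = enat (2 * (n + 1))"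
proof -
  define V where "V = eigensections (pt c ` S3) l"
  have sub: "fun_space.subspace V" unfolding V_def by (rule eigensections_subspace [OF c])
  have P1: "\<Psi> \<gamma> \<in> ladder 4 (6 * (l + 1)\<^sup>2)" for \<gamma> using \<Psi> unfolding ladder_param_def by blast
  have P2: "\<Psi> (\<lambda>j. r * \<gamma> j + s * \<gamma>' j) q = r * \<Psi> \<gamma> q + s * \<Psi> \<gamma>' q" if "q \<in> S3" for r s \<gamma> \<gamma>' q
    using \<Psi> that unfolding ladder_param_def by blast
  have P3: "\<forall>a\<in>ladder 4 (6 * (l + 1)\<^sup>2). \<exists>\<gamma>. (\<forall>j>n. \<gamma> j = 0) \<and> (\<forall>q\<in>S3. a q = \<Psi> \<gamma> q)"
    using \<Psi> unfolding ladder_param_def by blast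
  have P4: "\<gamma> j = 0" if "\<And>q. q \<in> S3 \<Longrightarrow> \<Psi> \<gamma> q = 0" "j \<le> n" for \<gamma> j
    using \<Psi> that unfolding ladder_param_def by blast
  have "\<exists>\<nu>. \<nu> \<in> V \<and> (\<forall>q\<in>S3. comp c 5 \<nu> q = \<Psi> \<gamma> q)" for \<gamma>
    using comp_surj [OF c P1] unfolding V_def by metis
  then obtain T where T: "\<And>\<gamma>. T \<gamma> \<in> V" "\<And>\<gamma> q. q \<in> S3 \<Longrightarrow> comp c 5 (T \<gamma>) q = \<Psi> \<gamma> q" by metis
  define K where "K = {..n} \<times> (UNIV :: bool set)"
  define e :: "nat \<times> bool \<Rightarrow> nat \<Rightarrow> complex" where "e = (\<lambda>(k, s) j. if j = k then (if s then \<i> else 1) else (0::complex))"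
  define B where "B = (\<lambda>x. T (e x)) ` K"
  have finK: "finite K" by (simp add: K_def)
  have cardK: "card K = 2 * (n + 1)" by (simp add: K_def card_cartesian_product)
  have Psum: "\<Psi> (\<lambda>j. \<Sum>x\<in>I. of_real (u x) * e x j) q = (\<Sum>x\<in>I. of_real (u x) * \<Psi> (e x) q)" if q: "q \<in> S3" for u I q
  proof (induction I rule: infinite_finite_induct)
    case (insert x I)
    have "\<Psi> (\<lambda>j. \<Sum>x\<in>insert x I. of_real (u x) * e x j) q = \<Psi> (\<lambda>j. of_real (u x) * e x j + 1 * (\<Sum>x\<in>I. of_real (u x) * e x j)) q"
      using insert.hyps by simp
    then show ?case unfolding P2 [OF q] using insert by simp
  qed (use P2 [OF q, of 0 "\<lambda>_. 0" 0 "\<lambda>_. 0"] in simp_all)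
  have coeff: "(\<Sum>x\<in>K. of_real (u x) * e x j) = of_real (u (j, False)) + \<i> * of_real (u (j, True))" if "j \<le> n" for u j
  proof -
    have "(\<Sum>x\<in>K. of_real (u x) * e x j) = (\<Sum>k\<le>n. if k = j then of_real (u (j, False)) + \<i> * of_real (u (j, True)) else 0)"
    proof -
      have "(\<Sum>x\<in>K. of_real (u x) * e x j) = (\<Sum>k\<le>n. \<Sum>s\<in>UNIV. of_real (u (k, s)) * e (k, s) j)"
        unfolding K_def sum.cartesian_product by (intro sum.cong refl) auto
      also have "\<dots> = (\<Sum>k\<le>n. if k = j then of_real (u (j, False)) + \<i> * of_real (u (j, True)) else 0)"
        by (intro sum.cong refl) (simp add: UNIV_bool e_def)
      finally show ?thesis .
    qed
    then show ?thesis using that by simp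
  qed
  have key: "u x = 0" if z: "\<And>q. q \<in> S3 \<Longrightarrow> (\<Sum>x\<in>K. of_real (u x) * \<Psi> (e x) q) = 0" and xK: "x \<in> K" for u x
  proof -
    obtain k s where x: "x = (k, s)" "k \<le> n" using xK by (auto simp: K_def)
    have "(\<Sum>x\<in>K. of_real (u x) * e x k) = 0"
      by (rule P4 [of "\<lambda>k. \<Sum>x\<in>K. of_real (u x) * e x k", OF _ x(2)]) (simp add: Psum z del: mem_sphere_0)
    then have "of_real (u (k, False)) + \<i> * of_real (u (k, True)) = 0" unfolding coeff [OF x(2)] .
    then have "u (k, False) = 0" "u (k, True) = 0" by (simp_all add: complex_eq_iff)
    then show ?thesis using x(1) by (cases s) auto
  qed
  have inj: "inj_on (\<lambda>x. T (e x)) K"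
  proof (rule inj_onI, rule ccontr)
    fix x y assume xy: "x \<in> K" "y \<in> K" "T (e x) = T (e y)" "x \<noteq> y"
    define u where "u = (\<lambda>z. if z = x then 1 else if z = y then - 1 else (0::real))"
    have "(\<Sum>z\<in>K. of_real (u z) * \<Psi> (e z) q) = 0" if q: "q \<in> S3" for q
    proof -
      have "(\<Sum>z\<in>K. of_real (u z) * \<Psi> (e z) q) = (\<Sum>z\<in>{x, y}. of_real (u z) * \<Psi> (e z) q)"
        using finK xy by (intro sum.mono_neutral_right) (auto simp: u_def)
      also have "\<dots> = \<Psi> (e x) q - \<Psi> (e y) q" using xy(4) by (simp add: u_def)
      also have "\<dots> = 0" using T(2) [OF q] xy(3) by (metis right_minus_eq)
      finally show ?thesis .
    qed
    from key [OF this xy(1)] show False by (simp add: u_def)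
  qed
  have finB: "finite B" unfolding B_def using finK by simp
  have ind: "fun_space.independent B"
    unfolding fun_space.dependent_finite [OF finB]
  proof
    assume "\<exists>u. (\<exists>v\<in>B. u v \<noteq> 0) \<and> (\<Sum>v\<in>B. (\<lambda>x. u v *\<^sub>R v x)) = 0"
    then obtain u v where u: "v \<in> B" "u v \<noteq> 0" "(\<Sum>v\<in>B. (\<lambda>x. u v *\<^sub>R v x)) = 0" by blast
    have "(\<Sum>x\<in>K. of_real (u (T (e x))) * \<Psi> (e x) q) = 0" if q: "q \<in> S3" for q
    proof -
      have "(\<Sum>x\<in>K. (\<lambda>p. u (T (e x)) *\<^sub>R T (e x) p)) = 0"
        using u(3) unfolding B_def sum.reindex [OF inj] o_def .
      then have "comp c 5 (\<Sum>x\<in>K. (\<lambda>p. u (T (e x)) *\<^sub>R T (e x) p)) q = 0"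
        by (simp add: comp_def zero_fun_def cv_zero cdot_def)
      then show ?thesis unfolding comp_sum T(2) [OF q] .
    qed
    note z = key [of "\<lambda>x. u (T (e x))", OF this]
    obtain x where "x \<in> K" "v = T (e x)" using u(1) unfolding B_def by blast
    then show False using z u(2) by simp
  qed
  have span: "V \<subseteq> fun_space.span B"
  proof
    fix \<nu> assume \<nu>: "\<nu> \<in> V"
    then have "comp c 5 \<nu> \<in> ladder 4 (6 * (l + 1)\<^sup>2)" unfolding V_def by (rule comp_ladder [OF c])
    from bspec [OF P3 this] obtain \<gamma> where \<gamma>: "\<forall>j>n. \<gamma> j = 0" "\<forall>q\<in>S3. comp c 5 \<nu> q = \<Psi> \<gamma> q" by (elim exE conjE)
    define u where "u = (\<lambda>(k, s). if s then Im (\<gamma> k) else Re (\<gamma> k))"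
    define \<nu>' where "\<nu>' = (\<Sum>x\<in>K. (\<lambda>p. u x *\<^sub>R T (e x) p))"
    have \<nu>'V: "\<nu>' \<in> V"
      unfolding \<nu>'_def by (rule fun_space.subspace_sum [OF sub], rule fun_space.subspace_scale [OF sub T(1)])
    have \<gamma>e: "(\<lambda>j. \<Sum>x\<in>K. of_real (u x) * e x j) = \<gamma>"
    proof
      fix j show "(\<Sum>x\<in>K. of_real (u x) * e x j) = \<gamma> j"
      proof (cases "j \<le> n")
        case True
        then show ?thesis unfolding coeff [OF True] by (simp add: u_def complex_eq_iff)
      next
        case False
        have "(\<Sum>x\<in>K. of_real (u x) * e x j) = 0"
          using False by (intro sum.neutral) (auto simp: K_def e_def)
        then show ?thesis using False \<gamma>(1) by simp
      qed
    qed
    have "comp c 5 (\<lambda>p. 1 *\<^sub>R \<nu> p + (- 1) *\<^sub>R \<nu>' p) q = 0" if q: "q \<in> S3" for q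
    proof -
      have "comp c 5 \<nu>' q = (\<Sum>x\<in>K. of_real (u x) * \<Psi> (e x) q)"
        unfolding \<nu>'_def comp_sum T(2) [OF q] ..
      also have "\<dots> = \<Psi> \<gamma> q" unfolding Psum [OF q, symmetric] \<gamma>e ..
      finally show ?thesis unfolding comp_lincomb using \<gamma>(2) q by simp
    qed
    moreover have "(\<lambda>p. 1 *\<^sub>R \<nu> p + (- 1) *\<^sub>R \<nu>' p) \<in> eigensections (pt c ` S3) l"
      using eigensections_lincomb [OF c] \<nu> \<nu>'V unfolding V_def by blast
    ultimately have "(\<lambda>p. 1 *\<^sub>R \<nu> p + (- 1) *\<^sub>R \<nu>' p) = (\<lambda>p. 0)"
      using comp_inj [OF c] by blast
    then have "\<nu> = \<nu>'" by (auto simp: fun_eq_iff)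
    moreover have "\<nu>' \<in> fun_space.span B"
      unfolding \<nu>'_def
      by (rule fun_space.span_sum, rule fun_space.span_scale, rule fun_space.span_base) (simp add: B_def)
    ultimately show "\<nu> \<in> fun_space.span B" by simp
  qed
  have "B \<subseteq> V" unfolding B_def using T(1) by blast
  then have "fun_space.dim V = card B"
    using fun_space.dim_unique [OF _ span ind refl] by blast
  then have "fun_space.dim V = 2 * (n + 1)"
    unfolding B_def card_image [OF inj] cardK .
  then show ?thesis
    unfolding V_def [symmetric] fun_edim_def using finB span by auto
qed

lemma fun_edim_eigensections_trivial:
  assumes c: "hol_tensor c" and l: "6 * (l + 1)\<^sup>2 < 30" "6 * (l + 1)\<^sup>2 \<notin> {0, 6, 14, 24}"
  shows "fun_edim (eigensections (pt c ` S3) l) = 0"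
proof -
  have "eigensections (pt c ` S3) l = {0}"
  proof -
    have "\<nu> = (\<lambda>p. 0)" if \<nu>: "\<nu> \<in> eigensections (pt c ` S3) l" for \<nu>
      by (rule comp_inj [OF c \<nu>]) (rule ladder_4_trivial [OF comp_ladder [OF c \<nu>] l])
    then show ?thesis using eigensections_0 [OF c] by (auto simp: zero_fun_def)
  qed
  moreover have "{0} \<subseteq> fun_space.span {}" by (simp add: fun_space.span_empty)
  moreover have "fun_space.dim {0 :: real^7 \<Rightarrow> real^7} = 0"
    using fun_space.dim_unique [of "{}" "{0 :: real^7 \<Rightarrow> real^7}" 0] by (simp add: fun_space.span_empty fun_space.independent_empty)
  ultimately show ?thesis unfolding fun_edim_def by (metis finite.emptyI zero_enat_def)
qed

section \<open>The Lie algebra of \<open>G\<^sub>2\<close>\<close>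

text \<open>A one-parameter subgroup of invertible matrices starts at an idempotent, hence at the identity.\<close>

lemma lie_algebra_velocity:
  assumes Z: "Z \<in> lie_algebra K" and K: "K \<subseteq> {A. invertible A}"
  obtains \<gamma> where "\<gamma> 0 = mat 1" "\<And>t. \<gamma> t \<in> K" "\<And>v. ((\<lambda>t. \<gamma> t *v v) has_vector_derivative Z *v v) (at 0)"
proof -
  obtain \<gamma> where \<gamma>: "\<And>s t. \<gamma> (s + t) = \<gamma> s ** \<gamma> t" "\<And>t. \<gamma> t \<in> K" "(\<gamma> has_vector_derivative Z) (at 0)"
    using Z unfolding lie_algebra_def by blast
  have "invertible (\<gamma> 0)" using \<gamma>(2) K by blast
  then obtain B where B: "B ** \<gamma> 0 = mat 1" unfolding invertible_def by blast
  have "\<gamma> 0 ** \<gamma> 0 = \<gamma> 0" using \<gamma>(1) [of 0 0] by simp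
  then have "B ** (\<gamma> 0 ** \<gamma> 0) = B ** \<gamma> 0" by simp
  then have 1: "\<gamma> 0 = mat 1" by (simp add: matrix_mul_assoc B)
  have "bounded_linear (\<lambda>A :: real^7^7. A *v v)" for v
    by (simp add: linear_conv_bounded_linear [symmetric] linear_iff matrix_vector_mult_add_rdistrib scaleR_matrix_vector_assoc)
  then have "((\<lambda>t. \<gamma> t *v v) has_vector_derivative Z *v v) (at 0)" for v
    using bounded_linear.has_vector_derivative \<gamma>(3) by blast
  then show thesis using that 1 \<gamma>(2) by blast
qed

text \<open>The derivations of \<open>phi\<close>: the linearised condition for membership in \<open>G2\<close>.\<close>

definition phi_der :: "real^7^7 \<Rightarrow> bool" where
  "phi_der Z \<longleftrightarrow> (\<forall>u v w. phi (Z *v u) v w + phi u (Z *v v) w + phi u v (Z *v w) = 0)"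

lemma has_vector_derivative_phi:
  assumes "(f has_vector_derivative f') (at t)" "(g has_vector_derivative g') (at t)" "(h has_vector_derivative h') (at t)"
  shows "((\<lambda>t. phi (f t) (g t) (h t)) has_vector_derivative phi f' (g t) (h t) + phi (f t) g' (h t) + phi (f t) (g t) h') (at t)"
proof -
  have "((\<lambda>t. cross (f t) (g t) \<bullet> h t) has_vector_derivative
      (cross (f t) (g t) \<bullet> h' + (cross (f t) g' + cross f' (g t)) \<bullet> h t)) (at t)"
    by (rule bounded_bilinear.has_vector_derivative [OF bounded_bilinear_inner
          bounded_bilinear.has_vector_derivative [OF bounded_bilinear_cross assms(1,2)] assms(3)])
  then show ?thesis
    unfolding phi_eq_inner_cross by (simp add: inner_add_left algebra_simps)
qed

lemma lie_algebra_G2_der: "lie_algebra G2 \<subseteq> {Z. phi_der Z}"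
proof
  fix Z assume "Z \<in> lie_algebra G2"
  moreover have "G2 \<subseteq> {A. invertible A}" by (auto simp: G2_def)
  ultimately obtain \<gamma> where \<gamma>: "\<gamma> 0 = mat 1" "\<And>t. \<gamma> t \<in> G2" "\<And>v. ((\<lambda>t. \<gamma> t *v v) has_vector_derivative Z *v v) (at 0)"
    by (rule lie_algebra_velocity) blast
  have "phi (Z *v u) v w + phi u (Z *v v) w + phi u v (Z *v w) = 0" for u v w
  proof -
    have "((\<lambda>t. phi (\<gamma> t *v u) (\<gamma> t *v v) (\<gamma> t *v w)) has_vector_derivative
        phi (Z *v u) v w + phi u (Z *v v) w + phi u v (Z *v w)) (at 0)"
      using has_vector_derivative_phi [OF \<gamma>(3) [of u] \<gamma>(3) [of v] \<gamma>(3) [of w]] by (simp add: \<gamma>(1))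
    moreover have "(\<lambda>t. phi (\<gamma> t *v u) (\<gamma> t *v v) (\<gamma> t *v w)) = (\<lambda>t. phi u v w)"
      using \<gamma>(2) by (auto simp: G2_def)
    ultimately show ?thesis
      using vector_derivative_unique_at [OF _ has_vector_derivative_const [of "phi u v w" "at 0"]] by metis
  qed
  then show "Z \<in> {Z. phi_der Z}" by (simp add: phi_der_def)
qed

text \<open>For \<open>Z\<^sup>3 = - Z\<close> the exponential series is \<open>1 + sin t Z + (1 - cos t) Z\<^sup>2\<close>.  Along this group
  the derivative of \<open>phi\<close> vanishes, so \<open>phi\<close> is preserved.\<close>

lemma lie_algebra_G2I:
  assumes Z: "phi_der Z" and cube: "Z ** (Z ** Z) = - Z"
  shows "Z \<in> lie_algebra G2"
proof -
  define \<gamma> where "\<gamma> = (\<lambda>t. mat 1 + sin t *\<^sub>R Z + (1 - cos t) *\<^sub>R (Z ** Z))"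
  have mult: "A ** (B + C) = A ** B + A ** C" "(B + C) ** A = B ** A + C ** A"
    "A ** (B - C) = A ** B - A ** C" "(B - C) ** A = B ** A - C ** A"
    "A ** (r *\<^sub>R B) = r *\<^sub>R (A ** B)" "(r *\<^sub>R A) ** B = r *\<^sub>R (A ** B)" "A ** (- B) = - (A ** B)" for A B C :: "real^7^7" and r
    by (simp_all add: matrix_matrix_mult_def vec_eq_iff sum.distrib sum_subtractf sum_distrib_left sum_negf [symmetric] algebra_simps)
  have cube': "(Z ** Z) ** Z = - Z" "(Z ** Z) ** (Z ** Z) = - (Z ** Z)"
    using cube by (simp_all add: matrix_mul_assoc [symmetric] mult)
  have add: "\<gamma> (s + t) = \<gamma> s ** \<gamma> t" for s t
    unfolding \<gamma>_def
    by (simp add: mult cube cube' sin_add cos_add algebra_simps)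
  have X\<gamma>: "Z ** \<gamma> t = cos t *\<^sub>R Z + sin t *\<^sub>R (Z ** Z)" for t
    unfolding \<gamma>_def by (simp add: mult cube algebra_simps)
  have der: "(\<gamma> has_vector_derivative Z ** \<gamma> t) (at t)" for t
  proof -
    have "(sin has_real_derivative cos t) (at t)" "((\<lambda>t. 1 - cos t) has_real_derivative sin t) (at t)"
      by (auto intro!: derivative_eq_intros)
    note d = this [unfolded has_real_derivative_iff_has_vector_derivative]
    show ?thesis
      unfolding X\<gamma> unfolding \<gamma>_def
      using has_vector_derivative_add [OF has_vector_derivative_add [OF has_vector_derivative_const [of "mat 1 :: real^7^7"]
          bounded_linear.has_vector_derivative [OF bounded_linear_scaleR_left [of Z] d(1)]]
          bounded_linear.has_vector_derivative [OF bounded_linear_scaleR_left [of "Z ** Z"] d(2)]]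
      by (simp only: add_0)
  qed
  have bl: "bounded_linear (\<lambda>A :: real^7^7. A *v v)" for v
    by (simp add: linear_conv_bounded_linear [symmetric] linear_iff matrix_vector_mult_add_rdistrib scaleR_matrix_vector_assoc)
  have derv: "((\<lambda>t. \<gamma> t *v v) has_vector_derivative Z *v (\<gamma> t *v v)) (at t)" for v t
    using bounded_linear.has_vector_derivative [OF bl der] by (simp add: matrix_vector_mul_assoc)
  have 0: "\<gamma> 0 = mat 1" by (simp add: \<gamma>_def)
  have inv: "\<gamma> t ** \<gamma> (- t) = mat 1" for t using add [of t "- t"] 0 by simp
  have "\<gamma> t \<in> G2" for t
  proof -
    have "invertible (\<gamma> t)" unfolding invertible_def using inv [of t] inv [of "- t"] by auto
    moreover have "phi (\<gamma> t *v u) (\<gamma> t *v v) (\<gamma> t *v w) = phi u v w" for u v w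
    proof -
      have "((\<lambda>t. phi (\<gamma> t *v u) (\<gamma> t *v v) (\<gamma> t *v w)) has_vector_derivative 0) (at t)" for t
        using has_vector_derivative_phi [OF derv [of u] derv [of v] derv [of w]]
        by (simp only: Z [unfolded phi_der_def, rule_format])
      then have "((\<lambda>t. phi (\<gamma> t *v u) (\<gamma> t *v v) (\<gamma> t *v w)) has_real_derivative 0) (at t)" for t
        by (simp add: has_real_derivative_iff_has_vector_derivative)
      then have "phi (\<gamma> t *v u) (\<gamma> t *v v) (\<gamma> t *v w) = phi (\<gamma> 0 *v u) (\<gamma> 0 *v v) (\<gamma> 0 *v w)"
        using DERIV_isconst_all [of "\<lambda>t. phi (\<gamma> t *v u) (\<gamma> t *v v) (\<gamma> t *v w)"] by blast
      then show ?thesis by (simp add: 0)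
    qed
    ultimately show ?thesis by (simp add: G2_def)
  qed
  moreover have "(\<gamma> has_vector_derivative Z) (at 0)" using der [of 0] 0 by simp
  ultimately show ?thesis unfolding lie_algebra_def using add by blast
qed

text \<open>For each \<open>k\<close> there are three pairs \<open>i < j\<close> with \<open>e\<^sub>i \<times> e\<^sub>j = \<plusminus> e\<^sub>k\<close>.  The three entries at
  these places, with the sign of the product, are \<open>u\<^sub>k\<close>, \<open>v\<^sub>k\<close> and \<open>- u\<^sub>k - v\<^sub>k\<close>.\<close>

definition g2_matrix :: "(real^7) \<times> (real^7) \<Rightarrow> real^7^7" where
  "g2_matrix = (\<lambda>(u, v). vector [
     vector [0, u $ 3, - u $ 2, u $ 5, - u $ 4, - u $ 7, u $ 6],
     vector [- u $ 3, 0, u $ 1, v $ 7, - v $ 6, v $ 5, - v $ 4],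
     vector [u $ 2, - u $ 1, 0, u $ 6 + v $ 6, u $ 7 + v $ 7, - u $ 4 - v $ 4, - u $ 5 - v $ 5],
     vector [- u $ 5, - v $ 7, - u $ 6 - v $ 6, 0, v $ 1, - v $ 3, v $ 2],
     vector [u $ 4, v $ 6, - u $ 7 - v $ 7, - v $ 1, 0, u $ 2 + v $ 2, u $ 3 + v $ 3],
     vector [u $ 7, - v $ 5, u $ 4 + v $ 4, v $ 3, - u $ 2 - v $ 2, 0, u $ 1 + v $ 1],
     vector [- u $ 6, v $ 4, u $ 5 + v $ 5, - v $ 2, - u $ 3 - v $ 3, - u $ 1 - v $ 1, 0]])"

text \<open>The equations \<open>Eijk\<close> for the basis vectors express the diagonal entries, the skewness and
  the seven relations among the entries above the diagonal; each of these is a combination of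
  few equations.\<close>

lemma phi_der_g2_matrix:
  assumes Z: "phi_der Z"
  shows "Z \<in> range g2_matrix"
proof -
  note simps = phi_eq_inner_cross column_def cross_def inner_vec_def sum_7 axis_def
  have e: "phi (column i Z) (axis j 1) (axis k 1) + phi (axis i 1) (column j Z) (axis k 1)
      + phi (axis i 1) (axis j 1) (column k Z) = 0" for i j k
    using Z unfolding phi_der_def matrix_vector_mult_basis [symmetric] by blast
  note E123 = e [of 1 2 3, simplified simps, simplified]
  note E124 = e [of 1 2 4, simplified simps, simplified]
  note E125 = e [of 1 2 5, simplified simps, simplified]
  note E126 = e [of 1 2 6, simplified simps, simplified]
  note E127 = e [of 1 2 7, simplified simps, simplified]
  note E134 = e [of 1 3 4, simplified simps, simplified]
  note E135 = e [of 1 3 5, simplified simps, simplified]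
  note E136 = e [of 1 3 6, simplified simps, simplified]
  note E137 = e [of 1 3 7, simplified simps, simplified]
  note E145 = e [of 1 4 5, simplified simps, simplified]
  note E146 = e [of 1 4 6, simplified simps, simplified]
  note E147 = e [of 1 4 7, simplified simps, simplified]
  note E156 = e [of 1 5 6, simplified simps, simplified]
  note E157 = e [of 1 5 7, simplified simps, simplified]
  note E167 = e [of 1 6 7, simplified simps, simplified]
  note E234 = e [of 2 3 4, simplified simps, simplified]
  note E235 = e [of 2 3 5, simplified simps, simplified]
  note E236 = e [of 2 3 6, simplified simps, simplified]
  note E237 = e [of 2 3 7, simplified simps, simplified]
  note E245 = e [of 2 4 5, simplified simps, simplified]
  note E246 = e [of 2 4 6, simplified simps, simplified]
  note E247 = e [of 2 4 7, simplified simps, simplified]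
  note E256 = e [of 2 5 6, simplified simps, simplified]
  note E257 = e [of 2 5 7, simplified simps, simplified]
  note E267 = e [of 2 6 7, simplified simps, simplified]
  note E345 = e [of 3 4 5, simplified simps, simplified]
  note E346 = e [of 3 4 6, simplified simps, simplified]
  note E347 = e [of 3 4 7, simplified simps, simplified]
  note E356 = e [of 3 5 6, simplified simps, simplified]
  note E357 = e [of 3 5 7, simplified simps, simplified]
  note E367 = e [of 3 6 7, simplified simps, simplified]
  note E456 = e [of 4 5 6, simplified simps, simplified]
  note E457 = e [of 4 5 7, simplified simps, simplified]
  note E467 = e [of 4 6 7, simplified simps, simplified]
  note E567 = e [of 5 6 7, simplified simps, simplified]
  have r1: "Z $ 1 $ 1 = 0"
    using E123 E145 E167 E247 E256 E346 E357 by linarith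
  have r2: "Z $ 2 $ 2 = 0"
    using E123 E145 E167 E247 E256 E346 E357 by linarith
  have r3: "Z $ 3 $ 3 = 0"
    using E123 E145 E167 E247 E256 E346 E357 by linarith
  have r4: "Z $ 4 $ 4 = 0"
    using E123 E145 E167 E247 E256 E346 E357 by linarith
  have r5: "Z $ 5 $ 5 = 0"
    using E123 E145 E167 E247 E256 E346 E357 by linarith
  have r6: "Z $ 6 $ 6 = 0"
    using E123 E145 E167 E247 E256 E346 E357 by linarith
  have r7: "Z $ 7 $ 7 = 0"
    using E123 E145 E167 E247 E256 E346 E357 by linarith
  have r8: "Z $ 2 $ 1 = - Z $ 1 $ 2"
    using E147 E156 E245 E267 by linarith
  have r9: "Z $ 3 $ 1 = - Z $ 1 $ 3"
    using E146 E157 E345 E367 by linarith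
  have r10: "Z $ 4 $ 1 = - Z $ 1 $ 4"
    using E127 E136 E234 E467 by linarith
  have r11: "Z $ 5 $ 1 = - Z $ 1 $ 5"
    using E126 E137 E235 E567 by linarith
  have r12: "Z $ 6 $ 1 = - Z $ 1 $ 6"
    using E125 E134 E236 E456 by linarith
  have r13: "Z $ 7 $ 1 = - Z $ 1 $ 7"
    using E124 E135 E237 E457 by linarith
  have r14: "Z $ 3 $ 2 = - Z $ 2 $ 3"
    using E246 E257 E347 E356 by linarith
  have r15: "Z $ 4 $ 2 = - Z $ 2 $ 4"
    using E125 E134 E236 E456 by linarith
  have r16: "Z $ 5 $ 2 = - Z $ 2 $ 5"
    using E124 E135 E237 E457 by linarith
  have r17: "Z $ 6 $ 2 = - Z $ 2 $ 6"
    using E127 E136 E234 E467 by linarith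
  have r18: "Z $ 7 $ 2 = - Z $ 2 $ 7"
    using E126 E137 E235 E567 by linarith
  have r19: "Z $ 4 $ 3 = - Z $ 3 $ 4"
    using E124 E135 E237 E457 by linarith
  have r20: "Z $ 5 $ 3 = - Z $ 3 $ 5"
    using E125 E134 E236 E456 by linarith
  have r21: "Z $ 6 $ 3 = - Z $ 3 $ 6"
    using E126 E137 E235 E567 by linarith
  have r22: "Z $ 7 $ 3 = - Z $ 3 $ 7"
    using E127 E136 E234 E467 by linarith
  have r23: "Z $ 5 $ 4 = - Z $ 4 $ 5"
    using E246 E257 E347 E356 by linarith
  have r24: "Z $ 6 $ 4 = - Z $ 4 $ 6"
    using E147 E156 E245 E267 by linarith
  have r25: "Z $ 7 $ 4 = - Z $ 4 $ 7"
    using E146 E157 E345 E367 by linarith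
  have r26: "Z $ 6 $ 5 = - Z $ 5 $ 6"
    using E146 E157 E345 E367 by linarith
  have r27: "Z $ 7 $ 5 = - Z $ 5 $ 7"
    using E147 E156 E245 E267 by linarith
  have r28: "Z $ 7 $ 6 = - Z $ 6 $ 7"
    using E246 E257 E347 E356 by linarith
  have r29: "Z $ 6 $ 7 = Z $ 2 $ 3 + Z $ 4 $ 5"
    using E246 E257 E347 E356 by linarith
  have r30: "Z $ 5 $ 6 = - Z $ 1 $ 3 + Z $ 4 $ 7"
    using E367 by linarith
  have r31: "Z $ 5 $ 7 = Z $ 1 $ 2 - Z $ 4 $ 6"
    using E267 by linarith
  have r32: "Z $ 3 $ 6 = Z $ 1 $ 5 + Z $ 2 $ 7"
    using E567 by linarith
  have r33: "Z $ 3 $ 7 = - Z $ 1 $ 4 - Z $ 2 $ 6"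
    using E467 by linarith
  have r34: "Z $ 3 $ 4 = Z $ 1 $ 7 - Z $ 2 $ 5"
    using E457 by linarith
  have r35: "Z $ 3 $ 5 = - Z $ 1 $ 6 + Z $ 2 $ 4"
    using E456 by linarith
  note r = r1 r2 r3 r4 r5 r6 r7 r8 r9 r10 r11 r12 r13 r14 r15 r16 r17 r18 r19 r20 r21 r22 r23 r24 r25 r26 r27 r28 r29 r30 r31 r32 r33 r34 r35
  have "Z = g2_matrix (vector [Z $ 2 $ 3, - Z $ 1 $ 3, Z $ 1 $ 2, - Z $ 1 $ 5, Z $ 1 $ 4, Z $ 1 $ 7, - Z $ 1 $ 6],
      vector [Z $ 4 $ 5, Z $ 4 $ 7, - Z $ 4 $ 6, - Z $ 2 $ 7, Z $ 2 $ 6, - Z $ 2 $ 5, Z $ 2 $ 4])"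
    unfolding g2_matrix_def case_prod_conv vec_eq_iff forall_7 vector_7
    by (intro conjI) (simp_all only: vector_7 r minus_minus minus_add_distrib minus_diff_eq add_0 diff_conv_add_uminus ac_simps)
  then show ?thesis by blast
qed

lemma linear_g2_matrix: "linear g2_matrix"
  by (rule linearI) (simp_all add: g2_matrix_def vec_eq_iff forall_7 case_prod_beta algebra_simps)

lemma inj_g2_matrix: "inj g2_matrix"
  unfolding linear_injective_0 [OF linear_g2_matrix]
  by (auto simp: g2_matrix_def vec_eq_iff forall_7 zero_prod_def)

lemma g2_matrix_vector:
  "g2_matrix (a, b) *v x = vector [
     (a $ 3) * x $ 2 + (- a $ 2) * x $ 3 + (a $ 5) * x $ 4 + (- a $ 4) * x $ 5 + (- a $ 7) * x $ 6 + (a $ 6) * x $ 7,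
     (- a $ 3) * x $ 1 + (a $ 1) * x $ 3 + (b $ 7) * x $ 4 + (- b $ 6) * x $ 5 + (b $ 5) * x $ 6 + (- b $ 4) * x $ 7,
     (a $ 2) * x $ 1 + (- a $ 1) * x $ 2 + (a $ 6 + b $ 6) * x $ 4 + (a $ 7 + b $ 7) * x $ 5 + (- a $ 4 - b $ 4) * x $ 6 + (- a $ 5 - b $ 5) * x $ 7,
     (- a $ 5) * x $ 1 + (- b $ 7) * x $ 2 + (- a $ 6 - b $ 6) * x $ 3 + (b $ 1) * x $ 5 + (- b $ 3) * x $ 6 + (b $ 2) * x $ 7,
     (a $ 4) * x $ 1 + (b $ 6) * x $ 2 + (- a $ 7 - b $ 7) * x $ 3 + (- b $ 1) * x $ 4 + (a $ 2 + b $ 2) * x $ 6 + (a $ 3 + b $ 3) * x $ 7,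
     (a $ 7) * x $ 1 + (- b $ 5) * x $ 2 + (a $ 4 + b $ 4) * x $ 3 + (b $ 3) * x $ 4 + (- a $ 2 - b $ 2) * x $ 5 + (a $ 1 + b $ 1) * x $ 7,
     (- a $ 6) * x $ 1 + (b $ 4) * x $ 2 + (a $ 5 + b $ 5) * x $ 3 + (- b $ 2) * x $ 4 + (- a $ 3 - b $ 3) * x $ 5 + (- a $ 1 - b $ 1) * x $ 6]"
  by (simp add: g2_matrix_def vec_eq_iff forall_7 matrix_vector_mult_def sum_7)

lemma g2_matrix_skew: "(g2_matrix (a, b) *v x) \<bullet> y + x \<bullet> (g2_matrix (a, b) *v y) = 0"
  unfolding g2_matrix_vector inner_vec_def sum_7 vector_7 inner_real_def by (simp only: distrib_left distrib_right left_diff_distrib right_diff_distrib minus_mult_left [symmetric] minus_mult_right [symmetric]) (simp add: algebra_simps)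

lemma phi_der_skew: "phi_der Z \<Longrightarrow> (Z *v x) \<bullet> y + x \<bullet> (Z *v y) = 0"
  using phi_der_g2_matrix g2_matrix_skew by fastforce

text \<open>The images of basis vectors are complex structures on the span of four of the \<open>e\<^sub>i\<close> and vanish
  on the other three, so they satisfy \<open>Z\<^sup>3 = - Z\<close>.\<close>

lemma g2_matrix_Basis:
  assumes "b \<in> Basis"
  shows "g2_matrix b \<in> lie_algebra G2"
proof -
  obtain k where b: "b = (axis k 1, 0) \<or> b = (0, axis k 1)"
    using assms by (auto simp: Basis_prod_def Basis_vec_def)
  have n: "(axis k (1 :: real) :: real^7) $ i = (if i = k then 1 else 0)" for i k by (simp add: axis_def)
  have skew: "(g2_matrix b *v x) \<bullet> y + x \<bullet> (g2_matrix b *v y) = 0" for x y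
    using g2_matrix_skew by (cases b) blast
  have "cross (g2_matrix b *v x) y + cross x (g2_matrix b *v y) = g2_matrix b *v cross x y" for x y
    using b exhaust_7 [of k]
    by (elim disjE; simp add: g2_matrix_vector n vec_eq_iff forall_7 cross_def; simp add: algebra_simps)
  then have der: "phi_der (g2_matrix b)"
    unfolding phi_der_def phi_eq_inner_cross by (metis skew inner_add_left)
  have "g2_matrix b *v (g2_matrix b *v (g2_matrix b *v x)) = - (g2_matrix b *v x)" for x
    using b exhaust_7 [of k]
    by (elim disjE; simp add: g2_matrix_vector n vec_eq_iff forall_7)
  moreover have neg: "(- A) *v x = - (A *v x)" for A :: "real^7^7" and x
    by (simp add: matrix_vector_mult_def vec_eq_iff sum_negf)
  ultimately have "g2_matrix b ** (g2_matrix b ** g2_matrix b) = - g2_matrix b"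
    by (simp add: matrix_eq matrix_vector_mul_assoc [symmetric] neg)
  with der show ?thesis by (rule lie_algebra_G2I)
qed

lemma dim_lie_algebra_G2: "dim (lie_algebra G2) = 14"
proof -
  have "range g2_matrix = span (g2_matrix ` Basis)"
    unfolding linear_span_image [OF linear_g2_matrix] by simp
  also have "\<dots> \<subseteq> span (lie_algebra G2)"
    by (rule span_mono) (use g2_matrix_Basis in blast)
  finally have "dim (range g2_matrix) \<le> dim (lie_algebra G2)"
    using dim_subset dim_span by metis
  moreover have "lie_algebra G2 \<subseteq> range g2_matrix"
    using lie_algebra_G2_der phi_der_g2_matrix by blast
  then have "dim (lie_algebra G2) \<le> dim (range g2_matrix)" by (rule dim_subset)
  moreover have "dim (range g2_matrix) = 14"
    using dim_image_eq [OF linear_g2_matrix, of UNIV] inj_g2_matrix by simp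
  ultimately show ?thesis by simp
qed

section \<open>Constancy on the three-sphere\<close>

lemma mem_S3_cnj: "q \<in> S3 \<longleftrightarrow> fst q * cnj (fst q) + snd q * cnj (snd q) = 1"
proof -
  have "complex_of_real ((norm q)\<^sup>2) = fst q * cnj (fst q) + snd q * cnj (snd q)"
    by (simp only: norm_prod_def real_sqrt_pow2 sum_power2_ge_zero of_real_add complex_norm_square)
  moreover have "norm q = 1 \<longleftrightarrow> (norm q)\<^sup>2 = 1"
    using power2_eq_iff_nonneg [of "norm q" 1] by simp
  ultimately show ?thesis unfolding mem_sphere_0 by (metis of_real_eq_1_iff)
qed

lemma flow_invariant:
  fixes f :: "complex \<times> complex \<Rightarrow> complex"
  assumes L: "unit_field L" and d: "\<And>q. q \<in> S3 \<Longrightarrow> ((\<lambda>t. f (flow L t q)) has_vector_derivative 0) (at 0)" and q: "q \<in> S3"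
  shows "f (flow L t q) = f q"
proof -
  have "((\<lambda>t. f (flow L t q)) has_vector_derivative 0) (at t)" for t
  proof -
    have "((\<lambda>s. f (flow L s (flow L t q))) has_vector_derivative 0) (at (t - t))"
      using d [OF flow_S3 [OF L q]] by simp
    then have "(((\<lambda>s. f (flow L s (flow L t q))) \<circ> (\<lambda>s. s - t)) has_vector_derivative 1 *\<^sub>R 0) (at t)"
      by (intro vector_diff_chain_at) (auto intro!: derivative_eq_intros simp: has_vector_derivative_def)
    then show ?thesis by (simp add: o_def flow_add [OF L])
  qed
  then obtain k where "\<And>t. f (flow L t q) = k"
    using has_vector_derivative_zero_constant [of UNIV "\<lambda>t. f (flow L t q)"] by auto
  from this [of t] this [of 0] show ?thesis by simp
qed

text \<open>Conjugating the flow of \<open>I2\<close> by the eighth turn \<open>flow I1 (pi / 4)\<close> gives the flow of \<open>I3\<close>.\<close>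

lemma flow_I3_conj: "flow I1 (- (pi / 4)) (flow I2 t (flow I1 (pi / 4) q)) = flow I3 (- t) q"
proof -
  define r :: real where "r = sqrt 2 / 2"
  define k :: complex where "k = of_real r"
  have rr: "r * r = 1/2" by (simp add: r_def)
  have kk: "k * k = 1/2" unfolding k_def of_real_mult [symmetric] rr by simp
  have r: "cos (pi / 4) = r" "sin (pi / 4) = r" unfolding r_def by (rule cos_45, rule sin_45)
  have ck: "cnj k = k" by (simp add: k_def)
  have f1: "flow I1 (pi / 4) q = (k * (fst q - cnj (snd q)), k * (snd q + cnj (fst q)))" for q
    by (simp add: flow_def I1_def scaleR_conv_of_real r k_def algebra_simps prod_eq_iff)
  have f2: "flow I1 (- (pi / 4)) q = (k * (fst q + cnj (snd q)), k * (snd q - cnj (fst q)))" for q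
    by (simp add: flow_def I1_def scaleR_conv_of_real r k_def algebra_simps prod_eq_iff)
  have f3: "flow I2 t q = (of_real (cos t) * fst q - of_real (sin t) * \<i> * cnj (snd q), of_real (cos t) * snd q + of_real (sin t) * \<i> * cnj (fst q))" for q
    by (simp add: flow_def I2_def scaleR_conv_of_real algebra_simps prod_eq_iff)
  have f4: "flow I3 (- t) q = (of_real (cos t) * fst q - of_real (sin t) * \<i> * fst q, of_real (cos t) * snd q - of_real (sin t) * \<i> * snd q)"
    by (simp add: flow_def I3_def scaleR_conv_of_real algebra_simps prod_eq_iff)
  show ?thesis
    unfolding f1 f2 f3 f4 fst_conv snd_conv prod.inject complex_cnj_add complex_cnj_diff complex_cnj_mult complex_cnj_cnj
      complex_cnj_complex_of_real complex_cnj_i ck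
    using kk by (intro conjI) algebra+
qed

text \<open>A function with vanishing \<open>up\<close> and \<open>dn\<close> is invariant under the flows of \<open>I1\<close> and \<open>I2\<close>, hence under
  that of \<open>I3\<close>, and by Euler angles these flows join any two points.\<close>

lemma updn_zero_const:
  assumes d: "\<And>q. q \<in> S3 \<Longrightarrow> has_updn f 0 0 q" and q: "q \<in> S3"
  shows "f q = f (1, 0)"
proof -
  have one: "(1, 0) \<in> S3" unfolding mem_S3_cnj by simp
  have d12: "((\<lambda>t. f (flow I1 t q)) has_vector_derivative 0) (at 0)" "((\<lambda>t. f (flow I2 t q)) has_vector_derivative 0) (at 0)"
    if "q \<in> S3" for q using d [OF that] by (simp_all add: has_updn_def)
  have i1: "f (flow I1 t q) = f q" if "q \<in> S3" for t q
    by (rule flow_invariant [OF unit_field_I(1)], rule d12(1), assumption, rule that)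
  have i2: "f (flow I2 t q) = f q" if "q \<in> S3" for t q
    by (rule flow_invariant [OF unit_field_I(2)], rule d12(2), assumption, rule that)
  have i3: "f (flow I3 t q) = f q" if q: "q \<in> S3" for t q
  proof -
    note s1 = flow_S3 [OF unit_field_I(1) q, of "pi / 4"]
    note s2 = flow_S3 [OF unit_field_I(2) s1, of "- t"]
    show ?thesis
      using i1 [OF s2, of "- (pi / 4)"] i2 [OF s1, of "- t"] i1 [OF q, of "pi / 4"] unfolding flow_I3_conj by simp
  qed
  have "(cmod (fst q))\<^sup>2 + (cmod (snd q))\<^sup>2 = 1"
    using q unfolding mem_S3_cnj complex_norm_square [symmetric] by (metis of_real_add of_real_eq_1_iff)
  then obtain t where t: "cmod (fst q) = cos t" "cmod (snd q) = sin t"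
    using sincos_total_pi_half [of "cmod (fst q)" "cmod (snd q)"] by auto
  define a b where "a = (Arg (fst q) + Arg (snd q)) / 2" and "b = (Arg (fst q) - Arg (snd q)) / 2"
  have ab: "a + b = Arg (fst q)" "a - b = Arg (snd q)" by (simp_all add: a_def b_def field_simps)
  have "flow I1 t (flow I3 b (1, 0)) = (of_real (cos t) * cis b, of_real (sin t) * cis (- b))"
    by (simp add: flow_I3 flow_def [of I1] I1_def scaleR_conv_of_real cis_cnj)
  then have "flow I3 a (flow I1 t (flow I3 b (1, 0))) = (of_real (cos t) * (cis a * cis b), of_real (sin t) * (cis a * cis (- b)))"
    by (simp add: flow_I3 algebra_simps)
  also have "\<dots> = (rcis (cmod (fst q)) (Arg (fst q)), rcis (cmod (snd q)) (Arg (snd q)))"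
    by (simp add: cis_mult ab rcis_def t)
  also have "\<dots> = q" by (simp add: rcis_cmod_Arg)
  finally have e: "q = flow I3 a (flow I1 t (flow I3 b (1, 0)))" ..
  note s1 = flow_S3 [OF unit_field_I(3) one, of b]
  note s2 = flow_S3 [OF unit_field_I(1) s1, of t]
  show ?thesis
    using i3 [OF s2, of a] i1 [OF s1, of t] i3 [OF one, of b] e by simp
qed

section \<open>The symmetries of the sphere\<close>

text \<open>The product of unit quaternions; left multiplications commute with the three flows.\<close>

definition lmul :: "complex \<times> complex \<Rightarrow> complex \<times> complex \<Rightarrow> complex \<times> complex" where
  "lmul p q = (fst p * fst q - cnj (snd p) * snd q, snd p * fst q + cnj (fst p) * snd q)"

lemma lmul_one: "lmul p (1, 0) = p" "lmul (1, 0) q = q"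
  by (simp_all add: lmul_def)

lemma lmul_assoc: "lmul (lmul p q) r = lmul p (lmul q r)"
  by (simp add: lmul_def algebra_simps)

lemma lmul_S3:
  assumes "p \<in> S3" "q \<in> S3" shows "lmul p q \<in> S3"
proof -
  have "fst (lmul p q) * cnj (fst (lmul p q)) + snd (lmul p q) * cnj (snd (lmul p q))
      = (fst p * cnj (fst p) + snd p * cnj (snd p)) * (fst q * cnj (fst q) + snd q * cnj (snd q))"
    by (simp add: lmul_def algebra_simps)
  then show ?thesis using assms unfolding mem_S3_cnj by simp
qed

lemma lmul_inverse:
  assumes p: "p \<in> S3"
  obtains p' where "p' \<in> S3" "lmul p p' = (1, 0)" "lmul p' p = (1, 0)"
proof
  show "(cnj (fst p), - snd p) \<in> S3" using p unfolding mem_S3_cnj by (simp add: mult.commute)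
  show "lmul p (cnj (fst p), - snd p) = (1, 0)" "lmul (cnj (fst p), - snd p) p = (1, 0)"
    using p unfolding mem_S3_cnj by (simp_all add: lmul_def mult.commute)
qed

lemma flow_lmul:
  "flow I1 t (lmul p q) = lmul p (flow I1 t q)" "flow I2 t (lmul p q) = lmul p (flow I2 t q)" "flow I3 t (lmul p q) = lmul p (flow I3 t q)"
  by (simp_all add: flow_def lmul_def I1_def I2_def I3_def scaleR_conv_of_real algebra_simps)

lemma has_updn_lmul: "has_updn f a b (lmul p q) \<Longrightarrow> has_updn (\<lambda>q. f (lmul p q)) a b q"
  unfolding has_updn_def flow_lmul .

text \<open>Sixty times the inverse of the pairing of \<open>H\<^sub>a\<close> with \<open>H\<^bsub>6-a\<^esub>\<close>.\<close>

definition wt :: "nat \<Rightarrow> complex" where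
  "wt a = (if a = 3 then 60 else if a = 2 \<or> a = 4 then - 45 else if a = 1 \<or> a = 5 then 18 else - 3)"

text \<open>With \<open>p = (1, 0)\<close> this is the resolution of the identity in the frame at \<open>q\<close>; in general it is the
  linear map that takes the frame at \<open>q\<close> to the frame at \<open>lmul p q\<close>.\<close>

definition tr :: "(7 \<Rightarrow> 3 \<Rightarrow> 3 \<Rightarrow> 3 \<Rightarrow> real) \<Rightarrow> complex \<times> complex \<Rightarrow> complex \<times> complex \<Rightarrow> 7 \<Rightarrow> 7 \<Rightarrow> complex" where
  "tr c p q i k = 1/60 * (\<Sum>a\<in>{0,1,2,3,4,5,6}. wt a * (G (c i) a (lmul p q) * G (c k) (6 - a) q))"

text \<open>The terms of the raised and of the lowered sum cancel in pairs, because of the weights.\<close>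

lemma tr_const:
  assumes c: "boruvka_tensor c" and p: "p \<in> S3" and q: "q \<in> S3"
  shows "tr c p q i k = tr c p (1, 0) i k"
proof (rule updn_zero_const [OF _ q])
  fix q assume q: "q \<in> S3"
  have h: "harmonic_tensor (c i)" for i using c by (simp add: boruvka_tensor_def)
  let ?P = "\<lambda>a. (6 - of_nat a) * G (c i) (a + 1) (lmul p q) * G (c k) (6 - a) q
      + G (c i) a (lmul p q) * ((6 - of_nat (6 - a)) * G (c k) ((6 - a) + 1) q)"
  let ?N = "\<lambda>a. - of_nat a * G (c i) (a - 1) (lmul p q) * G (c k) (6 - a) q
      + G (c i) a (lmul p q) * (- of_nat (6 - a) * G (c k) ((6 - a) - 1) q)"
  have "has_updn (\<lambda>q. G (c i) a (lmul p q) * G (c k) (6 - a) q) (?P a) (?N a) q" if "a \<in> {0,1,2,3,4,5,6}" for a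
  proof -
    have a: "a \<le> 6" "6 - a \<le> 6" using that by auto
    show ?thesis
      by (rule has_updn_mult [OF has_updn_lmul [OF has_updn_G [OF h lmul_S3 [OF p q] a(1)]] has_updn_G [OF h q a(2)]])
  qed
  then have "has_updn (\<lambda>q. tr c p q i k)
      (1/60 * (\<Sum>a\<in>{0,1,2,3,4,5,6}. wt a * ?P a)) (1/60 * (\<Sum>a\<in>{0,1,2,3,4,5,6}. wt a * ?N a)) q"
    unfolding tr_def by (intro has_updn_cmult has_updn_sum)
  moreover have "(\<Sum>a\<in>{0,1,2,3,4,5,6}. wt a * ?P a) = 0"
    by (simp add: wt_def One_nat_def [symmetric] del: One_nat_def)
  moreover have "(\<Sum>a\<in>{0,1,2,3,4,5,6}. wt a * ?N a) = 0"
    by (simp add: wt_def One_nat_def [symmetric] del: One_nat_def)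
  ultimately show "has_updn (\<lambda>q. tr c p q i k) 0 0 q" by simp
qed

lemma cdot_H_cases:
  assumes c: "boruvka_tensor c" and q: "q \<in> S3" and ab: "a \<le> 6" "b \<le> 6"
  shows "cdot (H c a q) (H c b q) = (if a + b = 6 then 60 / wt b else 0)"
proof (cases "a + b = 6")
  case True
  have "a \<in> {0,1,2,3,4,5,6}" using ab by auto
  moreover have "b = 6 - a" using True by simp
  moreover note cdot_H(1-4) [OF c q] cdot_H(2-4) [OF c q, unfolded cdot_commute [of "H c 4 q"] cdot_commute [of "H c 5 q"] cdot_commute [of "H c 6 q"]]
  ultimately show ?thesis by (elim insertE emptyE; simp add: wt_def One_nat_def [symmetric] del: One_nat_def)
next
  case False
  then show ?thesis using cdot_H(5) [OF c q ab] by simp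
qed

lemma tr_H:
  assumes c: "boruvka_tensor c" and q: "q \<in> S3" and b: "b \<le> 6"
  shows "(\<Sum>k\<in>UNIV. tr c p q i k * H c b q $ k) = H c b (lmul p q) $ i"
proof -
  have "(\<Sum>k\<in>UNIV. tr c p q i k * H c b q $ k)
      = (\<Sum>a\<in>{0,1,2,3,4,5,6}. 1/60 * wt a * G (c i) a (lmul p q) * cdot (H c (6 - a) q) (H c b q))"
    unfolding tr_def cdot_def sum_distrib_left sum_distrib_right
    by (subst sum.swap) (intro sum.cong refl, simp)
  also have "\<dots> = (\<Sum>a\<in>{0,1,2,3,4,5,6}. if a = b then G (c i) a (lmul p q) else 0)"
    by (intro sum.cong refl) (use b in \<open>auto simp: cdot_H_cases [OF c q] wt_def One_nat_def [symmetric] simp del: One_nat_def\<close>)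
  also have "\<dots> = G (c i) b (lmul p q)"
    using b by (subst sum.delta) (auto simp del: One_nat_def)
  finally show ?thesis by simp
qed

lemma cnj_G_index: "cnj (G (c i) 3 q) = G (c i) 3 q" "cnj (G (c i) 4 q) = - G (c i) 2 q" "cnj (G (c i) 5 q) = G (c i) 1 q"
  "cnj (G (c i) 6 q) = - G (c i) 0 q" "cnj (G (c i) 2 q) = - G (c i) 4 q" "cnj (G (c i) 1 q) = G (c i) 5 q" "cnj (G (c i) 0 q) = - G (c i) 6 q"
  for c :: "7 \<Rightarrow> 3 \<Rightarrow> 3 \<Rightarrow> 3 \<Rightarrow> real"
  using cnjv_H [of c q] unfolding vec_eq_iff cnjv_nth H_nth vector_uminus_component by blast+

lemma tr_real: "cnj (tr c p q i k) = tr c p q i k"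
  by (simp add: tr_def wt_def cnj_G_index One_nat_def [symmetric] del: One_nat_def)

definition cmv :: "real^7^7 \<Rightarrow> complex^7 \<Rightarrow> complex^7" where
  "cmv A u = (\<chi> i. \<Sum>k\<in>UNIV. of_real (A $ i $ k) * u $ k)"

lemma cmv_linear: "cmv A (u + v) = cmv A u + cmv A v" "cmv A (r *s u) = r *s cmv A u"
  by (simp_all add: cmv_def vec_eq_iff sum.distrib sum_distrib_left algebra_simps)

lemma cmv_cv: "cmv A (cv v) = cv (A *v v)"
  by (simp add: cmv_def vec_eq_iff matrix_vector_mult_def)

lemma cmv_cnjv: "cmv A (cnjv u) = cnjv (cmv A u)"
  by (simp add: cmv_def vec_eq_iff)

text \<open>The frame spans: a property of complex vectors that is stable under linear combinations and holds
  for the frame at one point holds for all real vectors.\<close>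

lemma frame_induct:
  assumes c: "boruvka_tensor c" and q: "q \<in> S3"
    and P: "\<And>u v. P u \<Longrightarrow> P v \<Longrightarrow> P (u + v)" "\<And>r u. P u \<Longrightarrow> P (r *s u)" "\<And>a. a \<le> 6 \<Longrightarrow> P (H c a q)"
  shows "P (cv v)"
proof -
  have n: "P (- u)" if "P u" for u using P(2) [OF that, of "- 1"] by simp
  have cn: "P (cnjv (H c j q))" if "j \<in> {4, 5, 6}" for j
    using that cnjv_H(2-4) [of c q] n [OF P(3)] P(3) by auto
  have R: "P (cv (RH c j \<zeta> q))" if "j \<in> {4, 5, 6}" for j \<zeta>
    unfolding cv_RH using that by (intro P(1) P(2) P(3) cn) auto
  show ?thesis
    by (subst frame_resolution [OF c q, of v], unfold cv_add cv_scaleR cv_pt, intro P(1) P(2) P(3) R) auto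
qed

lemma cv_cmv_eqI:
  assumes c: "boruvka_tensor c" and q: "q \<in> S3" and "\<And>a. a \<le> 6 \<Longrightarrow> cmv A (H c a q) = cmv B (H c a q)"
  shows "A = B"
proof -
  have "cmv A (cv v) = cmv B (cv v)" for v
    by (rule frame_induct [OF c q, of "\<lambda>u. cmv A u = cmv B u"]) (simp_all add: cmv_linear assms(3))
  then show ?thesis unfolding cmv_cv cv_eq_iff by (simp add: matrix_eq)
qed

text \<open>The matrix of \<open>tr\<close>, which is real because conjugation permutes the frame up to sign.\<close>

definition Rho :: "(7 \<Rightarrow> 3 \<Rightarrow> 3 \<Rightarrow> 3 \<Rightarrow> real) \<Rightarrow> complex \<times> complex \<Rightarrow> real^7^7" where
  "Rho c p = (\<chi> i k. Re (tr c p (1, 0) i k))"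

lemma one_S3: "(1, 0) \<in> S3"
  unfolding mem_S3_cnj by simp

lemma cmv_Rho:
  assumes c: "boruvka_tensor c" and p: "p \<in> S3" and q: "q \<in> S3" and b: "b \<le> 6"
  shows "cmv (Rho c p) (H c b q) = H c b (lmul p q)"
proof -
  have "of_real (Rho c p $ i $ k) = tr c p q i k" for i k
    using tr_real [of c p "(1, 0)" i k] tr_const [OF c p q, of i k] by (simp add: Rho_def complex_eq_iff)
  then show ?thesis using tr_H [OF c q b] by (simp add: cmv_def vec_eq_iff)
qed

lemma Rho_mult:
  assumes c: "boruvka_tensor c" and p: "p \<in> S3" "r \<in> S3"
  shows "Rho c (lmul p r) = Rho c p ** Rho c r"
proof (rule cv_cmv_eqI [OF c one_S3])
  fix a :: nat assume a: "a \<le> 6"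
  have m: "cmv (A ** B) u = cmv A (cmv B u)" for A B u
    unfolding cmv_def vec_eq_iff vec_lambda_beta matrix_matrix_mult_def sum_distrib_left sum_distrib_right of_real_sum
    by (subst sum.swap) (simp add: mult.assoc)
  show "cmv (Rho c (lmul p r)) (H c a (1, 0)) = cmv (Rho c p ** Rho c r) (H c a (1, 0))"
    unfolding m cmv_Rho [OF c lmul_S3 [OF p] one_S3 a] cmv_Rho [OF c p(2) one_S3 a]
      cmv_Rho [OF c p(1) lmul_S3 [OF p(2) one_S3] a] lmul_assoc ..
qed

lemma Rho_one:
  assumes c: "boruvka_tensor c"
  shows "Rho c (1, 0) = mat 1"
proof (rule cv_cmv_eqI [OF c one_S3])
  fix a :: nat assume a: "a \<le> 6"
  have "cmv (mat 1) u = u" for u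
    unfolding cmv_def vec_eq_iff mat_def vec_lambda_beta by (simp add: if_distrib [of of_real] if_distrib [of "\<lambda>x. x * _"] cong: if_cong)
  then show "cmv (Rho c (1, 0)) (H c a (1, 0)) = cmv (mat 1) (H c a (1, 0))"
    unfolding cmv_Rho [OF c one_S3 one_S3 a] lmul_one by simp
qed

lemma Rho_pt: "boruvka_tensor c \<Longrightarrow> p \<in> S3 \<Longrightarrow> q \<in> S3 \<Longrightarrow> Rho c p *v pt c q = pt c (lmul p q)"
  using cmv_Rho [of c p q 3] unfolding cv_pt [symmetric] cmv_cv cv_eq_iff by simp

lemma cross_H_const:
  assumes c: "hol_tensor c" and ab: "a \<le> 6" "b \<le> 6"
  shows "\<exists>k m. m \<le> 6 \<and> (\<forall>q\<in>S3. cross (H c a q) (H c b q) = k *s H c m q)"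
proof -
  define T where "T = (\<lambda>a b. \<exists>k m. m \<le> 6 \<and> (\<forall>q\<in>S3. cross (H c a q) (H c b q) = k *s H c m q))"
  have TI: "T a b \<and> T b a" if e: "\<And>q. q \<in> S3 \<Longrightarrow> cross (H c a q) (H c b q) = k *s H c m q" and "m \<le> 6" for a b k m
  proof
    show "T a b" unfolding T_def using that by blast
    have "cross (H c b q) (H c a q) = (- k) *s H c m q" if "q \<in> S3" for q
      using e [OF that] by (simp add: cross_skew [of "H c b q"] vector_smult_lneg)
    then show "T b a" unfolding T_def using \<open>m \<le> 6\<close> by blast
  qed
  have refl: "T a a" for a
    unfolding T_def by (intro exI [of _ 0] conjI ballI) (simp_all add: cross_refl)
  have l: "T 3 4 \<and> T 4 3" "T 3 5 \<and> T 5 3" "T 3 6 \<and> T 6 3" "T 2 5 \<and> T 5 2" "T 2 6 \<and> T 6 2" "T 4 5 \<and> T 5 4"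
    "T 4 6 \<and> T 6 4" "T 5 6 \<and> T 6 5" "T 1 6 \<and> T 6 1" "T 2 4 \<and> T 4 2" "T 1 5 \<and> T 5 1" "T 0 6 \<and> T 6 0"
    by (rule TI [OF cross_H(1) [OF c]] TI [OF cross_H(2) [OF c]] TI [OF cross_H(3) [OF c]] TI [OF cross_H(4) [OF c]]
        TI [OF cross_H(5) [OF c]] TI [OF cross_H(6) [OF c]] TI [OF cross_H(7) [OF c]] TI [OF cross_H(8) [OF c]]
        TI [OF cross_H(9) [OF c]] TI [OF cross_H(10) [OF c]] TI [OF cross_H(11) [OF c]] TI [OF cross_H(12) [OF c]], assumption, simp)+
  have l': "T 3 2 \<and> T 2 3" "T 3 1 \<and> T 1 3" "T 3 0 \<and> T 0 3" "T 2 1 \<and> T 1 2" "T 4 0 \<and> T 0 4" "T 5 0 \<and> T 0 5"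
    by (rule TI [OF cross_H_conj(1) [OF c]] TI [OF cross_H_conj(2) [OF c]] TI [OF cross_H_conj(3) [OF c]] TI [OF cross_H_conj(4) [OF c]]
        TI [OF cross_H_conj(7) [OF c]] TI [OF cross_H_conj(9) [OF c]], assumption, simp)+
  have l0: "T 2 0 \<and> T 0 2" "T 4 1 \<and> T 1 4" "T 1 0 \<and> T 0 1"
    by (rule TI [of _ _ 0 0]; simp add: cross_H_conj [OF c] del: mem_sphere_0 One_nat_def)+
  have "a \<in> {0,1,2,3,4,5,6}" "b \<in> {0,1,2,3,4,5,6}" using ab by auto
  then have "T a b"
    by (elim insertE emptyE; simp only: refl l l' l0)
  then show ?thesis unfolding T_def .
qed

text \<open>In the frame \<open>phi\<close> has constant coefficients, since the inner products and cross products of the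
  frame do not depend on the point.\<close>

lemma Rho_G2:
  assumes c: "hol_tensor c" and p: "p \<in> S3"
  shows "phi (Rho c p *v u) (Rho c p *v v) (Rho c p *v w) = phi u v w"
proof -
  have bt: "boruvka_tensor c" using c by (simp add: hol_tensor_def)
  let ?R = "cmv (Rho c p)" and ?q = "(1, 0) :: complex \<times> complex"
  note one = one_S3
  have cl: "cdot (u + u') v = cdot u v + cdot u' v" "cdot v (u + u') = cdot v u + cdot v u'"
    "cdot (r *s u) v = r * cdot u v" "cdot v (r *s u) = r * cdot v u" for u u' v :: "complex^7" and r
    by (simp_all add: cdot_def sum.distrib sum_distrib_left algebra_simps)
  have base: "cdot (cross (?R (H c a ?q)) (?R (H c b ?q))) (?R (H c d ?q)) = cdot (cross (H c a ?q) (H c b ?q)) (H c d ?q)"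
    if abd: "a \<le> 6" "b \<le> 6" "d \<le> 6" for a b d
  proof -
    obtain k m where k: "m \<le> 6" "\<forall>q\<in>S3. cross (H c a q) (H c b q) = k *s H c m q" using cross_H_const [OF c abd(1,2)] by blast
    show ?thesis
      unfolding cmv_Rho [OF bt p one abd(1)] cmv_Rho [OF bt p one abd(2)] cmv_Rho [OF bt p one abd(3)] lmul_one
        bspec [OF k(2) p] bspec [OF k(2) one] cl cdot_H_cases [OF bt p k(1) abd(3)] cdot_H_cases [OF bt one k(1) abd(3)] ..
  qed
  have 1: "cdot (cross (?R (H c a ?q)) (?R (H c b ?q))) (?R (cv w)) = cdot (cross (H c a ?q) (H c b ?q)) (cv w)"
    if "a \<le> 6" "b \<le> 6" for a b
    by (rule frame_induct [OF bt one, of "\<lambda>w. cdot (cross (?R (H c a ?q)) (?R (H c b ?q))) (?R w) = cdot (cross (H c a ?q) (H c b ?q)) w"])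
      (simp_all add: cmv_linear cl base that)
  have 2: "cdot (cross (?R (H c a ?q)) (?R (cv v))) (?R (cv w)) = cdot (cross (H c a ?q) (cv v)) (cv w)"
    if "a \<le> 6" for a
    by (rule frame_induct [OF bt one, of "\<lambda>v. cdot (cross (?R (H c a ?q)) (?R v)) (?R (cv w)) = cdot (cross (H c a ?q) v) (cv w)"])
      (simp_all add: cmv_linear cross_add cross_scale cl 1 that)
  have "cdot (cross (?R (cv u)) (?R (cv v))) (?R (cv w)) = cdot (cross (cv u) (cv v)) (cv w)"
    by (rule frame_induct [OF bt one, of "\<lambda>u. cdot (cross (?R u) (?R (cv v))) (?R (cv w)) = cdot (cross u (cv v)) (cv w)"])
      (simp_all add: cmv_linear cross_add cross_scale cl 2)
  then show ?thesis
    unfolding cmv_cv cross_cv cdot_cv of_real_eq_iff phi_eq_inner_cross .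
qed

lemma Rho_stabilizer:
  assumes c: "hol_tensor c" and p: "p \<in> S3"
  shows "Rho c p \<in> G2_stabilizer (pt c ` S3)"
proof -
  have bt: "boruvka_tensor c" using c by (simp add: hol_tensor_def)
  obtain p' where p': "p' \<in> S3" "lmul p p' = (1, 0)" "lmul p' p = (1, 0)" by (rule lmul_inverse [OF p])
  have "Rho c p ** Rho c p' = mat 1" "Rho c p' ** Rho c p = mat 1"
    using Rho_mult [OF bt p p'(1)] Rho_mult [OF bt p'(1) p] by (simp_all add: p'(2,3) Rho_one [OF bt])
  then have inv: "invertible (Rho c p)" unfolding invertible_def by blast
  have "(\<lambda>x. Rho c p *v x) ` (pt c ` S3) = pt c ` S3"
  proof (intro set_eqI iffI)
    fix y assume "y \<in> (\<lambda>x. Rho c p *v x) ` (pt c ` S3)"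
    then obtain q where "q \<in> S3" "y = Rho c p *v pt c q" by blast
    then show "y \<in> pt c ` S3" using Rho_pt [OF bt p] lmul_S3 [OF p] by blast
  next
    fix y assume "y \<in> pt c ` S3"
    then obtain q where q: "q \<in> S3" "y = pt c q" by blast
    have "y = Rho c p *v pt c (lmul p' q)"
      unfolding Rho_pt [OF bt p lmul_S3 [OF p'(1) q(1)]] lmul_assoc [symmetric] p'(2) lmul_one q(2) ..
    then show "y \<in> (\<lambda>x. Rho c p *v x) ` (pt c ` S3)" using lmul_S3 [OF p'(1) q(1)] by blast
  qed
  then show ?thesis using inv Rho_G2 [OF c p] by (simp add: G2_stabilizer_def G2_def)
qed

section \<open>The Lie algebra of the stabiliser\<close>

lemma has_vector_derivative_matrix:
  fixes f :: "real \<Rightarrow> real^'n^'m"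
  assumes "\<And>i k. ((\<lambda>t. f t $ i $ k) has_vector_derivative d $ i $ k) (at x)"
  shows "(f has_vector_derivative d) (at x)"
  unfolding has_vector_derivative_def
proof (subst has_derivative_componentwise_within, intro ballI)
  fix b :: "real^'n^'m" assume "b \<in> Basis"
  then obtain i k where b: "b = axis i (axis k 1)" by (auto simp: Basis_vec_def)
  show "((\<lambda>t. f t \<bullet> b) has_derivative (\<lambda>h. (h *\<^sub>R d) \<bullet> b)) (at x)"
    using assms [of i k] unfolding b has_vector_derivative_def by (simp add: inner_axis)
qed

text \<open>The left multiplications by the points of a great circle through \<open>(1, 0)\<close> form a one-parameter group,
  and at \<open>(1, 0)\<close> it moves the frame in the same way as the flow of \<open>L\<close>.\<close>

lemma stabilizer_lie_element:
  assumes c: "hol_tensor c" and L: "unit_field L" "\<And>t p q. flow L t (lmul p q) = lmul p (flow L t q)"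
  obtains Z where "Z \<in> lie_algebra (G2_stabilizer (pt c ` S3))"
    "\<And>a i. a \<le> 6 \<Longrightarrow> cmv Z (H c a (1, 0)) $ i = X L (G (c i) a) (1, 0)"
proof -
  have bt: "boruvka_tensor c" using c by (simp add: hol_tensor_def)
  define \<gamma> where "\<gamma> = (\<lambda>t. Rho c (flow L t (1, 0)))"
  define Z :: "real^7^7" where "Z = (\<chi> i k. Re (1/60 * (\<Sum>a\<in>{0,1,2,3,4,5,6}. wt a * (X L (G (c i) a) (1, 0) * G (c k) (6 - a) (1, 0)))))"
  note f = flow_S3 [OF L(1) one_S3]
  have dG: "((\<lambda>t. G (c i) a (flow L t (1, 0))) has_vector_derivative X L (G (c i) a) (1, 0)) (at 0)" if "a \<le> 6" for i a
    by (rule has_vector_derivative_X [OF L(1) smooth_on_imp_along [OF open_UNIV subset_UNIV smooth_on_G [OF that]] one_S3])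
  have entry: "((\<lambda>t. \<gamma> t $ i $ k) has_vector_derivative Z $ i $ k) (at 0)" for i k
  proof -
    have "((\<lambda>t. tr c (flow L t (1, 0)) (1, 0) i k) has_vector_derivative
        1/60 * (\<Sum>a\<in>{0,1,2,3,4,5,6}. wt a * (X L (G (c i) a) (1, 0) * G (c k) (6 - a) (1, 0)))) (at 0)"
      unfolding tr_def lmul_one
      by (intro has_vector_derivative_mult_right has_vector_derivative_sum has_vector_derivative_mult_left dG) auto
    from bounded_linear.has_vector_derivative [OF bounded_linear_Re this]
    show ?thesis unfolding \<gamma>_def Rho_def Z_def vec_lambda_beta .
  qed
  have "\<gamma> (s + t) = \<gamma> s ** \<gamma> t" for s t
  proof -
    have "flow L (s + t) (1, 0) = flow L t (lmul (flow L s (1, 0)) (1, 0))"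
      by (simp add: lmul_one flow_add [OF L(1)] add.commute)
    then show ?thesis unfolding \<gamma>_def L(2) by (simp add: Rho_mult [OF bt f f])
  qed
  moreover have "\<gamma> t \<in> G2_stabilizer (pt c ` S3)" for t
    unfolding \<gamma>_def by (rule Rho_stabilizer [OF c f])
  moreover have "(\<gamma> has_vector_derivative Z) (at 0)"
    by (rule has_vector_derivative_matrix [OF entry])
  ultimately have 1: "Z \<in> lie_algebra (G2_stabilizer (pt c ` S3))"
    unfolding lie_algebra_def by blast
  have 2: "cmv Z (H c a (1, 0)) $ i = X L (G (c i) a) (1, 0)" if a: "a \<le> 6" for a i
  proof -
    have "((\<lambda>t. cmv (\<gamma> t) (H c a (1, 0)) $ i) has_vector_derivative cmv Z (H c a (1, 0)) $ i) (at 0)"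
      unfolding cmv_def vec_lambda_beta
      by (intro has_vector_derivative_sum has_vector_derivative_mult_left
          bounded_linear.has_vector_derivative [OF bounded_linear_of_real entry])
    moreover have "(\<lambda>t. cmv (\<gamma> t) (H c a (1, 0)) $ i) = (\<lambda>t. G (c i) a (flow L t (1, 0)))"
      unfolding \<gamma>_def cmv_Rho [OF bt f one_S3 a] lmul_one H_nth ..
    ultimately show ?thesis using vector_derivative_unique_at [OF _ dG [OF a, of i]] by metis
  qed
  show thesis by (rule that [OF 1 2])
qed

lemma cdot_linear: "cdot (u + u') v = cdot u v + cdot u' v" "cdot v (u + u') = cdot v u + cdot v u'"
  "cdot (r *s u) v = r * cdot u v" "cdot v (r *s u) = r * cdot v u" for u u' v :: "complex^7"
  by (simp_all add: cdot_def sum.distrib sum_distrib_left algebra_simps)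

text \<open>The second pairing is purely imaginary when \<open>Z\<close> is skew, because conjugation exchanges \<open>H\<^sub>5\<close> and
  \<open>H\<^sub>1\<close>.\<close>

definition sym_param :: "(7 \<Rightarrow> 3 \<Rightarrow> 3 \<Rightarrow> 3 \<Rightarrow> real) \<Rightarrow> real^7^7 \<Rightarrow> complex \<times> real" where
  "sym_param c Z = (cdot (cmv Z (H c 3 (1, 0))) (H c 4 (1, 0)), Im (cdot (cmv Z (H c 5 (1, 0))) (H c 1 (1, 0))))"

lemma linear_sym_param: "linear (sym_param c)"
proof -
  have "cmv (A + B) u = cmv A u + cmv B u" "cmv (r *\<^sub>R A) u = of_real r *s cmv A u" for A B u r
    by (simp_all add: cmv_def vec_eq_iff sum.distrib sum_distrib_left algebra_simps)
  then show ?thesis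
    by (intro linearI) (simp_all add: sym_param_def cdot_linear scaleR_conv_of_real)
qed

text \<open>The symmetries generated by \<open>I1\<close>, \<open>I2\<close> and \<open>I3\<close> have the parameters \<open>(4, 0)\<close>, \<open>(4 \<i>, 0)\<close> and
  \<open>(0, 40/3)\<close>.\<close>

lemma sym_param_surj:
  assumes c: "hol_tensor c"
  shows "span (sym_param c ` lie_algebra (G2_stabilizer (pt c ` S3))) = UNIV"
proof -
  let ?q = "(1, 0) :: complex \<times> complex" and ?l = "lie_algebra (G2_stabilizer (pt c ` S3))"
  have bt: "boruvka_tensor c" using c by (simp add: hol_tensor_def)
  then have h: "harmonic_tensor (c i)" for i by (simp add: boruvka_tensor_def)
  note u = has_updn_X [OF has_updn_G [OF h one_S3]]
  note cases = cdot_H_cases [OF bt one_S3] wt_def cdot_linear cdot_diff cdot_neg One_nat_def [symmetric]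
  obtain Z1 where Z1: "Z1 \<in> ?l" "\<And>a i. a \<le> 6 \<Longrightarrow> cmv Z1 (H c a ?q) $ i = X I1 (G (c i) a) ?q"
    by (rule stabilizer_lie_element [OF c unit_field_I(1) flow_lmul(1)]) blast
  obtain Z2 where Z2: "Z2 \<in> ?l" "\<And>a i. a \<le> 6 \<Longrightarrow> cmv Z2 (H c a ?q) $ i = X I2 (G (c i) a) ?q"
    by (rule stabilizer_lie_element [OF c unit_field_I(2) flow_lmul(2)]) blast
  obtain Z3 where Z3: "Z3 \<in> ?l" "\<And>a i. a \<le> 6 \<Longrightarrow> cmv Z3 (H c a ?q) $ i = X I3 (G (c i) a) ?q"
    by (rule stabilizer_lie_element [OF c unit_field_I(3) flow_lmul(3)]) blast
  have "cmv Z1 (H c 3 ?q) = 3 *s H c 4 ?q + (- 3) *s H c 2 ?q" "cmv Z1 (H c 5 ?q) = 1 *s H c 6 ?q + (- 5) *s H c 4 ?q"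
    by (simp_all add: vec_eq_iff Z1(2) u)
  then have 1: "sym_param c Z1 = (4, 0)"
    unfolding sym_param_def by (simp add: cases del: One_nat_def)
  have "cmv Z2 (H c 3 ?q) = (- 3 * \<i>) *s H c 4 ?q + (- 3 * \<i>) *s H c 2 ?q" "cmv Z2 (H c 5 ?q) = (- \<i>) *s H c 6 ?q + (- 5 * \<i>) *s H c 4 ?q"
    by (simp_all add: vec_eq_iff Z2(2) u algebra_simps)
  then have 2: "sym_param c Z2 = (4 * \<i>, 0)"
    unfolding sym_param_def by (simp add: cases del: One_nat_def)
  have p3: "X I3 (G (c i) 3) ?q = 0" for i
  proof (rule X_eqI)
    have "G (c i) 3 (flow I3 t ?q) = G (c i) 3 ?q" for t
      using arg_cong [OF H_phase(1) [of c t ?q], of "\<lambda>v. cv v $ i"] unfolding cv_pt H_nth .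
    then show "((\<lambda>t. G (c i) 3 (flow I3 t ?q)) has_vector_derivative 0) (at 0)" by simp
  qed
  have p5: "X I3 (G (c i) 5) ?q = 4 * \<i> * G (c i) 5 ?q" for i
  proof -
    have "charged 4 (G (c i) 5)"
      by (rule charged_phaseI)
        (use arg_cong [OF H_phase(2) [of c], of "\<lambda>v. v $ i"] in \<open>simp only: H_nth vector_smult_component\<close>)
    then show ?thesis using one_S3 unfolding charged_def by simp
  qed
  have "cmv Z3 (H c 3 ?q) = 0 *s H c 3 ?q" "cmv Z3 (H c 5 ?q) = (4 * \<i>) *s H c 5 ?q"
    by (simp_all add: vec_eq_iff Z3(2) p3 p5)
  then have 3: "sym_param c Z3 = (0, 40/3)"
    unfolding sym_param_def by (simp only: cdot_linear) (simp add: cases del: One_nat_def)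
  have "x \<in> span (sym_param c ` ?l)" for x
  proof -
    have m: "(4, 0) \<in> span (sym_param c ` ?l)" "(4 * \<i>, 0) \<in> span (sym_param c ` ?l)" "(0, 40/3) \<in> span (sym_param c ` ?l)"
      using Z1(1) Z2(1) Z3(1) 1 2 3 by (metis imageI span_base)+
    have "x = (Re (fst x) / 4) *\<^sub>R (4, 0) + (Im (fst x) / 4) *\<^sub>R (4 * \<i>, 0) + (3 * snd x / 40) *\<^sub>R (0, 40/3)"
      by (simp add: prod_eq_iff complex_eq_iff)
    also have "\<dots> \<in> span (sym_param c ` ?l)"
      by (intro span_add span_scale m)
    finally show ?thesis .
  qed
  then show ?thesis by blast
qed

text \<open>The second condition says that \<open>Z\<close> takes the point \<open>H\<^sub>3\<close> to a tangent vector, that is, to a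
  combination of \<open>H\<^sub>2\<close> and \<open>H\<^sub>4\<close>.\<close>

definition infinitesimal :: "(7 \<Rightarrow> 3 \<Rightarrow> 3 \<Rightarrow> 3 \<Rightarrow> real) \<Rightarrow> (real^7^7) set" where
  "infinitesimal c = {Z. (\<forall>x y. (Z *v x) \<bullet> y + x \<bullet> (Z *v y) = 0) \<and>
     (\<forall>q\<in>S3. \<forall>b\<in>{0,1,3,5,6}. cdot (cmv Z (H c 3 q)) (H c b q) = 0)}"

lemma subspace_infinitesimal: "subspace (infinitesimal c)"
proof -
  have l: "cmv (A + B) u = cmv A u + cmv B u" "cmv (r *\<^sub>R A) u = of_real r *s cmv A u" "cmv 0 u = 0 *s u" for A B u r
    by (simp_all add: cmv_def vec_eq_iff sum.distrib sum_distrib_left algebra_simps)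
  have e: "((A + B) *v x) \<bullet> y + x \<bullet> ((A + B) *v y) = ((A *v x) \<bullet> y + x \<bullet> (A *v y)) + ((B *v x) \<bullet> y + x \<bullet> (B *v y))"
    "((r *\<^sub>R A) *v x) \<bullet> y + x \<bullet> ((r *\<^sub>R A) *v y) = r * ((A *v x) \<bullet> y + x \<bullet> (A *v y))" for A B :: "real^7^7" and x y r
    by (simp_all add: matrix_vector_mult_add_rdistrib inner_add_left inner_add_right scaleR_matrix_vector_assoc [symmetric] distrib_left)
  have "0 \<in> infinitesimal c"
    unfolding infinitesimal_def mem_Collect_eq l(3) cdot_linear by simp
  moreover have "A + B \<in> infinitesimal c" if "A \<in> infinitesimal c" "B \<in> infinitesimal c" for A B
    using that unfolding infinitesimal_def mem_Collect_eq e l cdot_linear by (simp del: mem_sphere_0)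
  moreover have "r *\<^sub>R A \<in> infinitesimal c" if "A \<in> infinitesimal c" for A r
    using that unfolding infinitesimal_def mem_Collect_eq e l cdot_linear by (simp del: mem_sphere_0)
  ultimately show ?thesis unfolding subspace_def by blast
qed

lemma lie_algebra_stabilizer_subset:
  assumes c: "boruvka_tensor c"
  shows "lie_algebra (G2_stabilizer (pt c ` S3)) \<subseteq> infinitesimal c"
proof
  fix Z assume Z: "Z \<in> lie_algebra (G2_stabilizer (pt c ` S3))"
  then have "Z \<in> lie_algebra G2" unfolding lie_algebra_def G2_stabilizer_def by blast
  then have skew: "(Z *v x) \<bullet> y + x \<bullet> (Z *v y) = 0" for x y
    using lie_algebra_G2_der phi_der_skew by blast
  have inv: "G2_stabilizer (pt c ` S3) \<subseteq> {A. invertible A}" unfolding G2_stabilizer_def G2_def by blast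
  obtain \<gamma> where \<gamma>: "\<gamma> 0 = mat 1" "\<And>t. \<gamma> t \<in> G2_stabilizer (pt c ` S3)" "\<And>v. ((\<lambda>t. \<gamma> t *v v) has_vector_derivative Z *v v) (at 0)"
    by (rule lie_algebra_velocity [OF Z inv]) blast
  have "cdot (cmv Z (H c 3 q)) (H c b q) = 0" if q: "q \<in> S3" and b: "b \<in> {0,1,3,5,6}" for q b
  proof -
    have "\<gamma> t *v pt c q \<in> pt c ` S3" for t using \<gamma>(2) [of t] q unfolding G2_stabilizer_def by blast
    moreover have "\<gamma> 0 *v pt c q = pt c q" by (simp add: \<gamma>(1))
    ultimately obtain \<zeta> where \<zeta>: "Z *v pt c q = RH c 4 \<zeta> q"
      by (rule curve_velocity [OF c q zero_less_one, where \<gamma> = "\<lambda>t. \<gamma> t *v pt c q", OF _ _ \<gamma>(3)]) blast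
    have "cnjv (H c 4 q) = (- 1) *s H c 2 q" unfolding cnjv_H by (simp add: vec_eq_iff)
    then have "cmv Z (H c 3 q) = (\<zeta> / 2) *s H c 4 q + (cnj \<zeta> / 2) *s ((- 1) *s H c 2 q)"
      unfolding cv_pt [symmetric] cmv_cv \<zeta> cv_RH by simp
    then show ?thesis
      using b by (auto simp: cdot_linear cdot_diff cdot_H_cases [OF c q] One_nat_def [symmetric] simp del: One_nat_def)
  qed
  then show "Z \<in> infinitesimal c" unfolding infinitesimal_def using skew by blast
qed

text \<open>Put \<open>m a b = (Z H\<^sub>a) \<bullet> H\<^sub>b\<close>.  Five of the functions \<open>m 3 b\<close> vanish identically, and raising and
  lowering these equations expresses all other pairings by \<open>m 3 4\<close>, \<open>m 3 2\<close> and \<open>m 1 5\<close>.  The first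
  two are conjugate up to sign, and \<open>m 1 5 = - m 5 1\<close> is imaginary.\<close>

lemma infinitesimal_eq_0:
  assumes c: "boruvka_tensor c" and Z: "Z \<in> infinitesimal c" and z: "sym_param c Z = 0"
  shows "Z = 0"
proof -
  have h: "harmonic_tensor (c i)" for i using c by (simp add: boruvka_tensor_def)
  have skew: "(Z *v x) \<bullet> y + x \<bullet> (Z *v y) = 0" for x y using Z unfolding infinitesimal_def by blast
  define m where "m = (\<lambda>a b q. cdot (cmv Z (H c a q)) (H c b q))"
  have t: "m 3 b q = 0" if "b \<in> {0,1,3,5,6}" "q \<in> S3" for b q
    using Z that unfolding infinitesimal_def m_def by blast
  have anti: "Z $ i $ k = - (Z $ k $ i)" for i k
    using skew [of "axis k 1" "axis i 1"]
    by (simp add: matrix_vector_mult_basis column_def inner_axis inner_commute [of "axis k 1"])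
  have sk: "cdot (cmv Z u) v = - cdot (cmv Z v) u" for u v
  proof -
    have "cdot (cmv Z u) v = (\<Sum>i\<in>UNIV. \<Sum>k\<in>UNIV. of_real (Z $ i $ k) * u $ k * v $ i)"
      by (simp add: cdot_def cmv_def sum_distrib_right)
    also have "\<dots> = (\<Sum>i\<in>UNIV. \<Sum>k\<in>UNIV. - (of_real (Z $ k $ i) * v $ i * u $ k))"
      by (intro sum.cong refl) (subst anti, simp)
    also have "\<dots> = - (\<Sum>k\<in>UNIV. \<Sum>i\<in>UNIV. of_real (Z $ k $ i) * v $ i * u $ k)"
      by (subst sum.swap) (simp add: sum_negf)
    also have "\<dots> = - cdot (cmv Z v) u" by (simp add: cdot_def cmv_def sum_distrib_right)
    finally show ?thesis .
  qed
  then have msk: "m a b q = - m b a q" for a b q unfolding m_def .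
  have mbil: "m a b q = bil (\<lambda>i k. of_real (Z $ k $ i)) (H c a q) (H c b q)" for a b q
    unfolding m_def bil_def cdot_def cmv_def vec_lambda_beta sum_distrib_right
    by (subst sum.swap) (simp add: mult.assoc)
  have mup: "has_updn (\<lambda>q. m a b q) ((6 - of_nat a) * m (a + 1) b q + (6 - of_nat b) * m a (b + 1) q)
      (- (of_nat a * m (a - 1) b q + of_nat b * m a (b - 1) q)) q" if "a \<le> 6" "b \<le> 6" "q \<in> S3" for a b q
    using has_updn_bil [OF h that(3,1,2), of "\<lambda>i k. of_real (Z $ k $ i)"] unfolding mbil by simp
  have zero: "p = 0 \<and> n = 0" if f: "\<And>q. q \<in> S3 \<Longrightarrow> f q = 0" and e: "has_updn f p n q" and q: "q \<in> S3" for f p n q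
  proof -
    have "up f q = 0" using up_cong [OF q f] has_updn_imp(1) [OF has_updn_const [of 0 q]] by (rule trans)
    moreover have "dn f q = 0" using dn_cong [OF q f] has_updn_imp(2) [OF has_updn_const [of 0 q]] by (rule trans)
    ultimately show ?thesis unfolding has_updn_imp [OF e] by simp
  qed
  have U: "(6 - of_nat a) * m (a + 1) b q + (6 - of_nat b) * m a (b + 1) q = 0"
    and D: "of_nat a * m (a - 1) b q + of_nat b * m a (b - 1) q = 0"
    if "\<And>q. q \<in> S3 \<Longrightarrow> m a b q = 0" "a \<le> 6" "b \<le> 6" "q \<in> S3" for a b q
    using zero [OF that(1) mup [OF that(2-4)] that(4)] by (simp_all only: neg_equal_0_iff_equal)
  have D2: "r * (of_nat a * m (a - 1) b q + of_nat b * m a (b - 1) q) + s * (of_nat a' * m (a' - 1) b' q + of_nat b' * m a' (b' - 1) q) = 0"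
    if "\<And>q. q \<in> S3 \<Longrightarrow> r * m a b q + s * m a' b' q = 0" "a \<le> 6" "b \<le> 6" "a' \<le> 6" "b' \<le> 6" "q \<in> S3" for a b a' b' r s q
    using zero [OF that(1) has_updn_add [OF has_updn_cmult [OF mup [OF that(2,3,6)], of r] has_updn_cmult [OF mup [OF that(4,5,6)], of s]] that(6)]
    by (simp only: mult_minus_right minus_add_distrib [symmetric] neg_equal_0_iff_equal)
  note fold1 = One_nat_def [symmetric]
  have m35: "m 3 5 q = 0" and m36: "m 3 6 q = 0" and m31: "m 3 1 q = 0" and m30: "m 3 0 q = 0" and m33: "m 3 3 q = 0"
    if "q \<in> S3" for q using t [OF _ that] by (simp_all del: mem_sphere_0)
  have m45: "m 4 5 q = 0" if q: "q \<in> S3" for q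
    using U [OF m35 _ _ q] m36 [OF q] by (simp add: fold1 del: mem_sphere_0 One_nat_def)
  have e25: "3 * m 2 5 q + 5 * m 3 4 q = 0" if q: "q \<in> S3" for q
    using D [OF m35 _ _ q] by (simp add: fold1 del: mem_sphere_0 One_nat_def)
  have m26: "m 2 6 q = 0" if q: "q \<in> S3" for q
    using D [OF m36 _ _ q] m35 [OF q] by (simp add: fold1 del: mem_sphere_0 One_nat_def)
  have m46: "m 4 6 q = 0" if q: "q \<in> S3" for q
    using U [OF m36 _ _ q] by (simp add: fold1 del: mem_sphere_0 One_nat_def)
  have m56: "m 5 6 q = 0" if q: "q \<in> S3" for q
    using U [OF m46 _ _ q] by (simp add: fold1 del: mem_sphere_0 One_nat_def)
  have e16: "2 * m 1 6 q + 6 * m 2 5 q = 0" if q: "q \<in> S3" for q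
    using D [OF m26 _ _ q] by (simp add: fold1 del: mem_sphere_0 One_nat_def)
  have e15: "3 * (2 * m 1 5 q + 5 * m 2 4 q) + 5 * (3 * m 2 4 q + 4 * m 3 3 q) = 0" if q: "q \<in> S3" for q
    using D2 [OF e25 _ _ _ _ q] by (simp add: fold1 del: mem_sphere_0 One_nat_def)
  have e06: "2 * (m 0 6 q + 6 * m 1 5 q) + 6 * (2 * m 1 5 q + 5 * m 2 4 q) = 0" if q: "q \<in> S3" for q
    using D2 [OF e16 _ _ _ _ q] by (simp add: fold1 del: mem_sphere_0 One_nat_def)
  have m21: "m 2 1 q = 0" if q: "q \<in> S3" for q
    using D [OF m31 _ _ q] m30 [OF q] by (simp add: fold1 del: mem_sphere_0 One_nat_def)
  have e41: "3 * m 4 1 q + 5 * m 3 2 q = 0" if q: "q \<in> S3" for q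
    using U [OF m31 _ _ q] by (simp add: fold1 del: mem_sphere_0 One_nat_def)
  have m40: "m 4 0 q = 0" if q: "q \<in> S3" for q
    using U [OF m30 _ _ q] m31 [OF q] by (simp add: fold1 del: mem_sphere_0 One_nat_def)
  have m20: "m 2 0 q = 0" if q: "q \<in> S3" for q
    using D [OF m30 _ _ q] by (simp add: fold1 del: mem_sphere_0 One_nat_def)
  have m10: "m 1 0 q = 0" if q: "q \<in> S3" for q
    using D [OF m20 _ _ q] by (simp add: fold1 del: mem_sphere_0 One_nat_def)
  have e50: "2 * m 5 0 q + 6 * m 4 1 q = 0" if q: "q \<in> S3" for q
    using U [OF m40 _ _ q] by (simp add: fold1 del: mem_sphere_0 One_nat_def)
  let ?q = "(1, 0) :: complex \<times> complex"
  note one = one_S3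
  have n: "cdot u (- v) = - cdot u v" "cmv Z (- u) = - cmv Z u" "cdot (- u) v = - cdot u v" for u v
    by (simp_all add: cdot_def cmv_def vec_eq_iff sum_negf)
  have z34: "m 3 4 ?q = 0" using z by (simp add: sym_param_def m_def zero_prod_def)
  have "cnj (m 3 4 ?q) = - m 3 2 ?q"
    unfolding m_def cdot_cnjv cmv_cnjv [symmetric] cnjv_H n ..
  then have z32: "m 3 2 ?q = 0" using z34 by simp
  have "cnj (m 5 1 ?q) = m 1 5 ?q"
    unfolding m_def cdot_cnjv cmv_cnjv [symmetric] cnjv_H ..
  moreover have "Im (m 5 1 ?q) = 0" using z by (simp add: sym_param_def m_def zero_prod_def)
  ultimately have z15: "m 1 5 ?q = 0" using msk [of 1 5 ?q] by (simp add: complex_eq_iff)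
  have z24: "m 2 4 ?q = 0" using e15 [OF one] z15 m33 [OF one] by simp
  have z25: "m 2 5 ?q = 0" using e25 [OF one] z34 by simp
  have z16: "m 1 6 ?q = 0" using e16 [OF one] z25 by simp
  have z06: "m 0 6 ?q = 0" using e06 [OF one] z15 z24 by simp
  have z41: "m 4 1 ?q = 0" using e41 [OF one] z32 by simp
  have z50: "m 5 0 ?q = 0" using e50 [OF one] z41 by simp
  note l = m35 [OF one] m36 [OF one] m31 [OF one] m30 [OF one] m45 [OF one] m26 [OF one] m46 [OF one] m56 [OF one]
    m21 [OF one] m40 [OF one] m20 [OF one] m10 [OF one] z34 z32 z15 z24 z25 z16 z06 z41 z50
  have sw: "m a b ?q = 0 \<Longrightarrow> m b a ?q = 0" for a b using msk [of b a ?q] by simp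
  have diag: "m a a ?q = 0" for a using msk [of a a ?q] by simp
  have all: "m a b ?q = 0" if "a \<le> 6" "b \<le> 6" for a b
  proof -
    have "a \<in> {0,1,2,3,4,5,6}" "b \<in> {0,1,2,3,4,5,6}" using that by auto
    then show ?thesis by (elim insertE emptyE; simp only: l l [THEN sw] diag)
  qed
  have 1: "cdot (cmv Z (H c a ?q)) (cv w) = 0" if "a \<le> 6" for a w
    by (rule frame_induct [OF c one, of "\<lambda>w. cdot (cmv Z (H c a ?q)) w = 0"])
      (simp_all add: cdot_linear all [OF that, unfolded m_def])
  have "cdot (cmv Z (cv v)) (cv w) = 0" for v w
    by (rule frame_induct [OF c one, of "\<lambda>v. cdot (cmv Z v) (cv w) = 0"]) (simp_all add: cdot_linear cmv_linear 1)
  then have "(Z *v v) \<bullet> w = 0" for v w unfolding cmv_cv cdot_cv by simp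
  then have "Z *v v = 0" for v by (metis inner_eq_zero_iff)
  then show ?thesis by (simp add: matrix_eq)
qed

lemma dim_lie_algebra_stabilizer:
  assumes c: "hol_tensor c"
  shows "dim (lie_algebra (G2_stabilizer (pt c ` S3))) = 3"
proof -
  let ?l = "lie_algebra (G2_stabilizer (pt c ` S3))" and ?V = "infinitesimal c" and ?f = "sym_param c"
  have bt: "boruvka_tensor c" using c by (simp add: hol_tensor_def)
  have "inj_on ?f ?V"
  proof (rule inj_onI)
    fix A B assume AB: "A \<in> ?V" "B \<in> ?V" "?f A = ?f B"
    have "?f (A - B) = 0" using AB(3) by (simp add: linear_diff [OF linear_sym_param])
    then have "A - B = 0"
      using infinitesimal_eq_0 [OF bt subspace_diff [OF subspace_infinitesimal AB(1,2)]] by simp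
    then show "A = B" by simp
  qed
  then have "dim ?V = dim (?f ` ?V)"
    using dim_image_eq [OF linear_sym_param, of c ?V] by (simp add: span_eq_iff [THEN iffD2, OF subspace_infinitesimal])
  moreover have "dim (?f ` ?V) \<le> 3" using dim_subset_UNIV [of "?f ` ?V"] by simp
  moreover have "dim ?l \<le> dim ?V" by (rule dim_subset [OF lie_algebra_stabilizer_subset [OF bt]])
  moreover have "3 \<le> dim ?l"
  proof -
    have "dim (?f ` ?l) = 3"
      using dim_span [of "?f ` ?l"] unfolding sym_param_surj [OF c] by simp
    then show ?thesis using dim_image_le [OF linear_sym_param, of c ?l] by simp
  qed
  ultimately show ?thesis by simp
qed

section \<open>The stability indices\<close>

text \<open>The map \<open>l \<mapsto> 6 (l + 1)\<^sup>2\<close> takes the values 0, 6, 14 and 24 at the four exceptional points and is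
  strictly between 0 and 24 on the open interval.\<close>

lemma eigen_dim_pt:
  assumes c: "hol_tensor c"
  shows "eigen_dim (pt c ` S3) (- 1) = ereal 10" "eigen_dim (pt c ` S3) 0 = ereal 14"
    "eigen_dim (pt c ` S3) (sqrt (7/3) - 1) = ereal 18" "eigen_dim (pt c ` S3) 1 = ereal 22"
    "l \<in> {-1<..<1} \<Longrightarrow> l \<noteq> 0 \<Longrightarrow> l \<noteq> sqrt (7/3) - 1 \<Longrightarrow> eigen_dim (pt c ` S3) l = 0"
proof -
  obtain \<Psi>0 \<Psi>6 \<Psi>14 \<Psi>24 where \<Psi>: "ladder_param 4 0 4 \<Psi>0" "ladder_param 4 6 6 \<Psi>6" "ladder_param 4 14 8 \<Psi>14" "ladder_param 4 24 10 \<Psi>24"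
    by (rule ladder_param_4)
  have d: "eigen_dim (pt c ` S3) l = ereal (real (2 * (n + 1)))" if "ladder_param 4 \<theta> n \<Psi>" "\<theta> = 6 * (l + 1)\<^sup>2" for l \<theta> n \<Psi>
    using fun_edim_eigensections [OF c that(1) [unfolded that(2)]] by (simp add: eigen_dim_def)
  show "eigen_dim (pt c ` S3) (- 1) = ereal 10" "eigen_dim (pt c ` S3) 0 = ereal 14"
    "eigen_dim (pt c ` S3) (sqrt (7/3) - 1) = ereal 18" "eigen_dim (pt c ` S3) 1 = ereal 22"
    using d [OF \<Psi>(1), of "- 1"] d [OF \<Psi>(2), of 0] d [OF \<Psi>(3), of "sqrt (7/3) - 1"] d [OF \<Psi>(4), of 1] by simp_all
  assume l: "l \<in> {-1<..<1}" "l \<noteq> 0" "l \<noteq> sqrt (7/3) - 1"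
  have p: "0 < l + 1" "l + 1 < 2" using l(1) by auto
  have "(l + 1)\<^sup>2 < 2\<^sup>2" using p by (intro power_strict_mono) auto
  then have lt: "6 * (l + 1)\<^sup>2 < 24" by simp
  have gt: "0 < 6 * (l + 1)\<^sup>2" using p by simp
  have "(l + 1)\<^sup>2 \<noteq> 1" using l(2) p by (auto simp: power2_eq_1_iff)
  moreover have "(l + 1)\<^sup>2 \<noteq> 7/3"
  proof
    assume "(l + 1)\<^sup>2 = 7/3"
    then have "sqrt (7/3) = l + 1" using p by (metis less_imp_le real_sqrt_unique)
    then show False using l(3) by simp
  qed
  ultimately have "6 * (l + 1)\<^sup>2 \<notin> {0, 6, 14, 24}" using lt gt by auto
  then have "fun_edim (eigensections (pt c ` S3) l) = 0"
    using fun_edim_eigensections_trivial [OF c] lt by simp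
  then show "eigen_dim (pt c ` S3) l = 0" by (simp add: eigen_dim_def)
qed

theorem theorem1p4:
  fixes S :: "(real^7) set" and C :: "(real^7) set"
  assumes "boruvka_sphere S" and "J_holomorphic_curve S"
    and "C = cone_over S"
  shows "s_ind_plus C = 41 \<and> s_ind_minus C = 30 \<and> \<not> rigid_cone C"
proof -
  obtain c0 where c0: "boruvka_tensor c0" "S = pt c0 ` S3" using boruvka_sphere_tensor [OF assms(1)] by blast
  obtain c where c: "hol_tensor c" "S = pt c ` S3"
    using J_holomorphic_hol_tensor [OF c0(1)] assms(2) unfolding c0(2) by metis
  have link: "link C = S"
    unfolding assms(3) by (rule link_cone_over) (use assms(2) in \<open>simp add: J_holomorphic_curve_def\<close>)
  note d = eigen_dim_pt [OF c(1), folded c(2)]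
  have s: "0 < sqrt (7/3 :: real)" "sqrt (7/3 :: real) < 2" "sqrt (7/3 :: real) \<noteq> 1"
  proof -
    have "sqrt (7/3 :: real) < sqrt (2\<^sup>2)" by (subst real_sqrt_less_iff) simp
    then show "0 < sqrt (7/3 :: real)" "sqrt (7/3 :: real) < 2" "sqrt (7/3 :: real) \<noteq> 1" by simp_all
  qed
  have "(\<Sum>\<^sub>\<infinity>l\<in>{-1<..<1}. eigen_dim S l) = (\<Sum>\<^sub>\<infinity>l\<in>{0, sqrt (7/3) - 1}. eigen_dim S l)"
    by (rule infsum_cong_neutral) (use s d(5) in auto)
  also have "\<dots> = ereal 32"
    using s(3) by (simp add: d(2,3))
  finally have inf: "(\<Sum>\<^sub>\<infinity>l\<in>{-1<..<1}. eigen_dim S l) = ereal 32" .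
  have q: "dim_quotient G2 (G2_stabilizer S) = 11"
    unfolding dim_quotient_def dim_lie_algebra_G2 c(2) dim_lie_algebra_stabilizer [OF c(1)] by simp
  have p: "s_ind_plus C = 41" and m: "s_ind_minus C = 30"
    unfolding s_ind_plus_def s_ind_minus_def link inf q d(1,4) by (simp_all add: numeral_eq_ereal)
  then show ?thesis by (simp add: rigid_cone_def)
qed

end
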